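(* The linearized problem (defined in the context) with its jump and boundary conditions is ill-posed in the sense of Hadamard in $H^k(\Omega)$ for every $k$. More precisely: for any $k,j\in\mathbb{N}$ with $j\ge k$ and any $T_0>0$ and $\alpha>0$ there exists a sequence $\{(\eta_n,v_n,q_n)\}_{n=1}^\infty$ of solutions to the linearized problem on $\Omega\times[0,\infty)$, satisfying the jump and boundary conditions, such that $$\|\eta_n(0)\|_{H^j}+\|v_n(0)\|_{H^j}+\|q_n(0)\|_{H^j}\le\frac1n$$ but $$\|v_n(t)\|_{H^k}\ge\|\eta_n(t)\|_{H^k}\ge\alpha\quad\text{for all }t\ge T_0.$$
   Context: **Steady state.** $g,m,\ell>0$. $P_\pm\in C^\infty((0,\infty))$ are nonnegative and strictly increasing with $1/P_\pm'\in L^\infty_{loc}((0,\infty))$, and $h_\pm(z)=\int_1^z \frac{P_\pm'(r)}{r}dr$. The number $\rho_0^->0$ satisfies $P_-(\rho_0^-)>P_+(\rho_0^-)$ and $P_-(\rho_0^-)\in P_+((0,\infty))$; $\rho_0^+:=P_+^{-1}(P_-(\rho_0^-))$, so $\rho_0^+>\rho_0^-$. It is assumed that $h_-(\rho_0^-)+gm\in h_-((0,\infty))$ and $h_+(\rho_0^+)-g\ell\in h_+((0,\infty))$. Define $\rho_0(x_3)=h_-^{-1}(h_-(\rho_0^-)-gx_3)$ for $-m<x_3<0$ and $\rho_0(x_3)=h_+^{-1}(h_+(\rho_0^+)-gx_3)$ for $0<x_3<\ell$. $P'(\rho_0)$ means $P_+'(\rho_0)$ for $x_3>0$ and $P_-'(\rho_0)$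 for $x_3<0$. **Domains and norms.** $\Omega=\mathbb{R}^2\times(-m,\ell)$, $\Omega_+=\mathbb{R}^2\times(0,\ell)$, $\Omega_-=\mathbb{R}^2\times(-m,0)$; $f_\pm$ is the restriction of $f$ to $\Omega_\pm$, and $[\![f]\!]=f_+|_{x_3=0}-f_-|_{x_3=0}$. $H^k(\Omega)$ denotes the piecewise Sobolev space of all $f$ with $f_\pm\in H^k(\Omega_\pm)$ (no condition across $\{x_3=0\}$), with $\|f\|_{H^k}^2=\|f_+\|_{H^k(\Omega_+)}^2+\|f_-\|_{H^k(\Omega_-)}^2$, where, with $I_+=(0,\ell)$, $I_-=(-m,0)$ and $\hat f(\xi,x_3)=\int_{\mathbb{R}^2}f(x_1,x_2,x_3)e^{-i(x_1\xi_1+x_2\xi_2)}dx_1dx_2$, $\|f\|_{H^k(\Omega_\pm)}^2=\sum_{j=0}^k\int_{\mathbb{R}^2}(1+|\xi|^2)^{k-j}\|\partial_{x_3}^j\hat f_\pm(\xi,\cdot)\|_{L^2(I_\pm)}^2d\xi$. **Linearized problem.** For $\eta,v:\Omega\times[0,T)\to\mathbb{R}^3$ and $q:\Omega\times[0,T)\to\mathbb{R}$, on $\Omega_+$ and on $\Omega_-$: $$\partial_t\eta=v,\qquad \partial_tq+\rho_0\operatorname{div}v=0,\qquad \rho_0\partial_tv+\nabla(P'(\rho_0)q)=-gq\,e_3-g\rho_0\nabla(e_3\cdot\eta),$$ with jump conditions $[\![v\cdot e_3]\!]=0$, $[\![P'(\rho_0)q]\!]=0$ and boundary conditions $v_-(x_1,x_2,-m,t)\cdot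 e_3=v_+(x_1,x_2,\ell,t)\cdot e_3=0$. A solution on $\Omega\times[0,T)$ is understood to have $\eta,v,q\in L^\infty_{loc}([0,T);H^2(\Omega))$ with $\partial_t\eta,\partial_tv,\partial_tq\in L^\infty_{loc}([0,T);H^1(\Omega))$ (values at each $t$ being those of the continuous representative), so that the equations, traces and initial values make sense. *)

theory Defs
  imports "HOL-Analysis.Analysis"
begin

section \<open>Smooth functions, weak derivatives and Sobolev spaces\<close>

primrec Ck_on :: "nat \<Rightarrow> 'a::euclidean_space set \<Rightarrow> ('a \<Rightarrow> real) \<Rightarrow> bool" where
  "Ck_on 0 S f \<longleftrightarrow> continuous_on S f"
| "Ck_on (Suc n) S f \<longleftrightarrow>
     f differentiable_on S \<and> (\<forall>b\<in>Basis. Ck_on n S (\<lambda>x. frechet_derivative f (at x) b))"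

text \<open>Only used for open \<open>S\<close>.\<close>

definition smooth_on :: "'a::euclidean_space set \<Rightarrow> ('a \<Rightarrow> real) \<Rightarrow> bool" where
  "smooth_on S f \<longleftrightarrow> (\<forall>n. Ck_on n S f)"

definition test_functions :: "'a::euclidean_space set \<Rightarrow> ('a \<Rightarrow> real) set" where
  "test_functions S =
     {\<phi>. smooth_on UNIV \<phi> \<and> (\<exists>K. compact K \<and> K \<subseteq> S \<and> (\<forall>x. x \<notin> K \<longrightarrow> \<phi> x = 0))}"

definition loc_integrable ::
    "'a::euclidean_space set \<Rightarrow> ('a \<Rightarrow> 'b::euclidean_space) \<Rightarrow> bool" where
  "loc_integrable S f \<longleftrightarrow> (\<forall>K. compact K \<and> K \<subseteq> S \<longrightarrow> set_integrable lebesgue K f)"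

text \<open>\<open>w\<close> is the distributional derivative of \<open>f\<close> in the direction \<open>b\<close> on the open set \<open>S\<close>.\<close>

definition weak_partial ::
    "'a::euclidean_space set \<Rightarrow> 'a \<Rightarrow> ('a \<Rightarrow> 'b::euclidean_space) \<Rightarrow> ('a \<Rightarrow> 'b) \<Rightarrow> bool" where
  "weak_partial S b f w \<longleftrightarrow> loc_integrable S f \<and> loc_integrable S w \<and>
     (\<forall>\<phi>\<in>test_functions S.
        (LINT x:S|lebesgue. frechet_derivative \<phi> (at x) b *\<^sub>R f x)
          = - (LINT x:S|lebesgue. \<phi> x *\<^sub>R w x))"

definition L2_on :: "'a::euclidean_space set \<Rightarrow> ('a \<Rightarrow> 'b::euclidean_space) \<Rightarrow> bool" where
  "L2_on S f \<longleftrightarrow> set_borel_measurable lebesgue S f \<and>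
     (\<integral>\<^sup>+x\<in>S. ennreal ((norm (f x))\<^sup>2) \<partial>lebesgue) < \<infinity>"

primrec sobolev_on ::
    "nat \<Rightarrow> 'a::euclidean_space set \<Rightarrow> ('a \<Rightarrow> 'b::euclidean_space) \<Rightarrow> bool" where
  "sobolev_on 0 S f \<longleftrightarrow> L2_on S f"
| "sobolev_on (Suc k) S f \<longleftrightarrow>
     L2_on S f \<and> (\<forall>b\<in>Basis. \<exists>w. weak_partial S b f w \<and> sobolev_on k S w)"

text \<open>A weak derivative is unique up to null sets, and below it is only ever used up to null sets
  and for functions that possess one; the choice is therefore immaterial.\<close>

definition wpartial ::
    "'a::euclidean_space set \<Rightarrow> 'a \<Rightarrow> ('a \<Rightarrow> 'b::euclidean_space) \<Rightarrow> 'a \<Rightarrow> 'b" where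
  "wpartial S b f = (SOME w. weak_partial S b f w)"

definition wgrad :: "(real^3) set \<Rightarrow> (real^3 \<Rightarrow> real) \<Rightarrow> real^3 \<Rightarrow> real^3" where
  "wgrad S f x = (\<chi> i. wpartial S (axis i 1) f x)"

definition wdiv :: "(real^3) set \<Rightarrow> (real^3 \<Rightarrow> real^3) \<Rightarrow> real^3 \<Rightarrow> real" where
  "wdiv S u x = (\<Sum>i\<in>UNIV. wpartial S (axis i 1) (\<lambda>y. u y $ i) x)"

text \<open>The \<open>j\<close>-th weak derivative of a function of one variable; the power is the iterated relation
  composition.\<close>

definition wderiv :: "real set \<Rightarrow> nat \<Rightarrow> (real \<Rightarrow> complex) \<Rightarrow> real \<Rightarrow> complex" where
  "wderiv I j u = (SOME w. (weak_partial I 1 ^^ j) u w)"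


section \<open>Slabs and the piecewise Sobolev norms\<close>

abbreviation e3 :: "real^3" where
  "e3 \<equiv> axis 3 1"

definition hor :: "real^3 \<Rightarrow> real^2" where
  "hor x = vector [x $ 1, x $ 2]"

definition pt :: "real^2 \<Rightarrow> real \<Rightarrow> real^3" where
  "pt y z = vector [y $ 1, y $ 2, z]"

definition slab :: "real set \<Rightarrow> (real^3) set" where
  "slab I = {x. x $ 3 \<in> I}"

text \<open>The horizontal Fourier transform
  \<open>\<integral> f (y, z) exp (- i y \<bullet> \<xi>) dy\<close> of a function that is merely square integrable on a slab is
  understood in the sense of Plancherel, i.e. as the limit in \<open>L\<^sup>2\<close> of the integrals over
  \<open>\<bar>y\<bar> \<le> R\<close> for \<open>R \<rightarrow> \<infinity>\<close>. It is determined up to null sets.\<close>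

definition hfourier_trunc :: "real \<Rightarrow> (real^3 \<Rightarrow> real) \<Rightarrow> real^2 \<Rightarrow> real \<Rightarrow> complex" where
  "hfourier_trunc R f \<xi> z =
     (LINT y:cball 0 R|lebesgue. complex_of_real (f (pt y z)) * cis (- (y \<bullet> \<xi>)))"

definition is_hfourier ::
    "real set \<Rightarrow> (real^3 \<Rightarrow> real) \<Rightarrow> (real^2 \<Rightarrow> real \<Rightarrow> complex) \<Rightarrow> bool" where
  "is_hfourier I f F \<longleftrightarrow> L2_on (UNIV \<times> I) (\<lambda>(\<xi>, z). F \<xi> z) \<and>
     ((\<lambda>R. \<integral>\<^sup>+p\<in>UNIV \<times> I.
         ennreal ((cmod (F (fst p) (snd p) - hfourier_trunc R f (fst p) (snd p)))\<^sup>2) \<partial>lebesgue)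
       \<longlongrightarrow> 0) at_top"

definition hfourier :: "real set \<Rightarrow> (real^3 \<Rightarrow> real) \<Rightarrow> real^2 \<Rightarrow> real \<Rightarrow> complex" where
  "hfourier I f = (SOME F. is_hfourier I f F)"

definition slab_norm_sq :: "nat \<Rightarrow> real set \<Rightarrow> (real^3 \<Rightarrow> real) \<Rightarrow> ennreal" where
  "slab_norm_sq k I f =
     (\<Sum>j\<le>k. \<integral>\<^sup>+\<xi>. ennreal ((1 + (norm \<xi>)\<^sup>2) ^ (k - j)) *
        (\<integral>\<^sup>+z\<in>I. ennreal ((cmod (wderiv I j (hfourier I f \<xi>) z))\<^sup>2) \<partial>lebesgue) \<partial>lebesgue)"

definition Iplus :: "real \<Rightarrow> real set" where
  "Iplus l = {0<..<l}"

definition Iminus :: "real \<Rightarrow> real set" where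
  "Iminus m = {-m<..<0}"

definition H_space :: "real \<Rightarrow> real \<Rightarrow> nat \<Rightarrow> (real^3 \<Rightarrow> 'b::euclidean_space) set" where
  "H_space m l k = {f. sobolev_on k (slab (Iplus l)) f \<and> sobolev_on k (slab (Iminus m)) f}"

text \<open>Meaningful for members of \<open>H_space m l k\<close> only (for which the squared norm is finite).
  The norm of a vector field is the Euclidean norm of the norms of its components.\<close>

definition H_norm :: "real \<Rightarrow> real \<Rightarrow> nat \<Rightarrow> (real^3 \<Rightarrow> 'b::euclidean_space) \<Rightarrow> real" where
  "H_norm m l k f = sqrt (enn2real (\<Sum>b\<in>Basis.
     slab_norm_sq k (Iplus l) (\<lambda>x. f x \<bullet> b) + slab_norm_sq k (Iminus m) (\<lambda>x. f x \<bullet> b)))"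


section \<open>Traces\<close>

text \<open>The trace of \<open>f\<close>, defined on \<open>slab I\<close>, on the plane \<open>x\<^sub>3 = c\<close> where \<open>c\<close> is an end
  point of \<open>I\<close>: the \<open>L\<^sup>2\<close> limit of \<open>f\<close> at the plane, taken in the mean over thin layers so that
  it does not depend on the values of \<open>f\<close> on null sets.\<close>

definition is_plane_trace :: "real set \<Rightarrow> real \<Rightarrow> (real^3 \<Rightarrow> real) \<Rightarrow> (real^2 \<Rightarrow> real) \<Rightarrow> bool" where
  "is_plane_trace I c f \<gamma> \<longleftrightarrow> L2_on UNIV \<gamma> \<and>
     ((\<lambda>e. (\<integral>\<^sup>+x\<in>slab (I \<inter> ball c e). ennreal ((f x - \<gamma> (hor x))\<^sup>2) \<partial>lebesgue) / ennreal e)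
       \<longlongrightarrow> 0) (at_right 0)"

definition plane_trace :: "real set \<Rightarrow> real \<Rightarrow> (real^3 \<Rightarrow> real) \<Rightarrow> real^2 \<Rightarrow> real" where
  "plane_trace I c f = (SOME \<gamma>. is_plane_trace I c f \<gamma>)"

definition plane_jump :: "real \<Rightarrow> real \<Rightarrow> (real^3 \<Rightarrow> real) \<Rightarrow> real^2 \<Rightarrow> real" where
  "plane_jump m l f y = plane_trace (Iplus l) 0 f y - plane_trace (Iminus m) 0 f y"


section \<open>Time-dependent functions\<close>

text \<open>Functions of time are curried: \<open>u t x\<close>. Times range over \<open>[0, T)\<close> with \<open>0 < T \<le> \<infinity>\<close>.\<close>

definition Linf_loc_H ::
    "real \<Rightarrow> real \<Rightarrow> nat \<Rightarrow> ereal \<Rightarrow> (real \<Rightarrow> real^3 \<Rightarrow> 'b::euclidean_space) \<Rightarrow> bool" where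
  "Linf_loc_H m l k T u \<longleftrightarrow>
     set_borel_measurable lebesgue
       ({t. 0 \<le> t \<and> ereal t < T} \<times> (slab (Iplus l) \<union> slab (Iminus m))) (\<lambda>(t, x). u t x) \<and>
     (\<forall>T'. ereal T' < T \<longrightarrow> (\<exists>C. AE t in lebesgue. 0 \<le> t \<and> t \<le> T' \<longrightarrow>
        u t \<in> H_space m l k \<and> H_norm m l k (u t) \<le> C))"

text \<open>\<open>\<partial>\<^sub>t u = w\<close>, in integrated form. Requiring the identity at all times (rather than almost
  all) selects the representative of \<open>u\<close> that is continuous in time.\<close>

definition has_time_deriv ::
    "real \<Rightarrow> real \<Rightarrow> ereal \<Rightarrow> (real \<Rightarrow> real^3 \<Rightarrow> 'b::euclidean_space) \<Rightarrow>
     (real \<Rightarrow> real^3 \<Rightarrow> 'b) \<Rightarrow> bool" where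
  "has_time_deriv m l T u w \<longleftrightarrow> (\<forall>s t. 0 \<le> s \<and> s \<le> t \<and> ereal t < T \<longrightarrow>
     (AE x in lebesgue. x \<in> slab (Iplus l) \<union> slab (Iminus m) \<longrightarrow>
        set_integrable lebesgue {s..t} (\<lambda>\<tau>. w \<tau> x) \<and>
        u t x - u s x = (LINT \<tau>:{s..t}|lebesgue. w \<tau> x)))"


section \<open>The steady state\<close>

definition enthalpy :: "(real \<Rightarrow> real) \<Rightarrow> real \<Rightarrow> real" where
  "enthalpy P z = (LBINT r=1..ereal z. deriv P r / r)"

definition rho0_plus :: "(real \<Rightarrow> real) \<Rightarrow> (real \<Rightarrow> real) \<Rightarrow> real \<Rightarrow> real" where
  "rho0_plus Pp Pm rm = inv_into {0<..} Pp (Pm rm)"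

text \<open>Here \<open>rm\<close> is the density \<open>\<rho>\<^sub>0\<^sup>-\<close>. The value at \<open>z = 0\<close> is irrelevant.\<close>

definition rho0 :: "real \<Rightarrow> (real \<Rightarrow> real) \<Rightarrow> (real \<Rightarrow> real) \<Rightarrow> real \<Rightarrow> real \<Rightarrow> real" where
  "rho0 g Pp Pm rm z =
     (if z > 0
      then inv_into {0<..} (enthalpy Pp) (enthalpy Pp (rho0_plus Pp Pm rm) - g * z)
      else inv_into {0<..} (enthalpy Pm) (enthalpy Pm rm - g * z))"

definition Pprime_rho0 :: "real \<Rightarrow> (real \<Rightarrow> real) \<Rightarrow> (real \<Rightarrow> real) \<Rightarrow> real \<Rightarrow> real \<Rightarrow> real" where
  "Pprime_rho0 g Pp Pm rm z =
     (if z > 0 then deriv Pp (rho0 g Pp Pm rm z) else deriv Pm (rho0 g Pp Pm rm z))"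

definition pressure_law :: "(real \<Rightarrow> real) \<Rightarrow> bool" where
  "pressure_law P \<longleftrightarrow> smooth_on {0<..} P \<and> (\<forall>r>0. P r \<ge> 0) \<and> strict_mono_on {0<..} P \<and>
     (\<forall>K. compact K \<and> K \<subseteq> {0<..} \<longrightarrow>
        (\<exists>C. AE r in lebesgue. r \<in> K \<longrightarrow> \<bar>1 / deriv P r\<bar> \<le> C))"


section \<open>The linearized problem\<close>

text \<open>In the following, \<open>\<rho>\<close> and \<open>p\<close> are the coefficients \<open>\<rho>\<^sub>0\<close> and \<open>P'(\<rho>\<^sub>0)\<close> as functions
  of \<open>x\<^sub>3\<close>, and \<open>\<eta>t\<close>, \<open>vt\<close>, \<open>qt\<close> are the time derivatives.\<close>

definition linearized_equations_on ::
    "real set \<Rightarrow> real \<Rightarrow> (real \<Rightarrow> real) \<Rightarrow> (real \<Rightarrow> real) \<Rightarrow>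
     (real^3 \<Rightarrow> real^3) \<Rightarrow> (real^3 \<Rightarrow> real^3) \<Rightarrow> (real^3 \<Rightarrow> real) \<Rightarrow>
     (real^3 \<Rightarrow> real^3) \<Rightarrow> (real^3 \<Rightarrow> real^3) \<Rightarrow> (real^3 \<Rightarrow> real) \<Rightarrow> bool" where
  "linearized_equations_on I g \<rho> p \<eta> v q \<eta>t vt qt \<longleftrightarrow>
     (AE x in lebesgue. x \<in> slab I \<longrightarrow>
        \<eta>t x = v x \<and>
        qt x + \<rho> (x $ 3) * wdiv (slab I) v x = 0 \<and>
        \<rho> (x $ 3) *\<^sub>R vt x + wgrad (slab I) (\<lambda>y. p (y $ 3) * q y) x
          = - (g * q x) *\<^sub>R e3 - (g * \<rho> (x $ 3)) *\<^sub>R wgrad (slab I) (\<lambda>y. e3 \<bullet> \<eta> y) x)"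

definition jump_boundary_conditions ::
    "real \<Rightarrow> real \<Rightarrow> (real \<Rightarrow> real) \<Rightarrow> (real^3 \<Rightarrow> real^3) \<Rightarrow> (real^3 \<Rightarrow> real) \<Rightarrow> bool" where
  "jump_boundary_conditions m l p v q \<longleftrightarrow>
     (AE y in lebesgue.
        plane_jump m l (\<lambda>x. v x \<bullet> e3) y = 0 \<and>
        plane_jump m l (\<lambda>x. p (x $ 3) * q x) y = 0 \<and>
        plane_trace (Iminus m) (-m) (\<lambda>x. v x \<bullet> e3) y = 0 \<and>
        plane_trace (Iplus l) l (\<lambda>x. v x \<bullet> e3) y = 0)"

definition linearized_solution ::
    "real \<Rightarrow> real \<Rightarrow> real \<Rightarrow> (real \<Rightarrow> real) \<Rightarrow> (real \<Rightarrow> real) \<Rightarrow> ereal \<Rightarrow>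
     (real \<Rightarrow> real^3 \<Rightarrow> real^3) \<Rightarrow> (real \<Rightarrow> real^3 \<Rightarrow> real^3) \<Rightarrow> (real \<Rightarrow> real^3 \<Rightarrow> real) \<Rightarrow> bool" where
  "linearized_solution g m l \<rho> p T \<eta> v q \<longleftrightarrow>
     Linf_loc_H m l 2 T \<eta> \<and> Linf_loc_H m l 2 T v \<and> Linf_loc_H m l 2 T q \<and>
     (\<exists>\<eta>t vt qt.
        Linf_loc_H m l 1 T \<eta>t \<and> Linf_loc_H m l 1 T vt \<and> Linf_loc_H m l 1 T qt \<and>
        has_time_deriv m l T \<eta> \<eta>t \<and> has_time_deriv m l T v vt \<and> has_time_deriv m l T q qt \<and>
        (AE t in lebesgue. 0 \<le> t \<and> ereal t < T \<longrightarrow>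
           linearized_equations_on (Iplus l) g \<rho> p (\<eta> t) (v t) (q t) (\<eta>t t) (vt t) (qt t) \<and>
           linearized_equations_on (Iminus m) g \<rho> p (\<eta> t) (v t) (q t) (\<eta>t t) (vt t) (qt t))) \<and>
     (\<forall>t. 0 \<le> t \<and> ereal t < T \<longrightarrow> jump_boundary_conditions m l p (v t) (q t))"

end

theory Submission
  imports Defs "HOL-Probability.Probability" "HOL-Computational_Algebra.Polynomial"
begin

text \<open>
  With \<open>q = - \<rho>\<^sub>0 div \<eta>\<close> the problem becomes a second-order system for \<open>\<eta>\<close>, and the potential fields
  \<open>\<eta> = exp (\<lambda> t) \<nabla>(exp (i x \<bullet> \<xi>) \<phi>(x\<^sub>3))\<close> solve it in each layer if
  \<open>(\<rho>\<^sub>0 \<phi>')' = \<rho>\<^sub>0 (s + \<mu> / P'(\<rho>\<^sub>0)) \<phi>\<close> with \<open>s = \<bar>\<xi>\<bar>\<^sup>2\<close> and \<open>\<mu> = \<lambda>\<^sup>2\<close>. Let \<open>u\<close> be the solution with \<open>u = 1\<close>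
  and \<open>u' = 0\<close> at the rigid wall of the layer and \<open>v = \<rho>\<^sub>0 u'\<close>, where the derivative is taken in the direction of
  the interface. The jump conditions then reduce to the dispersion relation
  \<open>\<mu> ((\<rho>\<^sub>0\<^sup>+)\<^sup>2 u\<^sub>+ / v\<^sub>+ + (\<rho>\<^sub>0\<^sup>-)\<^sup>2 u\<^sub>- / v\<^sub>-) = g (\<rho>\<^sub>0\<^sup>+ - \<rho>\<^sub>0\<^sup>-)\<close> at the interface. Its left-hand side
  increases with \<open>\<mu>\<close> from \<open>0\<close> to infinity, so there is a unique root \<open>\<mu>(s) > 0\<close>, the heavier fluid being on top;
  and since \<open>u / v\<close> is at most of order \<open>1 / sqrt s\<close>, the root is at least of order \<open>sqrt s\<close>. Superposing these
  modes over the annulus \<open>R \<le> \<bar>\<xi>\<bar> \<le> R + 1\<close> gives solutions whose Sobolev norms at time \<open>0\<close> are polynomially bounded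
  in \<open>R\<close>, while their growth up to any positive time is exponential in \<open>sqrt R\<close>.
\<close>

section \<open>Test functions and weak derivatives\<close>

text \<open>Why potential fields: hydrostatic balance P'(\<rho>) \<rho>' = - g \<rho> turns
  \<nabla>(P' q) + g q e3 into \<rho> \<nabla>(P' q / \<rho>), so the momentum equation says that
  the acceleration is the gradient of - (P' q / \<rho> + g \<eta>3). Each mode is normalized by
  \<phi>' = 1 at the interface. This matches the vertical velocities, leaves continuity of P' q as
  the only condition there, and keeps the modes bounded at high frequency although u and v grow;
  hence the polynomial initial norms. The obstacle is that \<open>wpartial\<close>,
  \<open>wderiv\<close>, \<open>hfourier\<close> and \<open>plane_trace\<close> are choices,
  determined up to null sets. All fields are therefore Fourier integrals over compact sets of
  frequencies, and each choice is evaluated by exhibiting one admissible object and proving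
  uniqueness almost everywhere. Norms become weighted integrals of squared amplitudes and are
  monotone in their moduli, so a rate that is at least 1 at all frequencies yields both comparisons,
  of v with \<eta> and of later with earlier times. The lower bound is read off from the vertical
  displacement just below the interface, where \<phi>' is close to 1.\<close>

primrec Cr :: "nat \<Rightarrow> real set \<Rightarrow> (real \<Rightarrow> real) \<Rightarrow> bool" where
  "Cr 0 S f \<longleftrightarrow> continuous_on S f"
| "Cr (Suc n) S f \<longleftrightarrow> (\<exists>f'. (\<forall>x\<in>S. (f has_real_derivative f' x) (at x within S)) \<and> Cr n S f')"

lemma Cr_imp_continuous: "Cr n S f \<Longrightarrow> continuous_on S f"
  by (cases n) (auto intro: DERIV_continuous_on)

lemma Cr_SucD: "Cr (Suc n) S f \<Longrightarrow> Cr n S f"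
proof (induction n arbitrary: f)
  case (Suc n)
  from Suc.prems obtain f' where "\<forall>x\<in>S. (f has_real_derivative f' x) (at x within S)" "Cr (Suc n) S f'"
    by auto
  with Suc.IH show ?case by (metis Cr.simps(2))
qed (auto intro: DERIV_continuous_on)

lemma Cr_add: "Cr n S f \<Longrightarrow> Cr n S g \<Longrightarrow> Cr n S (\<lambda>x. f x + g x)"
proof (induction n arbitrary: f g)
  case (Suc n)
  then obtain f' g' where "\<forall>x\<in>S. (f has_real_derivative f' x) (at x within S)" "Cr n S f'"
    "\<forall>x\<in>S. (g has_real_derivative g' x) (at x within S)" "Cr n S g'" by auto
  then show ?case using Suc.IH
    by (auto intro!: exI[of _ "\<lambda>x. f' x + g' x"] derivative_eq_intros)
qed (auto intro: continuous_intros)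

lemma Cr_const [simp]: "Cr n S (\<lambda>x. c)"
  by (induction n arbitrary: c) (auto intro!: exI[of _ "\<lambda>x. 0"])

lemma Cr_mult: "Cr n S f \<Longrightarrow> Cr n S g \<Longrightarrow> Cr n S (\<lambda>x. f x * g x)"
proof (induction n arbitrary: f g)
  case (Suc n)
  then obtain f' g' where *: "\<forall>x\<in>S. (f has_real_derivative f' x) (at x within S)" "Cr n S f'"
    "\<forall>x\<in>S. (g has_real_derivative g' x) (at x within S)" "Cr n S g'" by auto
  have "Cr n S f" "Cr n S g" using Suc.prems Cr_SucD by blast+
  with * show ?case using Suc.IH Cr_add
    by (auto intro!: exI[of _ "\<lambda>x. f' x * g x + g' x * f x"] derivative_eq_intros)
qed (auto intro: continuous_intros)

lemma Cr_cong: "(\<And>x. x \<in> S \<Longrightarrow> f x = g x) \<Longrightarrow> Cr n S f \<Longrightarrow> Cr n S g"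
proof (induction n arbitrary: f g)
  case 0
  then show ?case using continuous_on_cong[of S S f g] by simp
next
  case (Suc n)
  then obtain f' where "\<forall>x\<in>S. (f has_real_derivative f' x) (at x within S)" "Cr n S f'" by auto
  then have "\<forall>x\<in>S. (g has_real_derivative f' x) (at x within S)"
    using Suc.prems(1) by (auto intro: has_field_derivative_transform_within[OF _ zero_less_one])
  then show ?case using \<open>Cr n S f'\<close> by auto
qed

lemma Cr_compose:
  assumes "\<And>x. x \<in> S \<Longrightarrow> f x \<in> T" "Cr n S f" "Cr n T g"
  shows "Cr n S (\<lambda>x. g (f x))"
  using assms
proof (induction n arbitrary: g)
  case 0
  then show ?case by (auto intro: continuous_on_compose2)
next
  case (Suc n)
  then obtain f' g' where *: "\<forall>x\<in>S. (f has_real_derivative f' x) (at x within S)" "Cr n S f'"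
    "\<forall>x\<in>T. (g has_real_derivative g' x) (at x within T)" "Cr n T g'" by auto
  have "Cr n S (\<lambda>x. g' (f x))" using Suc * Cr_SucD by blast
  moreover have "((\<lambda>x. g (f x)) has_real_derivative g' (f x) * f' x) (at x within S)" if "x \<in> S" for x
  proof -
    have "(g has_real_derivative g' (f x)) (at (f x) within f ` S)"
      using * Suc.prems(1) that by (meson DERIV_subset image_subsetI)
    then show ?thesis using * that DERIV_image_chain[of g _ f x S] by (simp add: o_def)
  qed
  ultimately show ?case using Cr_mult[OF _ *(2)]
    by (auto intro!: exI[of _ "\<lambda>x. g' (f x) * f' x"])
qed

text \<open>Tensor products are closed under partial differentiation: differentiating in direction
  \<open>c\<close> replaces the single factor \<open>F c\<close> by its derivative. Hence the
  induction on the order runs with \<open>F\<close> arbitrary.\<close>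

lemma Ck_on_prod:
  fixes F :: "'a::euclidean_space \<Rightarrow> real \<Rightarrow> real"
  assumes "\<And>b. b \<in> Basis \<Longrightarrow> Cr n UNIV (F b)"
  shows "Ck_on n UNIV (\<lambda>x::'a. \<Prod>b\<in>Basis. F b (x \<bullet> b))"
  using assms
proof (induction n arbitrary: F)
  case 0
  have "continuous_on UNIV (\<lambda>x::'a. F b (x \<bullet> b))" if "b \<in> Basis" for b
    by (rule continuous_on_compose2[of UNIV "F b"]) (use 0 that in \<open>auto intro!: continuous_intros\<close>)
  then show ?case by (auto intro!: continuous_intros)
next
  case (Suc n)
  then obtain F' where F': "\<And>b x. b \<in> Basis \<Longrightarrow> (F b has_real_derivative F' b x) (at x)"
    "\<And>b. b \<in> Basis \<Longrightarrow> Cr n UNIV (F' b)" by simp metis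
  have d: "((\<lambda>x::'a. \<Prod>b\<in>Basis. F b (x \<bullet> b)) has_derivative
     (\<lambda>y. \<Sum>i\<in>Basis. (F' i (x \<bullet> i) * (y \<bullet> i)) * (\<Prod>j\<in>Basis - {i}. F j (x \<bullet> j)))) (at x)" for x
  proof (rule has_derivative_prod)
    fix i :: 'a assume "i \<in> Basis"
    from F'(1)[OF this, of "x \<bullet> i", unfolded has_field_derivative_def]
    have "(F i has_derivative (\<lambda>t. F' i (x \<bullet> i) * t)) (at (x \<bullet> i))" .
    moreover have "((\<lambda>y. y \<bullet> i) has_derivative (\<lambda>y. y \<bullet> i)) (at x)"
      by (intro bounded_linear_imp_has_derivative bounded_linear_inner_left)
    ultimately show "((\<lambda>x. F i (x \<bullet> i)) has_derivative (\<lambda>y. F' i (x \<bullet> i) * (y \<bullet> i))) (at x)"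
      using has_derivative_compose[where g = "F i" and f = "\<lambda>y. y \<bullet> i"] by blast
  qed
  have fd: "frechet_derivative (\<lambda>x::'a. \<Prod>b\<in>Basis. F b (x \<bullet> b)) (at x) c =
      (\<Prod>b\<in>Basis. (F(c := F' c)) b (x \<bullet> b))" if "c \<in> Basis" for x c
  proof -
    have "frechet_derivative (\<lambda>x::'a. \<Prod>b\<in>Basis. F b (x \<bullet> b)) (at x) c =
      (\<Sum>i\<in>Basis. (F' i (x \<bullet> i) * (c \<bullet> i)) * (\<Prod>j\<in>Basis - {i}. F j (x \<bullet> j)))"
      by (simp only: frechet_derivative_at[OF d, symmetric])
    also have "\<dots> = (\<Sum>i\<in>Basis. if i = c then F' i (x \<bullet> i) * (\<Prod>j\<in>Basis - {i}. F j (x \<bullet> j)) else 0)"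
      using that by (intro sum.cong) (auto simp: inner_Basis)
    also have "\<dots> = F' c (x \<bullet> c) * (\<Prod>j\<in>Basis - {c}. F j (x \<bullet> j))"
      using that by simp
    also have "\<dots> = (\<Prod>b\<in>Basis. (F(c := F' c)) b (x \<bullet> b))"
      using that by (subst (2) prod.remove[of _ c]) (auto intro!: prod.cong)
    finally show ?thesis .
  qed
  have "Ck_on n UNIV (\<lambda>x. \<Prod>b\<in>Basis. (F(c := F' c)) b (x \<bullet> b))" if "c \<in> Basis" for c
    using Suc.prems F' that by (intro Suc.IH) (auto intro: Cr_SucD simp del: Cr.simps(2))
  then show ?case using d fd by (auto simp: differentiable_on_def differentiable_def)
qed

text \<open>The classical flat function exp (- c / t), multiplied by a polynomial in 1 / t so that
  the class is closed under differentiation. The constant \<open>c\<close> is kept free because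
  \<open>flat c 1\<close> tends to the indicator of the positive half-line as \<open>c\<close> tends
  to 0.\<close>

definition flat :: "real \<Rightarrow> real poly \<Rightarrow> real \<Rightarrow> real" where
  "flat c p t = (if t > 0 then poly p (1 / t) * exp (- (c / t)) else 0)"

lemma poly_mult_exp_tendsto_0:
  fixes p :: "real poly"
  assumes "c > 0" shows "((\<lambda>x. poly p x * exp (- (c * x))) \<longlongrightarrow> 0) at_top"
proof -
  have "((\<lambda>x. coeff p i * (1 / c ^ i) * ((c * x) ^ i / exp (c * x))) \<longlongrightarrow> coeff p i * (1 / c ^ i) * 0) at_top" for i
    by (intro tendsto_mult tendsto_const
      filterlim_compose[OF tendsto_power_div_exp_0 filterlim_tendsto_pos_mult_at_top[OF tendsto_const assms filterlim_ident]])
  then have "((\<lambda>x. \<Sum>i\<le>degree p. coeff p i * (1 / c ^ i) * ((c * x) ^ i / exp (c * x))) \<longlongrightarrow> (\<Sum>i\<le>degree p. 0)) at_top"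
    by (intro tendsto_sum) simp
  then show ?thesis using assms
    by (simp add: poly_altdef sum_distrib_right sum_distrib_left exp_minus field_simps)
qed

lemma flat_tendsto_0: assumes "c > 0" shows "(flat c p \<longlongrightarrow> 0) (at 0)"
proof -
  have "((\<lambda>t. poly p (1 / t) * exp (- (c * (1 / t)))) \<longlongrightarrow> 0) (at_right 0)"
    by (rule filterlim_compose[OF poly_mult_exp_tendsto_0[OF assms], of "\<lambda>t. 1 / t"])
       (simp add: filterlim_inverse_at_top_right divide_inverse)
  then have "(flat c p \<longlongrightarrow> 0) (at_right 0)"
    by (rule Lim_transform_eventually) (auto simp: eventually_at_filter flat_def)
  moreover have "(flat c p \<longlongrightarrow> 0) (at_left 0)"
    by (rule Lim_transform_eventually[OF tendsto_const]) (auto simp: eventually_at_filter flat_def)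
  ultimately show ?thesis by (simp add: filterlim_split_at)
qed

text \<open>In the variable y = 1 / t the function is p(y) exp (- c y), and dy / dt = - y^2; so p is
  replaced by (c p - p') y^2, where \<open>[:0,0,1:]\<close> is y^2.\<close>

lemma flat_DERIV:
  assumes "c > 0"
  shows "(flat c p has_real_derivative flat c ((smult c p - pderiv p) * [:0,0,1:]) t) (at t)"
proof -
  consider "t > 0" | "t < 0" | "t = 0" by linarith
  then show ?thesis
  proof cases
    case 1
    have "((\<lambda>t. poly p (1 / t) * exp (- (c / t))) has_real_derivative
       flat c ((smult c p - pderiv p) * [:0,0,1:]) t) (at t)"
      using 1 by (auto intro!: derivative_eq_intros simp: flat_def field_simps power2_eq_square)
    then show ?thesis
      by (rule has_field_derivative_transform_within_open[of _ _ _ "{0<..}"]) (use 1 in \<open>auto simp: flat_def\<close>)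
  next
    case 2
    have "((\<lambda>t. 0) has_real_derivative 0) (at t)" by simp
    then have "(flat c p has_real_derivative 0) (at t)"
      by (rule has_field_derivative_transform_within_open[of _ _ _ "{..<0}"]) (use 2 in \<open>auto simp: flat_def\<close>)
    then show ?thesis using 2 by (simp add: flat_def)
  next
    case 3
    \<comment> \<open>The difference quotient at 0 is again flat: division by t multiplies the
      polynomial in 1 / t by its variable.\<close>
    have "((\<lambda>t. flat c (pCons 0 p) t) \<longlongrightarrow> 0) (at 0)" by (rule flat_tendsto_0[OF assms])
    then have "((\<lambda>y. (flat c p y - flat c p 0) / (y - 0)) \<longlongrightarrow> 0) (at 0)"
      by (rule Lim_transform_eventually) (auto simp: eventually_at_filter flat_def)
    then show ?thesis using 3 by (simp add: has_field_derivative_iff flat_def)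
  qed
qed

lemma Cr_flat: "c > 0 \<Longrightarrow> Cr n S (flat c p)"
proof (induction n arbitrary: p)
  case 0
  then show ?case
    using DERIV_continuous_on[of S "flat c p"] flat_DERIV has_field_derivative_at_within by simp blast
next
  case (Suc n)
  then show ?case using flat_DERIV has_field_derivative_at_within by simp blast
qed

lemma test_function_box:
  fixes a d :: "'a::euclidean_space"
  assumes "c > 0" "cbox a d \<subseteq> S"
  shows "(\<lambda>x. \<Prod>b\<in>Basis. flat c 1 (x \<bullet> b - a \<bullet> b) * flat c 1 (d \<bullet> b - x \<bullet> b)) \<in> test_functions S"
proof -
  have lin: "Cr n UNIV (\<lambda>t. u * t + e)" for n and u e :: real
    by (cases n) (auto intro!: continuous_intros exI[of _ "\<lambda>x. u"] derivative_eq_intros)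
  have "Cr n UNIV (\<lambda>t. flat c 1 (t - a \<bullet> b) * flat c 1 (d \<bullet> b - t))" for n and b :: 'a
    using Cr_compose[OF _ lin[of n 1 "- (a \<bullet> b)"] Cr_flat[OF assms(1), of n UNIV 1]]
      Cr_compose[OF _ lin[of n "-1" "d \<bullet> b"] Cr_flat[OF assms(1), of n UNIV 1]]
    by (intro Cr_mult) (simp_all add: algebra_simps)
  then have "smooth_on UNIV (\<lambda>x::'a. \<Prod>b\<in>Basis. flat c 1 (x \<bullet> b - a \<bullet> b) * flat c 1 (d \<bullet> b - x \<bullet> b))"
    unfolding smooth_on_def by (intro allI Ck_on_prod)
  moreover have "(\<Prod>b\<in>Basis. flat c 1 (x \<bullet> b - a \<bullet> b) * flat c 1 (d \<bullet> b - x \<bullet> b)) = 0"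
    if "x \<notin> cbox a d" for x :: 'a
  proof -
    from that obtain b where "b \<in> Basis" "\<not> (a \<bullet> b \<le> x \<bullet> b \<and> x \<bullet> b \<le> d \<bullet> b)"
      by (auto simp: mem_box)
    then show ?thesis by (intro prod_zero) (auto simp: flat_def intro!: bexI[of _ b])
  qed
  ultimately show ?thesis using assms(2) unfolding test_functions_def
    by (auto intro!: exI[of _ "cbox a d"])
qed

text \<open>The bumps increase to the indicator of the open box as the constant 1 / (n + 1)
  decreases, so testing against all of them amounts to integrating over the box.\<close>

lemma test_box_limit:
  fixes a d x :: "'a::euclidean_space"
  shows "(\<lambda>n. \<Prod>b\<in>Basis. flat (1 / real (Suc n)) 1 (x \<bullet> b - a \<bullet> b) * flat (1 / real (Suc n)) 1 (d \<bullet> b - x \<bullet> b))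
     \<longlonglongrightarrow> indicator (box a d) x"
proof -
  have 1: "(\<lambda>n. flat (1 / real (Suc n)) 1 t) \<longlonglongrightarrow> (if t > 0 then 1 else 0)" for t
  proof (cases "t > 0")
    case True
    have "(\<lambda>n. exp (- (inverse (real (Suc n)) / t))) \<longlonglongrightarrow> exp (- (0 / t))"
      by (intro tendsto_intros LIMSEQ_inverse_real_of_nat) (use True in auto)
    then show ?thesis using True by (simp add: flat_def divide_inverse)
  qed (simp add: flat_def)
  have "(\<lambda>n. \<Prod>b\<in>Basis. flat (1 / real (Suc n)) 1 (x \<bullet> b - a \<bullet> b) * flat (1 / real (Suc n)) 1 (d \<bullet> b - x \<bullet> b))
     \<longlonglongrightarrow> (\<Prod>b\<in>Basis. (if x \<bullet> b - a \<bullet> b > 0 then 1 else 0) * (if d \<bullet> b - x \<bullet> b > 0 then 1 else 0))"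
    by (intro tendsto_prod tendsto_mult 1)
  moreover have "(\<Prod>b\<in>Basis. (if x \<bullet> b - a \<bullet> b > 0 then 1 else 0) * (if d \<bullet> b - x \<bullet> b > 0 then 1 else 0))
     = (indicator (box a d) x :: real)"
  proof (cases "x \<in> box a d")
    case False
    then obtain b where "b \<in> Basis" "\<not> (a \<bullet> b < x \<bullet> b \<and> x \<bullet> b < d \<bullet> b)" by (auto simp: mem_box)
    then show ?thesis using False by (auto intro!: prod_zero bexI[of _ b])
  qed (auto simp: mem_box)
  ultimately show ?thesis by simp
qed

section \<open>The fundamental lemma of the calculus of variations\<close>

lemma flat_1_bounds: "c > 0 \<Longrightarrow> 0 \<le> flat c 1 t" "c > 0 \<Longrightarrow> flat c 1 t \<le> 1"
  by (auto simp: flat_def)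

lemma borel_measurable_flat [measurable]: "c > 0 \<Longrightarrow> flat c p \<in> borel_measurable borel"
  by (intro borel_measurable_continuous_onI Cr_imp_continuous[OF Cr_flat])

text \<open>Dominated convergence along the product bumps: they lie between 0 and 1 and vanish off
  the closed box, so |w| restricted to that box is a majorant.\<close>

lemma integral_box_eq_0:
  fixes w :: "'a::euclidean_space \<Rightarrow> real"
  assumes "loc_integrable S w" "cbox a d \<subseteq> S" "S \<in> sets lebesgue"
    and 0: "\<And>\<phi>. \<phi> \<in> test_functions S \<Longrightarrow> (LINT x:S|lebesgue. \<phi> x * w x) = 0"
  shows "(LINT x:box a d|lebesgue. w x) = 0"
proof -
  define ph where "ph n x = (\<Prod>b\<in>Basis. flat (1 / real (Suc n)) 1 (x \<bullet> b - a \<bullet> b) * flat (1 / real (Suc n)) 1 (d \<bullet> b - x \<bullet> b))"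
    for n and x :: 'a
  have ph_test: "ph n \<in> test_functions S" for n
    unfolding ph_def using assms(2) by (intro test_function_box) auto
  have ph_zero: "ph n x = 0" if "x \<notin> cbox a d" for n x
  proof -
    from that obtain b where "b \<in> Basis" "\<not> (a \<bullet> b \<le> x \<bullet> b \<and> x \<bullet> b \<le> d \<bullet> b)"
      by (auto simp: mem_box)
    then show ?thesis unfolding ph_def by (intro prod_zero) (auto simp: flat_def intro!: bexI[of _ b])
  qed
  have ph_bd: "0 \<le> ph n x" "ph n x \<le> 1" for n x
    unfolding ph_def by (intro prod_nonneg prod_le_1 ballI conjI mult_nonneg_nonneg mult_le_one flat_1_bounds; simp)+
  have [measurable]: "ph n \<in> borel_measurable lebesgue" for n
    unfolding ph_def by (intro measurable_completion) simp
  have int: "set_integrable lebesgue (cbox a d) w"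
    using assms(1,2) by (auto simp: loc_integrable_def)
  then have [measurable]: "(\<lambda>x. indicator (cbox a d) x * w x) \<in> borel_measurable lebesgue"
    by (auto simp: set_integrable_def)
  have [measurable]: "(\<lambda>x. indicator (box a d) x * (indicator (cbox a d) x * w x)) \<in> borel_measurable lebesgue"
    by (rule borel_measurable_times) (auto intro: measurable_completion)
  have "(\<lambda>n. LINT x|lebesgue. ph n x * (indicator (cbox a d) x * w x)) \<longlonglongrightarrow>
      (LINT x|lebesgue. indicator (box a d) x * (indicator (cbox a d) x * w x))"
  proof (rule integral_dominated_convergence)
    show "integrable lebesgue (\<lambda>x. \<bar>indicator (cbox a d) x * w x\<bar>)"
      using integrable_abs[OF int[unfolded set_integrable_def]] by simp
    show "AE x in lebesgue. norm (ph n x * (indicator (cbox a d) x * w x)) \<le> \<bar>indicator (cbox a d) x * w x\<bar>" for n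
      using ph_bd by (auto simp: abs_mult mult_left_le_one_le)
    show "AE x in lebesgue. (\<lambda>n. ph n x * (indicator (cbox a d) x * w x)) \<longlonglongrightarrow>
      indicator (box a d) x * (indicator (cbox a d) x * w x)"
      unfolding ph_def by (intro AE_I2 tendsto_mult tendsto_const test_box_limit)
  qed auto
  moreover have "(LINT x|lebesgue. ph n x * (indicator (cbox a d) x * w x)) = 0" for n
  proof -
    have "(LINT x|lebesgue. ph n x * (indicator (cbox a d) x * w x)) = (LINT x:S|lebesgue. ph n x * w x)"
      unfolding set_lebesgue_integral_def using assms(2) ph_zero
      by (intro Bochner_Integration.integral_cong) (auto simp: indicator_def)
    then show ?thesis using 0[OF ph_test] by simp
  qed
  ultimately have "(\<lambda>n::nat. 0) \<longlonglongrightarrow> (LINT x|lebesgue. indicator (box a d) x * (indicator (cbox a d) x * w x))"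
    by simp
  from LIMSEQ_unique[OF this tendsto_const]
  have "(LINT x|lebesgue. indicator (box a d) x * (indicator (cbox a d) x * w x)) = 0" .
  moreover have "(LINT x|lebesgue. indicator (box a d) x * (indicator (cbox a d) x * w x)) = (LINT x:box a d|lebesgue. w x)"
    unfolding set_lebesgue_integral_def using box_subset_cbox[of a d]
    by (intro Bochner_Integration.integral_cong) (auto simp: indicator_def)
  ultimately show ?thesis by simp
qed

text \<open>Open boxes are an intersection-stable generator of the Borel sets, so vanishing
  integrals extend from boxes to all Borel sets, and a density all of whose integrals vanish is zero
  almost everywhere. The argument runs on a Borel representative \<open>f'\<close> of the cut-off of
  \<open>w\<close> to the box.\<close>

lemma AE_0_on_box:
  fixes w :: "'a::euclidean_space \<Rightarrow> real"
  assumes int: "set_integrable lebesgue (box a d) w"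
    and 0: "\<And>a' d'. box a' d' \<subseteq> box a d \<Longrightarrow> (LINT x:box a' d'|lebesgue. w x) = 0"
  shows "AE x in lebesgue. x \<in> box a d \<longrightarrow> w x = 0"
proof -
  let ?f = "\<lambda>x. indicator (box a d) x * w x"
  have fint: "integrable lebesgue ?f" using int by (simp add: set_integrable_def)
  then obtain f' where f'[measurable]: "f' \<in> borel_measurable lborel" and ae: "AE x in lborel. ?f x = f' x"
    using completion_ex_borel_measurable_real[of ?f lborel] by auto
  have ae': "AE x in lebesgue. ?f x = f' x" using ae by (rule AE_completion)
  have f'm: "f' \<in> borel_measurable lebesgue" by (rule measurable_completion) simp
  have f'int: "integrable lborel f'"
    using integrable_cong_AE_imp[OF fint f'm ae'] integrable_completion[OF f'] by simp
  have eq: "(LINT x:A|lborel. f' x) = (LINT x|lebesgue. indicator A x * ?f x)" if "A \<in> sets borel" for A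
  proof -
    have "(LINT x:A|lborel. f' x) = (LINT x|lebesgue. indicator A x * f' x)"
    proof -
      have "(\<lambda>x. indicator A x * f' x) \<in> borel_measurable lborel" using that by simp
      from integral_completion[OF this] show ?thesis by (simp add: set_lebesgue_integral_def)
    qed
    also have "\<dots> = (LINT x|lebesgue. indicator A x * ?f x)"
    proof (rule integral_cong_AE)
      have A: "(\<lambda>x. indicator A x :: real) \<in> borel_measurable lebesgue"
        using that by (intro borel_measurable_indicator sets_completionI_sets) simp
      show "(\<lambda>x. indicator A x * f' x) \<in> borel_measurable lebesgue"
        "(\<lambda>x. indicator A x * ?f x) \<in> borel_measurable lebesgue"
        by (rule borel_measurable_times[OF A f'm], rule borel_measurable_times[OF A borel_measurable_integrable[OF fint]])
      show "AE x in lebesgue. indicator A x * f' x = indicator A x * ?f x" using ae' by eventually_elim simp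
    qed
    finally show ?thesis .
  qed
  have zero: "(LINT x:A|lborel. f' x) = 0" if "A \<in> sets borel" for A
  proof -
    have A: "A \<in> sigma_sets UNIV (range (\<lambda>(a, b). box a b :: 'a set))"
      using that by (simp add: borel_eq_box)
    have tot: "(LINT x|lborel. f' x) = 0"
      using eq[of UNIV] 0[of a d] by (simp add: set_lebesgue_integral_def)
    have "Int_stable (range (\<lambda>(a, b). box a b :: 'a set))"
      by (auto simp: Int_stable_def box_Int_box)
    moreover have "range (\<lambda>(a, b). box a b :: 'a set) \<subseteq> Pow UNIV" by simp
    ultimately show ?thesis using A
    proof (induction rule: sigma_sets_induct_disjoint)
      case (basic A)
      then obtain a' d' where A: "A = box a' d'" by auto
      obtain a'' d'' where B: "box a' d' \<inter> box a d = box a'' d''" using box_Int_box by blast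
      have "(LINT x|lebesgue. indicator A x * ?f x) = (LINT x:box a'' d''|lebesgue. w x)"
        unfolding set_lebesgue_integral_def A B[symmetric]
        by (intro Bochner_Integration.integral_cong) (auto simp: indicator_def)
      also have "\<dots> = 0" using B by (intro 0) blast
      finally show ?case using eq[of A] A by simp
    next
      case (compl A)
      then have "A \<in> sets borel" by (simp add: borel_eq_box)
      then have "(LINT x:UNIV - A|lborel. f' x) = (LINT x|lborel. f' x) - (LINT x:A|lborel. f' x)"
      proof -
        have "integrable lborel (\<lambda>x. indicator A x *\<^sub>R f' x)"
          using f'int \<open>A \<in> sets borel\<close> by (intro integrable_mult_indicator) simp_all
        then have "(LINT x|lborel. f' x - indicator A x *\<^sub>R f' x) = (LINT x|lborel. f' x) - (LINT x:A|lborel. f' x)"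
          unfolding set_lebesgue_integral_def by (rule Bochner_Integration.integral_diff[OF f'int])
        moreover have "indicator (UNIV - A) x *\<^sub>R f' x = f' x - indicator A x *\<^sub>R f' x" for x
          by (simp add: indicator_def)
        ultimately show ?thesis unfolding set_lebesgue_integral_def by presburger
      qed
      then show ?case using compl tot by simp
    next
      case (union A)
      then have "range A \<subseteq> sets borel" by (simp add: borel_eq_box)
      then have "(LINT x:(\<Union>i. A i)|lborel. f' x) = (\<Sum>i. (LINT x:A i|lborel. f' x))"
      proof (intro lebesgue_integral_countable_add)
        show "set_integrable lborel (\<Union>i. A i) f'"
          unfolding set_integrable_def using f'int \<open>range A \<subseteq> sets borel\<close>
          by (intro integrable_mult_indicator) auto
      qed (use union(1) \<open>range A \<subseteq> sets borel\<close> in \<open>auto simp: disjoint_family_on_def\<close>)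
      then show ?case using union(3) by simp
    qed (auto simp: set_lebesgue_integral_def)
  qed
  have "AE x in lborel. f' x = 0"
    by (rule density_unique_real[OF f'int]) (use zero in \<open>simp_all add: set_lebesgue_integral_def\<close>)
  then have "AE x in lebesgue. f' x = 0" by (rule AE_completion)
  with ae' show ?thesis by eventually_elim (auto simp: indicator_def split: if_splits)
qed

text \<open>An open set is a countable union of closed boxes contained in it, and the boundary of a
  box is negligible.\<close>

theorem fundamental_lemma_real:
  fixes w :: "'a::euclidean_space \<Rightarrow> real"
  assumes "open S" "loc_integrable S w"
    and 0: "\<And>\<phi>. \<phi> \<in> test_functions S \<Longrightarrow> (LINT x:S|lebesgue. \<phi> x * w x) = 0"
  shows "AE x in lebesgue. x \<in> S \<longrightarrow> w x = 0"
proof -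
  obtain D where D: "countable D" "D \<subseteq> Pow S" "\<And>X. X \<in> D \<Longrightarrow> \<exists>a b. X = cbox a b" "\<Union>D = S"
    using open_countable_Union_open_cbox[OF assms(1)] by metis
  have "AE x in lebesgue. x \<in> X \<longrightarrow> w x = 0" if XD: "X \<in> D" for X
  proof -
    obtain a b where "X = cbox a b" using D(3)[OF XD] by blast
    moreover have "X \<subseteq> S" using D(2) XD by blast
    ultimately have X: "X = cbox a b" "cbox a b \<subseteq> S" by auto
    have "set_integrable lebesgue (box a b) w"
      by (rule set_integrable_subset[of _ "cbox a b"])
        (use assms(2) X box_subset_cbox[of a b] in \<open>auto simp: loc_integrable_def\<close>)
    then have "AE x in lebesgue. x \<in> box a b \<longrightarrow> w x = 0"
    proof (rule AE_0_on_box)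
      fix a' d' assume *: "box a' d' \<subseteq> box a b"
      show "(LINT x:box a' d'|lebesgue. w x) = 0"
      proof (cases "box a' d' = {}")
        case False
        then have "cbox a' d' = closure (box a' d')" by simp
        also have "\<dots> \<subseteq> closure (box a b)" using * by (rule closure_mono)
        also have "\<dots> \<subseteq> S" using False * X(2) by (metis closure_box subset_empty)
        finally show ?thesis using assms by (intro integral_box_eq_0[of S]) auto
      qed (simp add: set_lebesgue_integral_def)
    qed
    moreover have "AE x in lebesgue. x \<notin> cbox a b - box a b"
      using negligible_frontier_interval[of a b] unfolding negligible_iff_null_sets by (rule AE_not_in)
    ultimately show ?thesis unfolding X(1) by eventually_elim auto
  qed
  then have "AE x in lebesgue. \<forall>X\<in>D. x \<in> X \<longrightarrow> w x = 0"
    unfolding AE_ball_countable[OF D(1)] by blast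
  then show ?thesis by eventually_elim (use D(4) in auto)
qed

text \<open>Componentwise reduction to the real case; integrability of
  \<open>\<phi> x *\<^sub>R w x\<close> lets the inner product with a basis vector pass through the
  integral.\<close>

theorem fundamental_lemma:
  fixes w :: "'a::euclidean_space \<Rightarrow> 'b::euclidean_space"
  assumes "open S" "loc_integrable S w"
    and 0: "\<And>\<phi>. \<phi> \<in> test_functions S \<Longrightarrow> (LINT x:S|lebesgue. \<phi> x *\<^sub>R w x) = 0"
    and int: "\<And>\<phi>. \<phi> \<in> test_functions S \<Longrightarrow> set_integrable lebesgue S (\<lambda>x. \<phi> x *\<^sub>R w x)"
  shows "AE x in lebesgue. x \<in> S \<longrightarrow> w x = 0"
proof -
  have "AE x in lebesgue. x \<in> S \<longrightarrow> w x \<bullet> b = 0" if "b \<in> Basis" for b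
  proof (rule fundamental_lemma_real[OF assms(1)])
    show "loc_integrable S (\<lambda>x. w x \<bullet> b)"
      unfolding loc_integrable_def
    proof (intro allI impI)
      fix K assume "compact K \<and> K \<subseteq> S"
      then have "set_integrable lebesgue K w" using assms(2) by (auto simp: loc_integrable_def)
      then have "integrable lebesgue (\<lambda>x. (indicator K x *\<^sub>R w x) \<bullet> b)"
        unfolding set_integrable_def by (intro integrable_inner_left) auto
      then show "set_integrable lebesgue K (\<lambda>x. w x \<bullet> b)" by (simp add: set_integrable_def)
    qed
    fix \<phi> :: "'a \<Rightarrow> real" assume ph: "\<phi> \<in> test_functions S"
    have *: "(LINT x|lebesgue. (indicator S x *\<^sub>R \<phi> x *\<^sub>R w x) \<bullet> b) = (LINT x:S|lebesgue. \<phi> x *\<^sub>R w x) \<bullet> b"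
      unfolding set_lebesgue_integral_def using int[OF ph, unfolded set_integrable_def]
      by (intro integral_inner_left) auto
    show "(LINT x:S|lebesgue. \<phi> x * (w x \<bullet> b)) = 0"
    proof -
      have "(\<lambda>x. (indicator S x *\<^sub>R \<phi> x *\<^sub>R w x) \<bullet> b) = (\<lambda>x. indicator S x *\<^sub>R (\<phi> x * (w x \<bullet> b)))"
        by (simp add: fun_eq_iff)
      then show ?thesis
        using *[unfolded 0[OF ph] inner_zero_left] unfolding set_lebesgue_integral_def by (simp only:)
    qed
  qed
  then have "AE x in lebesgue. \<forall>b\<in>Basis. x \<in> S \<longrightarrow> w x \<bullet> b = 0"
    by (intro AE_finite_allI) auto
  then show ?thesis by eventually_elim (auto intro: euclidean_eqI)
qed

section \<open>Weak derivatives: uniqueness and agreement with classical derivatives\<close>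

lemma test_function_continuous:
  assumes "\<phi> \<in> test_functions S"
  shows "continuous_on UNIV \<phi>" "\<phi> differentiable_on UNIV"
    "\<And>b. b \<in> Basis \<Longrightarrow> continuous_on UNIV (\<lambda>x. frechet_derivative \<phi> (at x) b)"
proof -
  have "Ck_on 0 UNIV \<phi>" "Ck_on (Suc 0) UNIV \<phi>" using assms unfolding test_functions_def smooth_on_def by blast+
  then show "continuous_on UNIV \<phi>" "\<phi> differentiable_on UNIV"
    "\<And>b. b \<in> Basis \<Longrightarrow> continuous_on UNIV (\<lambda>x. frechet_derivative \<phi> (at x) b)" by auto
qed

lemma set_integrable_test_scaleR:
  fixes w :: "'a::euclidean_space \<Rightarrow> 'b::euclidean_space"
  assumes "loc_integrable S w" "compact K" "K \<subseteq> S" "\<And>x. x \<notin> K \<Longrightarrow> \<phi> x = 0" "continuous_on UNIV \<phi>"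
  shows "set_integrable lebesgue S (\<lambda>x. \<phi> x *\<^sub>R w x)"
proof -
  have w: "integrable lebesgue (\<lambda>x. indicator K x *\<^sub>R w x)"
    using assms by (auto simp: loc_integrable_def set_integrable_def)
  have "compact (\<phi> ` K)" using assms by (intro compact_continuous_image) (auto intro: continuous_on_subset)
  then obtain C where C: "\<And>x. x \<in> K \<Longrightarrow> norm (\<phi> x) \<le> C"
    by (meson bounded_iff compact_imp_bounded imageI)
  have m: "\<phi> \<in> borel_measurable lebesgue"
    using assms(5) by (intro measurable_completion) (simp add: borel_measurable_continuous_onI)
  have "integrable lebesgue (\<lambda>x. \<phi> x *\<^sub>R (indicator K x *\<^sub>R w x))"
  proof (rule Bochner_Integration.integrable_bound[OF integrable_scaleR_right[OF w, of C]])
    show "(\<lambda>x. \<phi> x *\<^sub>R (indicator K x *\<^sub>R w x)) \<in> borel_measurable lebesgue"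
      by (rule borel_measurable_scaleR[OF m borel_measurable_integrable[OF w]])
    show "AE x in lebesgue. norm (\<phi> x *\<^sub>R indicator K x *\<^sub>R w x) \<le> norm (C *\<^sub>R indicator K x *\<^sub>R w x)"
      using C by (intro AE_I2) (force simp: indicator_def intro: mult_right_mono)
  qed
  moreover have "\<phi> x *\<^sub>R (indicator K x *\<^sub>R w x) = indicator S x *\<^sub>R \<phi> x *\<^sub>R w x" for x
    using assms by (cases "x \<in> K") (auto simp: indicator_def)
  ultimately show ?thesis by (simp only: set_integrable_def)
qed

text \<open>Two weak derivatives have the same integrals against all test functions, so the
  fundamental lemma applies to their difference. This turns any exhibited weak derivative into the
  value of \<open>wpartial\<close>, up to null sets.\<close>

lemma weak_partial_unique:
  fixes f :: "'a::euclidean_space \<Rightarrow> 'b::euclidean_space"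
  assumes S: "open S" and w: "weak_partial S b f w" "weak_partial S b f w'"
  shows "AE x in lebesgue. x \<in> S \<longrightarrow> w x = w' x"
proof -
  have li: "loc_integrable S w" "loc_integrable S w'" using w by (auto simp: weak_partial_def)
  have int: "set_integrable lebesgue S (\<lambda>x. \<phi> x *\<^sub>R w x)" "set_integrable lebesgue S (\<lambda>x. \<phi> x *\<^sub>R w' x)"
    if "\<phi> \<in> test_functions S" for \<phi>
    using that test_function_continuous[OF that] li unfolding test_functions_def
    by (auto intro: set_integrable_test_scaleR)
  have "AE x in lebesgue. x \<in> S \<longrightarrow> w x - w' x = 0"
  proof (rule fundamental_lemma[OF S])
    show "loc_integrable S (\<lambda>x. w x - w' x)" using li by (auto simp: loc_integrable_def)
    show "set_integrable lebesgue S (\<lambda>x. \<phi> x *\<^sub>R (w x - w' x))" if "\<phi> \<in> test_functions S" for \<phi>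
      using int[OF that] by (simp add: scaleR_diff_right)
    show "(LINT x:S|lebesgue. \<phi> x *\<^sub>R (w x - w' x)) = 0" if "\<phi> \<in> test_functions S" for \<phi>
    proof -
      have "(LINT x:S|lebesgue. \<phi> x *\<^sub>R w x) = (LINT x:S|lebesgue. \<phi> x *\<^sub>R w' x)"
        using w that by (simp add: weak_partial_def)
      then show ?thesis using int[OF that] by (simp add: scaleR_diff_right)
    qed
  qed
  then show ?thesis by eventually_elim simp
qed

lemma wpartial_AE:
  fixes f :: "'a::euclidean_space \<Rightarrow> 'b::euclidean_space"
  assumes "open S" "weak_partial S b f w"
  shows "AE x in lebesgue. x \<in> S \<longrightarrow> wpartial S b f x = w x"
  using weak_partial_unique[OF assms(1) _ assms(2)] someI[of "weak_partial S b f", OF assms(2)]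
  unfolding wpartial_def by blast

lemma loc_integrable_continuous:
  fixes f :: "'a::euclidean_space \<Rightarrow> 'b::euclidean_space"
  assumes "continuous_on S f" shows "loc_integrable S f"
  unfolding loc_integrable_def
proof (intro allI impI)
  fix K assume K: "compact K \<and> K \<subseteq> S"
  then have "continuous_on K f" using assms continuous_on_subset by blast
  then have "integrable lborel (\<lambda>x. indicator K x *\<^sub>R f x)"
    using borel_integrable_compact[of K f] K by (simp add: indicator_scaleR_eq_if)
  then show "set_integrable lebesgue K f"
    unfolding set_integrable_def by (subst integrable_completion) auto
qed

text \<open>The difference quotients of \<open>k\<close> in direction \<open>b\<close> have integral
  zero by translation invariance of Lebesgue measure, and they converge dominatedly to
  \<open>k'\<close>. This avoids splitting the space along \<open>b\<close>.\<close>

lemma integral_directional_derivative_eq_0: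
  fixes k :: "'a::euclidean_space \<Rightarrow> 'b::euclidean_space"
  assumes k: "continuous_on UNIV k" and k': "continuous_on UNIV k'" and K: "compact K"
    and supp: "\<And>x. x \<notin> K \<Longrightarrow> k x = 0" "\<And>x. x \<notin> K \<Longrightarrow> k' x = 0"
    and d: "\<And>x. ((\<lambda>t. k (x + t *\<^sub>R b)) has_vector_derivative k' x) (at 0)"
  shows "(LINT x|lborel. k' x) = 0"
proof -
  \<comment> \<open>Contains the supports of all difference quotients with step at most 1: a point
    belongs to it as soon as its translate by t b lies in \<open>K\<close> for some t in
    [0, 1].\<close>
  define K' where "K' = (\<lambda>(y, t). y - t *\<^sub>R b) ` (K \<times> {0..1::real})"
  have "compact K'" unfolding K'_def case_prod_beta
    by (intro compact_continuous_image compact_Times K continuous_intros) auto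
  have "compact (k' ` K)" using k' K by (intro compact_continuous_image) (auto intro: continuous_on_subset)
  then obtain B0 where B0: "\<And>x. x \<in> K \<Longrightarrow> norm (k' x) \<le> B0"
    by (meson bounded_iff compact_imp_bounded imageI)
  \<comment> \<open>\<open>K\<close> may be empty, in which case \<open>B0\<close> could be
    negative.\<close>
  define B where "B = max B0 0"
  have B: "norm (k' x) \<le> B" "B \<ge> 0" for x
    unfolding B_def using B0[of x] supp(2)[of x] by (cases "x \<in> K"; fastforce)+
  have d': "((\<lambda>t. k (x + t *\<^sub>R b)) has_vector_derivative k' (x + s *\<^sub>R b)) (at s)" for x s
  proof -
    have "((\<lambda>t. k ((x + s *\<^sub>R b) + t *\<^sub>R b)) has_vector_derivative k' (x + s *\<^sub>R b)) (at (s - s))"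
      using d[of "x + s *\<^sub>R b"] by simp
    then have "((\<lambda>t. k ((x + s *\<^sub>R b) + t *\<^sub>R b)) \<circ> (\<lambda>t. t - s) has_vector_derivative 1 *\<^sub>R k' (x + s *\<^sub>R b)) (at s)"
      by (intro vector_diff_chain_at) (auto intro!: derivative_eq_intros simp: has_vector_derivative_def)
    then show ?thesis by (simp add: o_def algebra_simps)
  qed
  have int_k: "integrable lborel k" "integrable lborel k'"
  proof -
    have "integrable lborel (\<lambda>x. if x \<in> K then k x else 0)" "integrable lborel (\<lambda>x. if x \<in> K then k' x else 0)"
      using borel_integrable_compact[OF K continuous_on_subset[OF k]]
        borel_integrable_compact[OF K continuous_on_subset[OF k']]
      by (simp_all add: indicator_scaleR_eq_if)
    moreover have "(\<lambda>x. if x \<in> K then k x else 0) = k" "(\<lambda>x. if x \<in> K then k' x else 0) = k'" using supp by auto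
    ultimately show "integrable lborel k" "integrable lborel k'" by simp_all
  qed
  define q where "q n x = real (Suc n) *\<^sub>R (k (x + (1 / real (Suc n)) *\<^sub>R b) - k x)" for n x
  have "(\<lambda>n. LINT x|lborel. q n x) \<longlonglongrightarrow> (LINT x|lborel. k' x)"
  proof (rule integral_dominated_convergence)
    show "integrable lborel (\<lambda>x. B * indicator K' x)"
      using \<open>compact K'\<close> by (intro integrable_mult_right integrable_real_indicator)
        (use emeasure_bounded_finite[OF compact_imp_bounded] in \<open>auto simp: infinity_ennreal_def compact_imp_closed\<close>)
    show "q n \<in> borel_measurable lborel" for n
      unfolding q_def using k by (auto intro!: borel_measurable_continuous_onI continuous_intros continuous_on_compose2[OF k])
    show "AE x in lborel. norm (q n x) \<le> B * indicator K' x" for n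
    proof (rule AE_I2)
      fix x
      let ?h = "1 / real (Suc n)"
      show "norm (q n x) \<le> B * indicator K' x"
      proof (cases "x \<in> K'")
        case True
        have "norm ((\<lambda>t. k (x + t *\<^sub>R b)) ?h - (\<lambda>t. k (x + t *\<^sub>R b)) 0) \<le> B * norm (?h - 0)"
        proof (rule differentiable_bound[of "{0..?h}"])
          fix t assume "t \<in> {0..?h}"
          show "((\<lambda>t. k (x + t *\<^sub>R b)) has_derivative (\<lambda>y. y *\<^sub>R k' (x + t *\<^sub>R b))) (at t within {0..?h})"
            using d'[of x t] unfolding has_vector_derivative_def by (rule has_derivative_at_withinI)
          show "onorm (\<lambda>y. y *\<^sub>R k' (x + t *\<^sub>R b)) \<le> B"
            using B(1) by (intro onorm_bound B(2)) (simp add: mult.commute[of B] mult_left_mono)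
        qed auto
        then have "norm (k (x + ?h *\<^sub>R b) - k x) \<le> B * ?h" by simp
        then have "norm (q n x) \<le> real (Suc n) * (B * ?h)"
          unfolding q_def by (simp only: norm_scaleR abs_of_nat mult_left_mono of_nat_0_le_iff)
        then show ?thesis using True by simp
      next
        case False
        have "x \<notin> K" using False unfolding K'_def by (force intro: image_eqI[of _ _ "(x, 0)"])
        moreover have "x + ?h *\<^sub>R b \<notin> K"
          using False unfolding K'_def by (force intro: image_eqI[of _ _ "(x + ?h *\<^sub>R b, ?h)"] simp del: of_nat_Suc)
        ultimately show ?thesis using False supp by (simp add: q_def)
      qed
    qed
    show "AE x in lborel. (\<lambda>n. q n x) \<longlonglongrightarrow> k' x"
    proof (rule AE_I2)
      fix x
      have "((\<lambda>t. (k (x + t *\<^sub>R b) - k x) /\<^sub>R t) \<longlongrightarrow> k' x) (at 0)"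
      proof -
        have "((\<lambda>t. norm (k (x + (0 + t) *\<^sub>R b) - k (x + 0 *\<^sub>R b) - t *\<^sub>R k' x) / norm t) \<longlongrightarrow> 0) (at 0)"
          using d[of x] unfolding has_vector_derivative_def has_derivative_at by blast
        then have "((\<lambda>t. norm ((k (x + t *\<^sub>R b) - k x) /\<^sub>R t - k' x)) \<longlongrightarrow> 0) (at 0)"
        proof (rule Lim_transform_eventually)
          have "norm (k (x + (0 + t) *\<^sub>R b) - k (x + 0 *\<^sub>R b) - t *\<^sub>R k' x) / norm t
            = norm ((k (x + t *\<^sub>R b) - k x) /\<^sub>R t - k' x)" if "t \<noteq> 0" for t
          proof -
            have "(k (x + t *\<^sub>R b) - k x) /\<^sub>R t - k' x = (k (x + t *\<^sub>R b) - k x - t *\<^sub>R k' x) /\<^sub>R t"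
              using that by (simp add: scaleR_diff_right)
            then show ?thesis by (simp add: divide_inverse mult.commute)
          qed
          then show "\<forall>\<^sub>F t in at 0. norm (k (x + (0 + t) *\<^sub>R b) - k (x + 0 *\<^sub>R b) - t *\<^sub>R k' x) / norm t
            = norm ((k (x + t *\<^sub>R b) - k x) /\<^sub>R t - k' x)"
            by (simp add: eventually_at_filter)
        qed
        from LIM_zero_cancel[OF tendsto_norm_zero_cancel[OF this]] show ?thesis .
      qed
      moreover have "filterlim (\<lambda>n. 1 / real (Suc n)) (at 0) sequentially"
        unfolding filterlim_at using LIMSEQ_inverse_real_of_nat by (simp add: divide_inverse)
      ultimately have "(\<lambda>n. (k (x + (1 / real (Suc n)) *\<^sub>R b) - k x) /\<^sub>R (1 / real (Suc n))) \<longlonglongrightarrow> k' x"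
        by (rule filterlim_compose)
      then show "(\<lambda>n. q n x) \<longlonglongrightarrow> k' x" by (simp add: q_def)
    qed
  qed (use int_k in auto)
  moreover have "(LINT x|lborel. q n x) = 0" for n
  proof -
    have "integrable lborel (\<lambda>x. k (x + c))" "(LINT x|lborel. k (x + c)) = (LINT x|lborel. k x)" for c
    proof -
      have m: "(+) c \<in> lborel \<rightarrow>\<^sub>M borel" "k \<in> borel_measurable borel"
        using k by (simp_all add: borel_measurable_continuous_onI)
      show "integrable lborel (\<lambda>x. k (x + c))"
        using integrable_distr_eq[OF m] int_k(1) by (simp add: lborel_distr_plus add.commute)
      show "(LINT x|lborel. k (x + c)) = (LINT x|lborel. k x)"
        using integral_distr[OF m] by (simp add: lborel_distr_plus add.commute)
    qed
    then show ?thesis unfolding q_def using int_k by simp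
  qed
  ultimately show ?thesis using LIMSEQ_unique[OF _ tendsto_const] by fastforce
qed

lemma test_function_derivative_support:
  assumes "\<phi> \<in> test_functions S"
  obtains K where "compact K" "K \<subseteq> S" "\<And>x. x \<notin> K \<Longrightarrow> \<phi> x = 0"
    "\<And>x. x \<notin> K \<Longrightarrow> frechet_derivative \<phi> (at x) b = 0"
proof -
  obtain K where K: "compact K" "K \<subseteq> S" "\<And>x. x \<notin> K \<Longrightarrow> \<phi> x = 0" using assms by (auto simp: test_functions_def)
  have "frechet_derivative \<phi> (at x) b = 0" if "x \<notin> K" for x
  proof -
    have "((\<lambda>x. 0) has_derivative (\<lambda>x. 0)) (at x)" by simp
    then have "(\<phi> has_derivative (\<lambda>x. 0)) (at x)"
      by (rule has_derivative_transform_within_open[of _ _ _ _ "- K"])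
        (use that K in \<open>auto simp: compact_imp_closed open_Compl\<close>)
    then have "frechet_derivative \<phi> (at x) = (\<lambda>x. 0)" by (rule frechet_derivative_at[symmetric])
    then show ?thesis by simp
  qed
  with K show thesis using that by blast
qed

text \<open>Integration by parts: the derivative of \<phi> f along \<open>b\<close> has integral
  zero. Differentiability is assumed only along the lines in direction \<open>b\<close>, which is
  what differentiation under the Fourier integral supplies.\<close>

lemma weak_partial_classical:
  fixes f :: "'a::euclidean_space \<Rightarrow> 'b::euclidean_space"
  assumes S: "open S" and f: "continuous_on S f" and w: "continuous_on S w" and b: "b \<in> Basis"
    and d: "\<And>x. x \<in> S \<Longrightarrow> ((\<lambda>t. f (x + t *\<^sub>R b)) has_vector_derivative w x) (at 0)"
  shows "weak_partial S b f w"
  unfolding weak_partial_def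
proof (intro conjI ballI)
  show li: "loc_integrable S f" "loc_integrable S w" using f w by (auto intro: loc_integrable_continuous)
  fix \<phi> assume ph: "\<phi> \<in> test_functions S"
  note phc = test_function_continuous[OF ph]
  obtain K where K: "compact K" "K \<subseteq> S" "\<And>x. x \<notin> K \<Longrightarrow> \<phi> x = 0"
    and dph0: "\<And>x. x \<notin> K \<Longrightarrow> frechet_derivative \<phi> (at x) b = 0"
    using test_function_derivative_support[OF ph] by blast
  have phd: "(\<phi> has_derivative frechet_derivative \<phi> (at x)) (at x)" for x
    using phc(2) by (simp add: differentiable_on_def frechet_derivative_works)
  define k where "k x = \<phi> x *\<^sub>R f x" for x
  define k' where "k' x = frechet_derivative \<phi> (at x) b *\<^sub>R f x + \<phi> x *\<^sub>R w x" for x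
  \<comment> \<open>Gluing: such a function is continuous on the open set \<open>S\<close> and zero
    on the open complement of \<open>K\<close>, and these two sets cover the space.\<close>
  have cont: "continuous_on UNIV h" if "continuous_on S h" "\<And>x. x \<notin> K \<Longrightarrow> h x = 0" for h :: "'a \<Rightarrow> 'b"
  proof -
    have "continuous_on (- K) h"
      using continuous_on_cong[of "-K" "-K" h "\<lambda>x. 0"] that(2) by simp
    then have "continuous_on (S \<union> - K) h"
      using that(1) S K by (intro continuous_on_open_Un) (auto simp: compact_imp_closed)
    moreover have "S \<union> - K = UNIV" using K by auto
    ultimately show ?thesis by simp
  qed
  have phS: "continuous_on S \<phi>" "continuous_on S (\<lambda>x. frechet_derivative \<phi> (at x) b)"
    using phc(1) phc(3)[OF b] by (auto intro: continuous_on_subset)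
  have "continuous_on UNIV k"
    unfolding k_def by (rule cont) (use f w phS K(3) in \<open>auto intro!: continuous_intros\<close>)
  have "continuous_on UNIV k'"
    unfolding k'_def by (rule cont) (use f w phS K(3) dph0 in \<open>auto intro!: continuous_intros\<close>)
  have "(LINT x|lborel. k' x) = 0"
  proof (rule integral_directional_derivative_eq_0[of k k' K b])
    show "continuous_on UNIV k" "continuous_on UNIV k'" by fact+
    show "((\<lambda>t. k (x + t *\<^sub>R b)) has_vector_derivative k' x) (at 0)" for x
    proof (cases "x \<in> S")
      case True
      have "((\<lambda>t. \<phi> (x + t *\<^sub>R b)) has_derivative (\<lambda>t. frechet_derivative \<phi> (at (x + 0 *\<^sub>R b)) (t *\<^sub>R b))) (at 0)"
        by (rule has_derivative_compose[of "\<lambda>t. x + t *\<^sub>R b" "\<lambda>t. t *\<^sub>R b"])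
          (auto intro!: derivative_eq_intros phd)
      moreover have "linear (frechet_derivative \<phi> (at x))"
        using phd has_derivative_linear by blast
      ultimately have "((\<lambda>t. \<phi> (x + t *\<^sub>R b)) has_vector_derivative frechet_derivative \<phi> (at x) b) (at 0)"
        by (simp add: has_vector_derivative_def linear_scale)
      from has_vector_derivative_scaleR[OF this[folded has_real_derivative_iff_has_vector_derivative] d[OF True]]
      show ?thesis by (simp add: k_def k'_def add.commute)
    next
      case False
      then have "x \<in> - K" "open (- K)" using K compact_imp_closed[OF K(1)] by auto
      have "((\<lambda>t. 0) has_vector_derivative 0) (at 0)" by simp
      then have "((\<lambda>t. k (x + t *\<^sub>R b)) has_vector_derivative 0) (at 0)"
      proof (rule has_vector_derivative_transform_within_open)
        show "open ((\<lambda>t. x + t *\<^sub>R b) -` (- K))"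
          by (rule open_vimage[OF \<open>open (- K)\<close>]) (intro continuous_intros)
      qed (use \<open>x \<in> - K\<close> K in \<open>auto simp: k_def\<close>)
      then show ?thesis using dph0[of x] K(3)[of x] \<open>x \<in> - K\<close> by (simp add: k'_def)
    qed
  qed (use K dph0 in \<open>auto simp: k_def k'_def\<close>)
  then have "(LINT x|lebesgue. k' x) = 0"
    using \<open>continuous_on UNIV k'\<close> by (subst integral_completion) (simp_all add: borel_measurable_continuous_onI)
  moreover have int: "set_integrable lebesgue S (\<lambda>x. frechet_derivative \<phi> (at x) b *\<^sub>R f x)"
      "set_integrable lebesgue S (\<lambda>x. \<phi> x *\<^sub>R w x)"
    using phc b K dph0 li by (auto intro!: set_integrable_test_scaleR[of S _ K])
  moreover have "(LINT x|lebesgue. k' x) = (LINT x:S|lebesgue. frechet_derivative \<phi> (at x) b *\<^sub>R f x + \<phi> x *\<^sub>R w x)"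
  proof -
    have "k' x = indicator S x *\<^sub>R k' x" for x
      using K(2,3) dph0 by (cases "x \<in> K") (auto simp: indicator_def k'_def)
    then show ?thesis unfolding set_lebesgue_integral_def k'_def by presburger
  qed
  ultimately show "(LINT x:S|lebesgue. frechet_derivative \<phi> (at x) b *\<^sub>R f x) = - (LINT x:S|lebesgue. \<phi> x *\<^sub>R w x)"
    by (simp add: set_integral_add eq_neg_iff_add_eq_0)
qed


section \<open>Weak derivatives of functions known almost everywhere\<close>

lemma loc_integrable_cong_AE:
  fixes f g :: "'a::euclidean_space \<Rightarrow> 'b::euclidean_space"
  assumes ae: "AE x in lebesgue. x \<in> S \<longrightarrow> f x = g x" and f: "loc_integrable S f"
  shows "loc_integrable S g"
  unfolding loc_integrable_def
proof (intro allI impI)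
  fix K assume K: "compact K \<and> K \<subseteq> S"
  then have fK: "integrable lebesgue (\<lambda>x. indicator K x *\<^sub>R f x)"
    using f by (auto simp: loc_integrable_def set_integrable_def)
  have eq: "AE x in lebesgue. indicator K x *\<^sub>R f x = indicator K x *\<^sub>R g x"
    using ae by eventually_elim (use K in \<open>auto simp: indicator_def\<close>)
  show "set_integrable lebesgue K g"
    unfolding set_integrable_def
    by (rule integrable_cong_AE_imp[OF fK borel_measurable_AE[OF borel_measurable_integrable[OF fK] eq] eq])
qed

lemma set_integral_cong_AE_test:
  fixes f g :: "'a::euclidean_space \<Rightarrow> 'b::euclidean_space"
  assumes "AE x in lebesgue. x \<in> S \<longrightarrow> f x = g x"
    "set_integrable lebesgue S (\<lambda>x. \<phi> x *\<^sub>R f x)" "set_integrable lebesgue S (\<lambda>x. \<phi> x *\<^sub>R g x)"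
  shows "(LINT x:S|lebesgue. \<phi> x *\<^sub>R f x) = (LINT x:S|lebesgue. \<phi> x *\<^sub>R g x)"
  unfolding set_lebesgue_integral_def
proof (rule integral_cong_AE)
  show "AE x in lebesgue. indicator S x *\<^sub>R \<phi> x *\<^sub>R f x = indicator S x *\<^sub>R \<phi> x *\<^sub>R g x"
    using assms(1) by eventually_elim (auto simp: indicator_def)
qed (use assms(2,3) in \<open>simp_all only: set_integrable_def borel_measurable_integrable\<close>)

lemma weak_partial_cong_AE:
  fixes f f' :: "'a::euclidean_space \<Rightarrow> 'b::euclidean_space"
  assumes f: "AE x in lebesgue. x \<in> S \<longrightarrow> f x = f' x" and w: "AE x in lebesgue. x \<in> S \<longrightarrow> w x = w' x"
    and b: "b \<in> Basis" and wp: "weak_partial S b f w"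
  shows "weak_partial S b f' w'"
  unfolding weak_partial_def
proof (intro conjI ballI)
  have li: "loc_integrable S f" "loc_integrable S w" using wp by (auto simp: weak_partial_def)
  show li': "loc_integrable S f'" "loc_integrable S w'" using loc_integrable_cong_AE li f w by blast+
  fix \<phi> assume ph: "\<phi> \<in> test_functions S"
  obtain K where K: "compact K" "K \<subseteq> S" "\<And>x. x \<notin> K \<Longrightarrow> \<phi> x = 0"
    "\<And>x. x \<notin> K \<Longrightarrow> frechet_derivative \<phi> (at x) b = 0"
    using test_function_derivative_support[OF ph] by blast
  note phc = test_function_continuous(1)[OF ph] test_function_continuous(3)[OF ph b]
  have "(LINT x:S|lebesgue. frechet_derivative \<phi> (at x) b *\<^sub>R f x) = (LINT x:S|lebesgue. frechet_derivative \<phi> (at x) b *\<^sub>R f' x)"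
    using set_integrable_test_scaleR[OF li(1) K(1,2,4) phc(2)] set_integrable_test_scaleR[OF li'(1) K(1,2,4) phc(2)]
    by (rule set_integral_cong_AE_test[OF f])
  moreover have "(LINT x:S|lebesgue. \<phi> x *\<^sub>R w x) = (LINT x:S|lebesgue. \<phi> x *\<^sub>R w' x)"
    using set_integrable_test_scaleR[OF li(2) K(1,2,3) phc(1)] set_integrable_test_scaleR[OF li'(2) K(1,2,3) phc(1)]
    by (rule set_integral_cong_AE_test[OF w])
  ultimately show "(LINT x:S|lebesgue. frechet_derivative \<phi> (at x) b *\<^sub>R f' x) = - (LINT x:S|lebesgue. \<phi> x *\<^sub>R w' x)"
    using wp ph by (simp add: weak_partial_def)
qed

text \<open>The iterated weak derivative is a choice from a relational power. By induction
  everything related to \<open>u\<close> by this power agrees with \<open>D j\<close> almost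
  everywhere, so it remains to relate \<open>u\<close> to something. Equality of \<open>u\<close>
  with \<open>D 0\<close> is assumed only almost everywhere, since \<open>u\<close> will be a slice
  of a chosen Fourier transform.\<close>

lemma wderiv_AE:
  fixes D :: "nat \<Rightarrow> real \<Rightarrow> complex"
  assumes I: "open I" and c: "\<And>j. continuous_on I (D j)"
    and d: "\<And>j x. x \<in> I \<Longrightarrow> (D j has_vector_derivative D (Suc j) x) (at x)"
    and u: "AE x in lebesgue. x \<in> I \<longrightarrow> u x = D 0 x"
  shows "AE x in lebesgue. x \<in> I \<longrightarrow> wderiv I j u x = D j x"
proof -
  have cl: "weak_partial I 1 (D j) (D (Suc j))" for j
  proof (rule weak_partial_classical[OF I c c])
    fix x assume "x \<in> I"
    then have "(D j \<circ> (\<lambda>t. x + t) has_vector_derivative 1 *\<^sub>R D (Suc j) x) (at 0)"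
      using d[of x j] by (intro vector_diff_chain_at) (auto intro!: derivative_eq_intros simp: has_vector_derivative_def)
    then show "((\<lambda>t. D j (x + t *\<^sub>R 1)) has_vector_derivative D (Suc j) x) (at 0)"
      by (simp add: o_def)
  qed simp
  have uniq: "AE x in lebesgue. x \<in> I \<longrightarrow> w x = D j x" if "(weak_partial I 1 ^^ j) u w" for j w
    using that
  proof (induction j arbitrary: w)
    case 0
    then show ?case using u by simp
  next
    case (Suc j)
    then obtain v where v: "(weak_partial I 1 ^^ j) u v" "weak_partial I 1 v w" by auto
    have "weak_partial I 1 (D j) w"
      by (rule weak_partial_cong_AE[OF Suc.IH[OF v(1)] _ _ v(2)]) auto
    then show ?case by (rule weak_partial_unique[OF I _ cl])
  qed
  have ex: "\<exists>w. (weak_partial I 1 ^^ j) u w" for j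
  proof (cases j)
    case (Suc i)
    \<comment> \<open>Only the first step leaves from \<open>u\<close>, which equals
      \<open>D 0\<close> merely almost everywhere; all later steps run through \<open>D\<close>
      itself.\<close>
    have "(weak_partial I 1 ^^ Suc i) u (D (Suc i))" for i
    proof (induction i)
      case 0
      have "weak_partial I 1 u (D (Suc 0))"
      proof (rule weak_partial_cong_AE[OF _ _ _ cl])
        show "AE x in lebesgue. x \<in> I \<longrightarrow> D 0 x = u x" using u by eventually_elim auto
      qed auto
      then show ?case by (simp add: OO_def)
    next
      case (Suc i)
      then show ?case by (rule relpowp_Suc_I) (rule cl)
    qed
    then show ?thesis using Suc by blast
  qed auto
  show ?thesis unfolding wderiv_def by (rule uniq[OF someI_ex[OF ex]])
qed

section \<open>The Fourier transform of bounded functions with bounded support\<close>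

lemma
  fixes f :: "'a::euclidean_space \<Rightarrow> real \<Rightarrow> complex"
  assumes "\<And>b. b \<in> Basis \<Longrightarrow> integrable lborel (f b)"
  shows integrable_lborel_prod_Basis: "integrable lborel (\<lambda>x::'a. \<Prod>b\<in>Basis. f b (x \<bullet> b))"
    and integral_lborel_prod_Basis: "(LINT x|lborel. (\<Prod>b\<in>Basis. f b (x \<bullet> b))) = (\<Prod>b\<in>Basis. LINT t|lborel. f b t)"
proof -
  interpret product_sigma_finite "\<lambda>_::'a. lborel :: real measure"
    by (rule product_sigma_finite.intro) (rule sigma_finite_lborel)
  have [measurable]: "\<And>b. b \<in> Basis \<Longrightarrow> f b \<in> borel_measurable borel"
    using assms borel_measurable_integrable by fastforce
  have meas: "(\<lambda>f. \<Sum>b\<in>Basis. f b *\<^sub>R b :: 'a) \<in> (\<Pi>\<^sub>M b\<in>Basis. lborel) \<rightarrow>\<^sub>M borel"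
    by measurable
  have m: "(\<lambda>x::'a. \<Prod>b\<in>Basis. f b (x \<bullet> b)) \<in> borel_measurable borel" by measurable
  have eq: "(\<lambda>x. \<Prod>b\<in>Basis. f b ((\<Sum>b\<in>Basis. x b *\<^sub>R b) \<bullet> b)) = (\<lambda>x. \<Prod>b\<in>Basis. f b (x b))"
    by (intro ext prod.cong) auto
  have "integrable (\<Pi>\<^sub>M b\<in>Basis. lborel) (\<lambda>x. \<Prod>b\<in>Basis. f b ((\<Sum>b\<in>Basis. x b *\<^sub>R b) \<bullet> b))"
    unfolding eq by (rule product_integrable_prod) (use assms in auto)
  then show "integrable lborel (\<lambda>x::'a. \<Prod>b\<in>Basis. f b (x \<bullet> b))"
    using integrable_distr_eq[OF meas m] by (simp add: lborel_eq[symmetric])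
  show "(LINT x|lborel. (\<Prod>b\<in>Basis. f b (x \<bullet> b))) = (\<Prod>b\<in>Basis. LINT t|lborel. f b t)"
    using integral_distr[OF meas m] assms
    by (simp add: lborel_eq[symmetric] eq product_integral_prod)
qed

text \<open>Not normalized: its integral is sqrt (2 pi) to the power of the dimension, and it
  reproduces itself under the Fourier transform up to this factor.\<close>

definition gauss :: "'a::euclidean_space \<Rightarrow> real" where
  "gauss x = exp (- (norm x)\<^sup>2 / 2)"

lemma gauss_pos: "0 < gauss x" "0 \<le> gauss x" by (simp_all add: gauss_def)

lemma continuous_gauss [continuous_intros]:
  "continuous_on S f \<Longrightarrow> continuous_on S (\<lambda>x. gauss (f x))"
  unfolding gauss_def by (intro continuous_intros) auto

lemma gauss_measurable [measurable]: "gauss \<in> borel_measurable borel"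
  by (intro borel_measurable_continuous_onI continuous_intros)

text \<open>Read off from the characteristic function of the standard normal distribution.\<close>

lemma gauss_char_1:
  fixes t :: real
  shows "integrable lborel (\<lambda>x. complex_of_real (exp (- x\<^sup>2 / 2)) * cis (x * t))"
    "(LINT x|lborel. complex_of_real (exp (- x\<^sup>2 / 2)) * cis (x * t)) = complex_of_real (sqrt (2 * pi) * exp (- t\<^sup>2 / 2))"
proof -
  have sd: "complex_of_real (exp (- x\<^sup>2 / 2)) * cis (x * t) =
      complex_of_real (sqrt (2 * pi)) * (std_normal_density x *\<^sub>R iexp (t * x))" for x
  proof -
    have "exp (- x\<^sup>2 / 2) = sqrt (2 * pi) * std_normal_density x" by (simp add: std_normal_density_def)
    then show ?thesis by (simp add: cis_conv_exp scaleR_conv_of_real mult.commute[of x t])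
  qed
  have "integrable std_normal_distribution (\<lambda>x. iexp (t * x))"
  proof -
    interpret real_distribution std_normal_distribution by (rule real_dist_normal_dist)
    show ?thesis by (rule integrable_const_bound[of _ 1]) auto
  qed
  then have i: "integrable lborel (\<lambda>x. std_normal_density x *\<^sub>R iexp (t * x))"
    by (subst (asm) integrable_density) auto
  show "integrable lborel (\<lambda>x. complex_of_real (exp (- x\<^sup>2 / 2)) * cis (x * t))"
    unfolding sd by (intro integrable_mult_right i)
  have "(LINT x|lborel. std_normal_density x *\<^sub>R iexp (t * x)) = char std_normal_distribution t"
    unfolding char_def by (subst integral_density) auto
  then show "(LINT x|lborel. complex_of_real (exp (- x\<^sup>2 / 2)) * cis (x * t)) = complex_of_real (sqrt (2 * pi) * exp (- t\<^sup>2 / 2))"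
    unfolding sd integral_mult_right_zero by (simp add: char_std_normal_distribution)
qed

lemma cis_sum: "finite A \<Longrightarrow> cis (\<Sum>i\<in>A. f i) = (\<Prod>i\<in>A. cis (f i))"
  by (induction A rule: finite_induct) (simp_all add: cis_mult[symmetric])

lemma gauss_char:
  fixes v :: "'a::euclidean_space"
  shows "integrable lborel (\<lambda>x::'a. complex_of_real (gauss x) * cis (x \<bullet> v))" (is ?A)
    "(LINT x|lborel. complex_of_real (gauss x) * cis (x \<bullet> v)) = complex_of_real (sqrt (2 * pi) ^ DIM('a) * gauss v)" (is ?B)
proof -
  have sq: "(norm x)\<^sup>2 = (\<Sum>b\<in>Basis. (x \<bullet> b)\<^sup>2)" for x :: 'a
    unfolding power2_norm_eq_inner by (subst euclidean_inner) (simp add: power2_eq_square)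
  have g: "gauss x = (\<Prod>b\<in>Basis. exp (- (x \<bullet> b)\<^sup>2 / 2))" for x :: 'a
    unfolding gauss_def sq by (simp add: exp_sum[symmetric] sum_negf[symmetric] sum_divide_distrib)
  have eq: "complex_of_real (gauss x) * cis (x \<bullet> v) =
      (\<Prod>b\<in>Basis. complex_of_real (exp (- (x \<bullet> b)\<^sup>2 / 2)) * cis ((x \<bullet> b) * (v \<bullet> b)))" for x
    unfolding g by (subst euclidean_inner) (simp add: cis_sum prod.distrib)
  show ?A unfolding eq by (rule integrable_lborel_prod_Basis[of "\<lambda>b t. complex_of_real (exp (- t\<^sup>2 / 2)) * cis (t * (v \<bullet> b))"])
     (rule gauss_char_1)
  have "(LINT x|lborel. complex_of_real (gauss x) * cis (x \<bullet> v)) =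
     (\<Prod>b\<in>Basis. LINT t|lborel. complex_of_real (exp (- t\<^sup>2 / 2)) * cis (t * (v \<bullet> b)))"
    unfolding eq by (rule integral_lborel_prod_Basis[of "\<lambda>b t. complex_of_real (exp (- t\<^sup>2 / 2)) * cis (t * (v \<bullet> b))"])
     (rule gauss_char_1)
  also have "\<dots> = complex_of_real (sqrt (2 * pi) ^ DIM('a) * gauss v)"
    unfolding gauss_char_1 by (simp add: g prod.distrib)
  finally show ?B .
qed

lemma integrable_gauss: "integrable lborel (gauss :: 'a::euclidean_space \<Rightarrow> real)"
  using integrable_norm[OF gauss_char(1)[of 0]] by (simp add: norm_mult gauss_pos)

lemma integral_gauss: "(LINT x|lborel. gauss (x::'a::euclidean_space)) = sqrt (2 * pi) ^ DIM('a)"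
proof -
  have "complex_of_real (LINT x|lborel. gauss (x::'a)) = complex_of_real (sqrt (2 * pi) ^ DIM('a))"
    using gauss_char(2)[of "0::'a"] by (simp add: gauss_def)
  then show ?thesis using of_real_eq_iff by blast
qed

lemma integrable_scaleR_iff:
  fixes f :: "_ \<Rightarrow> 'b::{banach, second_countable_topology}"
  assumes "c \<noteq> 0" shows "integrable M (\<lambda>x. c *\<^sub>R f x) \<longleftrightarrow> integrable M f"
  using assms integrable_scaleR_right[of "inverse c" M "\<lambda>x. c *\<^sub>R f x"] by auto

lemma lborel_integral_scaleR:
  fixes f :: "'a::euclidean_space \<Rightarrow> 'b::{banach, second_countable_topology}"
  assumes [measurable]: "f \<in> borel_measurable borel" and c: "c \<noteq> 0"
  shows "(LINT x|lborel. f x) = \<bar>c\<bar> ^ DIM('a) *\<^sub>R (LINT x|lborel. f (c *\<^sub>R x))"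
    "integrable lborel f \<longleftrightarrow> integrable lborel (\<lambda>x. f (c *\<^sub>R x))"
proof -
  have L: "lborel = density (distr lborel borel (\<lambda>x::'a. c *\<^sub>R x)) (\<lambda>_. \<bar>c\<bar>^DIM('a))"
    using lborel_affine[OF c, of 0] by simp
  show "(LINT x|lborel. f x) = \<bar>c\<bar> ^ DIM('a) *\<^sub>R (LINT x|lborel. f (c *\<^sub>R x))"
    by (subst L) (simp add: integral_density integral_distr)
  show "integrable lborel f \<longleftrightarrow> integrable lborel (\<lambda>x. f (c *\<^sub>R x))"
    by (subst L) (use c in \<open>simp add: integrable_density integrable_distr_eq integrable_scaleR_iff\<close>)
qed

lemma gauss_char_scaled:
  fixes u :: "'a::euclidean_space"
  assumes "\<sigma> > 0"
  shows "integrable lborel (\<lambda>x::'a. complex_of_real (gauss (\<sigma> *\<^sub>R x)) * cis (x \<bullet> u))"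
    "(LINT x|lborel. complex_of_real (gauss (\<sigma> *\<^sub>R x)) * cis (x \<bullet> u)) =
      complex_of_real ((sqrt (2 * pi) / \<sigma>) ^ DIM('a) * gauss (u /\<^sub>R \<sigma>))"
proof -
  let ?f = "\<lambda>x::'a. complex_of_real (gauss x) * cis (x \<bullet> (u /\<^sub>R \<sigma>))"
  have m: "?f \<in> borel_measurable borel" by (simp add: cis_conv_exp)
  have eq: "?f (\<sigma> *\<^sub>R x) = complex_of_real (gauss (\<sigma> *\<^sub>R x)) * cis (x \<bullet> u)" for x
    using assms by (simp flip: mult.assoc)
  show "integrable lborel (\<lambda>x::'a. complex_of_real (gauss (\<sigma> *\<^sub>R x)) * cis (x \<bullet> u))"
    using lborel_integral_scaleR(2)[OF m, of \<sigma>] gauss_char(1)[of "u /\<^sub>R \<sigma>"] assms unfolding eq by simp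
  have "complex_of_real (sqrt (2 * pi) ^ DIM('a) * gauss (u /\<^sub>R \<sigma>)) = \<bar>\<sigma>\<bar> ^ DIM('a) *\<^sub>R
     (LINT x|lborel. complex_of_real (gauss (\<sigma> *\<^sub>R x)) * cis (x \<bullet> u))"
    using lborel_integral_scaleR(1)[OF m, of \<sigma>] gauss_char(2)[of "u /\<^sub>R \<sigma>"] assms unfolding eq by simp
  then show "(LINT x|lborel. complex_of_real (gauss (\<sigma> *\<^sub>R x)) * cis (x \<bullet> u)) =
      complex_of_real ((sqrt (2 * pi) / \<sigma>) ^ DIM('a) * gauss (u /\<^sub>R \<sigma>))"
    using assms by (simp add: power_divide field_simps scaleR_conv_of_real)
qed

text \<open>Bounded Borel functions that vanish outside a ball. At a fixed height all amplitudes
  belong to this class, on which the Fourier integral converges absolutely.\<close>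

definition bcs :: "('a::euclidean_space \<Rightarrow> complex) \<Rightarrow> bool" where
  "bcs h \<longleftrightarrow> h \<in> borel_measurable borel \<and> (\<exists>M r. \<forall>x. cmod (h x) \<le> M \<and> (norm x > r \<longrightarrow> h x = 0))"

lemma bcsE:
  assumes "bcs h"
  obtains M r where "h \<in> borel_measurable borel" "M \<ge> 0" "r \<ge> 0" "\<And>x. cmod (h x) \<le> M" "\<And>x. norm x > r \<Longrightarrow> h x = 0"
proof -
  obtain M r where h: "h \<in> borel_measurable borel" "\<And>x. cmod (h x) \<le> M" "\<And>x. norm x > r \<Longrightarrow> h x = 0"
    using assms unfolding bcs_def by blast
  moreover have "M \<ge> 0" using h(2)[of 0] norm_ge_zero order_trans by blast
  ultimately show thesis using that[of M "max r 0"] by auto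
qed

lemma bcsI: "h \<in> borel_measurable borel \<Longrightarrow> (\<And>x. cmod (h x) \<le> M) \<Longrightarrow> (\<And>x. norm x > r \<Longrightarrow> h x = 0) \<Longrightarrow> bcs h"
  unfolding bcs_def by blast

lemma bcs_integrable:
  assumes "bcs h" shows "integrable lborel h"
proof -
  obtain M r where h: "h \<in> borel_measurable borel" "M \<ge> 0" "\<And>x. cmod (h x) \<le> M" "\<And>x. norm x > r \<Longrightarrow> h x = 0"
    using assms by (elim bcsE) blast
  show ?thesis
  proof (rule Bochner_Integration.integrable_bound)
    show "integrable lborel (\<lambda>x. M * indicator (cball 0 r) x)"
      using emeasure_bounded_finite[of "cball 0 r"]
      by (intro integrable_mult_right integrable_real_indicator) (auto simp: infinity_ennreal_def)
    show "AE x in lborel. norm (h x) \<le> norm (M * indicator (cball 0 r) x)"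
      using h by (intro AE_I2) (auto simp: indicator_def not_le)
  qed (use h in simp)
qed

lemma bcs_mult_bounded:
  assumes "bcs h" "g \<in> borel_measurable borel" "\<And>x. cmod (g x) \<le> B"
  shows "bcs (\<lambda>x. h x * g x)"
proof -
  obtain M r where h: "h \<in> borel_measurable borel" "M \<ge> 0" "\<And>x. cmod (h x) \<le> M" "\<And>x. norm x > r \<Longrightarrow> h x = 0"
    using assms by (elim bcsE) blast
  show ?thesis
    by (rule bcsI[of _ "M * B" r]) (use h assms in \<open>auto simp: norm_mult intro!: mult_mono\<close>)
qed

lemma cis_measurable [measurable]: "cis \<in> borel_measurable borel"
  by (intro borel_measurable_continuous_onI continuous_on_cis continuous_on_id)

lemma cnj_measurable [measurable]: "cnj \<in> borel_measurable borel"
  by (intro borel_measurable_continuous_onI continuous_intros)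

lemma bcs_cis: "bcs h \<Longrightarrow> bcs (\<lambda>x. h x * cis (x \<bullet> v))" "bcs h \<Longrightarrow> bcs (\<lambda>x. h x * cis (- (x \<bullet> v)))"
  by (rule bcs_mult_bounded[where B = 1]; simp)+

lemma bcs_cnj: "bcs h \<Longrightarrow> bcs (\<lambda>x. cnj (h x))"
  unfolding bcs_def using measurable_compose[OF _ cnj_measurable] by auto

lemma bcs_norm_sq: assumes "bcs h" shows "integrable lborel (\<lambda>x. (cmod (h x))\<^sup>2)"
proof -
  obtain M r where h: "h \<in> borel_measurable borel" "M \<ge> 0" "\<And>x. cmod (h x) \<le> M" "\<And>x. norm x > r \<Longrightarrow> h x = 0"
    using assms by (elim bcsE) blast
  have "integrable lborel (\<lambda>x. h x * cnj (h x))"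
    by (intro bcs_integrable bcs_mult_bounded[OF assms, of _ M]) (use h in auto)
  from integrable_Re[OF this] show ?thesis by (simp add: complex_mult_cnj cmod_power2)
qed

definition ft :: "('a::euclidean_space \<Rightarrow> complex) \<Rightarrow> 'a \<Rightarrow> complex" where
  "ft h \<xi> = (LINT x|lborel. h x * cis (- (x \<bullet> \<xi>)))"

lemma ft_measurable [measurable]:
  assumes [measurable]: "h \<in> borel_measurable borel"
  shows "ft h \<in> borel_measurable borel"
  unfolding ft_def by measurable

text \<open>Its Fourier integral with the opposite sign is |ft h|^2, and its value at 0 is the
  squared L2 norm of \<open>h\<close>; Plancherel's identity is the passage from the one to the
  other.\<close>

definition autocorr :: "('a::euclidean_space \<Rightarrow> complex) \<Rightarrow> 'a \<Rightarrow> complex" where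
  "autocorr h u = (LINT x|lborel. h x * cnj (h (x + u)))"

lemma autocorr_pair_bcs:
  fixes h :: "'a::euclidean_space \<Rightarrow> complex"
  assumes "bcs h"
  shows "bcs (\<lambda>(x, u). h x * cnj (h (x + u)))"
proof -
  obtain M r where h: "h \<in> borel_measurable borel" "M \<ge> 0" "r \<ge> 0" "\<And>x. cmod (h x) \<le> M" "\<And>x. norm x > r \<Longrightarrow> h x = 0"
    using assms by (elim bcsE) blast
  note [measurable] = h(1)
  show ?thesis
  \<comment> \<open>If x and x + u both have norm at most r, then u has norm at most 2 r, and the
    pair (x, u) at most 3 r.\<close>
  proof (rule bcsI[of _ "M * M" "3 * r"])
    show "(\<lambda>(x, u). h x * cnj (h (x + u))) \<in> borel_measurable borel"
      unfolding borel_prod[symmetric] by measurable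
    show "cmod (case p of (x, u) \<Rightarrow> h x * cnj (h (x + u))) \<le> M * M" for p
      using h by (auto simp: norm_mult split: prod.splits intro!: mult_mono)
    fix p :: "'a \<times> 'a" assume p: "3 * r < norm p"
    obtain x u where [simp]: "p = (x, u)" by fastforce
    have "norm p \<le> norm x + norm u" using norm_Pair_le[of x u] by simp
    moreover have "norm u \<le> norm (x + u) + norm x" using norm_triangle_ineq4[of "x + u" x] by simp
    ultimately have "norm x > r \<or> norm (x + u) > r" using p by linarith
    then show "(case p of (x, u) \<Rightarrow> h x * cnj (h (x + u))) = 0" using h(5) by auto
  qed
qed

lemma lborel_translate:
  fixes f :: "'a::euclidean_space \<Rightarrow> 'b::{banach, second_countable_topology}"
  assumes [measurable]: "f \<in> borel_measurable borel"
  shows "(LINT x|lborel. f (x + u)) = (LINT x|lborel. f x)"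
    "integrable lborel (\<lambda>x. f (x + u)) \<longleftrightarrow> integrable lborel f"
proof -
  have m: "(+) u \<in> lborel \<rightarrow>\<^sub>M borel" by simp
  show "(LINT x|lborel. f (x + u)) = (LINT x|lborel. f x)"
    using integral_distr[OF m assms] by (simp add: lborel_distr_plus add.commute)
  show "integrable lborel (\<lambda>x. f (x + u)) \<longleftrightarrow> integrable lborel f"
    using integrable_distr_eq[OF m assms] by (simp add: lborel_distr_plus add.commute)
qed

lemma bcs_translate: assumes "bcs h" shows "bcs (\<lambda>x. h (x + u))"
proof -
  obtain M r where h: "h \<in> borel_measurable borel" "M \<ge> 0" "\<And>x. cmod (h x) \<le> M" "\<And>x. norm x > r \<Longrightarrow> h x = 0"
    using assms by (elim bcsE) blast
  have "h (x + u) = 0" if "norm x > r + norm u" for x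
  proof -
    have "norm x \<le> norm (x + u) + norm u" using norm_triangle_ineq4[of "x + u" u] by simp
    then show ?thesis using that h by simp
  qed
  then show ?thesis using h by (intro bcsI[of _ M "r + norm u"]) auto
qed

text \<open>The product is at most half the sum of |h(x)|^2 and |h(x + u)|^2, and these have the
  same integral by translation invariance.\<close>

lemma autocorr_bound:
  assumes h: "bcs h"
  shows "cmod (autocorr h u) \<le> (LINT x|lborel. (cmod (h x))\<^sup>2)"
proof -
  have [measurable]: "h \<in> borel_measurable borel" using h by (auto simp: bcs_def)
  have i: "integrable lborel (\<lambda>x. (cmod (h x))\<^sup>2)" "integrable lborel (\<lambda>x. (cmod (h (x + u)))\<^sup>2)"
    using bcs_norm_sq h bcs_translate by blast+
  have "cmod (autocorr h u) \<le> (LINT x|lborel. ((cmod (h x))\<^sup>2 + (cmod (h (x + u)))\<^sup>2) / 2)"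
    unfolding autocorr_def
  proof (rule order_trans[OF integral_norm_bound integral_mono])
    have "bcs (\<lambda>x. h x * cnj (h (x + u)))"
      using h bcs_translate[OF h, THEN bcs_cnj, of u]
      by (elim bcsE[of "\<lambda>x. cnj (h (x + u))"]) (rule bcs_mult_bounded)
    then show "integrable lborel (\<lambda>x. cmod (h x * cnj (h (x + u))))" by (intro integrable_norm bcs_integrable)
    show "integrable lborel (\<lambda>x. ((cmod (h x))\<^sup>2 + (cmod (h (x + u)))\<^sup>2) / 2)" using i by simp
    fix x
    have "0 \<le> (cmod (h x) - cmod (h (x + u)))\<^sup>2" by simp
    then show "cmod (h x * cnj (h (x + u))) \<le> ((cmod (h x))\<^sup>2 + (cmod (h (x + u)))\<^sup>2) / 2"
      by (simp add: norm_mult power2_diff)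
  qed
  also have "\<dots> = (LINT x|lborel. (cmod (h x))\<^sup>2)"
    using i lborel_translate(1)[of "\<lambda>x. (cmod (h x))\<^sup>2" u] by simp
  finally show ?thesis .
qed

lemma autocorr_bcs:
  fixes h :: "'a::euclidean_space \<Rightarrow> complex"
  assumes "bcs h"
  shows "bcs (autocorr h)"
proof -
  obtain M r where h: "h \<in> borel_measurable borel" "M \<ge> 0" "r \<ge> 0" "\<And>x. cmod (h x) \<le> M" "\<And>x. norm x > r \<Longrightarrow> h x = 0"
    using assms by (elim bcsE) blast
  note [measurable] = h(1)
  show ?thesis
  proof (rule bcsI[OF _ autocorr_bound[OF assms], where r = "2 * r"])
    show "autocorr h \<in> borel_measurable borel" unfolding autocorr_def by measurable
    fix u :: 'a assume u: "2 * r < norm u"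
    have "h x * cnj (h (x + u)) = 0" for x
    proof -
      have "norm u \<le> norm (x + u) + norm x" using norm_triangle_ineq4[of "x + u" x] by simp
      then have "norm x > r \<or> norm (x + u) > r" using u by linarith
      then show ?thesis using h(5) by auto
    qed
    then show "autocorr h u = 0" unfolding autocorr_def by (simp only: Bochner_Integration.integral_zero)
  qed
qed

text \<open>Fubini and a translation of the inner variable by x, after which the double integral
  factors into \<open>ft h \<xi>\<close> and its conjugate.\<close>

lemma ft_norm_sq:
  fixes h :: "'a::euclidean_space \<Rightarrow> complex"
  assumes h: "bcs h"
  shows "complex_of_real ((cmod (ft h \<xi>))\<^sup>2) = (LINT u|lborel. autocorr h u * cis (u \<bullet> \<xi>))"
proof -
  have [measurable]: "h \<in> borel_measurable borel" using h by (auto simp: bcs_def)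
  have p: "bcs (\<lambda>p. (\<lambda>(x, u). h x * cnj (h (x + u))) p * cis (snd p \<bullet> \<xi>))"
    by (rule bcs_mult_bounded[OF autocorr_pair_bcs[OF h], of _ 1])
      (auto simp: borel_prod[symmetric])
  then have "integrable (lborel \<Otimes>\<^sub>M lborel) (\<lambda>(x, u). h x * cnj (h (x + u)) * cis (u \<bullet> \<xi>))"
    unfolding lborel_prod by (auto dest!: bcs_integrable simp: case_prod_beta')
  from lborel_pair.Fubini_integral[OF this]
  have "(LINT u|lborel. autocorr h u * cis (u \<bullet> \<xi>)) = (LINT x|lborel. LINT u|lborel. h x * cnj (h (x + u)) * cis (u \<bullet> \<xi>))"
    by (simp add: autocorr_def integral_mult_left_zero)
  also have "\<dots> = (LINT x|lborel. (h x * cis (- (x \<bullet> \<xi>))) * cnj (ft h \<xi>))"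
  proof (rule Bochner_Integration.integral_cong[OF refl])
    fix x
    have "(LINT u|lborel. h x * cnj (h (x + u)) * cis (u \<bullet> \<xi>)) =
       (LINT u|lborel. (h x * cis (- (x \<bullet> \<xi>))) * cnj (h (u + x) * cis (- ((u + x) \<bullet> \<xi>))))"
      by (intro Bochner_Integration.integral_cong refl)
        (simp add: cis_cnj cis_mult mult.assoc mult.left_commute[of "cis _"] inner_add_left add.commute)
    also have "\<dots> = (LINT u|lborel. (h x * cis (- (x \<bullet> \<xi>))) * cnj (h u * cis (- (u \<bullet> \<xi>))))"
      by (rule lborel_translate(1)[of "\<lambda>u. (h x * cis (- (x \<bullet> \<xi>))) * cnj (h u * cis (- (u \<bullet> \<xi>)))" x]) measurable
    also have "\<dots> = (h x * cis (- (x \<bullet> \<xi>))) * cnj (ft h \<xi>)"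
      unfolding ft_def by (simp only: integral_mult_right_zero Bochner_Integration.integral_cnj)
    finally show "(LINT u|lborel. h x * cnj (h (x + u)) * cis (u \<bullet> \<xi>)) = (h x * cis (- (x \<bullet> \<xi>))) * cnj (ft h \<xi>)" .
  qed
  also have "\<dots> = ft h \<xi> * cnj (ft h \<xi>)" by (simp add: ft_def integral_mult_left_zero)
  finally show ?thesis by (simp add: complex_norm_square[symmetric])
qed

lemma ft_norm_le: assumes "bcs h" shows "cmod (ft h \<xi>) \<le> (LINT x|lborel. cmod (h x))"
  unfolding ft_def by (rule order_trans[OF integral_norm_bound]) (simp add: norm_mult)

lemma ft_gauss:
  fixes h :: "'a::euclidean_space \<Rightarrow> complex"
  assumes h: "bcs h" and "\<sigma> > 0"
  shows "integrable lborel (\<lambda>\<xi>. gauss (\<sigma> *\<^sub>R \<xi>) * (cmod (ft h \<xi>))\<^sup>2)"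
    "complex_of_real (LINT \<xi>|lborel. gauss (\<sigma> *\<^sub>R \<xi>) * (cmod (ft h \<xi>))\<^sup>2) =
      sqrt (2 * pi) ^ DIM('a) * (LINT v|lborel. complex_of_real (gauss v) * autocorr h (\<sigma> *\<^sub>R v))"
proof -
  have [measurable]: "h \<in> borel_measurable borel" using h by (auto simp: bcs_def)
  have a: "bcs (autocorr h)" by (rule autocorr_bcs[OF h])
  then have [measurable]: "autocorr h \<in> borel_measurable borel" by (auto simp: bcs_def)
  have ga: "integrable lborel (\<lambda>\<xi>::'a. gauss (\<sigma> *\<^sub>R \<xi>))"
    using integrable_gauss[where 'a='a] lborel_integral_scaleR(2)[OF gauss_measurable[where 'a='a], of \<sigma>] assms(2) by simp
  show "integrable lborel (\<lambda>\<xi>. gauss (\<sigma> *\<^sub>R \<xi>) * (cmod (ft h \<xi>))\<^sup>2)"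
  proof (rule Bochner_Integration.integrable_bound[OF integrable_mult_right[OF ga, of "(LINT x|lborel. cmod (h x))\<^sup>2"]])
    show "AE x in lborel. norm (gauss (\<sigma> *\<^sub>R x) * (cmod (ft h x))\<^sup>2) \<le> norm ((LINT x|lborel. cmod (h x))\<^sup>2 * gauss (\<sigma> *\<^sub>R x))"
      using ft_norm_le[OF h] by (intro AE_I2) (auto simp: gauss_pos abs_mult mult.commute intro!: mult_left_mono power_mono)
  qed simp
  have pi: "integrable (lborel \<Otimes>\<^sub>M lborel) (\<lambda>(\<xi>::'a, u). complex_of_real (gauss (\<sigma> *\<^sub>R \<xi>)) * (autocorr h u * cis (u \<bullet> \<xi>)))"
  proof (rule lborel_pair.Fubini_integrable)
    show "(\<lambda>(\<xi>::'a, u). complex_of_real (gauss (\<sigma> *\<^sub>R \<xi>)) * (autocorr h u * cis (u \<bullet> \<xi>))) \<in> borel_measurable (lborel \<Otimes>\<^sub>M lborel)"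
      by measurable
    show "integrable lborel (\<lambda>x. LINT y|lborel. norm (case (x, y) of (\<xi>, u) \<Rightarrow> complex_of_real (gauss (\<sigma> *\<^sub>R \<xi>)) * (autocorr h u * cis (u \<bullet> \<xi>))))"
      using ga by (simp add: norm_mult gauss_pos)
    show "AE x in lborel. integrable lborel (\<lambda>y. case (x, y) of (\<xi>, u) \<Rightarrow> complex_of_real (gauss (\<sigma> *\<^sub>R \<xi>)) * (autocorr h u * cis (u \<bullet> \<xi>)))"
      using bcs_integrable[OF bcs_cis(1)[OF a]] by simp
  qed
  have "complex_of_real (LINT \<xi>|lborel. gauss (\<sigma> *\<^sub>R \<xi>) * (cmod (ft h \<xi>))\<^sup>2) =
     (LINT \<xi>|lborel. LINT u|lborel. complex_of_real (gauss (\<sigma> *\<^sub>R \<xi>)) * (autocorr h u * cis (u \<bullet> \<xi>)))"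
    unfolding integral_complex_of_real[symmetric] of_real_mult ft_norm_sq[OF h] by (simp add: integral_mult_right_zero)
  also have "\<dots> = (LINT u|lborel. LINT \<xi>|lborel. complex_of_real (gauss (\<sigma> *\<^sub>R \<xi>)) * (autocorr h u * cis (u \<bullet> \<xi>)))"
    using lborel_pair.Fubini_integral[OF pi] by simp
  also have "\<dots> = (LINT u|lborel. autocorr h u * (LINT \<xi>|lborel. complex_of_real (gauss (\<sigma> *\<^sub>R \<xi>)) * cis (\<xi> \<bullet> u)))"
    by (subst integral_mult_right_zero[symmetric]) (simp add: ac_simps inner_commute)
  also have "\<dots> = (LINT u|lborel. autocorr h u * complex_of_real ((sqrt (2 * pi) / \<sigma>) ^ DIM('a) * gauss (u /\<^sub>R \<sigma>)))"
    using gauss_char_scaled(2)[OF assms(2), where 'a = 'a] by simp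
  also have "\<dots> = \<bar>\<sigma>\<bar> ^ DIM('a) *\<^sub>R (LINT v|lborel. autocorr h (\<sigma> *\<^sub>R v) * complex_of_real ((sqrt (2 * pi) / \<sigma>) ^ DIM('a) * gauss ((\<sigma> *\<^sub>R v) /\<^sub>R \<sigma>)))"
    using assms(2) by (intro lborel_integral_scaleR) auto
  also have "\<dots> = \<bar>\<sigma>\<bar> ^ DIM('a) *\<^sub>R (LINT v|lborel. complex_of_real ((sqrt (2 * pi) / \<sigma>) ^ DIM('a)) * (complex_of_real (gauss v) * autocorr h (\<sigma> *\<^sub>R v)))"
    using assms(2) by (simp add: ac_simps)
  also have "\<dots> = sqrt (2 * pi) ^ DIM('a) * (LINT v|lborel. complex_of_real (gauss v) * autocorr h (\<sigma> *\<^sub>R v))"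
    using assms(2) by (simp add: integral_mult_right_zero scaleR_conv_of_real power_divide)
  finally show "complex_of_real (LINT \<xi>|lborel. gauss (\<sigma> *\<^sub>R \<xi>) * (cmod (ft h \<xi>))\<^sup>2) =
      sqrt (2 * pi) ^ DIM('a) * (LINT v|lborel. complex_of_real (gauss v) * autocorr h (\<sigma> *\<^sub>R v))" .
qed


section \<open>Plancherel's identity and inversion in L2\<close>

lemma ft_gauss_le:
  fixes h :: "'a::euclidean_space \<Rightarrow> complex"
  assumes h: "bcs h" and "\<sigma> > 0"
  shows "(LINT \<xi>|lborel. gauss (\<sigma> *\<^sub>R \<xi>) * (cmod (ft h \<xi>))\<^sup>2) \<le> (2 * pi) ^ DIM('a) * (LINT x|lborel. (cmod (h x))\<^sup>2)"
proof -
  let ?I = "LINT x|lborel. (cmod (h x))\<^sup>2"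
  have [measurable]: "autocorr h \<in> borel_measurable borel" using autocorr_bcs[OF h] by (auto simp: bcs_def)
  have "(LINT \<xi>|lborel. gauss (\<sigma> *\<^sub>R \<xi>) * (cmod (ft h \<xi>))\<^sup>2) \<le>
      cmod (complex_of_real (LINT \<xi>|lborel. gauss (\<sigma> *\<^sub>R \<xi>) * (cmod (ft h \<xi>))\<^sup>2))"
    by (metis complex_Re_le_cmod Re_complex_of_real)
  also have "\<dots> = sqrt (2 * pi) ^ DIM('a) * cmod (LINT v|lborel. complex_of_real (gauss v) * autocorr h (\<sigma> *\<^sub>R v))"
    unfolding ft_gauss(2)[OF assms] by (simp add: norm_mult norm_power)
  also have "\<dots> \<le> sqrt (2 * pi) ^ DIM('a) * (LINT v|lborel. gauss (v::'a) * ?I)"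
  proof (intro mult_left_mono order_trans[OF integral_norm_bound integral_mono'])
    show "integrable lborel (\<lambda>v::'a. gauss v * ?I)" using integrable_gauss[where 'a='a] by simp
    show "cmod (complex_of_real (gauss v) * autocorr h (\<sigma> *\<^sub>R v)) \<le> gauss v * ?I" for v
      using autocorr_bound[OF h] by (simp add: norm_mult gauss_pos mult_left_mono)
  qed (auto simp: gauss_pos)
  also have "\<dots> = sqrt (2 * pi) ^ DIM('a) * sqrt (2 * pi) ^ DIM('a) * ?I"
    by (simp add: integral_gauss)
  also have "sqrt (2 * pi) ^ DIM('a) * sqrt (2 * pi) ^ DIM('a) = (2 * pi) ^ DIM('a)"
    unfolding power_mult_distrib[symmetric] by simp
  finally show ?thesis .
qed

lemma gauss_tendsto_1: "(\<lambda>n. gauss (inverse (real (Suc n)) *\<^sub>R x)) \<longlonglongrightarrow> 1"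
proof -
  have "(\<lambda>n. gauss (inverse (real (Suc n)) *\<^sub>R x)) \<longlonglongrightarrow> exp (- (norm (0 *\<^sub>R x))\<^sup>2 / 2)"
    unfolding gauss_def by (intro tendsto_intros LIMSEQ_inverse_real_of_nat) simp
  then show ?thesis by simp
qed

lemma gauss_mono: "0 \<le> s \<Longrightarrow> s \<le> t \<Longrightarrow> gauss (t *\<^sub>R x) \<le> gauss (s *\<^sub>R x)"
  unfolding gauss_def by (auto intro!: power_mono mult_right_mono)

lemma ft_gauss_limit:
  fixes h :: "'a::euclidean_space \<Rightarrow> complex"
  assumes h: "bcs h" and "(\<lambda>n. LINT \<xi>|lborel. gauss (inverse (real (Suc n)) *\<^sub>R \<xi>) * (cmod (ft h \<xi>))\<^sup>2) \<longlonglongrightarrow> L"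
  shows "integrable lborel (\<lambda>\<xi>. (cmod (ft h \<xi>))\<^sup>2)" "(LINT \<xi>|lborel. (cmod (ft h \<xi>))\<^sup>2) = L"
proof -
  have [measurable]: "h \<in> borel_measurable borel" using h by (auto simp: bcs_def)
  have "has_bochner_integral lborel (\<lambda>\<xi>. (cmod (ft h \<xi>))\<^sup>2) L"
  proof (rule has_bochner_integral_monotone_convergence[OF _ _ _ assms(2)])
    show "integrable lborel (\<lambda>\<xi>. gauss (inverse (real (Suc n)) *\<^sub>R \<xi>) * (cmod (ft h \<xi>))\<^sup>2)" for n
      by (rule ft_gauss(1)[OF h]) simp
    show "AE x in lborel. mono (\<lambda>n. gauss (inverse (real (Suc n)) *\<^sub>R x) * (cmod (ft h x))\<^sup>2)"
      by (intro AE_I2 monoI mult_right_mono gauss_mono) (auto simp: le_imp_inverse_le)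
    show "AE x in lborel. (\<lambda>n. gauss (inverse (real (Suc n)) *\<^sub>R x) * (cmod (ft h x))\<^sup>2) \<longlonglongrightarrow> (cmod (ft h x))\<^sup>2"
      using tendsto_mult[OF gauss_tendsto_1 tendsto_const] by (intro AE_I2) fastforce
  qed simp
  then show "integrable lborel (\<lambda>\<xi>. (cmod (ft h \<xi>))\<^sup>2)" "(LINT \<xi>|lborel. (cmod (ft h \<xi>))\<^sup>2) = L"
    by (auto simp: has_bochner_integral_iff)
qed

text \<open>The bound for the autocorrelation is uniform in the damping, and monotone convergence
  removes the damping. No continuity enters, so the inequality also covers the truncated transforms
  used for inversion, which may jump at |y| = R.\<close>

theorem plancherel_le:
  fixes h :: "'a::euclidean_space \<Rightarrow> complex"
  assumes h: "bcs h"
  shows "integrable lborel (\<lambda>\<xi>. (cmod (ft h \<xi>))\<^sup>2)"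
    "(LINT \<xi>|lborel. (cmod (ft h \<xi>))\<^sup>2) \<le> (2 * pi) ^ DIM('a) * (LINT x|lborel. (cmod (h x))\<^sup>2)"
proof -
  let ?g = "\<lambda>n. LINT \<xi>|lborel. gauss (inverse (real (Suc n)) *\<^sub>R \<xi>) * (cmod (ft h \<xi>))\<^sup>2"
  have le: "?g n \<le> (2 * pi) ^ DIM('a) * (LINT x|lborel. (cmod (h x))\<^sup>2)" for n
    by (rule ft_gauss_le[OF h]) simp
  have "incseq ?g"
    by (intro incseq_SucI integral_mono ft_gauss(1)[OF h] mult_right_mono gauss_mono)
      (auto simp: le_imp_inverse_le simp del: of_nat_Suc)
  then obtain L where L: "?g \<longlonglongrightarrow> L" by (rule incseq_convergent) (use le in auto)
  note * = ft_gauss_limit[OF h L]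
  show "integrable lborel (\<lambda>\<xi>. (cmod (ft h \<xi>))\<^sup>2)" by (rule *)
  show "(LINT \<xi>|lborel. (cmod (ft h \<xi>))\<^sup>2) \<le> (2 * pi) ^ DIM('a) * (LINT x|lborel. (cmod (h x))\<^sup>2)"
    unfolding *(2) by (rule LIMSEQ_le_const2[OF L]) (use le in auto)
qed

text \<open>For continuous \<open>h\<close> the autocorrelation at \<sigma> v tends to its value at
  0, so the damped integrals converge to the full squared norm. This is one reason for working with
  amplitudes that are continuous in \<xi>.\<close>

theorem plancherel:
  fixes h :: "'a::euclidean_space \<Rightarrow> complex"
  assumes h: "bcs h" and c: "continuous_on UNIV h"
  shows "(LINT \<xi>|lborel. (cmod (ft h \<xi>))\<^sup>2) = (2 * pi) ^ DIM('a) * (LINT x|lborel. (cmod (h x))\<^sup>2)"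
proof -
  let ?I = "LINT x|lborel. (cmod (h x))\<^sup>2"
  obtain M r where hM: "h \<in> borel_measurable borel" "M \<ge> 0" "\<And>x. cmod (h x) \<le> M" "\<And>x. norm x > r \<Longrightarrow> h x = 0"
    using h by (elim bcsE) blast
  note [measurable] = hM(1)
  have [measurable]: "autocorr h \<in> borel_measurable borel" using autocorr_bcs[OF h] by (auto simp: bcs_def)
  have h0: "integrable lborel (\<lambda>x. M * cmod (h x))" using bcs_integrable[OF h] by simp
  have R: "(\<lambda>n. autocorr h (inverse (real (Suc n)) *\<^sub>R v)) \<longlonglongrightarrow> complex_of_real ?I" for v
  proof -
    have "(\<lambda>n. autocorr h (inverse (real (Suc n)) *\<^sub>R v)) \<longlonglongrightarrow> (LINT x|lborel. h x * cnj (h x))"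
      unfolding autocorr_def
    proof (rule integral_dominated_convergence[OF _ _ h0])
      show "AE x in lborel. (\<lambda>n. h x * cnj (h (x + inverse (real (Suc n)) *\<^sub>R v))) \<longlonglongrightarrow> h x * cnj (h x)"
      proof (intro AE_I2 tendsto_mult tendsto_const tendsto_cnj)
        fix x
        have "(\<lambda>n. x + inverse (real (Suc n)) *\<^sub>R v) \<longlonglongrightarrow> x + 0 *\<^sub>R v"
          by (intro tendsto_intros LIMSEQ_inverse_real_of_nat)
        then show "(\<lambda>n. h (x + inverse (real (Suc n)) *\<^sub>R v)) \<longlonglongrightarrow> h x"
          using c by (intro isCont_tendsto_compose[of _ h]) (auto simp: continuous_on_eq_continuous_at)
      qed
      show "AE x in lborel. cmod (h x * cnj (h (x + inverse (real (Suc n)) *\<^sub>R v))) \<le> M * cmod (h x)" for n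
        using hM(3) by (intro AE_I2) (simp add: norm_mult mult.commute[of M] mult_left_mono)
    qed simp_all
    also have "(LINT x|lborel. h x * cnj (h x)) = complex_of_real ?I"
      by (simp add: complex_norm_square[symmetric] del: of_real_power)
    finally show ?thesis .
  qed
  have I0: "integrable lborel (\<lambda>v::'a. gauss v * ?I)" using integrable_gauss[where 'a='a] by simp
  have "(\<lambda>n. LINT v|lborel. complex_of_real (gauss v) * autocorr h (inverse (real (Suc n)) *\<^sub>R v))
     \<longlonglongrightarrow> (LINT v|lborel. complex_of_real (gauss (v::'a)) * complex_of_real ?I)"
  proof (rule integral_dominated_convergence[OF _ _ I0])
    show "AE v in lborel. (\<lambda>n. complex_of_real (gauss v) * autocorr h (inverse (real (Suc n)) *\<^sub>R v))
       \<longlonglongrightarrow> complex_of_real (gauss v) * complex_of_real ?I"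
      by (intro AE_I2 tendsto_mult tendsto_const R)
    show "AE v in lborel. cmod (complex_of_real (gauss v) * autocorr h (inverse (real (Suc n)) *\<^sub>R v)) \<le> gauss v * ?I" for n
      using autocorr_bound[OF h] by (intro AE_I2) (simp add: norm_mult gauss_pos mult_left_mono)
  qed simp_all
  from tendsto_mult[OF tendsto_const this, of "complex_of_real (sqrt (2 * pi) ^ DIM('a))"]
  have "(\<lambda>n. complex_of_real (LINT \<xi>|lborel. gauss (inverse (real (Suc n)) *\<^sub>R \<xi>) * (cmod (ft h \<xi>))\<^sup>2))
     \<longlonglongrightarrow> complex_of_real (sqrt (2 * pi) ^ DIM('a)) * (LINT v|lborel. complex_of_real (gauss (v::'a)) * complex_of_real ?I)"
    by (simp add: ft_gauss(2)[OF h] del: of_nat_Suc)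
  also have "complex_of_real (sqrt (2 * pi) ^ DIM('a)) * (LINT v|lborel. complex_of_real (gauss (v::'a)) * complex_of_real ?I)
      = complex_of_real (sqrt (2 * pi) ^ DIM('a) * (LINT v|lborel. gauss (v::'a) * ?I))"
    unfolding of_real_mult integral_complex_of_real[symmetric] ..
  also have "\<dots> = complex_of_real ((2 * pi) ^ DIM('a) * ?I)"
  proof -
    have "sqrt (2 * pi) ^ DIM('a) * sqrt (2 * pi) ^ DIM('a) = (2 * pi) ^ DIM('a)"
      unfolding power_mult_distrib[symmetric] by simp
    then show ?thesis by (simp only: integral_mult_left_zero integral_gauss mult.assoc[symmetric])
  qed
  finally have "(\<lambda>n. LINT \<xi>|lborel. gauss (inverse (real (Suc n)) *\<^sub>R \<xi>) * (cmod (ft h \<xi>))\<^sup>2) \<longlonglongrightarrow> (2 * pi) ^ DIM('a) * ?I"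
    by (simp only: tendsto_of_real_iff)
  then show ?thesis by (rule ft_gauss_limit(2)[OF h])
qed

lemma bcs_ft_bounded:
  assumes "bcs h"
  shows "bcs (\<lambda>y. if norm y \<le> R then ft h (- y) else 0)"
proof -
  have [measurable]: "h \<in> borel_measurable borel" using assms by (auto simp: bcs_def)
  show ?thesis
    by (rule bcsI[of _ "LINT x|lborel. cmod (h x)" R]) (auto simp: ft_norm_le[OF assms])
qed

text \<open>\<open>f R\<close> is the truncated, unnormalized inverse transform of \<open>a\<close>.
  Expand the square: by Fubini the cross term is the squared norm of \<open>f R\<close>, and the
  last term is at most \<open>c\<close> times it. For continuous \<open>a\<close>, Plancherel turns
  the remaining difference into \<open>c\<close> times the energy of the inverse transform outside
  the ball of radius R, which tends to 0.\<close>

theorem ft_inversion_L2: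
  fixes a :: "'a::euclidean_space \<Rightarrow> complex"
  assumes a: "bcs a"
  defines "c \<equiv> (2 * pi) ^ DIM('a)" and "f \<equiv> \<lambda>R y. if norm y \<le> R then ft a (- y) else 0"
  shows "integrable lborel (\<lambda>\<xi>. (cmod (c * a \<xi> - ft (f R) \<xi>))\<^sup>2)"
    "(LINT \<xi>|lborel. (cmod (c * a \<xi> - ft (f R) \<xi>))\<^sup>2) \<le>
      c\<^sup>2 * (LINT \<xi>|lborel. (cmod (a \<xi>))\<^sup>2) - c * (LINT y|lborel. (cmod (f R y))\<^sup>2)"
proof -
  have fb: "bcs (f R)" unfolding f_def by (rule bcs_ft_bounded[OF a])
  have [measurable]: "a \<in> borel_measurable borel" "f R \<in> borel_measurable borel" using a fb by (auto simp: bcs_def)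
  have c: "c > 0" by (simp add: c_def)
  obtain B where B: "\<And>\<xi>. cmod (ft (f R) \<xi>) \<le> B" using ft_norm_le[OF fb] by blast
  have ab: "bcs (\<lambda>\<xi>. a \<xi> * cnj (ft (f R) \<xi>))" by (rule bcs_mult_bounded[OF a, of _ B]) (use B in auto)
  have sq: "(cmod (c * a \<xi> - ft (f R) \<xi>))\<^sup>2 = c\<^sup>2 * (cmod (a \<xi>))\<^sup>2 - 2 * c * Re (a \<xi> * cnj (ft (f R) \<xi>)) + (cmod (ft (f R) \<xi>))\<^sup>2" for \<xi>
    unfolding cmod_power2 by (simp add: power2_eq_square algebra_simps)
  have i: "integrable lborel (\<lambda>\<xi>. c\<^sup>2 * (cmod (a \<xi>))\<^sup>2)" "integrable lborel (\<lambda>\<xi>. 2 * c * Re (a \<xi> * cnj (ft (f R) \<xi>)))"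
    "integrable lborel (\<lambda>\<xi>. (cmod (ft (f R) \<xi>))\<^sup>2)"
    using bcs_norm_sq[OF a] bcs_integrable[OF ab] plancherel_le(1)[OF fb] by (auto simp del: complex_cnj_mult times_complex.sel)
  show "integrable lborel (\<lambda>\<xi>. (cmod (c * a \<xi> - ft (f R) \<xi>))\<^sup>2)"
    unfolding sq using i by (intro Bochner_Integration.integrable_add Bochner_Integration.integrable_diff)
  have pair: "integrable (lborel \<Otimes>\<^sub>M lborel) (\<lambda>(\<xi>, y). a \<xi> * (cnj (f R y) * cis (y \<bullet> \<xi>)))"
  proof (rule lborel_pair.Fubini_integrable)
    show "(\<lambda>(\<xi>, y). a \<xi> * (cnj (f R y) * cis (y \<bullet> \<xi>))) \<in> borel_measurable (lborel \<Otimes>\<^sub>M lborel)" by measurable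
    show "integrable lborel (\<lambda>x. LINT y|lborel. norm (case (x, y) of (\<xi>, y) \<Rightarrow> a \<xi> * (cnj (f R y) * cis (y \<bullet> \<xi>))))"
      using bcs_integrable[OF a] by (simp add: norm_mult)
    show "AE x in lborel. integrable lborel (\<lambda>y. case (x, y) of (\<xi>, y) \<Rightarrow> a \<xi> * (cnj (f R y) * cis (y \<bullet> \<xi>)))"
      using bcs_integrable[OF bcs_cis(1)[OF bcs_cnj[OF fb]]] by simp
  qed
  have "(LINT \<xi>|lborel. a \<xi> * cnj (ft (f R) \<xi>)) = (LINT \<xi>|lborel. LINT y|lborel. a \<xi> * (cnj (f R y) * cis (y \<bullet> \<xi>)))"
    unfolding ft_def Bochner_Integration.integral_cnj[symmetric] integral_mult_right_zero
    by (simp add: cis_cnj)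
  also have "\<dots> = (LINT y|lborel. LINT \<xi>|lborel. a \<xi> * (cnj (f R y) * cis (y \<bullet> \<xi>)))"
    using lborel_pair.Fubini_integral[OF pair] by simp
  also have "\<dots> = (LINT y|lborel. cnj (f R y) * ft a (- y))"
    unfolding ft_def integral_mult_right_zero[symmetric] by (simp add: ac_simps inner_commute)
  also have "\<dots> = (LINT y|lborel. complex_of_real ((cmod (f R y))\<^sup>2))"
    by (intro Bochner_Integration.integral_cong refl) (auto simp: f_def complex_norm_square[symmetric] mult.commute[of "cnj _"] simp del: of_real_power)
  also have "\<dots> = complex_of_real (LINT y|lborel. (cmod (f R y))\<^sup>2)" by (rule integral_complex_of_real)
  finally have cross: "(LINT \<xi>|lborel. a \<xi> * cnj (ft (f R) \<xi>)) = complex_of_real (LINT y|lborel. (cmod (f R y))\<^sup>2)" .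
  have "(LINT \<xi>|lborel. Re (a \<xi> * cnj (ft (f R) \<xi>))) = (LINT y|lborel. (cmod (f R y))\<^sup>2)"
    using integral_Re[OF bcs_integrable[OF ab]] cross by (simp del: times_complex.sel)
  then have "(LINT \<xi>|lborel. (cmod (c * a \<xi> - ft (f R) \<xi>))\<^sup>2) =
      c\<^sup>2 * (LINT \<xi>|lborel. (cmod (a \<xi>))\<^sup>2) - 2 * c * (LINT y|lborel. (cmod (f R y))\<^sup>2) + (LINT \<xi>|lborel. (cmod (ft (f R) \<xi>))\<^sup>2)"
    unfolding sq
    by (subst Bochner_Integration.integral_add[OF Bochner_Integration.integrable_diff[OF i(1,2)] i(3)],
        subst Bochner_Integration.integral_diff[OF i(1,2)]) (simp del: times_complex.sel)
  moreover have "(LINT \<xi>|lborel. (cmod (ft (f R) \<xi>))\<^sup>2) \<le> c * (LINT y|lborel. (cmod (f R y))\<^sup>2)"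
    unfolding c_def by (rule plancherel_le(2)[OF fb])
  ultimately show "(LINT \<xi>|lborel. (cmod (c * a \<xi> - ft (f R) \<xi>))\<^sup>2) \<le>
      c\<^sup>2 * (LINT \<xi>|lborel. (cmod (a \<xi>))\<^sup>2) - c * (LINT y|lborel. (cmod (f R y))\<^sup>2)"
    by linarith
qed

lemma lborel_reflect:
  fixes f :: "'a::euclidean_space \<Rightarrow> 'b::{banach, second_countable_topology}"
  assumes [measurable]: "f \<in> borel_measurable borel"
  shows "(LINT x|lborel. f (- x)) = (LINT x|lborel. f x)"
    "integrable lborel (\<lambda>x. f (- x)) \<longleftrightarrow> integrable lborel f"
  using lborel_integral_scaleR[OF assms, of "-1"] by simp_all

section \<open>Horizontal Fourier synthesis\<close>

lemma Basis_cart: "(Basis :: (real^'n) set) = (\<lambda>i. axis i 1) ` UNIV"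
  by (auto simp: Basis_vec_def)

lemma prod_Basis_cart:
  fixes f :: "real^'n \<Rightarrow> 'b::comm_monoid_mult"
  shows "(\<Prod>b\<in>Basis. f b) = (\<Prod>i\<in>UNIV. f (axis i 1))"
  unfolding Basis_cart by (subst prod.reindex) (auto simp: inj_on_def axis_eq_axis)

lemma pt_simps [simp]: "pt y z $ 1 = y $ 1" "pt y z $ 2 = y $ 2" "pt y z $ 3 = z" "hor (pt y z) = y"
  by (simp_all add: pt_def hor_def vec_eq_iff forall_2)

lemma pt_hor [simp]: "pt (hor x) (x $ 3) = x"
  by (simp add: pt_def hor_def vec_eq_iff forall_3)

lemma hor_simps [simp]: "hor x $ 1 = x $ 1" "hor x $ 2 = x $ 2" by (simp_all add: hor_def)

lemma continuous_on_pt [continuous_intros]: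
  assumes "continuous_on S f" "continuous_on S g"
  shows "continuous_on S (\<lambda>x. pt (f x) (g x))"
proof -
  have "pt y z = (\<chi> i. if i = 1 then y $ 1 else if i = 2 then y $ 2 else z)" for y z
    by (simp add: vec_eq_iff forall_3)
  moreover have "continuous_on S (\<lambda>x. if i = 1 then f x $ 1 else if i = 2 then f x $ 2 else g x)" for i :: 3
    using assms by (cases "i = 1"; cases "i = 2") (auto intro!: continuous_intros)
  ultimately show ?thesis by (simp add: continuous_on_vec_lambda)
qed

lemma continuous_on_hor [continuous_intros]:
  assumes "continuous_on S f"
  shows "continuous_on S (\<lambda>x. hor (f x))"
proof -
  have "hor x = (\<chi> i. if i = 1 then x $ 1 else x $ 2)" for x
    by (simp add: vec_eq_iff forall_2)
  moreover have "continuous_on S (\<lambda>x. if i = 1 then f x $ 1 else f x $ 2)" for i :: 2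
    using assms by (cases "i = 1") (auto intro!: continuous_intros)
  ultimately show ?thesis by (simp add: continuous_on_vec_lambda)
qed

lemma pt_measurable: "(\<lambda>p. pt (fst p) (snd p)) \<in> borel_measurable borel"
  by (intro borel_measurable_continuous_onI continuous_intros)

lemma hor_measurable [measurable]: "hor \<in> borel_measurable borel"
  by (intro borel_measurable_continuous_onI continuous_intros)

text \<open>Both measures agree on boxes, whose preimages are products of boxes. From this follows
  Tonelli's theorem in the form of integration over horizontal planes.\<close>

lemma lborel_pt: "lborel = distr lborel borel (\<lambda>p. pt (fst p) (snd p))"
proof (rule lborel_eqI)
  fix l u :: "real^3" assume lu: "\<And>b. b \<in> Basis \<Longrightarrow> l \<bullet> b \<le> u \<bullet> b"
  have lu': "l $ i \<le> u $ i" for i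
    using lu[of "axis i 1"] by (simp add: inner_axis Basis_cart)
  have hlu: "hor l $ i \<le> hor u $ i" for i
    using lu' exhaust_2[of i] by auto
  have eq: "(\<lambda>p. pt (fst p) (snd p)) -` box l u = box (hor l) (hor u) \<times> box (l $ 3) (u $ 3)"
    by (auto simp: mem_box_cart forall_2 forall_3)
  have "emeasure (distr lborel borel (\<lambda>p. pt (fst p) (snd p))) (box l u) = emeasure (lborel \<Otimes>\<^sub>M lborel) (box (hor l) (hor u) \<times> box (l $ 3) (u $ 3))"
    by (subst emeasure_distr) (simp_all add: eq pt_measurable lborel_prod)
  also have "\<dots> = emeasure lborel (box (hor l) (hor u)) * emeasure lborel (box (l $ 3) (u $ 3))"
    by (rule lborel.emeasure_pair_measure_Times) auto
  also have "\<dots> = ennreal ((u $ 1 - l $ 1) * (u $ 2 - l $ 2)) * ennreal (u $ 3 - l $ 3)"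
  proof -
    have "emeasure lborel (box (hor l) (hor u)) = (\<Prod>b\<in>Basis. (hor u - hor l) \<bullet> b)"
      by (rule emeasure_lborel_box) (auto simp: Basis_cart inner_axis hlu)
    moreover have "(\<Prod>b\<in>Basis. (hor u - hor l) \<bullet> b) = (u $ 1 - l $ 1) * (u $ 2 - l $ 2)"
      by (simp add: prod_Basis_cart inner_axis UNIV_2)
    moreover have "emeasure lborel (box (l $ 3) (u $ 3)) = u $ 3 - l $ 3"
      using lu'[of 3] by simp
    ultimately show ?thesis by simp
  qed
  also have "\<dots> = (\<Prod>b\<in>Basis. (u - l) \<bullet> b)"
  proof -
    have "(\<Prod>b\<in>Basis. (u - l) \<bullet> b) = ((u $ 1 - l $ 1) * (u $ 2 - l $ 2)) * (u $ 3 - l $ 3)"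
      unfolding prod_Basis_cart UNIV_3 by (simp add: inner_axis mult.assoc)
    moreover have "0 \<le> (u $ 1 - l $ 1) * (u $ 2 - l $ 2)" "0 \<le> u $ 3 - l $ 3"
      using lu'[of 1] lu'[of 2] lu'[of 3] by simp_all
    ultimately show ?thesis by (simp only: ennreal_mult)
  qed
  finally show "emeasure (distr lborel borel (\<lambda>p. pt (fst p) (snd p))) (box l u) = (\<Prod>b\<in>Basis. (u - l) \<bullet> b)" .
qed simp

lemma nn_integral_pt:
  assumes [measurable]: "g \<in> borel_measurable (borel :: (real^3) measure)"
  shows "(\<integral>\<^sup>+x. g x \<partial>lborel) = (\<integral>\<^sup>+z. \<integral>\<^sup>+y. g (pt y z) \<partial>lborel \<partial>lborel)"
proof -
  have m: "(\<lambda>(y, z). g (pt y z)) \<in> borel_measurable (lborel \<Otimes>\<^sub>M lborel)"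
    using measurable_compose[OF pt_measurable assms] by (simp add: lborel_prod case_prod_beta')
  have "(\<integral>\<^sup>+x. g x \<partial>lborel) = (\<integral>\<^sup>+p. g (pt (fst p) (snd p)) \<partial>lborel)"
    by (subst lborel_pt) (simp add: nn_integral_distr pt_measurable)
  also have "\<dots> = (\<integral>\<^sup>+z. \<integral>\<^sup>+y. g (pt y z) \<partial>lborel \<partial>lborel)"
    using lborel_pair.nn_integral_snd[OF m] by (simp add: lborel_prod case_prod_beta')
  finally show ?thesis .
qed

text \<open>A square containing the disc of radius \<open>r\<close>: integrals of functions
  supported in the disc are rewritten as integrals over a box, where continuity in parameters and
  differentiation under the integral apply.\<close>

abbreviation bx :: "real \<Rightarrow> (real^2) set" where
  "bx r \<equiv> cbox (- (r *\<^sub>R One)) (r *\<^sub>R One)"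

lemma norm_le_bx: "norm \<xi> \<le> r \<Longrightarrow> \<xi> \<in> bx r"
  using order_trans[OF Basis_le_norm[of _ \<xi>]] by (auto simp: mem_box abs_le_iff)  (force+)

lemma integral_bx:
  fixes g :: "real^2 \<Rightarrow> complex"
  assumes "continuous_on UNIV g" "\<And>\<xi>. norm \<xi> > r \<Longrightarrow> g \<xi> = 0"
  shows "integrable lborel g" "(LINT \<xi>|lborel. g \<xi>) = integral (bx r) g"
proof -
  have c: "continuous_on (bx r) g" using assms(1) continuous_on_subset by blast
  have i: "set_integrable lborel (bx r) g"
    unfolding set_integrable_def using c by (intro borel_integrable_compact) auto
  have eq: "(\<lambda>\<xi>. indicator (bx r) \<xi> *\<^sub>R g \<xi>) = g"
  proof
    show "indicator (bx r) \<xi> *\<^sub>R g \<xi> = g \<xi>" for \<xi>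
      using assms(2)[of \<xi>] norm_le_bx[of \<xi> r] by (cases "norm \<xi> \<le> r") auto
  qed
  show "integrable lborel g" using i unfolding set_integrable_def eq .
  have "(LINT \<xi>:bx r|lborel. g \<xi>) = integral (bx r) g"
    using i by (rule set_borel_integral_eq_integral)
  then show "(LINT \<xi>|lborel. g \<xi>) = integral (bx r) g" unfolding set_lebesgue_integral_def eq .
qed

lemma param_continuous:
  fixes G :: "'p::topological_space \<Rightarrow> real^2 \<Rightarrow> complex"
  assumes c: "continuous_on (U \<times> UNIV) (\<lambda>(p, \<xi>). G p \<xi>)" and s: "\<And>p \<xi>. norm \<xi> > r \<Longrightarrow> G p \<xi> = 0"
  shows "continuous_on U (\<lambda>p. LINT \<xi>|lborel. G p \<xi>)"
proof -
  have "continuous_on U (\<lambda>p. integral (bx r) (G p))"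
    by (rule integral_continuous_on_param) (auto intro: continuous_on_subset[OF c])
  moreover have "(LINT \<xi>|lborel. G p \<xi>) = integral (bx r) (G p)" if "p \<in> U" for p
    by (rule integral_bx) (use that s in \<open>auto intro!: continuous_on_compose2[OF c, of _ "\<lambda>\<xi>. (p, \<xi>)", simplified] continuous_intros\<close>)
  ultimately show ?thesis by (simp cong: continuous_on_cong)
qed

lemma param_derivative:
  fixes G :: "real \<Rightarrow> real^2 \<Rightarrow> complex"
  assumes c: "continuous_on (U \<times> UNIV) (\<lambda>(p, \<xi>). G p \<xi>)" and s: "\<And>p \<xi>. norm \<xi> > r \<Longrightarrow> G p \<xi> = 0"
    and c': "continuous_on (U \<times> UNIV) (\<lambda>(p, \<xi>). G' p \<xi>)" and s': "\<And>p \<xi>. norm \<xi> > r \<Longrightarrow> G' p \<xi> = 0"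
    and d: "\<And>p \<xi>. p \<in> U \<Longrightarrow> ((\<lambda>p. G p \<xi>) has_vector_derivative G' p \<xi>) (at p within U)"
    and U: "convex U" "p \<in> U"
  shows "((\<lambda>p. LINT \<xi>|lborel. G p \<xi>) has_vector_derivative (LINT \<xi>|lborel. G' p \<xi>)) (at p within U)"
proof -
  have cp: "continuous_on UNIV (G p)" "continuous_on UNIV (G' p)" if "p \<in> U" for p
    using that by (auto intro!: continuous_on_compose2[OF c, of _ "\<lambda>\<xi>. (p, \<xi>)", simplified]
        continuous_on_compose2[OF c', of _ "\<lambda>\<xi>. (p, \<xi>)", simplified] continuous_intros)
  have lhs: "((\<lambda>p. integral (bx r) (G p)) has_vector_derivative integral (bx r) (G' p)) (at p within U)"
    using cp U d
    by (intro leibniz_rule_vector_derivative integrable_continuous)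
      (auto intro: continuous_on_subset[OF c'] continuous_on_subset[OF cp(1)])
  have eq: "(LINT \<xi>|lborel. G p \<xi>) = integral (bx r) (G p)" "(LINT \<xi>|lborel. G' p \<xi>) = integral (bx r) (G' p)" if "p \<in> U" for p
    using integral_bx cp[OF that] s s' by blast+
  show ?thesis unfolding eq(2)[OF U(2)] by (rule has_vector_derivative_transform[OF U(2) eq(1) lhs])
qed

text \<open>\<open>D j\<close> is the \<open>j\<close>-th vertical derivative of an amplitude; the values for \<open>z\<close> outside
  \<open>[a, b]\<close> are immaterial, but are required to be continuous.\<close>

definition amp :: "real \<Rightarrow> real \<Rightarrow> real \<Rightarrow> (nat \<Rightarrow> real^2 \<Rightarrow> real \<Rightarrow> complex) \<Rightarrow> bool" where
  "amp a b r D \<longleftrightarrow> (\<forall>j. continuous_on UNIV (\<lambda>p. D j (fst p) (snd p))) \<and>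
     (\<forall>j \<xi> z. z \<in> {a..b} \<longrightarrow> (D j \<xi> has_vector_derivative D (Suc j) \<xi> z) (at z within {a..b})) \<and>
     (\<forall>j \<xi> z. norm \<xi> > r \<longrightarrow> D j \<xi> z = 0) \<and> (\<forall>j \<xi> z. D j (- \<xi>) z = cnj (D j \<xi> z))"

lemma ampD:
  assumes "amp a b r D"
  shows "continuous_on UNIV (\<lambda>p. D j (fst p) (snd p))"
    "z \<in> {a..b} \<Longrightarrow> (D j \<xi> has_vector_derivative D (Suc j) \<xi> z) (at z within {a..b})"
    "norm \<xi> > r \<Longrightarrow> D j \<xi> z = 0" "D j (- \<xi>) z = cnj (D j \<xi> z)"
  using assms by (auto simp: amp_def)

lemma amp_compose_continuous:
  assumes "amp a b r D" "continuous_on S f" "continuous_on S g"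
  shows "continuous_on S (\<lambda>x. D j (f x) (g x))"
  using continuous_on_compose2[OF ampD(1)[OF assms(1), of j], of S "\<lambda>x. (f x, g x)"] assms(2,3)
  by (auto intro!: continuous_intros)

lemma amp_D_interior:
  assumes "amp a b r D" "z \<in> {a<..<b}"
  shows "(D j \<xi> has_vector_derivative D (Suc j) \<xi> z) (at z)"
  using ampD(2)[OF assms(1), of z j \<xi>] assms(2) at_within_interior[of z "{a..b}"] by auto

lemma amp_shift: "amp a b r D \<Longrightarrow> amp a b r (\<lambda>j. D (Suc j))"
  unfolding amp_def by blast

lemma amp_mult:
  assumes D: "amp a b r D" and c: "continuous_on UNIV c" "\<And>\<xi>. c (- \<xi>) = cnj (c \<xi>)"
  shows "amp a b r (\<lambda>j \<xi> z. c \<xi> * D j \<xi> z)"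
  unfolding amp_def
proof (intro conjI allI impI)
  show "continuous_on UNIV (\<lambda>p. c (fst p) * D j (fst p) (snd p))" for j
    by (intro continuous_intros continuous_on_compose2[OF c(1)] ampD(1)[OF D]) auto
  show "((\<lambda>z. c \<xi> * D j \<xi> z) has_vector_derivative c \<xi> * D (Suc j) \<xi> z) (at z within {a..b})"
    if "z \<in> {a..b}" for j \<xi> z
    by (rule has_vector_derivative_mult_right[OF ampD(2)[OF D that]])
qed (use ampD[OF D] c in auto)

text \<open>There is no factor (2 pi)^-2, which is why (2 pi)^2 appears in transforms and norms
  below. The real part discards nothing for the amplitudes in use: the symmetry under \<xi> -> -
  \<xi> demanded by \<open>amp\<close> makes the integral real.\<close>

definition synth :: "(real^2 \<Rightarrow> real \<Rightarrow> complex) \<Rightarrow> real^3 \<Rightarrow> real" where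
  "synth A x = Re (LINT \<xi>|lborel. A \<xi> (x $ 3) * cis (\<xi> \<bullet> hor x))"

lemma synth_continuous:
  assumes D: "amp a b r D" shows "continuous_on UNIV (synth (D j))"
  unfolding synth_def
  by (intro continuous_on_Re param_continuous[of _ _ r])
    (auto simp: case_prod_beta ampD(3)[OF D] intro!: continuous_intros amp_compose_continuous[OF D])

lemma synth_measurable [measurable]: "amp a b r D \<Longrightarrow> synth (D j) \<in> borel_measurable borel"
  using synth_continuous by (rule borel_measurable_continuous_onI)

lemma amp_bcs: assumes D: "amp a b r D" shows "bcs (\<lambda>\<xi>. D j \<xi> z)"
proof -
  have c: "continuous_on UNIV (\<lambda>\<xi>. D j \<xi> z)" by (intro amp_compose_continuous[OF D] continuous_intros)
  have "compact ((\<lambda>\<xi>. D j \<xi> z) ` cball 0 r)"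
    by (intro compact_continuous_image continuous_on_subset[OF c]) auto
  then have "bounded ((\<lambda>\<xi>. D j \<xi> z) ` cball 0 r)" by (rule compact_imp_bounded)
  then obtain B where "\<forall>x\<in>(\<lambda>\<xi>. D j \<xi> z) ` cball 0 r. cmod x \<le> B" unfolding bounded_iff by blast
  then have B: "norm \<xi> \<le> r \<Longrightarrow> cmod (D j \<xi> z) \<le> B" for \<xi> by simp
  show ?thesis
  proof (rule bcsI[of _ "max B 0" r])
    show "(\<lambda>\<xi>. D j \<xi> z) \<in> borel_measurable borel" using c by (rule borel_measurable_continuous_onI)
    show "cmod (D j \<xi> z) \<le> max B 0" for \<xi>
      using B[of \<xi>] ampD(3)[OF D, of \<xi> j z] by (cases "norm \<xi> \<le> r") auto
  qed (rule ampD(3)[OF D])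
qed

text \<open>Conjugating the integrand has the same effect as reflecting \<xi>, so the integral
  equals its own conjugate.\<close>

lemma synth_pt_complex:
  assumes D: "amp a b r D"
  shows "complex_of_real (synth (D j) (pt y z)) = ft (\<lambda>\<xi>. D j \<xi> z) (- y)"
proof -
  let ?g = "\<lambda>\<xi>. D j \<xi> z * cis (\<xi> \<bullet> y)"
  have m: "?g \<in> borel_measurable borel" using bcs_cis(1)[OF amp_bcs[OF D]] by (auto simp: bcs_def)
  have "cnj (LINT \<xi>|lborel. ?g \<xi>) = (LINT \<xi>|lborel. ?g (- \<xi>))"
    by (simp add: Bochner_Integration.integral_cnj[symmetric] cis_cnj ampD(4)[OF D] del: Bochner_Integration.integral_cnj)
  also have "\<dots> = (LINT \<xi>|lborel. ?g \<xi>)" by (rule lborel_reflect(1)[OF m])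
  finally have "(LINT \<xi>|lborel. ?g \<xi>) \<in> \<real>" by (simp add: Reals_cnj_iff)
  then show ?thesis by (simp add: synth_def ft_def of_real_Re)
qed

lemma synth_L2_pt:
  assumes D: "amp a b r D"
  shows "integrable lborel (\<lambda>y. (synth (D j) (pt y z))\<^sup>2)"
    "(LINT y|lborel. (synth (D j) (pt y z))\<^sup>2) = (2 * pi)\<^sup>2 * (LINT \<xi>|lborel. (cmod (D j \<xi> z))\<^sup>2)"
proof -
  let ?h = "\<lambda>\<xi>. D j \<xi> z"
  have b: "bcs ?h" by (rule amp_bcs[OF D])
  have [measurable]: "?h \<in> borel_measurable borel" using b by (auto simp: bcs_def)
  have eq: "(synth (D j) (pt y z))\<^sup>2 = (cmod (ft ?h (- y)))\<^sup>2" for y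
    by (simp add: synth_pt_complex[OF D, symmetric])
  show "integrable lborel (\<lambda>y. (synth (D j) (pt y z))\<^sup>2)"
    unfolding eq using lborel_reflect(2)[of "\<lambda>y. (cmod (ft ?h y))\<^sup>2"] plancherel_le(1)[OF b] by simp
  have "continuous_on UNIV ?h" by (intro amp_compose_continuous[OF D] continuous_intros)
  from plancherel[OF b this]
  show "(LINT y|lborel. (synth (D j) (pt y z))\<^sup>2) = (2 * pi)\<^sup>2 * (LINT \<xi>|lborel. (cmod (D j \<xi> z))\<^sup>2)"
    unfolding eq using lborel_reflect(1)[of "\<lambda>y. (cmod (ft ?h y))\<^sup>2"] by simp
qed

lemma synth_DERIV_3:
  assumes D: "amp a b r D" and x: "x $ 3 \<in> {a<..<b}"
  shows "((\<lambda>t. synth (D j) (x + t *\<^sub>R axis 3 1)) has_vector_derivative synth (D (Suc j)) x) (at 0)"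
proof -
  define U where "U = {a - x $ 3<..<b - x $ 3}"
  have U: "open U" "0 \<in> U" "convex U" using x by (auto simp: U_def)
  have "((\<lambda>t. LINT \<xi>|lborel. D j \<xi> (x $ 3 + t) * cis (\<xi> \<bullet> hor x)) has_vector_derivative
     (LINT \<xi>|lborel. D (Suc j) \<xi> (x $ 3 + 0) * cis (\<xi> \<bullet> hor x))) (at 0 within U)"
  proof (rule param_derivative[where r = r, OF _ _ _ _ _ U(3,2)])
    show "((\<lambda>t. D j \<xi> (x $ 3 + t) * cis (\<xi> \<bullet> hor x)) has_vector_derivative D (Suc j) \<xi> (x $ 3 + t) * cis (\<xi> \<bullet> hor x)) (at t within U)"
      if "t \<in> U" for t \<xi>
    proof -
      have "(D j \<xi> has_vector_derivative D (Suc j) \<xi> (x $ 3 + t)) (at (x $ 3 + t))"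
        using that by (intro amp_D_interior[OF D]) (auto simp: U_def)
      then have "(D j \<xi> \<circ> (\<lambda>t. x $ 3 + t) has_vector_derivative 1 *\<^sub>R D (Suc j) \<xi> (x $ 3 + t)) (at t)"
        by (intro vector_diff_chain_at) (auto intro!: derivative_eq_intros simp: has_vector_derivative_def)
      then have "((\<lambda>t. D j \<xi> (x $ 3 + t)) has_vector_derivative D (Suc j) \<xi> (x $ 3 + t)) (at t)"
        by (simp add: o_def)
      from has_vector_derivative_at_within[OF has_vector_derivative_mult_left[OF this]] show ?thesis .
    qed
  qed (auto simp: case_prod_beta ampD(3)[OF D] intro!: continuous_intros amp_compose_continuous[OF D])
  then have "((\<lambda>t. LINT \<xi>|lborel. D j \<xi> (x $ 3 + t) * cis (\<xi> \<bullet> hor x)) has_vector_derivative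
     (LINT \<xi>|lborel. D (Suc j) \<xi> (x $ 3) * cis (\<xi> \<bullet> hor x))) (at 0)"
    using at_within_open[OF U(2,1)] by simp
  from bounded_linear.has_vector_derivative[OF bounded_linear_Re this]
  have "((\<lambda>t. Re (LINT \<xi>|lborel. D j \<xi> (x $ 3 + t) * cis (\<xi> \<bullet> hor x))) has_vector_derivative synth (D (Suc j)) x) (at 0)"
    by (simp add: synth_def)
  moreover have "hor (x + t *\<^sub>R axis 3 1) = hor x" for t
    by (simp add: vec_eq_iff forall_2 axis_def)
  ultimately show ?thesis by (simp add: synth_def)
qed

text \<open>Translates a horizontal index of space into an index of the plane; meaningful for i
  \<noteq> 3 only.\<close>

definition h2 :: "3 \<Rightarrow> 2" where "h2 i = (if i = 1 then 1 else 2)"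

lemma hor_axis: "i \<noteq> 3 \<Longrightarrow> hor (x + t *\<^sub>R axis i 1) = hor x + t *\<^sub>R axis (h2 i) 1"
  using exhaust_3[of i] by (auto simp: vec_eq_iff forall_2 axis_def h2_def)

lemma cis_has_vector_derivative:
  "((\<lambda>t. cis (c + t * d)) has_vector_derivative (\<i> * complex_of_real d) * cis (c + t * d)) (at t within S)"
proof -
  have eq: "(\<lambda>t. cis (c + t * d)) = (\<lambda>t. cis c * exp (t *\<^sub>R (\<i> * complex_of_real d)))"
    by (simp add: fun_eq_iff cis_conv_exp exp_add[symmetric] scaleR_conv_of_real algebra_simps)
  have "((\<lambda>t. cis c * exp (t *\<^sub>R (\<i> * complex_of_real d))) has_vector_derivative
      cis c * (exp (t *\<^sub>R (\<i> * complex_of_real d)) * (\<i> * complex_of_real d))) (at t within S)"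
    by (intro has_vector_derivative_mult_right exp_scaleR_has_vector_derivative_right)
  moreover have "cis c * (exp (t *\<^sub>R (\<i> * complex_of_real d)) * (\<i> * complex_of_real d)) = (\<i> * complex_of_real d) * cis (c + t * d)"
    using fun_cong[OF eq, of t] by (simp only: mult.commute mult.left_commute mult.assoc)
  ultimately show ?thesis unfolding eq by simp
qed

lemma synth_DERIV_h:
  assumes D: "amp a b r D" and i: "i \<noteq> 3"
  shows "((\<lambda>t. synth (D j) (x + t *\<^sub>R axis i 1)) has_vector_derivative
     synth (\<lambda>\<xi> z. (\<i> * complex_of_real (\<xi> $ h2 i)) * D j \<xi> z) x) (at 0)"
proof -
  have "((\<lambda>t. LINT \<xi>|lborel. D j \<xi> (x $ 3) * cis (\<xi> \<bullet> (hor x + t *\<^sub>R axis (h2 i) 1))) has_vector_derivative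
     (LINT \<xi>|lborel. \<i> * complex_of_real (\<xi> $ h2 i) * D j \<xi> (x $ 3) * cis (\<xi> \<bullet> (hor x + 0 *\<^sub>R axis (h2 i) 1)))) (at 0 within UNIV)"
  proof (rule param_derivative[where r = r])
    fix t and \<xi> :: "real^2"
    have "((\<lambda>t. cis (\<xi> \<bullet> (hor x + t *\<^sub>R axis (h2 i) 1))) has_vector_derivative
       (\<i> * complex_of_real (\<xi> $ h2 i)) * cis (\<xi> \<bullet> (hor x + t *\<^sub>R axis (h2 i) 1))) (at t)"
      using cis_has_vector_derivative[of "\<xi> \<bullet> hor x" "\<xi> $ h2 i" t UNIV] by (simp add: inner_add_right inner_axis)
    from has_vector_derivative_mult_right[OF this, of "D j \<xi> (x $ 3)"]
    show "((\<lambda>t. D j \<xi> (x $ 3) * cis (\<xi> \<bullet> (hor x + t *\<^sub>R axis (h2 i) 1))) has_vector_derivative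
       \<i> * complex_of_real (\<xi> $ h2 i) * D j \<xi> (x $ 3) * cis (\<xi> \<bullet> (hor x + t *\<^sub>R axis (h2 i) 1))) (at t)"
      by (simp add: mult.assoc mult.left_commute)
  qed (auto simp: case_prod_beta ampD(3)[OF D] intro!: continuous_intros amp_compose_continuous[OF D])
  from bounded_linear.has_vector_derivative[OF bounded_linear_Re this]
  have *: "((\<lambda>t. Re (LINT \<xi>|lborel. D j \<xi> (x $ 3) * cis (\<xi> \<bullet> (hor x + t *\<^sub>R axis (h2 i) 1)))) has_vector_derivative
     synth (\<lambda>\<xi> z. (\<i> * complex_of_real (\<xi> $ h2 i)) * D j \<xi> z) x) (at 0)"
    by (simp add: synth_def)
  have "axis i 1 $ 3 = (0 :: real)" using i by (simp add: axis_def)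
  then show ?thesis using * by (simp add: synth_def hor_axis[OF i])
qed

text \<open>The amplitude of the partial derivative in the direction \<open>i\<close>.\<close>

definition pamp :: "3 \<Rightarrow> (nat \<Rightarrow> real^2 \<Rightarrow> real \<Rightarrow> complex) \<Rightarrow> nat \<Rightarrow> real^2 \<Rightarrow> real \<Rightarrow> complex" where
  "pamp i D = (if i = 3 then (\<lambda>j. D (Suc j)) else (\<lambda>j \<xi> z. (\<i> * complex_of_real (\<xi> $ h2 i)) * D j \<xi> z))"

text \<open>The factor i \<xi> respects the symmetry in \<open>amp\<close>, since conjugation and
  reflection of \<xi> both change its sign. Amplitudes are thus closed under all partial
  derivatives.\<close>

lemma amp_pamp: assumes "amp a b r D" shows "amp a b r (pamp i D)"
proof (cases "i = 3")
  case True
  then show ?thesis using amp_shift[OF assms] by (simp add: pamp_def)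
next
  case False
  then show ?thesis unfolding pamp_def
    by (simp add: mult.assoc) (rule amp_mult[OF assms, of "\<lambda>\<xi>. \<i> * complex_of_real (\<xi> $ h2 i)", simplified mult.assoc];
      auto intro!: continuous_intros)
qed

lemma synth_DERIV:
  assumes "amp a b r D" "x \<in> slab {a<..<b}"
  shows "((\<lambda>t. synth (D j) (x + t *\<^sub>R axis i 1)) has_vector_derivative synth (pamp i D j) x) (at 0)"
  using synth_DERIV_3[OF assms(1)] synth_DERIV_h[OF assms(1)] assms(2)
  by (cases "i = 3") (auto simp: pamp_def slab_def)

lemma open_slab: "open I \<Longrightarrow> open (slab I)"
proof -
  assume "open I"
  moreover have "slab I = (\<lambda>x. x $ 3) -` I" by (auto simp: slab_def)
  ultimately show "open (slab I)" by (auto intro!: open_vimage continuous_intros)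
qed

lemma amp_bounded:
  assumes D: "amp a b r D"
  obtains M where "M \<ge> 0" "\<And>\<xi> z. z \<in> {a..b} \<Longrightarrow> cmod (D j \<xi> z) \<le> M"
proof -
  have "compact ((\<lambda>p. D j (fst p) (snd p)) ` (cball 0 r \<times> {a..b}))"
    by (intro compact_continuous_image continuous_on_subset[OF ampD(1)[OF D]] compact_Times) auto
  then have "bounded ((\<lambda>p. D j (fst p) (snd p)) ` (cball 0 r \<times> {a..b}))" by (rule compact_imp_bounded)
  then obtain B where B: "\<forall>x\<in>(\<lambda>p. D j (fst p) (snd p)) ` (cball 0 r \<times> {a..b}). cmod x \<le> B"
    unfolding bounded_iff by blast
  have "cmod (D j \<xi> z) \<le> max B 0" if "z \<in> {a..b}" for \<xi> z
  proof (cases "norm \<xi> \<le> r")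
    case True
    then have "D j \<xi> z \<in> (\<lambda>p. D j (fst p) (snd p)) ` (cball 0 r \<times> {a..b})" using that by force
    then have "cmod (D j \<xi> z) \<le> B" using B by blast
    then show ?thesis by simp
  qed (simp add: ampD(3)[OF D])
  then show thesis using that[of "max B 0"] by auto
qed

section \<open>Square integrability and Sobolev regularity of synthesized fields\<close>

definition volc :: "real \<Rightarrow> real" where "volc r = measure lborel (cball (0::real^2) r)"

lemma volc_nonneg: "volc r \<ge> 0" by (simp add: volc_def)

lemma emeasure_volc: "emeasure lborel (cball (0::real^2) r) = ennreal (volc r)"
  unfolding volc_def using emeasure_bounded_finite[of "cball (0::real^2) r"]
  by (subst emeasure_eq_ennreal_measure) (auto simp: infinity_ennreal_def)

lemma integral_sq_le_volc:
  fixes h :: "real^2 \<Rightarrow> complex"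
  assumes h: "bcs h" and M: "M \<ge> 0" "\<And>\<xi>. cmod (h \<xi>) \<le> M" "\<And>\<xi>. norm \<xi> > r \<Longrightarrow> h \<xi> = 0"
  shows "(LINT \<xi>|lborel. (cmod (h \<xi>))\<^sup>2) \<le> M\<^sup>2 * volc r"
proof -
  have "(LINT \<xi>|lborel. (cmod (h \<xi>))\<^sup>2) \<le> (LINT \<xi>|lborel. M\<^sup>2 * indicator (cball (0::real^2) r) \<xi>)"
  proof (rule integral_mono[OF bcs_norm_sq[OF h]])
    show "integrable lborel (\<lambda>\<xi>. M\<^sup>2 * indicator (cball (0::real^2) r) \<xi>)"
      using emeasure_volc by (intro integrable_mult_right integrable_real_indicator) auto
    show "(cmod (h \<xi>))\<^sup>2 \<le> M\<^sup>2 * indicator (cball 0 r) \<xi>" for \<xi>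
      using M(2)[of \<xi>] M(3)[of \<xi>] by (cases "norm \<xi> \<le> r") (auto intro: power_mono)
  qed
  also have "\<dots> = M\<^sup>2 * volc r" by (simp add: volc_def)
  finally show ?thesis .
qed

lemma synth_nn_L2_pt:
  assumes D: "amp a b r D"
  shows "(\<integral>\<^sup>+y. ennreal ((synth (D j) (pt y z))\<^sup>2) \<partial>lborel) = ennreal ((2 * pi)\<^sup>2 * (LINT \<xi>|lborel. (cmod (D j \<xi> z))\<^sup>2))"
  using nn_integral_eq_integral[OF synth_L2_pt(1)[OF D]] synth_L2_pt(2)[OF D] by simp

lemma synth_nn_L2_slab:
  assumes D: "amp a b r D" "a < b"
  shows "(\<integral>\<^sup>+x\<in>slab {a<..<b}. ennreal ((synth (D j) x)\<^sup>2) \<partial>lborel) < \<infinity>"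
proof -
  obtain M where M: "M \<ge> 0" "\<And>\<xi> z. z \<in> {a..b} \<Longrightarrow> cmod (D j \<xi> z) \<le> M" using amp_bounded[OF D(1)] by blast
  note [measurable] = synth_measurable[OF D(1)]
  have [measurable]: "slab {a<..<b} \<in> sets borel" using open_slab[of "{a<..<b}"] by simp
  have "(\<integral>\<^sup>+x\<in>slab {a<..<b}. ennreal ((synth (D j) x)\<^sup>2) \<partial>lborel) =
     (\<integral>\<^sup>+z. \<integral>\<^sup>+y. ennreal ((synth (D j) (pt y z))\<^sup>2) * indicator (slab {a<..<b}) (pt y z) \<partial>lborel \<partial>lborel)"
    by (rule nn_integral_pt) simp
  also have "\<dots> = (\<integral>\<^sup>+z. (\<integral>\<^sup>+y. ennreal ((synth (D j) (pt y z))\<^sup>2) \<partial>lborel) * indicator {a<..<b} z \<partial>lborel)"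
    by (intro nn_integral_cong) (auto simp: indicator_def slab_def)
  also have "\<dots> \<le> (\<integral>\<^sup>+z. ennreal ((2 * pi)\<^sup>2 * (M\<^sup>2 * volc r)) * indicator {a<..<b} z \<partial>lborel)"
  proof (rule nn_integral_mono)
    fix z :: real
    show "(\<integral>\<^sup>+y. ennreal ((synth (D j) (pt y z))\<^sup>2) \<partial>lborel) * indicator {a<..<b} z \<le>
       ennreal ((2 * pi)\<^sup>2 * (M\<^sup>2 * volc r)) * indicator {a<..<b} z"
    proof (cases "z \<in> {a<..<b}")
      case True
      then have "(LINT \<xi>|lborel. (cmod (D j \<xi> z))\<^sup>2) \<le> M\<^sup>2 * volc r"
        by (intro integral_sq_le_volc[OF amp_bcs[OF D(1)] M(1)] M(2) ampD(3)[OF D(1)]) auto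
      then show ?thesis
        using True unfolding synth_nn_L2_pt[OF D(1)] by (simp add: ennreal_leI mult_left_mono)
    qed simp
  qed
  also have "\<dots> < \<infinity>" using D(2) by (simp add: nn_integral_cmult_indicator ennreal_mult_less_top)
  finally show ?thesis .
qed

text \<open>Polymorphic in the value space, so that vector fields and scalars share their lemmas.
  Each component uses only member 0 of its sequence; the other members are its vertical
  derivatives.\<close>

definition fld :: "('b::euclidean_space \<Rightarrow> nat \<Rightarrow> real^2 \<Rightarrow> real \<Rightarrow> complex) \<Rightarrow> real^3 \<Rightarrow> 'b" where
  "fld D x = (\<Sum>c\<in>Basis. synth (D c 0) x *\<^sub>R c)"

lemma fld_inner: "b \<in> Basis \<Longrightarrow> fld D x \<bullet> b = synth (D b 0) x"
  by (simp add: fld_def inner_sum_left inner_Basis if_distrib[of "\<lambda>t. _ * t"] cong: if_cong)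

lemma fld_continuous:
  assumes "\<And>c. c \<in> Basis \<Longrightarrow> amp a b r (D c)"
  shows "continuous_on UNIV (fld D)"
  unfolding fld_def using assms by (auto intro!: continuous_intros synth_continuous)

lemma fld_L2_on:
  assumes D: "\<And>c. c \<in> Basis \<Longrightarrow> amp a b r (D c)" and ab: "a < b"
  shows "L2_on (slab {a<..<b}) (fld D)"
  unfolding L2_on_def
proof
  have os: "slab {a<..<b} \<in> sets borel" using open_slab[of "{a<..<b}"] by simp
  have "(\<lambda>x. indicator (slab {a<..<b}) x *\<^sub>R fld D x) \<in> borel_measurable borel"
    using os borel_measurable_continuous_onI[OF fld_continuous[OF D]] by (intro borel_measurable_scaleR) auto
  then show "set_borel_measurable lebesgue (slab {a<..<b}) (fld D)"
    unfolding set_borel_measurable_def by (intro measurable_completion) simp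
  have n: "(norm (fld D x))\<^sup>2 = (\<Sum>c\<in>Basis. (synth (D c 0) x)\<^sup>2)" for x
    unfolding power2_norm_eq_inner
    by (subst euclidean_inner) (auto simp: fld_inner power2_eq_square intro!: sum.cong)
  have m: "(\<lambda>x. ennreal ((synth (D c 0) x)\<^sup>2) * indicator (slab {a<..<b}) x) \<in> borel_measurable lborel" if "c \<in> Basis" for c
    using synth_measurable[OF D[OF that]] os by measurable
  have "(\<integral>\<^sup>+x\<in>slab {a<..<b}. ennreal ((norm (fld D x))\<^sup>2) \<partial>lebesgue) =
     (\<Sum>c\<in>Basis. \<integral>\<^sup>+x\<in>slab {a<..<b}. ennreal ((synth (D c 0) x)\<^sup>2) \<partial>lborel)"
  proof -
    have "(\<integral>\<^sup>+x\<in>slab {a<..<b}. ennreal ((norm (fld D x))\<^sup>2) \<partial>lebesgue) =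
       (\<integral>\<^sup>+x. (\<Sum>c\<in>Basis. ennreal ((synth (D c 0) x)\<^sup>2) * indicator (slab {a<..<b}) x) \<partial>lborel)"
      unfolding nn_integral_completion n
      by (intro nn_integral_cong) (simp add: sum_ennreal[symmetric] sum_distrib_right del: sum_ennreal)
    also have "\<dots> = (\<Sum>c\<in>Basis. \<integral>\<^sup>+x\<in>slab {a<..<b}. ennreal ((synth (D c 0) x)\<^sup>2) \<partial>lborel)"
      by (rule nn_integral_sum) (rule m)
    finally show ?thesis .
  qed
  also have "\<dots> < \<infinity>"
    using synth_nn_L2_slab[OF D ab] by (simp add: less_top)
  finally show "(\<integral>\<^sup>+x\<in>slab {a<..<b}. ennreal ((norm (fld D x))\<^sup>2) \<partial>lebesgue) < \<infinity>" .
qed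

lemma fld_weak_partial:
  assumes D: "\<And>c. c \<in> Basis \<Longrightarrow> amp a b r (D c)"
  shows "weak_partial (slab {a<..<b}) (axis i 1) (fld D) (fld (\<lambda>c. pamp i (D c)))"
proof (rule weak_partial_classical)
  show "open (slab {a<..<b})" by (intro open_slab) simp
  show "continuous_on (slab {a<..<b}) (fld D)" "continuous_on (slab {a<..<b}) (fld (\<lambda>c. pamp i (D c)))"
    by (rule continuous_on_subset[OF fld_continuous]; use D amp_pamp in blast)+
  show "axis i 1 \<in> (Basis :: (real^3) set)" by (simp add: Basis_cart)
  show "((\<lambda>t. fld D (x + t *\<^sub>R axis i 1)) has_vector_derivative fld (\<lambda>c. pamp i (D c)) x) (at 0)"
    if "x \<in> slab {a<..<b}" for x
    unfolding fld_def
  proof (rule has_vector_derivative_sum)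
    fix c :: 'a assume c: "c \<in> Basis"
    show "((\<lambda>t. synth (D c 0) (x + t *\<^sub>R axis i 1) *\<^sub>R c) has_vector_derivative synth (pamp i (D c) 0) x *\<^sub>R c) (at 0)"
      using bounded_linear.has_vector_derivative[OF bounded_linear_scaleR_left synth_DERIV[OF D[OF c] that]] .
  qed
qed

text \<open>A weak derivative of such a field is again such a field, so the induction with arbitrary
  amplitudes yields every Sobolev order.\<close>

lemma fld_sobolev:
  assumes "\<And>c. c \<in> Basis \<Longrightarrow> amp a b r (D c)" and "a < b"
  shows "sobolev_on k (slab {a<..<b}) (fld D)"
  using assms(1)
proof (induction k arbitrary: D)
  case 0
  then show ?case using fld_L2_on[OF 0 assms(2)] by simp
next
  case (Suc k)
  have "\<exists>w. weak_partial (slab {a<..<b}) b' (fld D) w \<and> sobolev_on k (slab {a<..<b}) w" if "b' \<in> Basis" for b'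
  proof -
    obtain i where "b' = axis i 1" using \<open>b' \<in> Basis\<close> by (auto simp: Basis_cart)
    moreover have "sobolev_on k (slab {a<..<b}) (fld (\<lambda>c. pamp i (D c)))"
      by (rule Suc.IH) (use Suc.prems amp_pamp in blast)
    ultimately show ?thesis using fld_weak_partial[where D = D, OF Suc.prems] by blast
  qed
  then show ?case using fld_L2_on[OF Suc.prems assms(2)] by simp
qed

lemma L2_on_cong:
  assumes "\<And>x. x \<in> S \<Longrightarrow> f x = g x" shows "L2_on S f \<longleftrightarrow> L2_on S g"
proof -
  have 1: "(\<lambda>x. indicator S x *\<^sub>R f x) = (\<lambda>x. indicator S x *\<^sub>R g x)"
  proof
    show "indicator S x *\<^sub>R f x = indicator S x *\<^sub>R g x" for x
      using assms[of x] by (cases "x \<in> S") auto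
  qed
  have 2: "(\<integral>\<^sup>+x\<in>S. ennreal ((norm (f x))\<^sup>2) \<partial>lebesgue) = (\<integral>\<^sup>+x\<in>S. ennreal ((norm (g x))\<^sup>2) \<partial>lebesgue)"
    using assms by (intro nn_integral_cong) (auto simp: indicator_def)
  show ?thesis unfolding L2_on_def set_borel_measurable_def 1 2 ..
qed

lemma sobolev_on_cong:
  fixes f g :: "'a::euclidean_space \<Rightarrow> 'b::euclidean_space"
  assumes "\<And>x. x \<in> S \<Longrightarrow> f x = g x" "sobolev_on k S f" shows "sobolev_on k S g"
proof (cases k)
  case 0
  then show ?thesis using assms L2_on_cong[of S f g] by simp
next
  case (Suc n)
  have "weak_partial S b g w" if "weak_partial S b f w" "b \<in> Basis" for b w
    by (rule weak_partial_cong_AE[OF _ _ that(2,1)]) (use assms(1) in auto)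
  then show ?thesis using assms Suc L2_on_cong[of S f g] by (auto) blast
qed

section \<open>The horizontal Fourier transform of a synthesized field\<close>

lemma AE_pairD:
  fixes P :: "'a::euclidean_space \<Rightarrow> 'b::euclidean_space \<Rightarrow> bool"
  assumes "AE p in lebesgue. P (fst p) (snd p)"
  shows "AE x in lebesgue. AE y in lebesgue. P x y"
proof -
  have "AE p in lborel \<Otimes>\<^sub>M lborel. P (fst p) (snd p)"
    using assms unfolding AE_completion_iff lborel_prod .
  from lborel_pair.AE_pair[OF this] show ?thesis
    unfolding AE_completion_iff by simp
qed

text \<open>At a fixed height the truncated horizontal transform is the transform of a truncated
  inverse transform, which is the situation of \<open>ft_inversion_L2\<close>.\<close>

lemma hfourier_trunc_ft:
  assumes D: "amp a b r D" and f: "\<And>y. f (pt y z) = synth (D j) (pt y z)"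
  shows "hfourier_trunc R f \<xi> z = ft (\<lambda>y. if norm y \<le> R then ft (\<lambda>\<xi>. D j \<xi> z) (- y) else 0) \<xi>"
proof -
  let ?g = "\<lambda>y. if norm y \<le> R then ft (\<lambda>\<xi>. D j \<xi> z) (- y) else 0"
  have m: "(\<lambda>y. ?g y * cis (- (y \<bullet> \<xi>))) \<in> borel_measurable lborel"
    using bcs_cis(2)[OF bcs_ft_bounded[OF amp_bcs[OF D, of j z], of R], of \<xi>] by (simp add: bcs_def)
  have "indicator (cball 0 R) y *\<^sub>R (complex_of_real (f (pt y z)) * cis (- (y \<bullet> \<xi>))) = ?g y * cis (- (y \<bullet> \<xi>))" for y
    by (simp add: indicator_def f synth_pt_complex[OF D])
  then have "hfourier_trunc R f \<xi> z = (LINT y|lebesgue. ?g y * cis (- (y \<bullet> \<xi>)))"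
    unfolding hfourier_trunc_def set_lebesgue_integral_def by simp
  then show ?thesis unfolding ft_def[of ?g] by (subst (asm) integral_completion[OF m])
qed

text \<open>Joint measurability in (\<xi>, z), required for Tonelli's theorem in the convergence
  proof and for splitting the error integrals in the uniqueness proof.\<close>

lemma hfourier_trunc_measurable:
  assumes D: "amp a b r D" and f: "\<And>x. x \<in> slab {a<..<b} \<Longrightarrow> f x = synth (D j) x"
  shows "(\<lambda>p. indicator {a<..<b} (snd p) *\<^sub>R hfourier_trunc R f (fst p) (snd p)) \<in> borel_measurable lborel"
proof -
  note [measurable] = synth_measurable[OF D]
  have [measurable]: "(\<lambda>p. pt (fst p) (snd p)) \<in> borel \<Otimes>\<^sub>M borel \<rightarrow>\<^sub>M borel"
    using pt_measurable by (simp add: borel_prod)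
  have m3: "(\<lambda>p. pt (snd p) (snd (fst p))) \<in> (borel \<Otimes>\<^sub>M borel) \<Otimes>\<^sub>M borel \<rightarrow>\<^sub>M borel"
    using measurable_compose[of "\<lambda>p. (snd p, snd (fst p))" "(borel \<Otimes>\<^sub>M borel) \<Otimes>\<^sub>M borel" "borel \<Otimes>\<^sub>M borel" "\<lambda>p. pt (fst p) (snd p)" borel]
    by simp
  have eq: "indicator {a<..<b} (snd p) *\<^sub>R hfourier_trunc R f (fst p) (snd p) =
     indicator {a<..<b} (snd p) *\<^sub>R (LINT y|lborel. (if norm y \<le> R then complex_of_real (synth (D j) (pt y (snd p))) else 0) * cis (- (y \<bullet> fst p)))" for p
  proof (cases "snd p \<in> {a<..<b}")
    case True
    then have "\<And>y. f (pt y (snd p)) = synth (D j) (pt y (snd p))" by (intro f) (simp add: slab_def)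
    from hfourier_trunc_ft[OF D this, of R "fst p"] show ?thesis
      by (simp add: ft_def[of "\<lambda>y. if norm y \<le> R then _ y else 0"] synth_pt_complex[OF D] if_distrib cong: if_cong)
  qed simp
  have "(\<lambda>p. indicator {a<..<b} (snd p) *\<^sub>R (LINT y|lborel. (if norm y \<le> R then complex_of_real (synth (D j) (pt y (snd p))) else 0) * cis (- (y \<bullet> fst p))))
     \<in> borel_measurable (borel \<Otimes>\<^sub>M borel)"
  proof (intro borel_measurable_scaleR sigma_finite_measure.borel_measurable_lebesgue_integral sigma_finite_lborel)
    show "(\<lambda>(p, y). (if norm y \<le> R then complex_of_real (synth (D j) (pt y (snd p))) else 0) * cis (- (y \<bullet> fst p))) \<in> borel_measurable ((borel \<Otimes>\<^sub>M borel) \<Otimes>\<^sub>M lborel)"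
    proof -
      have [measurable]: "(\<lambda>p. synth (D j) (pt (snd p) (snd (fst p)))) \<in> borel_measurable ((borel \<Otimes>\<^sub>M borel) \<Otimes>\<^sub>M lborel)"
        using measurable_compose[OF m3 synth_measurable[OF D]]
        by (subst measurable_cong_sets[OF sets_pair_measure_cong[OF refl sets_lborel] refl])
      show ?thesis unfolding case_prod_beta' by measurable
    qed
  qed measurable
  then show ?thesis unfolding eq by (simp add: borel_prod)
qed

text \<open>At each height the inversion estimate bounds the error by a multiple of the energy of
  the field outside the disc of radius R. Integrated over the height, this is the tail of a
  convergent integral.\<close>

lemma is_hfourier_synth:
  fixes D :: "nat \<Rightarrow> real^2 \<Rightarrow> real \<Rightarrow> complex"
  assumes D: "amp a b r D" "a < b" and f: "\<And>x. x \<in> slab {a<..<b} \<Longrightarrow> f x = synth (D j) x"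
  shows "is_hfourier {a<..<b} f (\<lambda>\<xi> z. (2 * pi)\<^sup>2 * D j \<xi> z)"
proof -
  let ?I = "{a<..<b}" and ?c = "(2 * pi)\<^sup>2"
  let ?F = "\<lambda>\<xi> z. complex_of_real ?c * D j \<xi> z"
  obtain M where M: "M \<ge> 0" "\<And>\<xi> z. z \<in> {a..b} \<Longrightarrow> cmod (D j \<xi> z) \<le> M" using amp_bounded[OF D(1)] by blast
  note [measurable] = synth_measurable[OF D(1)]
  have os[measurable]: "slab ?I \<in> sets borel" using open_slab[of ?I] by simp
  have Fm: "(\<lambda>p. ?F (fst p) (snd p)) \<in> borel_measurable borel"
    by (intro borel_measurable_continuous_onI continuous_intros ampD(1)[OF D(1)])
  have IU: "UNIV \<times> ?I \<in> sets borel" by (intro borel_open open_Times) auto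
  have "L2_on (UNIV \<times> ?I) (\<lambda>(\<xi>, z). ?F \<xi> z)"
    unfolding L2_on_def
  proof
    have "(\<lambda>p. indicator (UNIV \<times> ?I) p *\<^sub>R ?F (fst p) (snd p)) \<in> borel_measurable lborel"
      using Fm borel_measurable_indicator[OF IU] by (intro borel_measurable_scaleR) simp_all
    then show "set_borel_measurable lebesgue (UNIV \<times> ?I) (\<lambda>(\<xi>, z). ?F \<xi> z)"
      unfolding set_borel_measurable_def by (intro measurable_completion) (simp add: case_prod_beta')
    have "(\<integral>\<^sup>+x\<in>UNIV \<times> ?I. ennreal ((cmod (case x of (\<xi>, z) \<Rightarrow> ?F \<xi> z))\<^sup>2) \<partial>lebesgue)
       \<le> (\<integral>\<^sup>+x. ennreal ((?c * M)\<^sup>2) * indicator (cball (0::real^2) r \<times> ?I) x \<partial>lborel)"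
      unfolding nn_integral_completion
    proof (rule nn_integral_mono)
      fix x :: "(real^2) \<times> real"
      obtain \<xi> z where x: "x = (\<xi>, z)" by fastforce
      have "z \<in> ?I \<Longrightarrow> cmod (?F \<xi> z) \<le> ?c * M" using M(2)[of z \<xi>] by (simp add: norm_mult norm_power mult_left_mono)
      then show "ennreal ((cmod (case x of (\<xi>, z) \<Rightarrow> ?F \<xi> z))\<^sup>2) * indicator (UNIV \<times> ?I) x \<le> ennreal ((?c * M)\<^sup>2) * indicator (cball 0 r \<times> ?I) x"
        using ampD(3)[OF D(1), of \<xi> j z] unfolding x
        by (cases "norm \<xi> \<le> r") (auto simp: indicator_def simp del: of_real_power of_real_mult intro!: ennreal_leI power_mono)
    qed
    also have "\<dots> = ennreal ((?c * M)\<^sup>2) * emeasure (lborel \<Otimes>\<^sub>M lborel) (cball (0::real^2) r \<times> ?I)"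
      using borel_closed[of "cball (0::real^2) r"] by (subst nn_integral_cmult_indicator) (auto simp: lborel_prod[symmetric])
    also have "\<dots> < \<infinity>"
      using D(2) by (subst lborel.emeasure_pair_measure_Times) (auto simp: emeasure_volc ennreal_mult_less_top)
    finally show "(\<integral>\<^sup>+x\<in>UNIV \<times> ?I. ennreal ((cmod (case x of (\<xi>, z) \<Rightarrow> ?F \<xi> z))\<^sup>2) \<partial>lebesgue) < \<infinity>" .
  qed
  moreover have "((\<lambda>R. \<integral>\<^sup>+p\<in>UNIV \<times> ?I.
         ennreal ((cmod (?F (fst p) (snd p) - hfourier_trunc R f (fst p) (snd p)))\<^sup>2) \<partial>lebesgue) \<longlongrightarrow> 0) at_top"
  proof (rule tendsto_sandwich[OF _ _ tendsto_const])
    let ?t = "\<lambda>R x. ennreal (?c * (synth (D j) x)\<^sup>2) * indicator (slab ?I) x * indicator {x. R < norm (hor x)} x"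
    show "\<forall>\<^sub>F R in at_top. (\<integral>\<^sup>+p\<in>UNIV \<times> ?I. ennreal ((cmod (?F (fst p) (snd p) - hfourier_trunc R f (fst p) (snd p)))\<^sup>2) \<partial>lebesgue)
       \<le> (\<integral>\<^sup>+x. ?t R x \<partial>lborel)"
    proof (intro always_eventually allI)
      fix R
      have fm: "(\<lambda>(\<xi>, z). ennreal ((cmod (?F \<xi> z - hfourier_trunc R f \<xi> z))\<^sup>2) * indicator ?I z) \<in> borel_measurable (lborel \<Otimes>\<^sub>M lborel)"
      proof -
        have "(\<lambda>p. ennreal ((cmod (indicator ?I (snd p) *\<^sub>R ?F (fst p) (snd p) - indicator ?I (snd p) *\<^sub>R hfourier_trunc R f (fst p) (snd p)))\<^sup>2)) \<in> borel_measurable (lborel \<Otimes>\<^sub>M lborel)"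
        proof -
          have "(\<lambda>p. indicator (UNIV \<times> ?I) p *\<^sub>R ?F (fst p) (snd p)) \<in> borel_measurable lborel"
            using Fm borel_measurable_indicator[OF IU] by (intro borel_measurable_scaleR) simp_all
          then have [measurable]: "(\<lambda>p. indicator ?I (snd p) *\<^sub>R ?F (fst p) (snd p)) \<in> borel_measurable lborel"
            by (simp add: indicator_def mem_Times_iff)
          note [measurable] = hfourier_trunc_measurable[OF D(1) f, of R]
          show ?thesis unfolding lborel_prod by measurable
        qed
        moreover have "(\<lambda>p. ennreal ((cmod (indicator ?I (snd p) *\<^sub>R ?F (fst p) (snd p) - indicator ?I (snd p) *\<^sub>R hfourier_trunc R f (fst p) (snd p)))\<^sup>2))
          = (\<lambda>(\<xi>, z). ennreal ((cmod (?F \<xi> z - hfourier_trunc R f \<xi> z))\<^sup>2) * indicator ?I z)"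
          by (rule ext) (simp add: indicator_def case_prod_beta)
        ultimately show ?thesis by (simp only:)
      qed
      have "(\<integral>\<^sup>+p\<in>UNIV \<times> ?I. ennreal ((cmod (?F (fst p) (snd p) - hfourier_trunc R f (fst p) (snd p)))\<^sup>2) \<partial>lebesgue)
        = (\<integral>\<^sup>+p. (case p of (\<xi>, z) \<Rightarrow> ennreal ((cmod (?F \<xi> z - hfourier_trunc R f \<xi> z))\<^sup>2) * indicator ?I z) \<partial>(lborel \<Otimes>\<^sub>M lborel))"
        unfolding nn_integral_completion lborel_prod
        by (intro nn_integral_cong) (auto simp: indicator_def case_prod_beta mem_Times_iff)
      also have "\<dots> = (\<integral>\<^sup>+z. \<integral>\<^sup>+\<xi>. ennreal ((cmod (?F \<xi> z - hfourier_trunc R f \<xi> z))\<^sup>2) * indicator ?I z \<partial>lborel \<partial>lborel)"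
        using lborel_pair.nn_integral_snd[OF fm] by simp
      also have "\<dots> \<le> (\<integral>\<^sup>+z. \<integral>\<^sup>+y. ?t R (pt y z) \<partial>lborel \<partial>lborel)"
      proof (rule nn_integral_mono)
        fix z :: real
        show "(\<integral>\<^sup>+\<xi>. ennreal ((cmod (?F \<xi> z - hfourier_trunc R f \<xi> z))\<^sup>2) * indicator ?I z \<partial>lborel) \<le> (\<integral>\<^sup>+y. ?t R (pt y z) \<partial>lborel)"
        proof (cases "z \<in> ?I")
          case True
          let ?h = "\<lambda>\<xi>. D j \<xi> z" and ?s = "\<lambda>y. synth (D j) (pt y z)"
          let ?fR = "\<lambda>y. if norm y \<le> R then ft ?h (- y) else 0"
          have [measurable]: "(\<lambda>y. pt y z) \<in> borel_measurable borel"
            by (intro borel_measurable_continuous_onI continuous_intros)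
          have hb: "bcs ?h" by (rule amp_bcs[OF D(1)])
          have "\<And>y. f (pt y z) = synth (D j) (pt y z)" using True by (intro f) (simp add: slab_def)
          from hfourier_trunc_ft[OF D(1) this] have T: "hfourier_trunc R f \<xi> z = ft ?fR \<xi>" for \<xi> .
          note inv = ft_inversion_L2[OF hb, of R]
          have sI: "integrable lborel (\<lambda>y. (?s y)\<^sup>2)" "integrable lborel (\<lambda>y. (?s y)\<^sup>2 * indicator {y. norm y \<le> R} y)"
            "integrable lborel (\<lambda>y. (?s y)\<^sup>2 * indicator {y. R < norm y} y)"
            using synth_L2_pt(1)[OF D(1)]
            by (auto intro!: integrable_real_mult_indicator)
          have fRs: "(cmod (?fR y))\<^sup>2 = (?s y)\<^sup>2 * indicator {y. norm y \<le> R} y" for y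
            by (simp add: indicator_def synth_pt_complex[OF D(1), symmetric])
          have "(\<integral>\<^sup>+\<xi>. ennreal ((cmod (?F \<xi> z - hfourier_trunc R f \<xi> z))\<^sup>2) * indicator ?I z \<partial>lborel)
             = (\<integral>\<^sup>+\<xi>. ennreal ((cmod (?F \<xi> z - ft ?fR \<xi>))\<^sup>2) \<partial>lborel)" using True by (simp add: T)
          also have "\<dots> = ennreal (LINT \<xi>|lborel. (cmod (?F \<xi> z - ft ?fR \<xi>))\<^sup>2)"
            using inv(1) by (intro nn_integral_eq_integral) auto
          also have "\<dots> \<le> ennreal (?c\<^sup>2 * (LINT \<xi>|lborel. (cmod (?h \<xi>))\<^sup>2) - ?c * (LINT y|lborel. (cmod (?fR y))\<^sup>2))"
            using inv(2) by (intro ennreal_leI) auto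
          \<comment> \<open>Plancherel at this height replaces the norm of the amplitude by the norm
            of the slice of the field.\<close>
          also have "?c\<^sup>2 * (LINT \<xi>|lborel. (cmod (?h \<xi>))\<^sup>2) - ?c * (LINT y|lborel. (cmod (?fR y))\<^sup>2)
             = ?c * ((LINT y|lborel. (?s y)\<^sup>2) - (LINT y|lborel. (?s y)\<^sup>2 * indicator {y. norm y \<le> R} y))"
            unfolding fRs synth_L2_pt(2)[OF D(1)] by (simp add: power2_eq_square algebra_simps)
          also have "(LINT y|lborel. (?s y)\<^sup>2) - (LINT y|lborel. (?s y)\<^sup>2 * indicator {y. norm y \<le> R} y) =
             (LINT y|lborel. (?s y)\<^sup>2 * indicator {y. R < norm y} y)"
            by (subst Bochner_Integration.integral_diff[symmetric, OF sI(1,2)])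
              (auto intro!: Bochner_Integration.integral_cong simp: indicator_def)
          also have "ennreal (?c * \<dots>) = ennreal (LINT y|lborel. ?c * ((?s y)\<^sup>2 * indicator {y. R < norm y} y))" by simp
          also have "\<dots> = (\<integral>\<^sup>+y. ennreal (?c * ((?s y)\<^sup>2 * indicator {y. R < norm y} y)) \<partial>lborel)"
            using sI(3) by (intro nn_integral_eq_integral[symmetric]) auto
          also have "\<dots> = (\<integral>\<^sup>+y. ?t R (pt y z) \<partial>lborel)"
            using True by (intro nn_integral_cong) (auto simp: indicator_def slab_def)
          finally show ?thesis .
        qed simp
      qed
      also have "\<dots> = (\<integral>\<^sup>+x. ?t R x \<partial>lborel)"
        by (rule nn_integral_pt[symmetric]) measurable
      finally show "(\<integral>\<^sup>+p\<in>UNIV \<times> ?I. ennreal ((cmod (?F (fst p) (snd p) - hfourier_trunc R f (fst p) (snd p)))\<^sup>2) \<partial>lebesgue)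
       \<le> (\<integral>\<^sup>+x. ?t R x \<partial>lborel)" .
    qed
    show "((\<lambda>R. \<integral>\<^sup>+x. ?t R x \<partial>lborel) \<longlongrightarrow> 0) at_top"
    proof (rule tendsto_at_topI_sequentially)
      fix X :: "nat \<Rightarrow> real" assume X: "filterlim X at_top sequentially"
      have "(\<lambda>n. \<integral>\<^sup>+x. ?t (X n) x \<partial>lborel) \<longlonglongrightarrow> (\<integral>\<^sup>+x. 0 \<partial>(lborel :: (real^3) measure))"
      proof (rule nn_integral_dominated_convergence[where w = "\<lambda>x. ennreal (?c * (synth (D j) x)\<^sup>2) * indicator (slab ?I) x"])
        show "AE x in lborel. (\<lambda>n. ?t (X n) x) \<longlonglongrightarrow> 0"
        proof (intro AE_I2 tendsto_eventually)
          fix x :: "real^3"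
          show "\<forall>\<^sub>F n in sequentially. ?t (X n) x = 0"
            using X[unfolded filterlim_at_top, rule_format, of "norm (hor x)"] by eventually_elim simp
        qed
        have "(\<integral>\<^sup>+x. ennreal (?c * (synth (D j) x)\<^sup>2) * indicator (slab ?I) x \<partial>lborel) =
           ennreal ?c * (\<integral>\<^sup>+x\<in>slab ?I. ennreal ((synth (D j) x)\<^sup>2) \<partial>lborel)"
          by (subst nn_integral_cmult[symmetric]) (auto simp: ennreal_mult mult.assoc)
        then show "(\<integral>\<^sup>+x. ennreal (?c * (synth (D j) x)\<^sup>2) * indicator (slab ?I) x \<partial>lborel) < \<infinity>"
          using synth_nn_L2_slab[OF D, of j] by (simp add: ennreal_mult_less_top)
      qed (auto simp: indicator_def)
      then show "(\<lambda>n. \<integral>\<^sup>+x. ?t (X n) x \<partial>lborel) \<longlonglongrightarrow> 0" by simp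
    qed
  qed simp
  ultimately show ?thesis unfolding is_hfourier_def by simp
qed

lemma norm_diff_sq_le:
  fixes x y t :: "'a::real_normed_vector"
  shows "(norm (x - y))\<^sup>2 \<le> 2 * (norm (x - t))\<^sup>2 + 2 * (norm (y - t))\<^sup>2"
proof -
  have "norm (x - y) \<le> norm (x - t) + norm (y - t)"
    using norm_triangle_ineq4[of "x - t" "y - t"] by simp
  then have "(norm (x - y))\<^sup>2 \<le> (norm (x - t) + norm (y - t))\<^sup>2" by (intro power_mono) auto
  also have "\<dots> \<le> 2 * (norm (x - t))\<^sup>2 + 2 * (norm (y - t))\<^sup>2"
    using sum_squares_bound[of "norm (x - t)" "norm (y - t)"] by (simp add: power2_sum)
  finally show ?thesis .
qed

text \<open>Two L2 limits of one family coincide: their distance is bounded by the two errors for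
  every R.\<close>

lemma is_hfourier_unique:
  assumes F: "is_hfourier I f F" "is_hfourier I f F'" and I: "I \<in> sets borel"
    and T: "\<And>R. (\<lambda>p. indicator I (snd p) *\<^sub>R hfourier_trunc R f (fst p) (snd p)) \<in> borel_measurable lborel"
  shows "AE p in lebesgue. snd p \<in> I \<longrightarrow> F (fst p) (snd p) = F' (fst p) (snd p)"
proof -
  let ?e = "\<lambda>F R. \<integral>\<^sup>+p\<in>UNIV \<times> I. ennreal ((cmod (F (fst p) (snd p) - hfourier_trunc R f (fst p) (snd p)))\<^sup>2) \<partial>lebesgue"
  have UI: "indicator (UNIV \<times> I) p = (indicator I (snd p) :: 'c::zero_neq_one)" for p :: "(real^2) \<times> real"
    by (simp add: indicator_def mem_Times_iff)
  have mF: "(\<lambda>p. indicator I (snd p) *\<^sub>R F (fst p) (snd p)) \<in> borel_measurable lebesgue" if "is_hfourier I f F" for F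
    using that unfolding is_hfourier_def L2_on_def set_borel_measurable_def UI by (simp add: case_prod_beta')
  have mT: "(\<lambda>p. indicator I (snd p) *\<^sub>R hfourier_trunc R f (fst p) (snd p)) \<in> borel_measurable lebesgue" for R
    using measurable_completion[OF T] .
  have sq: "ennreal ((cmod (x - y))\<^sup>2) * indicator I z = ennreal ((cmod (indicator I z *\<^sub>R x - indicator I z *\<^sub>R y))\<^sup>2)" for x y and z :: real
    by (simp add: indicator_def)
  have le: "(\<integral>\<^sup>+p\<in>UNIV \<times> I. ennreal ((cmod (F (fst p) (snd p) - F' (fst p) (snd p)))\<^sup>2) \<partial>lebesgue)
      \<le> 2 * ?e F R + 2 * ?e F' R" for R
  proof -
    have "(\<integral>\<^sup>+p\<in>UNIV \<times> I. ennreal ((cmod (F (fst p) (snd p) - F' (fst p) (snd p)))\<^sup>2) \<partial>lebesgue)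
      \<le> (\<integral>\<^sup>+p. 2 * (ennreal ((cmod (F (fst p) (snd p) - hfourier_trunc R f (fst p) (snd p)))\<^sup>2) * indicator (UNIV \<times> I) p)
          + 2 * (ennreal ((cmod (F' (fst p) (snd p) - hfourier_trunc R f (fst p) (snd p)))\<^sup>2) * indicator (UNIV \<times> I) p) \<partial>lebesgue)"
    proof (rule nn_integral_mono)
      fix p :: "(real^2) \<times> real"
      have "ennreal ((cmod (F (fst p) (snd p) - F' (fst p) (snd p)))\<^sup>2) \<le>
        ennreal (2 * (cmod (F (fst p) (snd p) - hfourier_trunc R f (fst p) (snd p)))\<^sup>2 + 2 * (cmod (F' (fst p) (snd p) - hfourier_trunc R f (fst p) (snd p)))\<^sup>2)"
        by (intro ennreal_leI norm_diff_sq_le)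
      then show "ennreal ((cmod (F (fst p) (snd p) - F' (fst p) (snd p)))\<^sup>2) * indicator (UNIV \<times> I) p \<le>
        2 * (ennreal ((cmod (F (fst p) (snd p) - hfourier_trunc R f (fst p) (snd p)))\<^sup>2) * indicator (UNIV \<times> I) p)
          + 2 * (ennreal ((cmod (F' (fst p) (snd p) - hfourier_trunc R f (fst p) (snd p)))\<^sup>2) * indicator (UNIV \<times> I) p)"
        by (simp add: indicator_def ennreal_plus ennreal_mult)
    qed
    also have "\<dots> = 2 * ?e F R + 2 * ?e F' R"
      unfolding UI sq using mF[OF F(1)] mF[OF F(2)] mT[of R]
      by (subst nn_integral_add) (auto simp: nn_integral_cmult)
    finally show ?thesis .
  qed
  have "((\<lambda>R. 2 * ?e F R + 2 * ?e F' R) \<longlongrightarrow> 2 * 0 + 2 * 0) at_top"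
    using F unfolding is_hfourier_def by (intro tendsto_add ennreal_tendsto_cmult) auto
  then have "(\<integral>\<^sup>+p\<in>UNIV \<times> I. ennreal ((cmod (F (fst p) (snd p) - F' (fst p) (snd p)))\<^sup>2) \<partial>lebesgue) \<le> 2 * 0 + 2 * 0"
    by (rule tendsto_lowerbound) (use le in auto)
  then have "(\<integral>\<^sup>+p. ennreal ((cmod (indicator I (snd p) *\<^sub>R F (fst p) (snd p) - indicator I (snd p) *\<^sub>R F' (fst p) (snd p)))\<^sup>2) \<partial>lebesgue) = 0"
    unfolding UI sq by simp
  then have "AE p in lebesgue. ennreal ((cmod (indicator I (snd p) *\<^sub>R F (fst p) (snd p) - indicator I (snd p) *\<^sub>R F' (fst p) (snd p)))\<^sup>2) = 0"
    using mF[OF F(1)] mF[OF F(2)] by (subst (asm) nn_integral_0_iff_AE) auto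
  then show ?thesis by eventually_elim (auto simp: indicator_def)
qed

text \<open>The squared slab norm expressed by amplitudes: with the convention of
  \<open>synth\<close>, the horizontal transform of the field is (2 pi)^2 \<open>D 0\<close>, and
  its vertical derivatives are (2 pi)^2 \<open>D j\<close>.\<close>

definition nsq :: "nat \<Rightarrow> real \<Rightarrow> real \<Rightarrow> (nat \<Rightarrow> real^2 \<Rightarrow> real \<Rightarrow> complex) \<Rightarrow> ennreal" where
  "nsq k a b D = (\<Sum>j\<le>k. \<integral>\<^sup>+\<xi>. ennreal ((1 + (norm \<xi>)\<^sup>2) ^ (k - j)) *
     (\<integral>\<^sup>+z\<in>{a<..<b}. ennreal (((2 * pi)\<^sup>2 * cmod (D j \<xi> z))\<^sup>2) \<partial>lborel) \<partial>lborel)"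

text \<open>The chosen transform agrees with the amplitude for almost every (\<xi>, z), hence for
  almost every \<xi> at almost every z; for such \<xi> the chosen vertical derivatives are evaluated
  by \<open>wderiv_AE\<close>.\<close>

theorem slab_norm_sq_synth:
  fixes D :: "nat \<Rightarrow> real^2 \<Rightarrow> real \<Rightarrow> complex"
  assumes D: "amp a b r D" "a < b" and f: "\<And>x. x \<in> slab {a<..<b} \<Longrightarrow> f x = synth (D 0) x"
  shows "slab_norm_sq k {a<..<b} f = nsq k a b D"
proof -
  let ?I = "{a<..<b}"
  have h: "is_hfourier ?I f (hfourier ?I f)"
    unfolding hfourier_def by (rule someI[of "is_hfourier ?I f"]) (rule is_hfourier_synth[OF D f])
  have "AE p in lebesgue. snd p \<in> ?I \<longrightarrow> hfourier ?I f (fst p) (snd p) = (2 * pi)\<^sup>2 * D 0 (fst p) (snd p)"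
    by (rule is_hfourier_unique[OF h is_hfourier_synth[OF D f] _ hfourier_trunc_measurable[OF D(1) f]]) auto
  from AE_pairD[OF this]
  have ae: "AE \<xi> in lebesgue. AE z in lebesgue. z \<in> ?I \<longrightarrow> hfourier ?I f \<xi> z = (2 * pi)\<^sup>2 * D 0 \<xi> z" .
  have wd: "AE z in lebesgue. z \<in> ?I \<longrightarrow> wderiv ?I j (hfourier ?I f \<xi>) z = (2 * pi)\<^sup>2 * D j \<xi> z"
    if "AE z in lebesgue. z \<in> ?I \<longrightarrow> hfourier ?I f \<xi> z = (2 * pi)\<^sup>2 * D 0 \<xi> z" for j \<xi>
  proof (rule wderiv_AE[of _ "\<lambda>j z. (2 * pi)\<^sup>2 * D j \<xi> z", OF _ _ _ that])
    show "continuous_on ?I (\<lambda>z. complex_of_real ((2 * pi)\<^sup>2) * D j \<xi> z)" for j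
      by (intro continuous_intros amp_compose_continuous[OF D(1)])
    show "((\<lambda>z. complex_of_real ((2 * pi)\<^sup>2) * D j \<xi> z) has_vector_derivative complex_of_real ((2 * pi)\<^sup>2) * D (Suc j) \<xi> x) (at x)"
      if "x \<in> ?I" for j x
      by (rule has_vector_derivative_mult_right[OF amp_D_interior[OF D(1) that]])
  qed simp
  have inner: "(\<integral>\<^sup>+z\<in>?I. ennreal ((cmod (wderiv ?I j (hfourier ?I f \<xi>) z))\<^sup>2) \<partial>lebesgue)
     = (\<integral>\<^sup>+z\<in>?I. ennreal (((2 * pi)\<^sup>2 * cmod (D j \<xi> z))\<^sup>2) \<partial>lborel)"
    if "AE z in lebesgue. z \<in> ?I \<longrightarrow> hfourier ?I f \<xi> z = (2 * pi)\<^sup>2 * D 0 \<xi> z" for j \<xi>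
  proof -
    have "(\<integral>\<^sup>+z\<in>?I. ennreal ((cmod (wderiv ?I j (hfourier ?I f \<xi>) z))\<^sup>2) \<partial>lebesgue)
       = (\<integral>\<^sup>+z\<in>?I. ennreal (((2 * pi)\<^sup>2 * cmod (D j \<xi> z))\<^sup>2) \<partial>lebesgue)"
    proof (rule nn_integral_cong_AE)
      show "AE z in lebesgue. ennreal ((cmod (wderiv ?I j (hfourier ?I f \<xi>) z))\<^sup>2) * indicator ?I z =
          ennreal (((2 * pi)\<^sup>2 * cmod (D j \<xi> z))\<^sup>2) * indicator ?I z"
        using wd[OF that, of j]
      proof eventually_elim
        case (elim z)
        then show ?case
          by (cases "z \<in> ?I") (simp_all add: norm_mult norm_power)
      qed
    qed
    then show ?thesis by (simp add: nn_integral_completion)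
  qed
  have "(\<integral>\<^sup>+\<xi>. ennreal ((1 + (norm \<xi>)\<^sup>2) ^ (k - j)) *
        (\<integral>\<^sup>+z\<in>?I. ennreal ((cmod (wderiv ?I j (hfourier ?I f \<xi>) z))\<^sup>2) \<partial>lebesgue) \<partial>lebesgue)
     = (\<integral>\<^sup>+\<xi>. ennreal ((1 + (norm \<xi>)\<^sup>2) ^ (k - j)) *
        (\<integral>\<^sup>+z\<in>?I. ennreal (((2 * pi)\<^sup>2 * cmod (D j \<xi> z))\<^sup>2) \<partial>lborel) \<partial>lebesgue)" for j
    by (rule nn_integral_cong_AE) (use ae in \<open>eventually_elim; simp add: inner\<close>)
  then show ?thesis unfolding slab_norm_sq_def nsq_def by (simp add: nn_integral_completion)
qed

lemma nsq_le:
  assumes D: "amp a b r D" "a < b" and M: "M \<ge> 0" "\<And>j \<xi> z. j \<le> k \<Longrightarrow> z \<in> {a<..<b} \<Longrightarrow> cmod (D j \<xi> z) \<le> M"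
  shows "nsq k a b D \<le> ennreal (real (Suc k) * ((1 + r\<^sup>2) ^ k * (((2 * pi)\<^sup>2 * M)\<^sup>2 * (b - a))) * volc r)"
proof -
  let ?I = "{a<..<b}"
  let ?B = "((2 * pi)\<^sup>2 * M)\<^sup>2 * (b - a)"
  have B: "?B \<ge> 0" using D(2) by simp
  have z: "(\<integral>\<^sup>+z\<in>?I. ennreal (((2 * pi)\<^sup>2 * cmod (D j \<xi> z))\<^sup>2) \<partial>lborel) \<le> ennreal ?B" if "j \<le> k" for j \<xi>
  proof -
    have "(\<integral>\<^sup>+z\<in>?I. ennreal (((2 * pi)\<^sup>2 * cmod (D j \<xi> z))\<^sup>2) \<partial>lborel) \<le> (\<integral>\<^sup>+z. ennreal (((2 * pi)\<^sup>2 * M)\<^sup>2) * indicator ?I z \<partial>lborel)"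
      using M(2)[OF that] M(1) by (intro nn_integral_mono) (auto simp: indicator_def intro!: ennreal_leI power_mono mult_left_mono)
    also have "\<dots> = ennreal ?B" using D(2) by (simp add: nn_integral_cmult_indicator ennreal_mult del: power_mult_distrib)
    finally show ?thesis .
  qed
  have "(\<integral>\<^sup>+\<xi>. ennreal ((1 + (norm \<xi>)\<^sup>2) ^ (k - j)) *
     (\<integral>\<^sup>+z\<in>?I. ennreal (((2 * pi)\<^sup>2 * cmod (D j \<xi> z))\<^sup>2) \<partial>lborel) \<partial>lborel) \<le> ennreal ((1 + r\<^sup>2) ^ k * ?B * volc r)" if "j \<le> k" for j
  proof -
    have "(\<integral>\<^sup>+\<xi>. ennreal ((1 + (norm \<xi>)\<^sup>2) ^ (k - j)) *
     (\<integral>\<^sup>+z\<in>?I. ennreal (((2 * pi)\<^sup>2 * cmod (D j \<xi> z))\<^sup>2) \<partial>lborel) \<partial>lborel)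
     \<le> (\<integral>\<^sup>+\<xi>. ennreal ((1 + r\<^sup>2) ^ k * ?B) * indicator (cball (0::real^2) r) \<xi> \<partial>lborel)"
    proof (rule nn_integral_mono)
      fix \<xi> :: "real^2"
      show "ennreal ((1 + (norm \<xi>)\<^sup>2) ^ (k - j)) *
         (\<integral>\<^sup>+z\<in>?I. ennreal (((2 * pi)\<^sup>2 * cmod (D j \<xi> z))\<^sup>2) \<partial>lborel) \<le> ennreal ((1 + r\<^sup>2) ^ k * ?B) * indicator (cball 0 r) \<xi>"
      proof (cases "norm \<xi> \<le> r")
        case True
        have "(1 + (norm \<xi>)\<^sup>2) ^ (k - j) \<le> (1 + r\<^sup>2) ^ (k - j)" using True by (intro power_mono add_mono) auto
        also have "\<dots> \<le> (1 + r\<^sup>2) ^ k" by (intro power_increasing) auto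
        finally have "ennreal ((1 + (norm \<xi>)\<^sup>2) ^ (k - j)) * (\<integral>\<^sup>+z\<in>?I. ennreal (((2 * pi)\<^sup>2 * cmod (D j \<xi> z))\<^sup>2) \<partial>lborel)
           \<le> ennreal ((1 + r\<^sup>2) ^ k) * ennreal ?B"
          by (intro mult_mono z that ennreal_leI) auto
        also have "\<dots> = ennreal ((1 + r\<^sup>2) ^ k * ?B)" using B by (intro ennreal_mult[symmetric]) auto
        finally show ?thesis using True by simp
      next
        case False
        then have "cmod (D j \<xi> z) = 0" for z using ampD(3)[OF D(1)] by simp
        then show ?thesis by simp
      qed
    qed
    also have "\<dots> = ennreal ((1 + r\<^sup>2) ^ k * ?B) * ennreal (volc r)"
      by (subst nn_integral_cmult_indicator) (auto simp: emeasure_volc)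
    also have "\<dots> = ennreal ((1 + r\<^sup>2) ^ k * ?B * volc r)"
      using B volc_nonneg by (intro ennreal_mult[symmetric]) auto
    finally show ?thesis .
  qed
  then have "nsq k a b D \<le> (\<Sum>j\<le>k. ennreal ((1 + r\<^sup>2) ^ k * ?B * volc r))"
    unfolding nsq_def by (intro sum_mono) auto
  also have "\<dots> = ennreal (\<Sum>j\<le>k. (1 + r\<^sup>2) ^ k * ?B * volc r)"
    using B volc_nonneg by (intro sum_ennreal) auto
  also have "(\<Sum>j\<le>k. (1 + r\<^sup>2) ^ k * ?B * volc r) = real (Suc k) * ((1 + r\<^sup>2) ^ k * ?B) * volc r"
    by simp
  finally show ?thesis .
qed

lemma nsq_finite:
  assumes "amp a b r D" "a < b" shows "nsq k a b D < \<infinity>"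
proof -
  have "\<exists>M. \<forall>j \<xi> z. M j \<ge> 0 \<and> (z \<in> {a..b} \<longrightarrow> cmod (D j \<xi> z) \<le> M j)"
    by (rule choice) (metis amp_bounded[OF assms(1)])
  then obtain M where M: "\<And>j. M j \<ge> (0::real)" "\<And>j \<xi> z. z \<in> {a..b} \<Longrightarrow> cmod (D j \<xi> z) \<le> M j" by blast
  have "nsq k a b D \<le> ennreal (real (Suc k) * ((1 + r\<^sup>2) ^ k * (((2 * pi)\<^sup>2 * (\<Sum>j\<le>k. M j))\<^sup>2 * (b - a))) * volc r)"
  proof (rule nsq_le[OF assms])
    show "0 \<le> (\<Sum>j\<le>k. M j)" using M(1) by (simp add: sum_nonneg)
    fix j \<xi> z assume "j \<le> k" "z \<in> {a<..<b}"
    then have "cmod (D j \<xi> z) \<le> M j" using M(2) by simp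
    also have "\<dots> \<le> (\<Sum>j\<le>k. M j)" using \<open>j \<le> k\<close> M(1) by (intro member_le_sum) auto
    finally show "cmod (D j \<xi> z) \<le> (\<Sum>j\<le>k. M j)" .
  qed
  then show ?thesis by (rule order.strict_trans1) simp
qed

lemma nsq_mono:
  assumes "\<And>j \<xi> z. z \<in> {a<..<b} \<Longrightarrow> cmod (D j \<xi> z) \<le> cmod (D' j \<xi> z)"
  shows "nsq k a b D \<le> nsq k a b D'"
  unfolding nsq_def using assms
  by (intro sum_mono nn_integral_mono mult_left_mono) (auto simp: indicator_def intro!: ennreal_leI power_mono mult_left_mono)

text \<open>Keeps only the summand j = 0, whose weight is at least 1, and only the contribution of
  \<open>X\<close> times the smaller interval.\<close>

lemma nsq_ge:
  assumes c: "c \<ge> 0" "\<And>\<xi> z. \<xi> \<in> X \<Longrightarrow> z \<in> {a1<..<b1} \<Longrightarrow> c \<le> cmod (D 0 \<xi> z)"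
    and X: "X \<in> sets borel" "emeasure lborel X = ennreal v" "v \<ge> 0" and ab: "{a1<..<b1} \<subseteq> {a<..<b}" "a1 \<le> b1"
  shows "ennreal (((2 * pi)\<^sup>2 * c)\<^sup>2 * (b1 - a1) * v) \<le> nsq k a b D"
proof -
  have "ennreal (((2 * pi)\<^sup>2 * c)\<^sup>2 * (b1 - a1) * v) = (\<integral>\<^sup>+\<xi>. ennreal (((2 * pi)\<^sup>2 * c)\<^sup>2 * (b1 - a1)) * indicator X \<xi> \<partial>lborel)"
    using X ab(2) by (subst nn_integral_cmult_indicator) (auto simp: ennreal_mult[symmetric])
  also have "\<dots> \<le> (\<integral>\<^sup>+\<xi>. ennreal ((1 + (norm \<xi>)\<^sup>2) ^ (k - 0)) *
     (\<integral>\<^sup>+z\<in>{a<..<b}. ennreal (((2 * pi)\<^sup>2 * cmod (D 0 \<xi> z))\<^sup>2) \<partial>lborel) \<partial>lborel)"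
  proof (rule nn_integral_mono)
    fix \<xi> :: "real^2"
    show "ennreal (((2 * pi)\<^sup>2 * c)\<^sup>2 * (b1 - a1)) * indicator X \<xi> \<le> ennreal ((1 + (norm \<xi>)\<^sup>2) ^ (k - 0)) *
     (\<integral>\<^sup>+z\<in>{a<..<b}. ennreal (((2 * pi)\<^sup>2 * cmod (D 0 \<xi> z))\<^sup>2) \<partial>lborel)"
    proof (cases "\<xi> \<in> X")
      case True
      have "ennreal (((2 * pi)\<^sup>2 * c)\<^sup>2 * (b1 - a1)) = (\<integral>\<^sup>+z. ennreal (((2 * pi)\<^sup>2 * c)\<^sup>2) * indicator {a1<..<b1} z \<partial>lborel)"
        using ab(2) by (subst nn_integral_cmult_indicator) (auto simp: ennreal_mult[symmetric])
      also have "\<dots> \<le> (\<integral>\<^sup>+z\<in>{a<..<b}. ennreal (((2 * pi)\<^sup>2 * cmod (D 0 \<xi> z))\<^sup>2) \<partial>lborel)"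
      proof (rule nn_integral_mono)
        fix z
        have "ennreal (((2 * pi)\<^sup>2 * c)\<^sup>2) \<le> ennreal (((2 * pi)\<^sup>2 * cmod (D 0 \<xi> z))\<^sup>2)" if "z \<in> {a1<..<b1}"
          using c(1) c(2)[OF True that] by (intro ennreal_leI power_mono mult_left_mono) auto
        then show "ennreal (((2 * pi)\<^sup>2 * c)\<^sup>2) * indicator {a1<..<b1} z \<le> ennreal (((2 * pi)\<^sup>2 * cmod (D 0 \<xi> z))\<^sup>2) * indicator {a<..<b} z"
          using ab(1) by (auto simp: indicator_def simp del: power_mult_distrib)
      qed
      also have "\<dots> = 1 * \<dots>" by simp
      also have "\<dots> \<le> ennreal ((1 + (norm \<xi>)\<^sup>2) ^ (k - 0)) * (\<integral>\<^sup>+z\<in>{a<..<b}. ennreal (((2 * pi)\<^sup>2 * cmod (D 0 \<xi> z))\<^sup>2) \<partial>lborel)"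
        by (intro mult_right_mono) (auto simp: one_le_power intro!: ennreal_leI[of 1, simplified])
      finally show ?thesis using True by simp
    qed simp
  qed
  also have "\<dots> \<le> nsq k a b D"
    unfolding nsq_def by (rule member_le_sum[of 0 "{..k}" "\<lambda>j. \<integral>\<^sup>+\<xi>. ennreal ((1 + (norm \<xi>)\<^sup>2) ^ (k - j)) *
     (\<integral>\<^sup>+z\<in>{a<..<b}. ennreal (((2 * pi)\<^sup>2 * cmod (D j \<xi> z))\<^sup>2) \<partial>lborel) \<partial>lborel"]) auto
  finally show ?thesis .
qed

section \<open>Traces of synthesized fields\<close>

lemma AE_hor:
  assumes "AE y in lborel. P y"
  shows "AE x in lborel. P (hor x)"
proof -
  obtain N where N: "N \<in> null_sets lborel" "{y. \<not> P y} \<subseteq> N"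
    using assms unfolding eventually_ae_filter by auto
  note [measurable] = null_setsD2[OF N(1), simplified]
  have "(\<integral>\<^sup>+x. indicator N (hor x) \<partial>lborel) = (\<integral>\<^sup>+z. \<integral>\<^sup>+y. indicator N y \<partial>lborel \<partial>(lborel :: real measure))"
    by (subst nn_integral_pt) simp_all
  also have "\<dots> = 0" using null_setsD1[OF N(1)] by simp
  finally have "AE x in lborel. indicator N (hor x) = (0::ennreal)"
    by (subst (asm) nn_integral_0_iff_AE) auto
  then show ?thesis by eventually_elim (use N(2) in \<open>auto simp: indicator_def split: if_splits\<close>)
qed

lemma end_point_ball:
  fixes c e :: real
  assumes "c = a \<or> c = b" "0 < e" "e \<le> b - a"
  shows "emeasure lborel ({a<..<b} \<inter> ball c e) = ennreal e"
proof -
  have "{a<..<b} \<inter> ball c e = (if c = a then {a<..<a + e} else {b - e<..<b})"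
    using assms by (auto simp: dist_real_def)
  then show ?thesis using assms(2) by simp
qed

text \<open>Over a layer of thickness e the integral of (\<gamma> - \<gamma>')^2 is e times its
  integral over the plane. After the division by e in the definition of a trace, this fixed number
  is bounded by a quantity tending to 0.\<close>

lemma is_plane_trace_unique:
  assumes t: "is_plane_trace {a<..<b} c f \<gamma>" "is_plane_trace {a<..<b} c f \<gamma>'"
    and c: "c = a \<or> c = b" and ab: "a < b"
    and f: "(\<lambda>x. indicator (slab {a<..<b}) x *\<^sub>R f x) \<in> borel_measurable borel"
  shows "AE y in lebesgue. \<gamma> y = \<gamma>' y"
proof -
  have ex: "\<exists>g. g \<in> borel_measurable borel \<and> (AE y in lborel. \<gamma> y = g y)" if "is_plane_trace {a<..<b} c f \<gamma>" for \<gamma>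
  proof -
    have "\<gamma> \<in> borel_measurable lebesgue"
      using that by (simp add: is_plane_trace_def L2_on_def set_borel_measurable_def)
    from completion_ex_borel_measurable_real[OF this] show ?thesis by auto
  qed
  obtain g g' where g: "g \<in> borel_measurable borel" "AE y in lborel. \<gamma> y = g y"
    and g': "g' \<in> borel_measurable borel" "AE y in lborel. \<gamma>' y = g' y"
    using ex[OF t(1)] ex[OF t(2)] by blast
  note [measurable] = g(1) g'(1)
  let ?J = "\<lambda>e. {a<..<b} \<inter> ball c e"
  have os: "slab (?J e) \<in> sets borel" for e using open_slab[of "?J e"] by (simp add: open_Int)
  let ?E = "\<lambda>\<gamma> e. (\<integral>\<^sup>+x\<in>slab (?J e). ennreal ((f x - \<gamma> (hor x))\<^sup>2) \<partial>lebesgue)"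
  have Eg: "?E \<gamma> e = (\<integral>\<^sup>+x\<in>slab (?J e). ennreal ((f x - g (hor x))\<^sup>2) \<partial>lborel)"
    if "AE y in lborel. \<gamma> y = g y" for \<gamma> g :: "real^2 \<Rightarrow> real" and e
    unfolding nn_integral_completion
    by (rule nn_integral_cong_AE) (use AE_hor[OF that] in \<open>eventually_elim; simp\<close>)
  define d where "d = (\<integral>\<^sup>+y. ennreal ((g y - g' y)\<^sup>2) \<partial>lborel)"
  have le: "d \<le> 2 * (?E \<gamma> e / ennreal e) + 2 * (?E \<gamma>' e / ennreal e)" if e: "0 < e" "e \<le> b - a" for e
  proof -
    have fm: "(\<lambda>x. ennreal ((f x - g (hor x))\<^sup>2) * indicator (slab (?J e)) x) \<in> borel_measurable lborel"
      if [measurable]: "g \<in> borel_measurable borel" for g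
    proof -
      have "(\<lambda>x. ennreal ((indicator (slab {a<..<b}) x *\<^sub>R f x - g (hor x))\<^sup>2) * indicator (slab (?J e)) x) \<in> borel_measurable lborel"
        using f os[of e] by measurable
      moreover have "(\<lambda>x. ennreal ((indicator (slab {a<..<b}) x *\<^sub>R f x - g (hor x))\<^sup>2) * indicator (slab (?J e)) x)
        = (\<lambda>x. ennreal ((f x - g (hor x))\<^sup>2) * indicator (slab (?J e)) x)"
        by (rule ext) (auto simp: indicator_def slab_def)
      ultimately show ?thesis by (simp only:)
    qed
    note [measurable] = os[of e]
    have "(\<integral>\<^sup>+x. ennreal ((g (hor x) - g' (hor x))\<^sup>2) * indicator (slab (?J e)) x \<partial>lborel)
       = (\<integral>\<^sup>+z. \<integral>\<^sup>+y. ennreal ((g y - g' y)\<^sup>2) * indicator (?J e) z \<partial>lborel \<partial>lborel)"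
      by (subst nn_integral_pt) (auto simp: slab_def indicator_def intro!: nn_integral_cong)
    also have "\<dots> = (\<integral>\<^sup>+z. d * indicator (?J e) z \<partial>lborel)"
      unfolding d_def by (subst nn_integral_multc) auto
    also have "\<dots> = d * ennreal e"
      by (subst nn_integral_cmult_indicator) (auto simp: end_point_ball[OF c e])
    finally have "d * ennreal e = (\<integral>\<^sup>+x. ennreal ((g (hor x) - g' (hor x))\<^sup>2) * indicator (slab (?J e)) x \<partial>lborel)" ..
    also have "\<dots> \<le> (\<integral>\<^sup>+x. 2 * (ennreal ((f x - g (hor x))\<^sup>2) * indicator (slab (?J e)) x) + 2 * (ennreal ((f x - g' (hor x))\<^sup>2) * indicator (slab (?J e)) x) \<partial>lborel)"
    proof (rule nn_integral_mono)
      fix x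
      have "(g (hor x) - g' (hor x))\<^sup>2 \<le> 2 * (f x - g (hor x))\<^sup>2 + 2 * (f x - g' (hor x))\<^sup>2"
        using norm_diff_sq_le[of "g (hor x)" "g' (hor x)" "f x"] by (simp add: power2_commute)
      then have "ennreal ((g (hor x) - g' (hor x))\<^sup>2) \<le> ennreal (2 * (f x - g (hor x))\<^sup>2 + 2 * (f x - g' (hor x))\<^sup>2)"
        by (rule ennreal_leI)
      then show "ennreal ((g (hor x) - g' (hor x))\<^sup>2) * indicator (slab (?J e)) x \<le>
         2 * (ennreal ((f x - g (hor x))\<^sup>2) * indicator (slab (?J e)) x) + 2 * (ennreal ((f x - g' (hor x))\<^sup>2) * indicator (slab (?J e)) x)"
        by (simp add: indicator_def ennreal_plus ennreal_mult)
    qed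
    also have "\<dots> = 2 * ?E \<gamma> e + 2 * ?E \<gamma>' e"
      unfolding Eg[OF g(2)] Eg[OF g'(2)] using fm[OF g(1)] fm[OF g'(1)]
      by (subst nn_integral_add) (auto simp: nn_integral_cmult)
    finally have "d * ennreal e / ennreal e \<le> (2 * ?E \<gamma> e + 2 * ?E \<gamma>' e) / ennreal e"
      by (rule divide_right_mono_ennreal)
    moreover have "d * ennreal e / ennreal e = d" using e(1) by (simp add: ennreal_mult_divide_eq)
    ultimately show ?thesis by (simp add: add_divide_distrib_ennreal ennreal_times_divide)
  qed
  have "((\<lambda>e. 2 * (?E \<gamma> e / ennreal e) + 2 * (?E \<gamma>' e / ennreal e)) \<longlongrightarrow> 2 * 0 + 2 * 0) (at_right 0)"
    using t unfolding is_plane_trace_def by (intro tendsto_add ennreal_tendsto_cmult) auto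
  then have "d \<le> 2 * 0 + 2 * 0"
    by (rule tendsto_lowerbound)
      (use ab in \<open>auto simp: eventually_at_right_field intro!: exI[of _ "b - a"] le\<close>)
  then have "AE y in lborel. ennreal ((g y - g' y)\<^sup>2) = 0"
    unfolding d_def by (subst nn_integral_0_iff_AE[symmetric]) auto
  then have "AE y in lborel. \<gamma> y = \<gamma>' y" using g(2) g'(2) by eventually_elim auto
  then show ?thesis by (rule AE_completion)
qed

text \<open>The amplitude is Lipschitz in z uniformly in \<xi>, so by the Plancherel inequality a
  slice at distance at most e from the plane differs from the trace by O(e) in L2. The averaged
  squared error is then O(e^2).\<close>

lemma is_plane_trace_synth:
  fixes D :: "nat \<Rightarrow> real^2 \<Rightarrow> real \<Rightarrow> complex"
  assumes D: "amp a b r D" "a < b" and c: "c = a \<or> c = b"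
    and f: "\<And>x. x \<in> slab {a<..<b} \<Longrightarrow> f x = synth (D 0) x"
  shows "is_plane_trace {a<..<b} c f (\<lambda>y. synth (D 0) (pt y c))"
  unfolding is_plane_trace_def
proof
  note [measurable] = synth_measurable[OF D(1)]
  have [measurable]: "(\<lambda>y. pt y z) \<in> borel_measurable borel" for z
    by (intro borel_measurable_continuous_onI continuous_intros)
  have "(\<lambda>y. synth (D 0) (pt y c)) \<in> borel_measurable lebesgue"
    by (intro measurable_completion) simp
  then show "L2_on UNIV (\<lambda>y. synth (D 0) (pt y c))"
    using synth_nn_L2_pt[OF D(1), of 0 c]
    by (simp add: L2_on_def set_borel_measurable_def nn_integral_completion)
  obtain M where M: "M \<ge> 0" "\<And>\<xi> z. z \<in> {a..b} \<Longrightarrow> cmod (D 1 \<xi> z) \<le> M" using amp_bounded[OF D(1)] by blast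
  let ?J = "\<lambda>e. {a<..<b} \<inter> ball c e"
  have cI: "c \<in> {a..b}" using c D(2) by auto
  have lip: "cmod (D 0 \<xi> z - D 0 \<xi> c) \<le> M * e" if "z \<in> ?J e" for \<xi> z e
  proof -
    have "cmod (D 0 \<xi> z - D 0 \<xi> c) \<le> M * norm (z - c)"
    proof (rule differentiable_bound[of "{a..b}"])
      fix w assume w: "w \<in> {a..b}"
      show "(D 0 \<xi> has_derivative (\<lambda>t. t *\<^sub>R D (Suc 0) \<xi> w)) (at w within {a..b})"
        using ampD(2)[OF D(1) w] by (simp add: has_vector_derivative_def)
      show "onorm (\<lambda>t. t *\<^sub>R D (Suc 0) \<xi> w) \<le> M"
        using M(2)[OF w, of \<xi>] by (intro onorm_bound M(1)) (simp add: mult.commute[of M] mult_left_mono)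
    qed (use that cI in auto)
    also have "\<dots> \<le> M * e" using that M(1) by (intro mult_left_mono) (auto simp: dist_real_def abs_minus_commute)
    finally show ?thesis .
  qed
  let ?K = "(2 * pi)\<^sup>2 * (M\<^sup>2 * volc r)"
  have inner: "(\<integral>\<^sup>+y. ennreal ((synth (D 0) (pt y z) - synth (D 0) (pt y c))\<^sup>2) \<partial>lborel) \<le> ennreal (?K * e\<^sup>2)"
    if z: "z \<in> ?J e" for z e
  proof -
    let ?h = "\<lambda>\<xi>. D 0 \<xi> z - D 0 \<xi> c"
    have e: "e > 0" using z by (auto simp: dist_real_def)
    have b: "bcs ?h"
    proof -
      have "(\<lambda>\<xi>. D 0 \<xi> w) \<in> borel_measurable borel" for w using amp_bcs[OF D(1)] by (auto simp: bcs_def)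
      then show ?thesis
        by (intro bcsI[of ?h "M * e" r] lip[OF z]) (simp_all add: ampD(3)[OF D(1)])
    qed
    have eq: "complex_of_real (synth (D 0) (pt y z) - synth (D 0) (pt y c)) = ft ?h (- y)" for y
    proof -
      have i: "integrable lborel (\<lambda>\<xi>. D 0 \<xi> w * cis (- (\<xi> \<bullet> (- y))))" for w
        by (rule bcs_integrable[OF bcs_cis(2)[OF amp_bcs[OF D(1)]]])
      show ?thesis
        using Bochner_Integration.integral_diff[OF i i, of z c]
        by (simp add: synth_pt_complex[OF D(1)] ft_def left_diff_distrib)
    qed
    have sq: "(synth (D 0) (pt y z) - synth (D 0) (pt y c))\<^sup>2 = (cmod (ft ?h (- y)))\<^sup>2" for y
      unfolding eq[symmetric] by (simp only: norm_of_real power2_abs)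
    have [measurable]: "?h \<in> borel_measurable borel" using b by (auto simp: bcs_def)
    have "(\<integral>\<^sup>+y. ennreal ((synth (D 0) (pt y z) - synth (D 0) (pt y c))\<^sup>2) \<partial>lborel) = ennreal (LINT y|lborel. (cmod (ft ?h (- y)))\<^sup>2)"
      unfolding sq using lborel_reflect(2)[of "\<lambda>y. (cmod (ft ?h y))\<^sup>2"] plancherel_le(1)[OF b]
      by (intro nn_integral_eq_integral) auto
    also have "\<dots> \<le> ennreal ((2 * pi)\<^sup>2 * ((M * e)\<^sup>2 * volc r))"
    proof (rule ennreal_leI)
      have "(LINT y|lborel. (cmod (ft ?h (- y)))\<^sup>2) = (LINT y|lborel. (cmod (ft ?h y))\<^sup>2)"
        by (rule lborel_reflect(1)) measurable
      also have "\<dots> \<le> (2 * pi)\<^sup>2 * (LINT \<xi>|lborel. (cmod (?h \<xi>))\<^sup>2)"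
        using plancherel_le(2)[OF b] by simp
      also have "\<dots> \<le> (2 * pi)\<^sup>2 * ((M * e)\<^sup>2 * volc r)"
        using M(1) e by (intro mult_left_mono integral_sq_le_volc[OF b] lip[OF z]) (auto simp: ampD(3)[OF D(1)])
      finally show "(LINT y|lborel. (cmod (ft ?h (- y)))\<^sup>2) \<le> (2 * pi)\<^sup>2 * ((M * e)\<^sup>2 * volc r)" .
    qed
    also have "(2 * pi)\<^sup>2 * ((M * e)\<^sup>2 * volc r) = ?K * e\<^sup>2" by (simp add: power_mult_distrib)
    finally show ?thesis .
  qed
  have os: "slab (?J e) \<in> sets borel" for e using open_slab[of "?J e"] by (simp add: open_Int)
  have le: "(\<integral>\<^sup>+x\<in>slab (?J e). ennreal ((f x - synth (D 0) (pt (hor x) c))\<^sup>2) \<partial>lebesgue) / ennreal e \<le> ennreal (?K * e\<^sup>2)"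
    if e: "0 < e" "e \<le> b - a" for e
  proof -
    note [measurable] = os[of e]
    have ptc: "(\<lambda>x. pt (hor x) c) \<in> borel_measurable borel"
      by (intro borel_measurable_continuous_onI continuous_intros)
    note [measurable] = measurable_compose[OF ptc synth_measurable[OF D(1)]]
    have "(\<integral>\<^sup>+x\<in>slab (?J e). ennreal ((f x - synth (D 0) (pt (hor x) c))\<^sup>2) \<partial>lebesgue) =
      (\<integral>\<^sup>+x\<in>slab (?J e). ennreal ((synth (D 0) x - synth (D 0) (pt (hor x) c))\<^sup>2) \<partial>lborel)"
      unfolding nn_integral_completion using f by (intro nn_integral_cong) (auto simp: indicator_def slab_def)
    also have "\<dots> = (\<integral>\<^sup>+z. \<integral>\<^sup>+y. ennreal ((synth (D 0) (pt y z) - synth (D 0) (pt y c))\<^sup>2) * indicator (?J e) z \<partial>lborel \<partial>lborel)"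
      by (subst nn_integral_pt) (auto simp: slab_def indicator_def intro!: nn_integral_cong)
    also have "\<dots> \<le> (\<integral>\<^sup>+z. ennreal (?K * e\<^sup>2) * indicator (?J e) z \<partial>lborel)"
    proof (rule nn_integral_mono)
      fix z
      show "(\<integral>\<^sup>+y. ennreal ((synth (D 0) (pt y z) - synth (D 0) (pt y c))\<^sup>2) * indicator (?J e) z \<partial>lborel) \<le> ennreal (?K * e\<^sup>2) * indicator (?J e) z"
        using inner[of z e] by (cases "z \<in> ?J e") simp_all
    qed
    also have "\<dots> = ennreal (?K * e\<^sup>2) * ennreal e"
      by (subst nn_integral_cmult_indicator) (auto simp: end_point_ball[OF c e])
    finally have "(\<integral>\<^sup>+x\<in>slab (?J e). ennreal ((f x - synth (D 0) (pt (hor x) c))\<^sup>2) \<partial>lebesgue) / ennreal e \<le> ennreal (?K * e\<^sup>2) * ennreal e / ennreal e"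
      by (rule divide_right_mono_ennreal)
    then show ?thesis using e(1) by (simp add: ennreal_mult_divide_eq)
  qed
  show "((\<lambda>e. (\<integral>\<^sup>+x\<in>slab (?J e). ennreal ((f x - synth (D 0) (pt (hor x) c))\<^sup>2) \<partial>lebesgue) / ennreal e) \<longlongrightarrow> 0) (at_right 0)"
  proof (rule tendsto_sandwich[OF _ _ tendsto_const])
    show "\<forall>\<^sub>F e in at_right 0. (\<integral>\<^sup>+x\<in>slab (?J e). ennreal ((f x - synth (D 0) (pt (hor x) c))\<^sup>2) \<partial>lebesgue) / ennreal e \<le> ennreal (?K * e\<^sup>2)"
      unfolding eventually_at_right_field using D(2) by (intro exI[of _ "b - a"] conjI allI impI le) simp_all
    have "((\<lambda>e. ennreal (?K * e\<^sup>2)) \<longlongrightarrow> ennreal (?K * 0\<^sup>2)) (at_right 0)"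
      by (intro tendsto_ennrealI tendsto_intros)
    then show "((\<lambda>e. ennreal (?K * e\<^sup>2)) \<longlongrightarrow> 0) (at_right 0)" by simp
  qed simp
qed

theorem plane_trace_synth:
  fixes D :: "nat \<Rightarrow> real^2 \<Rightarrow> real \<Rightarrow> complex"
  assumes D: "amp a b r D" "a < b" and c: "c = a \<or> c = b"
    and f: "\<And>x. x \<in> slab {a<..<b} \<Longrightarrow> f x = synth (D 0) x"
  shows "AE y in lebesgue. plane_trace {a<..<b} c f y = synth (D 0) (pt y c)"
proof (rule is_plane_trace_unique[OF _ is_plane_trace_synth[OF D c f] c D(2)])
  show "is_plane_trace {a<..<b} c f (plane_trace {a<..<b} c f)"
    unfolding plane_trace_def by (rule someI[of "is_plane_trace {a<..<b} c f"]) (rule is_plane_trace_synth[OF D c f])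
  have "(\<lambda>x. indicator (slab {a<..<b}) x *\<^sub>R synth (D 0) x) \<in> borel_measurable borel"
    using synth_measurable[OF D(1)] open_slab[of "{a<..<b}"] by (intro borel_measurable_scaleR borel_measurable_indicator) auto
  moreover have "(\<lambda>x. indicator (slab {a<..<b}) x *\<^sub>R synth (D 0) x) = (\<lambda>x. indicator (slab {a<..<b}) x *\<^sub>R f x)"
    using f by (intro ext) (simp add: indicator_def)
  ultimately show "(\<lambda>x. indicator (slab {a<..<b}) x *\<^sub>R f x) \<in> borel_measurable borel" by (simp only:)
qed

section \<open>The vertical mode equation\<close>

text \<open>One-sided derivatives at the end points suffice: they give continuity on the closed
  interval, while monotonicity uses the interior derivatives only.\<close>

lemma nondecreasing_within:
  fixes f f' :: "real \<Rightarrow> real"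
  assumes d: "\<And>x. x \<in> {a..b} \<Longrightarrow> (f has_real_derivative f' x) (at x within {a..b})"
    and nn: "\<And>x. x \<in> {a..b} \<Longrightarrow> 0 \<le> f' x" and xy: "a \<le> x" "x \<le> y" "y \<le> b"
  shows "f x \<le> f y"
proof (rule DERIV_nonneg_imp_increasing_open[OF xy(2)])
  have "continuous_on {a..b} f" by (rule DERIV_continuous_on) (rule d)
  then show "continuous_on {x..y} f" by (rule continuous_on_subset) (use xy in auto)
  fix t assume t: "x < t" "t < y"
  then have "at t within {a..b} = at t" using xy by (intro at_within_Icc_at) auto
  then show "\<exists>y. (f has_real_derivative y) (at t) \<and> 0 \<le> y" using d[of t] nn[of t] t xy by auto
qed

lemma increasing_within:
  fixes f f' :: "real \<Rightarrow> real"
  assumes d: "\<And>x. x \<in> {a..b} \<Longrightarrow> (f has_real_derivative f' x) (at x within {a..b})"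
    and nn: "\<And>x. x \<in> {a..b} \<Longrightarrow> 0 < f' x" and xy: "a \<le> x" "x < y" "y \<le> b"
  shows "f x < f y"
proof (rule DERIV_pos_imp_increasing_open[OF xy(2)])
  have "continuous_on {a..b} f" by (rule DERIV_continuous_on) (rule d)
  then show "continuous_on {x..y} f" by (rule continuous_on_subset) (use xy in auto)
  fix t assume t: "x < t" "t < y"
  then have "at t within {a..b} = at t" using xy by (intro at_within_Icc_at) auto
  then show "\<exists>y. (f has_real_derivative y) (at t) \<and> 0 < y" using d[of t] nn[of t] t xy by auto
qed

text \<open>The primitive \<open>\<integral>\<^sub>0\<^sup>x f\<close>, rescaled to a fixed interval so that continuity in parameters is immediate.\<close>

definition prim :: "(real \<Rightarrow> real) \<Rightarrow> real \<Rightarrow> real" where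
  "prim f x = x * integral {0..1} (\<lambda>t. f (x * t))"

lemma prim_eq:
  assumes f: "continuous_on UNIV f" and x: "x \<ge> 0"
  shows "prim f x = integral {0..x} f"
proof (cases "x = 0")
  case False
  then have x0: "x > 0" using x by simp
  have "f integrable_on {0..x}"
    using f by (intro integrable_continuous_real) (auto intro: continuous_on_subset)
  then have "(f has_integral integral {0..x} f) {0..x}" by (rule integrable_integral)
  from has_integral_stretch_real[OF this, of x] x0
  have "((\<lambda>t. f (x * t)) has_integral (1 / x) * integral {0..x} f) ((\<lambda>t. t / x) ` {0..x})" by simp
  moreover have "(\<lambda>t. t / x) ` {0..x} = {0..1}"
    using x0 by (auto simp: image_iff field_simps intro!: bexI[of _ "x * _"])
  ultimately show ?thesis using x0 by (simp add: prim_def integral_unique)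
qed (simp add: prim_def)

lemma prim_continuous:
  fixes f :: "'p::topological_space \<Rightarrow> real \<Rightarrow> real"
  assumes "continuous_on UNIV (\<lambda>q. f (fst q) (snd q))"
  shows "continuous_on UNIV (\<lambda>q. prim (f (fst q)) (snd q))"
proof -
  have "continuous_on (UNIV \<times> cbox 0 1) (\<lambda>(q, t). f (fst q) (snd q * t))"
    unfolding case_prod_beta
    using continuous_on_compose2[OF assms, of "UNIV \<times> cbox 0 1" "\<lambda>p. (fst (fst p), snd (fst p) * snd p)"]
    by (simp add: continuous_intros)
  from integral_continuous_on_param[OF this]
  show ?thesis unfolding prim_def by (intro continuous_intros) simp
qed

lemma prim_deriv:
  assumes f: "continuous_on UNIV f" and x: "x \<in> {0..L}"
  shows "(prim f has_real_derivative f x) (at x within {0..L})"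
proof -
  have "((\<lambda>x. integral {0..x} f) has_real_derivative f x) (at x within {0..L})"
    using f x by (intro integral_has_real_derivative) (auto intro: continuous_on_subset)
  then show ?thesis
    by (rule has_field_derivative_transform_within[OF _ zero_less_one x]) (simp add: prim_eq[OF f])
qed

text \<open>The bound for the integrand integrates to the next term of the exponential series; this
  is the induction step of the Picard estimate.\<close>

lemma prim_bounds:
  assumes f: "continuous_on UNIV f" and x: "x \<in> {0..L}" and B: "B \<ge> 0"
    and b: "\<And>t. t \<in> {0..L} \<Longrightarrow> 0 \<le> f t \<and> f t \<le> B * ((B * t) ^ n / fact n)"
  shows "0 \<le> prim f x \<and> prim f x \<le> (B * x) ^ Suc n / fact (Suc n)"
proof
  have p0: "prim f 0 = 0" by (simp add: prim_def)
  have "prim f 0 \<le> prim f x"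
    by (rule nondecreasing_within[of 0 L "prim f" f, OF prim_deriv[OF f] b[THEN conjunct1]]) (use x in auto)
  then show "0 \<le> prim f x" using p0 by simp
  let ?g = "\<lambda>x. (B * x) ^ Suc n / fact (Suc n)"
  have g: "(?g has_real_derivative B * ((B * t) ^ n / fact n)) (at t within {0..L})" for t
  proof -
    have "((\<lambda>x. (B * x) ^ Suc n) has_real_derivative real (Suc n) * (B * (B * t) ^ n)) (at t within {0..L})"
      using DERIV_power[OF DERIV_cmult_Id[of B t "{0..L}"], of "Suc n"] by (simp only: diff_Suc_Suc diff_zero)
    from DERIV_cdivide[OF this, of "fact (Suc n)"]
    have "(?g has_real_derivative real (Suc n) * (B * (B * t) ^ n) / fact (Suc n)) (at t within {0..L})" .
    moreover have "real (Suc n) * (B * (B * t) ^ n) / fact (Suc n) = B * ((B * t) ^ n / fact n)"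
      unfolding fact_Suc by (simp del: of_nat_Suc)
    ultimately show ?thesis by (simp only:)
  qed
  have "?g 0 - prim f 0 \<le> ?g x - prim f x"
  proof (rule nondecreasing_within[of 0 L "\<lambda>x. ?g x - prim f x" "\<lambda>t. B * ((B * t) ^ n / fact n) - f t"])
    fix t assume t: "t \<in> {0..L}"
    show "((\<lambda>x. ?g x - prim f x) has_real_derivative B * ((B * t) ^ n / fact n) - f t) (at t within {0..L})"
      by (rule DERIV_diff[OF g prim_deriv[OF f t]])
    show "0 \<le> B * ((B * t) ^ n / fact n) - f t" using b[OF t] by linarith
  qed (use x in auto)
  then show "prim f x \<le> ?g x" using p0 by simp
qed

text \<open>The vertical mode equation \<open>(R u')' = R (s + \<mu> W) u\<close> on \<open>[0, L]\<close>, with \<open>u = 1\<close>,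
  \<open>u' = 0\<close> at the rigid wall \<open>x = 0\<close>, as a first-order system for \<open>u\<close> and \<open>v = R u'\<close>.\<close>

locale side =
  fixes R W :: "real \<Rightarrow> real" and L r1 r2 w2 :: real
  assumes L: "L > 0" and r1: "r1 > 0" and w2: "w2 > 0"
    and R_cont: "continuous_on UNIV R" and W_cont: "continuous_on UNIV W"
    and R_bd: "\<And>x. r1 \<le> R x" "\<And>x. R x \<le> r2" and W_bd: "\<And>x. 0 \<le> W x" "\<And>x. W x \<le> w2"
begin

lemma R_pos: "R x > 0" using R_bd(1)[of x] r1 by linarith

lemma r2: "r2 > 0" using R_bd[of 0] r1 by linarith

text \<open>The n-th summand of the Picard series rather than the n-th iterate: the system is
  linear, so its solution is the sum of the powers of the integral operator applied to (1, 0). For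
  nonnegative parameters all summands are nonnegative on [0, L]. The argument \<theta> is the pair
  (s, \<mu>).\<close>

primrec pic :: "nat \<Rightarrow> real \<times> real \<Rightarrow> (real \<Rightarrow> real) \<times> (real \<Rightarrow> real)" where
  "pic 0 \<theta> = (\<lambda>x. 1, \<lambda>x. 0)"
| "pic (Suc n) \<theta> = (prim (\<lambda>x. snd (pic n \<theta>) x / R x), prim (\<lambda>x. R x * (fst \<theta> + snd \<theta> * W x) * fst (pic n \<theta>) x))"

lemma pic_continuous:
  "continuous_on UNIV (\<lambda>q. fst (pic n (fst q)) (snd q))" "continuous_on UNIV (\<lambda>q. snd (pic n (fst q)) (snd q))"
proof (induction n)
  case (Suc n)
  have [continuous_intros]: "continuous_on UNIV (\<lambda>q::(real \<times> real) \<times> real. R (snd q))"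
    "continuous_on UNIV (\<lambda>q::(real \<times> real) \<times> real. W (snd q))"
    by (auto intro!: continuous_on_compose2[OF R_cont] continuous_on_compose2[OF W_cont] continuous_intros)
  have "R x \<noteq> 0" for x using R_pos[of x] by simp
  then show "continuous_on UNIV (\<lambda>q. fst (pic (Suc n) (fst q)) (snd q))"
    "continuous_on UNIV (\<lambda>q. snd (pic (Suc n) (fst q)) (snd q))"
    using Suc by (auto intro!: prim_continuous[of "\<lambda>\<theta> x. snd (pic n \<theta>) x / R x"]
        prim_continuous[of "\<lambda>\<theta> x. R x * (fst \<theta> + snd \<theta> * W x) * fst (pic n \<theta>) x"] continuous_intros)
qed simp_all

lemma pic_continuous_x: "continuous_on UNIV (fst (pic n \<theta>))" "continuous_on UNIV (snd (pic n \<theta>))"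
  using continuous_on_compose2[OF pic_continuous(1), of UNIV "\<lambda>x. (\<theta>, x)"]
    continuous_on_compose2[OF pic_continuous(2), of UNIV "\<lambda>x. (\<theta>, x)"]
  by (simp_all add: continuous_intros)

lemma rhs_continuous:
  "continuous_on UNIV (\<lambda>x. snd (pic n \<theta>) x / R x)"
  "continuous_on UNIV (\<lambda>x. R x * (fst \<theta> + snd \<theta> * W x) * fst (pic n \<theta>) x)"
proof -
  have "R x \<noteq> 0" for x using R_pos[of x] by simp
  then show "continuous_on UNIV (\<lambda>x. snd (pic n \<theta>) x / R x)"
    "continuous_on UNIV (\<lambda>x. R x * (fst \<theta> + snd \<theta> * W x) * fst (pic n \<theta>) x)"
    by (intro continuous_intros pic_continuous_x R_cont W_cont; simp)+
qed

text \<open>Dominates both coefficients of the system, 1 / R and R (s + \<mu> W), for parameters in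
  [0, b].\<close>

definition Bd :: "real \<Rightarrow> real" where "Bd b = max (1 / r1) (r2 * (b + b * w2))"

lemma Bd_nonneg: "Bd b \<ge> 0" using r1 by (simp add: Bd_def le_max_iff_disj)

lemma pic_bounds:
  assumes "0 \<le> fst \<theta>" "fst \<theta> \<le> b" "0 \<le> snd \<theta>" "snd \<theta> \<le> b" "x \<in> {0..L}"
  shows "0 \<le> fst (pic n \<theta>) x \<and> fst (pic n \<theta>) x \<le> (Bd b * x) ^ n / fact n"
    "0 \<le> snd (pic n \<theta>) x \<and> snd (pic n \<theta>) x \<le> (Bd b * x) ^ n / fact n"
  using assms(5)
proof (induction n arbitrary: x)
  case (Suc n)
  have rb: "0 \<le> R t * (fst \<theta> + snd \<theta> * W t)" "R t * (fst \<theta> + snd \<theta> * W t) \<le> Bd b" for t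
  proof -
    have "snd \<theta> * W t \<le> b * w2" using W_bd[of t] assms by (intro mult_mono) auto
    then have "R t * (fst \<theta> + snd \<theta> * W t) \<le> r2 * (b + b * w2)"
      using R_bd[of t] R_pos[of t] W_bd[of t] assms r2 by (intro mult_mono add_mono add_nonneg_nonneg mult_nonneg_nonneg) auto
    then show "R t * (fst \<theta> + snd \<theta> * W t) \<le> Bd b" by (simp add: Bd_def)
    show "0 \<le> R t * (fst \<theta> + snd \<theta> * W t)"
      using R_pos[of t] W_bd[of t] assms by (intro mult_nonneg_nonneg add_nonneg_nonneg) auto
  qed
  have ib: "1 / R t \<le> Bd b" for t
  proof -
    have "1 / R t \<le> 1 / r1" using R_bd(1)[of t] r1 by (simp add: frac_le)
    then show ?thesis by (simp add: Bd_def)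
  qed
  { case 1
    have "0 \<le> snd (pic n \<theta>) t / R t \<and> snd (pic n \<theta>) t / R t \<le> Bd b * ((Bd b * t) ^ n / fact n)" if "t \<in> {0..L}" for t
    proof
      show "0 \<le> snd (pic n \<theta>) t / R t" using Suc.IH(2)[OF that] R_pos[of t] by simp
      have "1 / R t * snd (pic n \<theta>) t \<le> Bd b * ((Bd b * t) ^ n / fact n)"
        using Suc.IH(2)[OF that] ib[of t] Bd_nonneg by (intro mult_mono) auto
      then show "snd (pic n \<theta>) t / R t \<le> Bd b * ((Bd b * t) ^ n / fact n)" by simp
    qed
    from prim_bounds[OF rhs_continuous(1) 1 Bd_nonneg this] show ?case by simp
  next
    case 2
    have "0 \<le> R t * (fst \<theta> + snd \<theta> * W t) * fst (pic n \<theta>) t \<and>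
        R t * (fst \<theta> + snd \<theta> * W t) * fst (pic n \<theta>) t \<le> Bd b * ((Bd b * t) ^ n / fact n)" if "t \<in> {0..L}" for t
      using Suc.IH(1)[OF that] mult_nonneg_nonneg[OF rb(1)[of t]] mult_mono[OF rb(2)[of t] _ Bd_nonneg] by blast
    from prim_bounds[OF rhs_continuous(2) 2 Bd_nonneg this] show ?case by simp
  }
qed auto

definition u :: "real \<Rightarrow> real \<Rightarrow> real \<Rightarrow> real" where "u s \<mu> x = (\<Sum>n. fst (pic n (s, \<mu>)) x)"
definition v :: "real \<Rightarrow> real \<Rightarrow> real \<Rightarrow> real" where "v s \<mu> x = (\<Sum>n. snd (pic n (s, \<mu>)) x)"

text \<open>The majorant (B L)^n / n! is the same for all parameters in a bounded range, so
  convergence is uniform in (s, \<mu>, x) jointly.\<close>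

lemma pic_uniform:
  fixes h
  assumes h: "h = fst \<or> h = snd" and b: "b \<ge> 0"
  shows "\<And>q. q \<in> ({0..b} \<times> {0..b}) \<times> {0..L} \<Longrightarrow> norm (h (pic n (fst q)) (snd q)) \<le> (Bd b * L) ^ n / fact n"
    "summable (\<lambda>n. (Bd b * L) ^ n / fact n)"
    "uniform_limit (({0..b} \<times> {0..b}) \<times> {0..L}) (\<lambda>n q. \<Sum>i<n. h (pic i (fst q)) (snd q)) (\<lambda>q. \<Sum>i. h (pic i (fst q)) (snd q)) sequentially"
proof -
  show s: "summable (\<lambda>n. (Bd b * L) ^ n / fact n)"
    using summable_exp[of "Bd b * L"] by (simp add: field_simps)
  show n: "norm (h (pic n (fst q)) (snd q)) \<le> (Bd b * L) ^ n / fact n" if q: "q \<in> ({0..b} \<times> {0..b}) \<times> {0..L}" for n q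
  proof -
    have "0 \<le> h (pic n (fst q)) (snd q) \<and> h (pic n (fst q)) (snd q) \<le> (Bd b * snd q) ^ n / fact n"
      using h pic_bounds[of "fst q" b "snd q" n] q by (auto simp: mem_Times_iff)
    moreover have "(Bd b * snd q) ^ n / fact n \<le> (Bd b * L) ^ n / fact n"
      using q Bd_nonneg by (intro divide_right_mono power_mono mult_left_mono) (auto simp: mem_Times_iff)
    ultimately show ?thesis by simp
  qed
  show "uniform_limit (({0..b} \<times> {0..b}) \<times> {0..L}) (\<lambda>n q. \<Sum>i<n. h (pic i (fst q)) (snd q)) (\<lambda>q. \<Sum>i. h (pic i (fst q)) (snd q)) sequentially"
    by (rule Weierstrass_m_test[OF n s])
qed

lemma uv_summable:
  assumes "s \<ge> 0" "\<mu> \<ge> 0" "x \<in> {0..L}"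
  shows "summable (\<lambda>n. fst (pic n (s, \<mu>)) x)" "summable (\<lambda>n. snd (pic n (s, \<mu>)) x)"
proof -
  let ?b = "max s \<mu>"
  have q: "((s, \<mu>), x) \<in> ({0..?b} \<times> {0..?b}) \<times> {0..L}" "?b \<ge> 0" using assms by auto
  show "summable (\<lambda>n. fst (pic n (s, \<mu>)) x)" "summable (\<lambda>n. snd (pic n (s, \<mu>)) x)"
    using pic_uniform(1)[of fst ?b "((s, \<mu>), x)"] pic_uniform(1)[of snd ?b "((s, \<mu>), x)"] q
    by (auto intro!: summable_comparison_test'[OF pic_uniform(2)[of fst ?b], of 0])
qed

lemma uv_continuous:
  "continuous_on (({0..} \<times> {0..}) \<times> {0..L}) (\<lambda>q. u (fst (fst q)) (snd (fst q)) (snd q))"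
  "continuous_on (({0..} \<times> {0..}) \<times> {0..L}) (\<lambda>q. v (fst (fst q)) (snd (fst q)) (snd q))"
proof -
  have *: "continuous_on (({0..} \<times> {0..}) \<times> {0..L}) (\<lambda>q. \<Sum>i. h (pic i (fst q)) (snd q))"
    if h: "h = fst \<or> h = snd" for h :: "(real \<Rightarrow> real) \<times> (real \<Rightarrow> real) \<Rightarrow> real \<Rightarrow> real"
    unfolding continuous_on_eq_continuous_within
  proof
    fix q :: "(real \<times> real) \<times> real" assume q: "q \<in> ({0..} \<times> {0..}) \<times> {0..L}"
    \<comment> \<open>The extra 1 puts both parameters strictly below \<open>b\<close>, so that the
      box is a neighbourhood of the point relative to the quadrant.\<close>
    define b where "b = max (fst (fst q)) (snd (fst q)) + 1"
    have b: "b \<ge> 0" using q by (auto simp: b_def mem_Times_iff)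
    have "continuous_on (({0..b} \<times> {0..b}) \<times> {0..L}) (\<lambda>q. \<Sum>i. h (pic i (fst q)) (snd q))"
    proof (rule uniform_limit_theorem[OF _ pic_uniform(3)[OF h b]])
      show "\<forall>\<^sub>F n in sequentially. continuous_on (({0..b} \<times> {0..b}) \<times> {0..L}) (\<lambda>q. \<Sum>i<n. h (pic i (fst q)) (snd q))"
        using h pic_continuous by (intro always_eventually allI continuous_intros) (auto intro: continuous_on_subset)
    qed simp
    moreover have qb: "q \<in> ({0..b} \<times> {0..b}) \<times> {0..L}" using q by (auto simp: b_def mem_Times_iff)
    ultimately have "continuous (at q within ({0..b} \<times> {0..b}) \<times> {0..L}) (\<lambda>q. \<Sum>i. h (pic i (fst q)) (snd q))"
      using continuous_on_eq_continuous_within by blast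
    moreover have "at q within ({0..b} \<times> {0..b}) \<times> {0..L} = at q within ({0..} \<times> {0..}) \<times> {0..L}"
    proof (rule at_within_nhd[of _ "({..<b} \<times> {..<b}) \<times> UNIV"])
      show "q \<in> ({..<b} \<times> {..<b}) \<times> UNIV" by (auto simp: b_def mem_Times_iff)
      show "open (({..<b} \<times> {..<b}) \<times> (UNIV :: real set))" by (intro open_Times) auto
    qed auto
    ultimately show "continuous (at q within ({0..} \<times> {0..}) \<times> {0..L}) (\<lambda>q. \<Sum>i. h (pic i (fst q)) (snd q))"
      by simp
  qed
  show "continuous_on (({0..} \<times> {0..}) \<times> {0..L}) (\<lambda>q. u (fst (fst q)) (snd (fst q)) (snd q))"
    "continuous_on (({0..} \<times> {0..}) \<times> {0..L}) (\<lambda>q. v (fst (fst q)) (snd (fst q)) (snd q))"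
    using *[of fst] *[of snd] by (simp_all add: u_def v_def)
qed

section \<open>Bounds for the solution at fixed parameters\<close>

context
  fixes s \<mu> :: real
  assumes s: "s \<ge> 0" and mu: "\<mu> \<ge> 0"
begin

lemma uv_0: "u s \<mu> 0 = 1" "v s \<mu> 0 = 0"
proof -
  have "(\<lambda>n. fst (pic n (s, \<mu>)) 0) = (\<lambda>n. if n = 0 then 1 else 0)" "(\<lambda>n. snd (pic n (s, \<mu>)) 0) = (\<lambda>n. 0)"
  proof -
    have "fst (pic n (s, \<mu>)) 0 = (if n = 0 then 1 else 0)" "snd (pic n (s, \<mu>)) 0 = 0" for n
      by (cases n; simp add: prim_def)+
    then show "(\<lambda>n. fst (pic n (s, \<mu>)) 0) = (\<lambda>n. if n = 0 then 1 else 0)" "(\<lambda>n. snd (pic n (s, \<mu>)) 0) = (\<lambda>n. 0)"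
      by auto
  qed
  then show "u s \<mu> 0 = 1" "v s \<mu> 0 = 0"
    using sums_unique[OF sums_single[of 0 "\<lambda>_. 1::real"]] by (simp_all add: u_def v_def)
qed

lemma uv_nonneg: "x \<in> {0..L} \<Longrightarrow> 1 \<le> u s \<mu> x" "x \<in> {0..L} \<Longrightarrow> 0 \<le> v s \<mu> x"
proof -
  assume x: "x \<in> {0..L}"
  have nn: "0 \<le> fst (pic n (s, \<mu>)) x" "0 \<le> snd (pic n (s, \<mu>)) x" for n
    using pic_bounds[of "(s, \<mu>)" "max s \<mu>" x n] s mu x by auto
  have "(\<Sum>n<1. fst (pic n (s, \<mu>)) x) \<le> u s \<mu> x"
    unfolding u_def by (rule sum_le_suminf[OF uv_summable(1)[OF s mu x]]) (use nn in auto)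
  then show "1 \<le> u s \<mu> x" by simp
  show "0 \<le> v s \<mu> x" unfolding v_def by (rule suminf_nonneg[OF uv_summable(2)[OF s mu x]]) (use nn in auto)
qed

text \<open>Term-by-term differentiation of the Picard series. Both equations have the same shape,
  so \<open>lim\<close> treats a component \<open>h\<close> whose summand n + 1 has as derivative
  \<open>c\<close> times summand n of the other component \<open>h2\<close>.\<close>

lemma uv_deriv:
  assumes x: "x \<in> {0..L}"
  shows "(u s \<mu> has_real_derivative v s \<mu> x / R x) (at x within {0..L})"
    "(v s \<mu> has_real_derivative R x * (s + \<mu> * W x) * u s \<mu> x) (at x within {0..L})"
proof -
  let ?b = "max s \<mu>"
  have b: "?b \<ge> 0" using s by simp
  have un: "uniform_limit {0..L} (\<lambda>n x. \<Sum>i<n. h (pic i (s, \<mu>)) x) (\<lambda>x. \<Sum>i. h (pic i (s, \<mu>)) x) sequentially"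
    if "h = fst \<or> h = snd" for h :: "(real \<Rightarrow> real) \<times> (real \<Rightarrow> real) \<Rightarrow> real \<Rightarrow> real"
    using s mu pic_uniform(1)[OF that b, where q = "((s, \<mu>), _)"]
    by (intro Weierstrass_m_test[OF _ pic_uniform(2)[OF that b]]) auto
  have lim: "(h' has_real_derivative g x) (at x within {0..L})"
    if h: "h = fst \<or> h = snd" and h'_def: "h' = (\<lambda>x. \<Sum>i. h (pic i (s, \<mu>)) x)"
      and d: "\<And>n x. x \<in> {0..L} \<Longrightarrow> (h (pic (Suc n) (s, \<mu>)) has_real_derivative c x * h2 (pic n (s, \<mu>)) x) (at x within {0..L})"
      and d0: "\<And>x. (h (pic 0 (s, \<mu>)) has_real_derivative 0) (at x within {0..L})"
      and h2: "h2 = fst \<or> h2 = snd" and c: "continuous_on UNIV c"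
      and g: "g = (\<lambda>x. c x * (\<Sum>i. h2 (pic i (s, \<mu>)) x))"
    for h h2 :: "(real \<Rightarrow> real) \<times> (real \<Rightarrow> real) \<Rightarrow> real \<Rightarrow> real" and h' c g
  proof -
    \<comment> \<open>The constant initial summand contributes 0, which shifts the index by
      one.\<close>
    let ?f' = "\<lambda>n x. case n of 0 \<Rightarrow> 0 | Suc m \<Rightarrow> c x * h2 (pic m (s, \<mu>)) x"
    have cb: "bounded (c ` {0..L})"
      using c by (intro compact_imp_bounded compact_continuous_image) (auto intro: continuous_on_subset)
    have gb: "bounded ((\<lambda>x. \<Sum>i. h2 (pic i (s, \<mu>)) x) ` {0..L})"
    proof (intro compact_imp_bounded compact_continuous_image)
      show "continuous_on {0..L} (\<lambda>x. \<Sum>i. h2 (pic i (s, \<mu>)) x)"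
      proof (rule uniform_limit_theorem[OF _ un[OF h2]])
        have "continuous_on {0..L} (h2 (pic i (s, \<mu>)))" for i
          using h2 continuous_on_subset[OF pic_continuous_x(1)] continuous_on_subset[OF pic_continuous_x(2)] by auto
        then show "\<forall>\<^sub>F n in sequentially. continuous_on {0..L} (\<lambda>x. \<Sum>i<n. h2 (pic i (s, \<mu>)) x)"
          by (intro always_eventually allI continuous_intros)
      qed simp
    qed simp
    have "uniform_limit {0..L} (\<lambda>n x. c x * (\<Sum>i<n. h2 (pic i (s, \<mu>)) x)) g sequentially"
      unfolding g by (rule uniform_lim_mult[OF uniform_limit_const un[OF h2] cb gb])
    moreover have "(\<Sum>i<Suc n. ?f' i x) = c x * (\<Sum>i<n. h2 (pic i (s, \<mu>)) x)" for n x
      by (subst sum.lessThan_Suc_shift) (simp add: sum_distrib_left)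
    ultimately have "uniform_limit {0..L} (\<lambda>n x. \<Sum>i<Suc n. ?f' i x) g sequentially" by simp
    then have U: "uniform_limit {0..L} (\<lambda>n x. \<Sum>i<n. ?f' i x) g sequentially"
      using filterlim_sequentially_Suc[of "\<lambda>n x. \<Sum>i<n. ?f' i x"] by blast
    have "\<exists>k. \<forall>x\<in>{0..L}. (\<lambda>n. h (pic n (s, \<mu>)) x) sums k x \<and> (k has_field_derivative g x) (at x within {0..L})"
    proof (rule has_field_derivative_series[OF _ _ U])
      show "(h (pic n (s, \<mu>)) has_real_derivative ?f' n x) (at x within {0..L})" if "x \<in> {0..L}" for n x
        using d[OF that] d0 by (cases n) auto
      show "summable (\<lambda>n. h (pic n (s, \<mu>)) x)" using uv_summable[OF s mu x] h by auto
    qed (use x in auto)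
    then obtain k where k: "\<And>x. x \<in> {0..L} \<Longrightarrow> (\<lambda>n. h (pic n (s, \<mu>)) x) sums k x"
      "\<And>x. x \<in> {0..L} \<Longrightarrow> (k has_field_derivative g x) (at x within {0..L})" by blast
    have "h' x = k x" if "x \<in> {0..L}" for x using sums_unique[OF k(1)[OF that]] by (simp add: h'_def)
    then show ?thesis
      by (intro has_field_derivative_transform_within[OF k(2)[OF x] zero_less_one x]) simp
  qed
  have iR: "continuous_on UNIV (\<lambda>x. 1 / R x)"
    using R_cont less_imp_neq[OF R_pos, symmetric] by (intro continuous_intros) auto
  have "(u s \<mu> has_real_derivative (1 / R x * v s \<mu> x)) (at x within {0..L})"
  proof (rule lim[of fst _ "\<lambda>x. 1 / R x" snd, OF _ _ _ _ _ iR])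
    show "(fst (pic (Suc n) (s, \<mu>)) has_real_derivative 1 / R x * snd (pic n (s, \<mu>)) x) (at x within {0..L})" if "x \<in> {0..L}" for n x
      using prim_deriv[OF rhs_continuous(1) that] by simp
  qed (auto simp: u_def[abs_def] v_def[abs_def])
  then show "(u s \<mu> has_real_derivative v s \<mu> x / R x) (at x within {0..L})" by simp
  have kc: "continuous_on UNIV (\<lambda>x. R x * (s + \<mu> * W x))" using R_cont W_cont by (intro continuous_intros)
  show "(v s \<mu> has_real_derivative R x * (s + \<mu> * W x) * u s \<mu> x) (at x within {0..L})"
  proof (rule lim[of snd _ "\<lambda>x. R x * (s + \<mu> * W x)" fst, OF _ _ _ _ _ kc])
    show "(snd (pic (Suc n) (s, \<mu>)) has_real_derivative R x * (s + \<mu> * W x) * fst (pic n (s, \<mu>)) x) (at x within {0..L})" if "x \<in> {0..L}" for n x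
      using prim_deriv[OF rhs_continuous(2) that, of "(s, \<mu>)" n] by simp
  qed (auto simp: u_def[abs_def] v_def[abs_def])
qed

lemma v_mono: "0 \<le> x \<Longrightarrow> x \<le> y \<Longrightarrow> y \<le> L \<Longrightarrow> v s \<mu> x \<le> v s \<mu> y"
proof (rule nondecreasing_within[OF uv_deriv(2)])
  fix x assume "x \<in> {0..L}"
  then show "0 \<le> R x * (s + \<mu> * W x) * u s \<mu> x"
    using R_pos[of x] W_bd[of x] s mu uv_nonneg(1)[of x] by (intro mult_nonneg_nonneg add_nonneg_nonneg) auto
qed auto

lemma u_mono: "0 \<le> x \<Longrightarrow> x \<le> y \<Longrightarrow> y \<le> L \<Longrightarrow> u s \<mu> x \<le> u s \<mu> y"
proof (rule nondecreasing_within[OF uv_deriv(1)])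
  fix x assume "x \<in> {0..L}"
  then show "0 \<le> v s \<mu> x / R x" using R_pos[of x] uv_nonneg(2)[of x] by auto
qed auto

lemma v_lower: assumes x: "x \<in> {0..L}" shows "r1 * s * x \<le> v s \<mu> x"
proof -
  have "v s \<mu> 0 - r1 * s * 0 \<le> v s \<mu> x - r1 * s * x"
  proof (rule nondecreasing_within[of 0 L "\<lambda>x. v s \<mu> x - r1 * s * x" "\<lambda>x. R x * (s + \<mu> * W x) * u s \<mu> x - r1 * s"])
    fix x assume x: "x \<in> {0..L}"
    show "((\<lambda>x. v s \<mu> x - r1 * s * x) has_real_derivative R x * (s + \<mu> * W x) * u s \<mu> x - r1 * s) (at x within {0..L})"
      using uv_deriv(2)[OF x] by (auto intro!: derivative_eq_intros)
    have "r1 * s \<le> R x * (s + \<mu> * W x)"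
      using R_bd(1)[of x] r1 s mu W_bd[of x] by (intro mult_mono) auto
    also have "\<dots> \<le> R x * (s + \<mu> * W x) * u s \<mu> x"
      using uv_nonneg(1)[OF x] R_pos[of x] W_bd[of x] s mu by (intro mult_right_le_one_le[THEN order_trans, rotated] mult_left_mono[of 1 "u s \<mu> x", simplified]) (auto intro!: mult_nonneg_nonneg add_nonneg_nonneg)
    finally show "0 \<le> R x * (s + \<mu> * W x) * u s \<mu> x - r1 * s" by simp
  qed (use x in auto)
  then show ?thesis by (simp add: uv_0)
qed

lemma v_L_pos: "s > 0 \<Longrightarrow> v s \<mu> L > 0"
  using v_lower[of L] L r1 by (auto intro: less_le_trans[of _ "r1 * s * L"])

text \<open>An energy estimate: the difference of the two sides vanishes at the wall, and its
  derivative 2 u v (R (s + \<mu> W) - s r1^2 / R) is nonnegative because R is at least r1. It bounds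
  v below by a multiple of sqrt s u once u is away from 1.\<close>

lemma energy_lower: assumes x: "x \<in> {0..L}" shows "s * r1\<^sup>2 * ((u s \<mu> x)\<^sup>2 - 1) \<le> (v s \<mu> x)\<^sup>2"
proof -
  let ?f = "\<lambda>x. (v s \<mu> x)\<^sup>2 - s * r1\<^sup>2 * ((u s \<mu> x)\<^sup>2 - 1)"
  have "?f 0 \<le> ?f x"
  proof (rule nondecreasing_within[of 0 L ?f "\<lambda>x. 2 * u s \<mu> x * v s \<mu> x * (R x * (s + \<mu> * W x) - s * r1\<^sup>2 / R x)"])
    fix x assume x: "x \<in> {0..L}"
    show "(?f has_real_derivative 2 * u s \<mu> x * v s \<mu> x * (R x * (s + \<mu> * W x) - s * r1\<^sup>2 / R x)) (at x within {0..L})"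
      using R_pos[of x] by (auto intro!: derivative_eq_intros uv_deriv[OF x] simp: field_simps)
    have "r1\<^sup>2 / R x \<le> R x" using R_bd(1)[of x] r1 R_pos[of x] by (simp add: divide_le_eq power2_eq_square mult_mono)
    then have "s * r1\<^sup>2 / R x \<le> s * R x" using s mult_left_mono by fastforce
    also have "\<dots> \<le> R x * (s + \<mu> * W x)" using R_pos[of x] W_bd[of x] mu by (simp add: algebra_simps)
    finally show "0 \<le> 2 * u s \<mu> x * v s \<mu> x * (R x * (s + \<mu> * W x) - s * r1\<^sup>2 / R x)"
      using uv_nonneg[OF x] by simp
  qed (use x in auto)
  then show ?thesis by (simp add: uv_0)
qed

text \<open>The same energy argument in the opposite direction, with the upper bounds of the
  coefficients.\<close>

lemma energy_upper: assumes x: "x \<in> {0..L}" shows "(v s \<mu> x)\<^sup>2 \<le> (s + \<mu> * w2) * r2\<^sup>2 * ((u s \<mu> x)\<^sup>2 - 1)"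
proof -
  let ?f = "\<lambda>x. (s + \<mu> * w2) * r2\<^sup>2 * ((u s \<mu> x)\<^sup>2 - 1) - (v s \<mu> x)\<^sup>2"
  have "?f 0 \<le> ?f x"
  proof (rule nondecreasing_within[of 0 L ?f "\<lambda>x. 2 * u s \<mu> x * v s \<mu> x * ((s + \<mu> * w2) * r2\<^sup>2 / R x - R x * (s + \<mu> * W x))"])
    fix x assume x: "x \<in> {0..L}"
    show "(?f has_real_derivative 2 * u s \<mu> x * v s \<mu> x * ((s + \<mu> * w2) * r2\<^sup>2 / R x - R x * (s + \<mu> * W x))) (at x within {0..L})"
      using R_pos[of x] by (auto intro!: derivative_eq_intros uv_deriv[OF x] simp: field_simps)
    have "R x \<le> r2\<^sup>2 / R x" using R_bd(2)[of x] R_pos[of x] by (simp add: le_divide_eq power2_eq_square mult_mono)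
    moreover have "s + \<mu> * W x \<le> s + \<mu> * w2" "0 \<le> s + \<mu> * W x" using W_bd[of x] mu s by (auto intro: mult_left_mono)
    ultimately have "(s + \<mu> * W x) * R x \<le> (s + \<mu> * w2) * (r2\<^sup>2 / R x)" using R_pos[of x] by (intro mult_mono) auto
    then show "0 \<le> 2 * u s \<mu> x * v s \<mu> x * ((s + \<mu> * w2) * r2\<^sup>2 / R x - R x * (s + \<mu> * W x))"
      using uv_nonneg[OF x] by (simp add: mult.commute)
  qed (use x in auto)
  then show ?thesis by (simp add: uv_0)
qed

text \<open>Integrates the linear lower bound for v; for large s it makes u at least 2 at the
  interface.\<close>

lemma u_lower: assumes x: "x \<in> {0..L}" shows "1 + r1 * s * x\<^sup>2 / (2 * r2) \<le> u s \<mu> x"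
proof -
  let ?f = "\<lambda>x. u s \<mu> x - r1 * s * x\<^sup>2 / (2 * r2)"
  have "?f 0 \<le> ?f x"
  proof (rule nondecreasing_within[of 0 L ?f "\<lambda>x. v s \<mu> x / R x - r1 * s * x / r2"])
    fix x assume x: "x \<in> {0..L}"
    show "(?f has_real_derivative v s \<mu> x / R x - r1 * s * x / r2) (at x within {0..L})"
      using r2 by (auto intro!: derivative_eq_intros uv_deriv[OF x] simp: field_simps)
    have "r1 * s * x / r2 \<le> v s \<mu> x / R x"
      using v_lower[OF x] R_bd(2)[of x] R_pos[of x] uv_nonneg(2)[OF x] by (intro frac_le) auto
    then show "0 \<le> v s \<mu> x / R x - r1 * s * x / r2" by simp
  qed (use x in auto)
  then show ?thesis by (simp add: uv_0)
qed

end

text \<open>Since \<open>\<mu> u = (1 / (s / \<mu> + W)) v' / R\<close>, the quotient \<open>\<mu> u / v\<close> is a logarithmic derivative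
  of \<open>v\<close> for the dual equation, whose coefficients are monotone in \<open>\<mu>\<close>.\<close>

lemma ratio_strict_mono:
  assumes s: "s > 0" and m: "0 \<le> \<mu>1" "\<mu>1 < \<mu>2"
  shows "\<mu>1 * (u s \<mu>1 L / v s \<mu>1 L) < \<mu>2 * (u s \<mu>2 L / v s \<mu>2 L)"
proof -
  have m2: "0 \<le> \<mu>2" "0 \<le> s" using m s by auto
  let ?u1 = "u s \<mu>1" and ?u2 = "u s \<mu>2" and ?v1 = "v s \<mu>1" and ?v2 = "v s \<mu>2"
  \<comment> \<open>The cross-multiplied difference of the two quotients. In its derivative the
    terms containing W carry the common factor \<mu>1 \<mu>2 and cancel, which leaves a manifestly
    positive expression.\<close>
  let ?f = "\<lambda>x. \<mu>2 * (?u2 x * ?v1 x) - \<mu>1 * (?u1 x * ?v2 x)"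
  have "?f 0 < ?f L"
  proof (rule increasing_within[of 0 L ?f "\<lambda>x. (\<mu>2 - \<mu>1) * (?v1 x * ?v2 x / R x + s * R x * ?u1 x * ?u2 x)"])
    fix x assume x: "x \<in> {0..L}"
    note d1 = uv_deriv[OF m2(2) m(1) x] and d2 = uv_deriv[OF m2(2) m2(1) x]
    show "(?f has_real_derivative (\<mu>2 - \<mu>1) * (?v1 x * ?v2 x / R x + s * R x * ?u1 x * ?u2 x)) (at x within {0..L})"
      using R_pos[of x] by (auto intro!: derivative_eq_intros d1 d2 simp: field_simps)
    have "0 \<le> ?v1 x" "0 \<le> ?v2 x" "1 \<le> ?u1 x" "1 \<le> ?u2 x"
      using uv_nonneg[OF m2(2) m(1) x] uv_nonneg[OF m2(2) m2(1) x] by auto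
    then show "0 < (\<mu>2 - \<mu>1) * (?v1 x * ?v2 x / R x + s * R x * ?u1 x * ?u2 x)"
      using m s R_pos[of x] by (intro mult_pos_pos add_nonneg_pos) auto
  qed (use L in auto)
  then have "\<mu>1 * (?u1 L * ?v2 L) < \<mu>2 * (?u2 L * ?v1 L)"
    by (simp add: uv_0[OF m2(2) m(1)] uv_0[OF m2(2) m2(1)])
  then show ?thesis
    using v_L_pos[OF m2(2) m(1) s] v_L_pos[OF m2(2) m2(1) s] by (simp add: field_simps)
qed

text \<open>The threshold for s is the condition r1 s L^2 / (2 r2) \<ge> 1, which yields u \<ge> 2
  and hence u^2 - 1 \<ge> u^2 / 4 in the energy estimate.\<close>

lemma ratio_upper:
  assumes "s \<ge> 2 * r2 / (r1 * L\<^sup>2)" "s > 0" "\<mu> \<ge> 0"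
  shows "u s \<mu> L / v s \<mu> L \<le> 2 / (r1 * sqrt s)"
proof -
  have s0: "s \<ge> 0" and LL: "L \<in> {0..L}" using assms L by auto
  have "1 \<le> r1 * s * L\<^sup>2 / (2 * r2)" using assms(1) r1 r2 L by (simp add: field_simps)
  then have u2: "u s \<mu> L \<ge> 2" using u_lower[OF s0 assms(3) LL] by simp
  then have "4 \<le> (u s \<mu> L)\<^sup>2" using power_mono[OF u2, of 2] by simp
  then have "(u s \<mu> L)\<^sup>2 / 4 \<le> (u s \<mu> L)\<^sup>2 - 1" by simp
  then have "s * r1\<^sup>2 * ((u s \<mu> L)\<^sup>2 / 4) \<le> s * r1\<^sup>2 * ((u s \<mu> L)\<^sup>2 - 1)" using s0 by (intro mult_left_mono) auto
  also have "\<dots> \<le> (v s \<mu> L)\<^sup>2" by (rule energy_lower[OF s0 assms(3) LL])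
  finally have "(sqrt s * r1 * u s \<mu> L / 2)\<^sup>2 \<le> (v s \<mu> L)\<^sup>2" using s0 by (simp add: power_mult_distrib power_divide)
  then have "sqrt s * r1 * u s \<mu> L / 2 \<le> v s \<mu> L"
    using uv_nonneg(2)[OF s0 assms(3) LL] by (rule power2_le_imp_le)
  then show ?thesis using v_L_pos[OF s0 assms(3,2)] r1 assms(2) by (simp add: field_simps)
qed

text \<open>Serves the existence of a root: it bounds the left-hand side of the dispersion relation
  below by a multiple of \<mu> / sqrt (s + \<mu> w2), which is unbounded in \<mu>.\<close>

lemma ratio_lower:
  assumes "s > 0" "\<mu> \<ge> 0"
  shows "1 / (r2 * sqrt (s + \<mu> * w2)) \<le> u s \<mu> L / v s \<mu> L"
proof -
  have s0: "s \<ge> 0" and LL: "L \<in> {0..L}" using assms L by auto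
  have k: "s + \<mu> * w2 > 0" using assms w2 by (simp add: add_pos_nonneg)
  have "(v s \<mu> L)\<^sup>2 \<le> (s + \<mu> * w2) * r2\<^sup>2 * ((u s \<mu> L)\<^sup>2 - 1)" by (rule energy_upper[OF s0 assms(2) LL])
  also have "\<dots> \<le> (s + \<mu> * w2) * r2\<^sup>2 * (u s \<mu> L)\<^sup>2" using k by (intro mult_left_mono) auto
  also have "\<dots> = (sqrt (s + \<mu> * w2) * r2 * u s \<mu> L)\<^sup>2" using k by (simp add: power_mult_distrib)
  finally have sq: "(v s \<mu> L)\<^sup>2 \<le> (sqrt (s + \<mu> * w2) * r2 * u s \<mu> L)\<^sup>2" .
  have "0 \<le> u s \<mu> L" using uv_nonneg(1)[OF s0 assms(2) LL] by linarith
  then have "0 \<le> sqrt (s + \<mu> * w2) * r2 * u s \<mu> L"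
    using k r2 by (intro mult_nonneg_nonneg) simp_all
  from power2_le_imp_le[OF sq this]
  have "v s \<mu> L \<le> sqrt (s + \<mu> * w2) * r2 * u s \<mu> L" .
  then show ?thesis using v_L_pos[OF s0 assms(2,1)] r2 k by (simp add: field_simps)
qed

lemma ratio_continuous:
  "continuous_on ({0<..} \<times> {0..}) (\<lambda>q. u (fst q) (snd q) L / v (fst q) (snd q) L)"
proof (intro continuous_on_divide)
  have c: "continuous_on ({0<..} \<times> {0..}) (\<lambda>q::real \<times> real. (q, L))" by (intro continuous_intros)
  have i: "(\<lambda>q::real \<times> real. (q, L)) ` ({0<..} \<times> {0..}) \<subseteq> ({0..} \<times> {0..}) \<times> {0..L}" using L by auto
  show "continuous_on ({0<..} \<times> {0..}) (\<lambda>q. u (fst q) (snd q) L)"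
    using continuous_on_compose2[OF uv_continuous(1) c i] by simp
  show "continuous_on ({0<..} \<times> {0..}) (\<lambda>q. v (fst q) (snd q) L)"
    using continuous_on_compose2[OF uv_continuous(2) c i] by simp
  show "\<forall>q\<in>{0<..} \<times> {0..}. v (fst q) (snd q) L \<noteq> 0"
  proof
    fix q :: "real \<times> real" assume "q \<in> {0<..} \<times> {0..}"
    then have "v (fst q) (snd q) L > 0" by (intro v_L_pos) auto
    then show "v (fst q) (snd q) L \<noteq> 0" by simp
  qed
qed

end

section \<open>The dispersion relation\<close>

text \<open>No derivative is used: the signs of \<open>F s \<mu> - c\<close> at \<mu> = M(s0) - d
  and \<mu> = M(s0) + d persist for s near s0 and trap M(s) in between. Continuity of the root makes
  the amplitudes continuous in \<xi>.\<close>

lemma implicit_function_strict_mono: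
  fixes F :: "real \<Rightarrow> real \<Rightarrow> real"
  assumes cont: "continuous_on ({0<..} \<times> {0..}) (\<lambda>q. F (fst q) (snd q))"
    and strict: "\<And>s \<mu>1 \<mu>2. s > 0 \<Longrightarrow> 0 \<le> \<mu>1 \<Longrightarrow> \<mu>1 < \<mu>2 \<Longrightarrow> F s \<mu>1 < F s \<mu>2"
    and low: "\<And>s. s > 0 \<Longrightarrow> F s 0 < c" and high: "\<And>s. s > 0 \<Longrightarrow> 0 < K s \<and> c < F s (K s)"
  obtains M where "\<And>s. s > 0 \<Longrightarrow> 0 < M s \<and> M s < K s \<and> F s (M s) = c" "continuous_on {0<..} M"
proof -
  have cmu: "continuous_on {0..} (F s)" if "s > 0" for s
    using continuous_on_compose2[OF cont, of "{0..}" "\<lambda>\<mu>. (s, \<mu>)"] that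
    by (simp add: continuous_intros image_subset_iff)
  have cs: "continuous_on {0<..} (\<lambda>s. F s \<mu>)" if "\<mu> \<ge> 0" for \<mu>
    using continuous_on_compose2[OF cont, of "{0<..}" "\<lambda>s. (s, \<mu>)"] that
    by (simp add: continuous_intros image_subset_iff)
  have "\<exists>\<mu>. 0 < \<mu> \<and> \<mu> < K s \<and> F s \<mu> = c" if s: "s > 0" for s
  proof -
    have "\<exists>x\<ge>0. x \<le> K s \<and> F s x = c"
      by (rule IVT') (use low[OF s] high[OF s] cmu[OF s] in \<open>auto intro: continuous_on_subset\<close>)
    then obtain x where x: "x \<ge> 0" "x \<le> K s" "F s x = c" by blast
    moreover have "x \<noteq> 0" "x \<noteq> K s" using x low[OF s] high[OF s] by auto
    ultimately show ?thesis by (intro exI[of _ x]) auto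
  qed
  then obtain M where M: "\<And>s. s > 0 \<Longrightarrow> 0 < M s \<and> M s < K s \<and> F s (M s) = c" by metis
  have "continuous_on {0<..} M"
    unfolding continuous_on_def
  proof
    fix s0 :: real assume "s0 \<in> {0<..}"
    then have s0: "s0 > 0" by simp
    show "(M \<longlongrightarrow> M s0) (at s0 within {0<..})"
    proof (rule tendstoI)
      fix e :: real assume e: "e > 0"
      define d where "d = min (e / 2) (M s0 / 2)"
      have d: "0 < d" "d < e" "d < M s0" using e M[OF s0] by (auto simp: d_def)
      have *: "((\<lambda>s. F s \<mu>) \<longlongrightarrow> F s0 \<mu>) (at s0 within {0<..})" if "\<mu> \<ge> 0" for \<mu>
        using cs[OF that] s0 by (simp add: continuous_on_def)
      have "F s0 (M s0 - d) < F s0 (M s0)" "F s0 (M s0) < F s0 (M s0 + d)"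
        using d M[OF s0] by (auto intro!: strict[OF s0])
      then have "F s0 (M s0 - d) < c" "c < F s0 (M s0 + d)" using M[OF s0] by auto
      then have "\<forall>\<^sub>F s in at s0 within {0<..}. F s (M s0 - d) < c" "\<forall>\<^sub>F s in at s0 within {0<..}. c < F s (M s0 + d)"
        using order_tendstoD[OF *[of "M s0 - d"]] order_tendstoD[OF *[of "M s0 + d"]] d M[OF s0] by auto
      moreover have "\<forall>\<^sub>F s in at s0 within {0<..}. s \<in> {0<..}" by (simp add: eventually_at_filter)
      ultimately show "\<forall>\<^sub>F s in at s0 within {0<..}. dist (M s) (M s0) < e"
      proof eventually_elim
        case (elim s)
        then have s: "s > 0" by simp
        have "M s0 - d < M s"
        proof (rule ccontr)
          assume "\<not> M s0 - d < M s"
          then have "F s (M s) \<le> F s (M s0 - d)"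
            using strict[OF s, of "M s" "M s0 - d"] M[OF s] by (cases "M s = M s0 - d") auto
          then show False using elim M[OF s] by simp
        qed
        moreover have "M s < M s0 + d"
        proof (rule ccontr)
          assume "\<not> M s < M s0 + d"
          then have "F s (M s0 + d) \<le> F s (M s)"
            using strict[OF s, of "M s0 + d" "M s"] M[OF s0] d by (cases "M s = M s0 + d") auto
          then show False using elim M[OF s] by simp
        qed
        ultimately show ?case using d by (auto simp: dist_real_def)
      qed
    qed
  qed
  with M show thesis using that by blast
qed

text \<open>The jump conditions at the interface determine \<open>\<mu> = \<lambda>\<^sup>2\<close> as a function
  of \<open>s = \<bar>\<xi>\<bar>\<^sup>2\<close>.\<close>

locale two_sides = P: side Rp Wp Lp p1 p2 pw + N: side Rm Wm Lm m1 m2 mw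
  for Rp Wp Lp p1 p2 pw Rm Wm Lm m1 m2 mw
begin

definition disp :: "real \<Rightarrow> real \<Rightarrow> real" where
  "disp s \<mu> = \<mu> * ((Rp Lp)\<^sup>2 * (P.u s \<mu> Lp / P.v s \<mu> Lp) + (Rm Lm)\<^sup>2 * (N.u s \<mu> Lm / N.v s \<mu> Lm))"

lemma disp_growth:
  assumes c: "c > 0"
  obtains M K k s1 where "\<And>s. s > 0 \<Longrightarrow> 0 < M s \<and> disp s (M s) = c" "continuous_on {0<..} M"
    "K > 0" "k > 0" "\<And>s. s > 0 \<Longrightarrow> M s \<le> K * (1 + s)" "\<And>s. s \<ge> s1 \<Longrightarrow> s > 0 \<Longrightarrow> k * sqrt s \<le> M s"
proof -
  \<comment> \<open>Chosen so that \<open>(Rp Lp)\<^sup>2 / p2 * c' = c + 1\<close>. The constant K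
    then makes \<mu> / sqrt (s + \<mu> pw), which at \<mu> = K (1 + s) is at least sqrt (K / (1 +
    pw)), exceed c'.\<close>
  define c' where "c' = (c + 1) * p2 / (Rp Lp)\<^sup>2"
  define K where "K = 1 + (1 + pw) * c'\<^sup>2"
  have RL: "Rp Lp > 0" "Rm Lm > 0" using P.R_pos N.R_pos by auto
  have c': "c' > 0" using c P.r2 RL by (simp add: c'_def)
  have K: "K \<ge> 1" using P.w2 by (simp add: K_def)
  have strict: "disp s \<mu>1 < disp s \<mu>2" if "s > 0" "0 \<le> \<mu>1" "\<mu>1 < \<mu>2" for s \<mu>1 \<mu>2
  proof -
    have "(Rp Lp)\<^sup>2 * (\<mu>1 * (P.u s \<mu>1 Lp / P.v s \<mu>1 Lp)) < (Rp Lp)\<^sup>2 * (\<mu>2 * (P.u s \<mu>2 Lp / P.v s \<mu>2 Lp))"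
      "(Rm Lm)\<^sup>2 * (\<mu>1 * (N.u s \<mu>1 Lm / N.v s \<mu>1 Lm)) < (Rm Lm)\<^sup>2 * (\<mu>2 * (N.u s \<mu>2 Lm / N.v s \<mu>2 Lm))"
      by (rule mult_strict_left_mono[OF P.ratio_strict_mono[OF that]] mult_strict_left_mono[OF N.ratio_strict_mono[OF that]];
          use RL in simp)+
    then show ?thesis by (simp add: disp_def algebra_simps)
  qed
  have cont: "continuous_on ({0<..} \<times> {0..}) (\<lambda>q. disp (fst q) (snd q))"
    unfolding disp_def by (intro continuous_intros P.ratio_continuous N.ratio_continuous)
  have high: "0 < K * (1 + s) \<and> c < disp s (K * (1 + s))" if s: "s > 0" for s
  proof
    let ?\<mu> = "K * (1 + s)"
    show mu: "0 < ?\<mu>" using K s by simp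
    have wp: "pw > 0" by (rule P.w2)
    have "c' < sqrt K / sqrt (1 + pw)"
    proof -
      have "c'\<^sup>2 < K / (1 + pw)" using wp by (simp add: K_def field_simps)
      then have "sqrt (c'\<^sup>2) < sqrt (K / (1 + pw))" by (rule real_sqrt_less_mono)
      then show ?thesis using c' by (simp add: real_sqrt_divide)
    qed
    also have "\<dots> \<le> ?\<mu> / sqrt (s + ?\<mu> * pw)"
    proof -
      have "s + ?\<mu> * pw \<le> ?\<mu> * (1 + pw)" using K s wp mult_mono[of 1 K s "1 + s"] by (simp add: algebra_simps)
      then have "sqrt (s + ?\<mu> * pw) \<le> sqrt ?\<mu> * sqrt (1 + pw)" by (simp add: real_sqrt_mult[symmetric])
      moreover have "0 < sqrt (s + ?\<mu> * pw)" using s mu wp by (simp add: add_pos_pos)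
      ultimately have "?\<mu> / (sqrt ?\<mu> * sqrt (1 + pw)) \<le> ?\<mu> / sqrt (s + ?\<mu> * pw)"
        by (intro frac_le) (use mu in auto)
      moreover have "?\<mu> / (sqrt ?\<mu> * sqrt (1 + pw)) = sqrt ?\<mu> / sqrt (1 + pw)"
        using mu by (metis divide_divide_eq_left real_div_sqrt less_imp_le)
      moreover have "sqrt K \<le> sqrt ?\<mu>" using K s by (intro real_sqrt_le_mono) (simp add: algebra_simps)
      then have "sqrt K / sqrt (1 + pw) \<le> sqrt ?\<mu> / sqrt (1 + pw)" using wp by (intro divide_right_mono) auto
      ultimately show ?thesis by linarith
    qed
    finally have "c' < ?\<mu> / sqrt (s + ?\<mu> * pw)" .
    then have "(Rp Lp)\<^sup>2 / p2 * c' < (Rp Lp)\<^sup>2 / p2 * (?\<mu> / sqrt (s + ?\<mu> * pw))"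
      using RL P.r2 by (intro mult_strict_left_mono) auto
    moreover have "(Rp Lp)\<^sup>2 / p2 * c' = c + 1" using RL P.r2 by (simp add: c'_def)
    moreover have "(Rp Lp)\<^sup>2 / p2 * (?\<mu> / sqrt (s + ?\<mu> * pw)) = ?\<mu> * ((Rp Lp)\<^sup>2 * (1 / (p2 * sqrt (s + ?\<mu> * pw))))"
      by simp
    ultimately have "c < ?\<mu> * ((Rp Lp)\<^sup>2 * (1 / (p2 * sqrt (s + ?\<mu> * pw))))" by linarith
    also have "\<dots> \<le> ?\<mu> * ((Rp Lp)\<^sup>2 * (P.u s ?\<mu> Lp / P.v s ?\<mu> Lp))"
      using P.ratio_lower[OF s less_imp_le[OF mu]] mu by (intro mult_left_mono) auto
    \<comment> \<open>One layer alone already exceeds c; the contribution of the other is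
      nonnegative.\<close>
    also have "\<dots> \<le> disp s ?\<mu>"
    proof -
      have "0 \<le> N.u s ?\<mu> Lm / N.v s ?\<mu> Lm"
        using N.uv_nonneg[of s ?\<mu> Lm] N.L s mu by simp
      then show ?thesis using mu unfolding disp_def
        by (intro mult_left_mono) (auto simp del: times_divide_eq_right)
    qed
    finally show "c < disp s ?\<mu>" .
  qed
  have low: "disp s 0 < c" for s using c by (simp add: disp_def)
  obtain M where M: "\<And>s. s > 0 \<Longrightarrow> 0 < M s \<and> M s < K * (1 + s) \<and> disp s (M s) = c" "continuous_on {0<..} M"
    using implicit_function_strict_mono[OF cont strict low high] by blast
  \<comment> \<open>Adds the upper bounds of both layers: the dispersion function is at most \<mu> C
    / sqrt s beyond the threshold s1, so its root is at least (c / C) sqrt s.\<close>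
  define C where "C = (Rp Lp)\<^sup>2 * (2 / p1) + (Rm Lm)\<^sup>2 * (2 / m1)"
  have C: "C > 0" using RL P.r1 N.r1 by (simp add: C_def add_pos_pos)
  define s1 where "s1 = max (2 * p2 / (p1 * Lp\<^sup>2)) (2 * m2 / (m1 * Lm\<^sup>2))"
  have lower: "c / C * sqrt s \<le> M s" if s: "s \<ge> s1" "s > 0" for s
  proof -
    have m: "0 < M s" "0 \<le> M s" using M(1)[OF s(2)] by auto
    have "c = disp s (M s)" using M(1)[OF s(2)] by simp
    also have "\<dots> \<le> M s * ((Rp Lp)\<^sup>2 * (2 / (p1 * sqrt s)) + (Rm Lm)\<^sup>2 * (2 / (m1 * sqrt s)))"
      unfolding disp_def using s m(2)
      by (intro mult_left_mono add_mono P.ratio_upper N.ratio_upper) (auto simp: s1_def)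
    also have "\<dots> = M s * C / sqrt s" by (simp add: C_def add_divide_distrib distrib_left)
    finally show ?thesis using s C by (simp add: field_simps)
  qed
  show thesis
    by (rule that[of M K "c / C" s1]) (use M K C c lower in \<open>auto simp: less_imp_le\<close>)
qed

end

text \<open>\<open>Cr n\<close> hides its derivative under an existential quantifier, so each n
  could come with its own. One-sided derivatives on a nondegenerate interval are unique, hence a
  single one serves all n.\<close>

lemma Cr_all_deriv:
  assumes ab: "a < b" and f: "\<And>n. Cr n {a..b} f"
  obtains f' where "\<And>x. x \<in> {a..b} \<Longrightarrow> (f has_real_derivative f' x) (at x within {a..b})" "\<And>n. Cr n {a..b} f'"
proof -
  have "\<exists>f'. (\<forall>x\<in>{a..b}. (f has_real_derivative f' x) (at x within {a..b})) \<and> Cr n {a..b} f'" for n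
    using f[of "Suc n"] by simp
  then obtain F where F: "\<And>n x. x \<in> {a..b} \<Longrightarrow> (f has_real_derivative F n x) (at x within {a..b})" "\<And>n. Cr n {a..b} (F n)"
    by metis
  have eq: "F n x = F 0 x" if "x \<in> {a..b}" for n x
    using vector_derivative_unique_within_closed_interval[of a b x f "F n x" "F 0 x"] F(1)[OF that] ab that
    by (simp add: has_real_derivative_iff_has_vector_derivative)
  have "Cr n {a..b} (F 0)" for n by (rule Cr_cong[OF eq F(2)[of n]])
  with F(1)[of _ 0] show thesis using that by blast
qed

text \<open>Polynomials in s and \<mu> whose coefficients are smooth functions of z, generated
  inductively so that the closure properties and the growth bound are plain inductions.\<close>

inductive coef :: "real set \<Rightarrow> (real \<Rightarrow> real \<Rightarrow> real \<Rightarrow> real) \<Rightarrow> bool" for S where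
  base: "(\<And>n. Cr n S f) \<Longrightarrow> coef S (\<lambda>s \<mu> z. f z)"
| s: "coef S A \<Longrightarrow> coef S (\<lambda>s \<mu> z. s * A s \<mu> z)"
| mu: "coef S A \<Longrightarrow> coef S (\<lambda>s \<mu> z. \<mu> * A s \<mu> z)"
| add: "coef S A \<Longrightarrow> coef S B \<Longrightarrow> coef S (\<lambda>s \<mu> z. A s \<mu> z + B s \<mu> z)"

lemma coef_mult:
  assumes "coef S A" "\<And>n. Cr n S f" shows "coef S (\<lambda>s \<mu> z. f z * A s \<mu> z)"
  using assms(1)
proof induction
  case (base h)
  then show ?case using assms(2) Cr_mult by (intro coef.base) blast
next
  case (s A)
  then show ?case using coef.s[OF s.IH] by (simp add: mult.left_commute)
next
  case (mu A)
  then show ?case using coef.mu[OF mu.IH] by (simp add: mult.left_commute)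
next
  case (add A B)
  then show ?case using coef.add[OF add.IH] by (simp add: distrib_left)
qed

lemma coef_deriv:
  assumes "coef {a..b} A" "a < b"
  shows "\<exists>A'. coef {a..b} A' \<and> (\<forall>s \<mu>. \<forall>z\<in>{a..b}. (A s \<mu> has_real_derivative A' s \<mu> z) (at z within {a..b}))"
  using assms(1)
proof induction
  case (base f)
  obtain f' where "\<And>x. x \<in> {a..b} \<Longrightarrow> (f has_real_derivative f' x) (at x within {a..b})" "\<And>n. Cr n {a..b} f'"
    using Cr_all_deriv[OF assms(2) base] by blast
  then show ?case using coef.base[of "{a..b}" f'] by (intro exI[of _ "\<lambda>s \<mu>. f'"]) auto
next
  case (s A)
  then obtain A' where "coef {a..b} A'" "\<And>s \<mu> z. z \<in> {a..b} \<Longrightarrow> (A s \<mu> has_real_derivative A' s \<mu> z) (at z within {a..b})" by blast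
  then show ?case using coef.s[of "{a..b}" A'] by (intro exI[of _ "\<lambda>s \<mu> z. s * A' s \<mu> z"]) (auto intro: DERIV_cmult)
next
  case (mu A)
  then obtain A' where "coef {a..b} A'" "\<And>s \<mu> z. z \<in> {a..b} \<Longrightarrow> (A s \<mu> has_real_derivative A' s \<mu> z) (at z within {a..b})" by blast
  then show ?case using coef.mu[of "{a..b}" A'] by (intro exI[of _ "\<lambda>s \<mu> z. \<mu> * A' s \<mu> z"]) (auto intro: DERIV_cmult)
next
  case (add A B)
  then obtain A' B' where "coef {a..b} A'" "\<And>s \<mu> z. z \<in> {a..b} \<Longrightarrow> (A s \<mu> has_real_derivative A' s \<mu> z) (at z within {a..b})"
    "coef {a..b} B'" "\<And>s \<mu> z. z \<in> {a..b} \<Longrightarrow> (B s \<mu> has_real_derivative B' s \<mu> z) (at z within {a..b})" by blast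
  then show ?case using coef.add[of "{a..b}" A' B'] by (intro exI[of _ "\<lambda>s \<mu> z. A' s \<mu> z + B' s \<mu> z"]) (auto intro: DERIV_add)
qed

lemma coef_continuous:
  assumes "coef S A" shows "continuous_on ((UNIV \<times> UNIV) \<times> S) (\<lambda>q. A (fst (fst q)) (snd (fst q)) (snd q))"
  using assms
proof induction
  case (base f)
  then show ?case using continuous_on_compose2[OF Cr_imp_continuous[OF base[of 0]], of "(UNIV \<times> UNIV) \<times> S" snd]
    by (force intro!: continuous_intros)
qed (intro continuous_intros; assumption)+

lemma coef_bound:
  assumes "coef {a..b} A"
  obtains C N where "C \<ge> 0" "\<And>s \<mu> z. s \<ge> 0 \<Longrightarrow> \<mu> \<ge> 0 \<Longrightarrow> z \<in> {a..b} \<Longrightarrow> \<bar>A s \<mu> z\<bar> \<le> C * (1 + s + \<mu>) ^ N"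
proof -
  have "\<exists>C N. C \<ge> 0 \<and> (\<forall>s \<mu> z. s \<ge> 0 \<longrightarrow> \<mu> \<ge> 0 \<longrightarrow> z \<in> {a..b} \<longrightarrow> \<bar>A s \<mu> z\<bar> \<le> C * (1 + s + \<mu>) ^ N)"
    using assms
  proof induction
    case (base f)
    have "compact (f ` {a..b})" by (rule compact_continuous_image[OF Cr_imp_continuous[OF base[of 0]]]) simp
    then have "bounded (f ` {a..b})" by (rule compact_imp_bounded)
    then obtain B where B: "\<forall>y\<in>f ` {a..b}. norm y \<le> B" unfolding bounded_iff by blast
    then show ?case by (intro exI[of _ "max B 0"] exI[of _ 0]) (auto simp: le_max_iff_disj)
  next
    case (s A)
    then obtain C N where C: "C \<ge> 0" "\<And>s \<mu> z. s \<ge> 0 \<Longrightarrow> \<mu> \<ge> 0 \<Longrightarrow> z \<in> {a..b} \<Longrightarrow> \<bar>A s \<mu> z\<bar> \<le> C * (1 + s + \<mu>) ^ N" by blast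
    have "\<bar>s * A s \<mu> z\<bar> \<le> C * (1 + s + \<mu>) ^ Suc N" if "s \<ge> 0" "\<mu> \<ge> 0" "z \<in> {a..b}" for s \<mu> z
    proof -
      have "s * \<bar>A s \<mu> z\<bar> \<le> (1 + s + \<mu>) * (C * (1 + s + \<mu>) ^ N)" using C that by (intro mult_mono) auto
      then show ?thesis using that by (simp add: abs_mult mult.left_commute)
    qed
    then show ?case using C(1) by blast
  next
    case (mu A)
    then obtain C N where C: "C \<ge> 0" "\<And>s \<mu> z. s \<ge> 0 \<Longrightarrow> \<mu> \<ge> 0 \<Longrightarrow> z \<in> {a..b} \<Longrightarrow> \<bar>A s \<mu> z\<bar> \<le> C * (1 + s + \<mu>) ^ N" by blast
    have "\<bar>\<mu> * A s \<mu> z\<bar> \<le> C * (1 + s + \<mu>) ^ Suc N" if "s \<ge> 0" "\<mu> \<ge> 0" "z \<in> {a..b}" for s \<mu> z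
    proof -
      have "\<mu> * \<bar>A s \<mu> z\<bar> \<le> (1 + s + \<mu>) * (C * (1 + s + \<mu>) ^ N)" using C that by (intro mult_mono) auto
      then show ?thesis using that by (simp add: abs_mult mult.left_commute)
    qed
    then show ?case using C(1) by blast
  next
    case (add A B)
    then obtain C N C' N' where C: "C \<ge> 0" "\<And>s \<mu> z. s \<ge> 0 \<Longrightarrow> \<mu> \<ge> 0 \<Longrightarrow> z \<in> {a..b} \<Longrightarrow> \<bar>A s \<mu> z\<bar> \<le> C * (1 + s + \<mu>) ^ N"
      "C' \<ge> 0" "\<And>s \<mu> z. s \<ge> 0 \<Longrightarrow> \<mu> \<ge> 0 \<Longrightarrow> z \<in> {a..b} \<Longrightarrow> \<bar>B s \<mu> z\<bar> \<le> C' * (1 + s + \<mu>) ^ N'" by blast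
    have "\<bar>A s \<mu> z + B s \<mu> z\<bar> \<le> (C + C') * (1 + s + \<mu>) ^ (N + N')" if "s \<ge> 0" "\<mu> \<ge> 0" "z \<in> {a..b}" for s \<mu> z
    proof -
      have "C * (1 + s + \<mu>) ^ N \<le> C * (1 + s + \<mu>) ^ (N + N')" "C' * (1 + s + \<mu>) ^ N' \<le> C' * (1 + s + \<mu>) ^ (N + N')"
        using that C by (auto intro!: mult_left_mono power_increasing)
      then show ?thesis using C(2)[OF that] C(4)[OF that] by (simp add: distrib_right)
    qed
    then show ?case using C by (intro exI[of _ "C + C'"] exI[of _ "N + N'"]) auto
  qed
  then show thesis using that by blast
qed

text \<open>Since the coefficients are polynomial in \<open>s\<close> and \<open>\<mu>\<close>, every \<open>z\<close>-derivative of a mode grows at most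
  polynomially in the frequency.\<close>

lemma coef_sequence:
  assumes ab: "a < b" and A0: "coef {a..b} A0" "coef {a..b} B0" and w: "\<And>n. Cr n {a..b} w" and h: "\<And>n. Cr n {a..b} h"
  obtains A B where "A 0 = A0" "B 0 = B0" "\<And>n. coef {a..b} (A n)" "\<And>n. coef {a..b} (B n)"
    "\<And>n s \<mu> z \<phi> \<psi>. z \<in> {a..b} \<Longrightarrow> (\<phi> has_real_derivative \<psi> z) (at z within {a..b}) \<Longrightarrow>
      (\<psi> has_real_derivative h z * \<psi> z + (s + \<mu> * w z) * \<phi> z) (at z within {a..b}) \<Longrightarrow>
      ((\<lambda>z. A n s \<mu> z * \<phi> z + B n s \<mu> z * \<psi> z) has_real_derivative A (Suc n) s \<mu> z * \<phi> z + B (Suc n) s \<mu> z * \<psi> z) (at z within {a..b})"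
proof -
  let ?P = "\<lambda>p. coef {a..b} (fst p) \<and> coef {a..b} (snd p)"
  let ?Q = "\<lambda>p p'. \<forall>s \<mu> z \<phi> \<psi>. z \<in> {a..b} \<longrightarrow> (\<phi> has_real_derivative \<psi> z) (at z within {a..b}) \<longrightarrow>
      (\<psi> has_real_derivative h z * \<psi> z + (s + \<mu> * w z) * \<phi> z) (at z within {a..b}) \<longrightarrow>
      ((\<lambda>z. fst p s \<mu> z * \<phi> z + snd p s \<mu> z * \<psi> z) has_real_derivative fst p' s \<mu> z * \<phi> z + snd p' s \<mu> z * \<psi> z) (at z within {a..b})"
  \<comment> \<open>Dependent choice of the sequence of coefficient pairs; the clause for n = 0
    fixes the starting pair.\<close>
  have "\<exists>f. \<forall>n. (?P (f n) \<and> (n = 0 \<longrightarrow> f n = (A0, B0))) \<and> ?Q (f n) (f (Suc n))"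
  proof (rule dependent_nat_choice)
    show "\<exists>p. ?P p \<and> (0 = 0 \<longrightarrow> p = (A0, B0))" using A0 by (intro exI[of _ "(A0, B0)"]) simp
    fix p and n :: nat assume "?P p \<and> (n = 0 \<longrightarrow> p = (A0, B0))"
    then have p: "coef {a..b} (fst p)" "coef {a..b} (snd p)" by auto
    obtain A' where A': "coef {a..b} A'" "\<And>s \<mu> z. z \<in> {a..b} \<Longrightarrow> (fst p s \<mu> has_real_derivative A' s \<mu> z) (at z within {a..b})"
      using coef_deriv[OF p(1) ab] by blast
    obtain B' where B': "coef {a..b} B'" "\<And>s \<mu> z. z \<in> {a..b} \<Longrightarrow> (snd p s \<mu> has_real_derivative B' s \<mu> z) (at z within {a..b})"
      using coef_deriv[OF p(2) ab] by blast
    \<comment> \<open>Differentiate A \<phi> + B \<psi> and replace \<psi>' by its equation: the new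
      coefficients are A' + (s + \<mu> w) B and A + B' + h B.\<close>
    let ?p = "(\<lambda>s \<mu> z. A' s \<mu> z + (s * snd p s \<mu> z + \<mu> * (w z * snd p s \<mu> z)), \<lambda>s \<mu> z. (fst p s \<mu> z + B' s \<mu> z) + h z * snd p s \<mu> z)"
    have "?P ?p"
      using A'(1) B'(1) p coef_mult[OF p(2) w] coef_mult[OF p(2) h] by (simp add: coef.intros(2-4))
    moreover have "?Q p ?p"
    proof (intro allI impI)
      fix s \<mu> z and \<phi> \<psi> :: "real \<Rightarrow> real"
      assume z: "z \<in> {a..b}" and d: "(\<phi> has_real_derivative \<psi> z) (at z within {a..b})"
        "(\<psi> has_real_derivative h z * \<psi> z + (s + \<mu> * w z) * \<phi> z) (at z within {a..b})"
      show "((\<lambda>z. fst p s \<mu> z * \<phi> z + snd p s \<mu> z * \<psi> z) has_real_derivative fst ?p s \<mu> z * \<phi> z + snd ?p s \<mu> z * \<psi> z) (at z within {a..b})"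
        by (rule DERIV_cong[OF DERIV_add[OF DERIV_mult[OF A'(2)[OF z] d(1)] DERIV_mult[OF B'(2)[OF z] d(2)]]])
          (simp add: algebra_simps)
    qed
    ultimately show "\<exists>p'. (?P p' \<and> (Suc n = 0 \<longrightarrow> p' = (A0, B0))) \<and> ?Q p p'" by (intro exI[of _ ?p]) simp
  qed
  then obtain f where f': "\<forall>n. (?P (f n) \<and> (n = 0 \<longrightarrow> f n = (A0, B0))) \<and> ?Q (f n) (f (Suc n))"
    by (rule exE)
  have f: "?P (f n)" "f 0 = (A0, B0)" for n
    using spec[OF f', of n, THEN conjunct1, THEN conjunct1] spec[OF f', of 0, THEN conjunct1, THEN conjunct2]
    by simp_all
  note fQ = spec[OF f', THEN conjunct2]
  show thesis
  proof (rule that[of "\<lambda>n. fst (f n)" "\<lambda>n. snd (f n)"])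
    fix n s \<mu> z and \<phi> \<psi> :: "real \<Rightarrow> real"
    assume *: "z \<in> {a..b}" "(\<phi> has_real_derivative \<psi> z) (at z within {a..b})"
      "(\<psi> has_real_derivative h z * \<psi> z + (s + \<mu> * w z) * \<phi> z) (at z within {a..b})"
    show "((\<lambda>z. fst (f n) s \<mu> z * \<phi> z + snd (f n) s \<mu> z * \<psi> z) has_real_derivative
       fst (f (Suc n)) s \<mu> z * \<phi> z + snd (f (Suc n)) s \<mu> z * \<psi> z) (at z within {a..b})"
      by (rule fQ[rule_format, OF *])
  qed (use f in simp_all)
qed

section \<open>Exponentially growing fields\<close>

type_synonym ampseq = "nat \<Rightarrow> real^2 \<Rightarrow> real \<Rightarrow> complex"

text \<open>The amplitudes, at time t, of the n-th time derivative of a field that grows like exp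
  (\<Lambda> t).\<close>

definition tfam :: "(real^2 \<Rightarrow> real) \<Rightarrow> nat \<Rightarrow> real \<Rightarrow> ampseq \<Rightarrow> ampseq" where
  "tfam \<Lambda> n t D = (\<lambda>j \<xi> z. complex_of_real (\<Lambda> \<xi> ^ n * exp (\<Lambda> \<xi> * t)) * D j \<xi> z)"

lemma amp_tfam:
  assumes "amp a b r D" "continuous_on UNIV \<Lambda>" "\<And>\<xi>. \<Lambda> (- \<xi>) = \<Lambda> \<xi>"
  shows "amp a b r (tfam \<Lambda> n t D)"
  unfolding tfam_def by (rule amp_mult[OF assms(1)]) (use assms(2,3) in \<open>auto intro!: continuous_intros\<close>)

lemma pamp_tfam: "pamp i (tfam \<Lambda> n t D) = tfam \<Lambda> n t (pamp i D)"
  by (simp add: pamp_def tfam_def fun_eq_iff mult.left_commute)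

text \<open>Glues the fields of the two layers. Points of the interface receive the lower field;
  they belong to neither slab.\<close>

definition fld2 :: "('b::euclidean_space \<Rightarrow> ampseq) \<Rightarrow> ('b \<Rightarrow> ampseq) \<Rightarrow> real^3 \<Rightarrow> 'b" where
  "fld2 Dp Dm x = (if x $ 3 > 0 then fld Dp x else fld Dm x)"

lemma fld2_slab:
  "x \<in> slab {0<..<l} \<Longrightarrow> fld2 Dp Dm x = fld Dp x" "x \<in> slab {-m<..<0} \<Longrightarrow> fld2 Dp Dm x = fld Dm x"
  by (auto simp: fld2_def slab_def)

definition nsq2 :: "real \<Rightarrow> real \<Rightarrow> nat \<Rightarrow> ('b::euclidean_space \<Rightarrow> ampseq) \<Rightarrow> ('b \<Rightarrow> ampseq) \<Rightarrow> ennreal" where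
  "nsq2 m l k Dp Dm = (\<Sum>b\<in>Basis. nsq k 0 l (Dp b) + nsq k (-m) 0 (Dm b))"

definition amps2 :: "real \<Rightarrow> real \<Rightarrow> real \<Rightarrow> ('b::euclidean_space \<Rightarrow> ampseq) \<Rightarrow> ('b \<Rightarrow> ampseq) \<Rightarrow> bool" where
  "amps2 m l r Dp Dm \<longleftrightarrow> m > 0 \<and> l > 0 \<and> (\<forall>b\<in>Basis. amp 0 l r (Dp b) \<and> amp (-m) 0 r (Dm b))"

lemma fld2_H_space:
  assumes "amps2 m l r Dp Dm" shows "fld2 Dp Dm \<in> H_space m l k"
proof -
  have "sobolev_on k (slab {0<..<l}) (fld2 Dp Dm)"
    by (rule sobolev_on_cong[OF fld2_slab(1)[symmetric] fld_sobolev[where D = Dp and a = 0 and b = l and r = r]]) (use assms in \<open>auto simp: amps2_def\<close>)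
  moreover have "sobolev_on k (slab {-m<..<0}) (fld2 Dp Dm)"
    by (rule sobolev_on_cong[OF fld2_slab(2)[symmetric] fld_sobolev[where D = Dm and a = "-m" and b = 0 and r = r]]) (use assms in \<open>auto simp: amps2_def\<close>)
  ultimately show ?thesis by (simp add: H_space_def Iplus_def Iminus_def)
qed

lemma fld2_H_norm:
  assumes "amps2 m l r Dp Dm" shows "H_norm m l k (fld2 Dp Dm) = sqrt (enn2real (nsq2 m l k Dp Dm))"
proof -
  have "slab_norm_sq k {0<..<l} (\<lambda>x. fld2 Dp Dm x \<bullet> b) = nsq k 0 l (Dp b)"
    "slab_norm_sq k {-m<..<0} (\<lambda>x. fld2 Dp Dm x \<bullet> b) = nsq k (-m) 0 (Dm b)" if "b \<in> Basis" for b
    by (rule slab_norm_sq_synth[of _ _ r]; use assms that in \<open>simp add: amps2_def fld2_slab fld_inner\<close>)+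
  then show ?thesis by (simp add: H_norm_def nsq2_def Iplus_def Iminus_def)
qed

lemma nsq2_finite: "amps2 m l r Dp Dm \<Longrightarrow> nsq2 m l k Dp Dm < \<infinity>"
  unfolding nsq2_def amps2_def using nsq_finite[of 0 l r _ k] nsq_finite[of "-m" 0 r _ k]
  by (auto simp: less_top[symmetric])

lemma fld2_H_norm_le:
  assumes "amps2 m l r Dp Dm" "nsq2 m l k Dp Dm \<le> ennreal (c\<^sup>2)" "c \<ge> 0"
  shows "H_norm m l k (fld2 Dp Dm) \<le> c"
proof -
  have "enn2real (nsq2 m l k Dp Dm) \<le> c\<^sup>2" using assms(2) by (intro enn2real_leI) auto
  then show ?thesis unfolding fld2_H_norm[OF assms(1)] using assms(3) by (intro real_le_lsqrt) auto
qed

lemma fld2_H_norm_ge: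
  assumes "amps2 m l r Dp Dm" "ennreal (c\<^sup>2) \<le> nsq k (-m) 0 (Dm b)" "b \<in> Basis"
  shows "c \<le> H_norm m l k (fld2 Dp Dm)"
proof -
  have "nsq k (-m) 0 (Dm b) \<le> nsq k 0 l (Dp b) + nsq k (-m) 0 (Dm b)" by simp
  also have "\<dots> \<le> nsq2 m l k Dp Dm"
    unfolding nsq2_def using assms(3) by (intro member_le_sum) auto
  finally have "ennreal (c\<^sup>2) \<le> nsq2 m l k Dp Dm" using assms(2) by (rule order_trans[rotated])
  then have "c\<^sup>2 \<le> enn2real (nsq2 m l k Dp Dm)"
    using nsq2_finite[OF assms(1), of k] enn2real_mono[of "ennreal (c\<^sup>2)"] by (simp add: less_top)
  then show ?thesis unfolding fld2_H_norm[OF assms(1)] by (intro real_le_rsqrt) auto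
qed

text \<open>All later comparisons of norms, between times and between \<eta> and v, go through this
  monotonicity in the moduli instead of a computation.\<close>

lemma fld2_H_norm_mono:
  assumes "amps2 m l r Dp Dm" "amps2 m l r' Dp' Dm'"
    and "\<And>b j \<xi> z. b \<in> Basis \<Longrightarrow> cmod (Dp b j \<xi> z) \<le> cmod (Dp' b j \<xi> z)"
    and "\<And>b j \<xi> z. b \<in> Basis \<Longrightarrow> cmod (Dm b j \<xi> z) \<le> cmod (Dm' b j \<xi> z)"
  shows "H_norm m l k (fld2 Dp Dm) \<le> H_norm m l k (fld2 Dp' Dm')"
proof -
  have "nsq2 m l k Dp Dm \<le> nsq2 m l k Dp' Dm'"
    unfolding nsq2_def using assms(3,4) by (intro sum_mono add_mono nsq_mono) auto
  then have "enn2real (nsq2 m l k Dp Dm) \<le> enn2real (nsq2 m l k Dp' Dm')"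
    using nsq2_finite[OF assms(2), of k] by (intro enn2real_mono) (auto simp: less_top)
  then show ?thesis unfolding fld2_H_norm[OF assms(1)] fld2_H_norm[OF assms(2)] by simp
qed

text \<open>With the displacement amplitudes, n = 0, 1, 2 give \<eta>, v and the time derivative of
  v; with the amplitudes of q, n = 0, 1 give q and its time derivative.\<close>

definition evol :: "(real^2 \<Rightarrow> real) \<Rightarrow> ('b::euclidean_space \<Rightarrow> ampseq) \<Rightarrow> ('b \<Rightarrow> ampseq) \<Rightarrow> nat \<Rightarrow> real \<Rightarrow> real^3 \<Rightarrow> 'b" where
  "evol \<Lambda> Dp Dm n t = fld2 (\<lambda>b. tfam \<Lambda> n t (Dp b)) (\<lambda>b. tfam \<Lambda> n t (Dm b))"

lemma synth_tfam_deriv: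
  assumes D: "amp a b r D" and L: "continuous_on UNIV \<Lambda>"
  shows "((\<lambda>t. synth (tfam \<Lambda> n t D 0) x) has_real_derivative synth (tfam \<Lambda> (Suc n) t D 0) x) (at t)"
proof -
  have [continuous_intros]: "continuous_on S (\<lambda>p. \<Lambda> (f p))" if "continuous_on S f" for S and f :: "_ \<Rightarrow> real^2"
    by (rule continuous_on_compose2[OF L that]) auto
  have "((\<lambda>t. LINT \<xi>|lborel. tfam \<Lambda> n t D 0 \<xi> (x $ 3) * cis (\<xi> \<bullet> hor x)) has_vector_derivative
     (LINT \<xi>|lborel. tfam \<Lambda> (Suc n) t D 0 \<xi> (x $ 3) * cis (\<xi> \<bullet> hor x))) (at t within UNIV)"
  proof (rule param_derivative[where r = r])
    fix t \<xi>
    have "((\<lambda>t. exp (t *\<^sub>R \<Lambda> \<xi>)) has_vector_derivative exp (t *\<^sub>R \<Lambda> \<xi>) * \<Lambda> \<xi>) (at t)"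
      by (rule exp_scaleR_has_vector_derivative_right)
    then have "((\<lambda>t. complex_of_real (exp (t *\<^sub>R \<Lambda> \<xi>))) has_vector_derivative complex_of_real (exp (t *\<^sub>R \<Lambda> \<xi>) * \<Lambda> \<xi>)) (at t)"
      by (rule bounded_linear.has_vector_derivative[OF bounded_linear_of_real])
    from has_vector_derivative_mult_right[OF this, of "complex_of_real (\<Lambda> \<xi> ^ n) * (D 0 \<xi> (x $ 3) * cis (\<xi> \<bullet> hor x))"]
    show "((\<lambda>t. tfam \<Lambda> n t D 0 \<xi> (x $ 3) * cis (\<xi> \<bullet> hor x)) has_vector_derivative
        tfam \<Lambda> (Suc n) t D 0 \<xi> (x $ 3) * cis (\<xi> \<bullet> hor x)) (at t)"
      by (simp add: tfam_def ac_simps)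
  qed (auto simp: case_prod_beta tfam_def ampD(3)[OF D] intro!: continuous_intros amp_compose_continuous[OF D])
  from bounded_linear.has_vector_derivative[OF bounded_linear_Re this]
  show ?thesis by (simp add: synth_def has_real_derivative_iff_has_vector_derivative)
qed

lemma synth_tfam_continuous:
  assumes D: "amp a b r D" and L: "continuous_on UNIV \<Lambda>"
  shows "continuous_on UNIV (\<lambda>p. synth (tfam \<Lambda> n (fst p) D 0) (snd p))"
proof -
  have [continuous_intros]: "continuous_on S (\<lambda>p. \<Lambda> (f p))" if "continuous_on S f" for S and f :: "_ \<Rightarrow> real^2"
    by (rule continuous_on_compose2[OF L that]) auto
  show ?thesis unfolding synth_def
    by (intro continuous_on_Re param_continuous[of _ _ r])
      (auto simp: case_prod_beta tfam_def ampD(3)[OF D] intro!: continuous_intros amp_compose_continuous[OF D])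
qed

context
  fixes m l r :: real and \<Lambda> :: "real^2 \<Rightarrow> real" and Dp Dm :: "'b::euclidean_space \<Rightarrow> ampseq"
  assumes D: "amps2 m l r Dp Dm" and L: "continuous_on UNIV \<Lambda>" "\<And>\<xi>. \<Lambda> (- \<xi>) = \<Lambda> \<xi>" "\<And>\<xi>. 1 \<le> \<Lambda> \<xi>"
begin

lemma evol_amps2: "amps2 m l r (\<lambda>b. tfam \<Lambda> n t (Dp b)) (\<lambda>b. tfam \<Lambda> n t (Dm b))"
  using D amp_tfam L unfolding amps2_def by blast

lemma evol_H_space: "evol \<Lambda> Dp Dm n t \<in> H_space m l k"
  unfolding evol_def by (rule fld2_H_space[OF evol_amps2])

lemma evol_H_norm_mono: "n \<le> n' \<Longrightarrow> t \<le> t' \<Longrightarrow> H_norm m l k (evol \<Lambda> Dp Dm n t) \<le> H_norm m l k (evol \<Lambda> Dp Dm n' t')"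
proof -
  assume nt: "n \<le> n'" "t \<le> t'"
  have "cmod (complex_of_real (\<Lambda> \<xi> ^ n * exp (\<Lambda> \<xi> * t))) \<le> cmod (complex_of_real (\<Lambda> \<xi> ^ n' * exp (\<Lambda> \<xi> * t')))" for \<xi>
  proof -
    have "\<Lambda> \<xi> ^ n * exp (\<Lambda> \<xi> * t) \<le> \<Lambda> \<xi> ^ n' * exp (\<Lambda> \<xi> * t')"
      using L(3)[of \<xi>] nt by (intro mult_mono power_increasing) (auto intro!: mult_left_mono)
    moreover have "0 \<le> \<Lambda> \<xi> ^ n * exp (\<Lambda> \<xi> * t)" using L(3)[of \<xi>] by simp
    ultimately show ?thesis unfolding norm_of_real by linarith
  qed
  then show ?thesis
    unfolding evol_def by (intro fld2_H_norm_mono[OF evol_amps2 evol_amps2]) (auto simp: tfam_def norm_mult simp del: of_real_mult intro!: mult_right_mono)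
qed

lemma evol_Linf_loc: "Linf_loc_H m l k \<infinity> (evol \<Lambda> Dp Dm n)"
  unfolding Linf_loc_H_def
proof (intro conjI allI impI)
  let ?S = "{t. 0 \<le> t \<and> ereal t < \<infinity>} \<times> (slab (Iplus l) \<union> slab (Iminus m))"
  have "?S \<in> sets (borel :: (real \<times> (real^3)) measure)"
  proof -
    have "{t. 0 \<le> t \<and> ereal t < \<infinity>} = {0..}" by auto
    moreover have "open (slab (Iplus l) \<union> slab (Iminus m))"
      by (intro open_Un open_slab) (auto simp: Iplus_def Iminus_def)
    ultimately have "?S \<in> sets (borel \<Otimes>\<^sub>M borel)" by (intro pair_measureI) auto
    then show ?thesis unfolding borel_prod .
  qed
  moreover have "(\<lambda>(t, x). evol \<Lambda> Dp Dm n t x) \<in> borel_measurable borel"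
  proof -
    have fm: "(\<lambda>p. fld (\<lambda>b. tfam \<Lambda> n (fst p) (F b)) (snd p)) \<in> borel_measurable borel"
      if "\<And>b. b \<in> Basis \<Longrightarrow> amp a c r (F b)" for F :: "'b \<Rightarrow> ampseq" and a c
      unfolding fld_def using synth_tfam_continuous[OF that L(1)]
      by (intro borel_measurable_continuous_onI continuous_intros) auto
    have c: "{p :: real \<times> (real^3). snd p $ 3 > 0} \<in> sets borel"
      by (intro borel_open open_Collect_less continuous_intros)
    have "(\<lambda>p. if p \<in> {p. snd p $ 3 > 0} then fld (\<lambda>b. tfam \<Lambda> n (fst p) (Dp b)) (snd p) else fld (\<lambda>b. tfam \<Lambda> n (fst p) (Dm b)) (snd p)) \<in> borel_measurable borel"
      by (rule measurable_If_set) (use D fm c in \<open>auto simp: amps2_def\<close>)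
    then show ?thesis by (simp add: evol_def fld2_def case_prod_beta')
  qed
  ultimately have "(\<lambda>p. indicator ?S p *\<^sub>R (case p of (t, x) \<Rightarrow> evol \<Lambda> Dp Dm n t x)) \<in> borel_measurable lborel"
    by (intro borel_measurable_scaleR borel_measurable_indicator) simp_all
  then show "set_borel_measurable lebesgue ?S (\<lambda>(t, x). evol \<Lambda> Dp Dm n t x)"
    unfolding set_borel_measurable_def by (rule measurable_completion)
  \<comment> \<open>By monotonicity in time the norm at \<open>T'\<close> bounds all earlier
    ones.\<close>
  show "\<exists>C. AE t in lebesgue. 0 \<le> t \<and> t \<le> T' \<longrightarrow> evol \<Lambda> Dp Dm n t \<in> H_space m l k \<and> H_norm m l k (evol \<Lambda> Dp Dm n t) \<le> C" for T'
    by (intro exI[of _ "H_norm m l k (evol \<Lambda> Dp Dm n T')"] AE_I2) (auto intro: evol_H_space evol_H_norm_mono)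
qed

text \<open>The fundamental theorem of calculus at every single point x, since synthesized fields
  are classically differentiable in time.\<close>

lemma evol_time_deriv: "has_time_deriv m l \<infinity> (evol \<Lambda> Dp Dm n) (evol \<Lambda> Dp Dm (Suc n))"
  unfolding has_time_deriv_def
proof (intro allI impI AE_I2)
  fix s t :: real and x :: "real^3" assume st: "0 \<le> s \<and> s \<le> t \<and> ereal t < \<infinity>"
  have fd: "((\<lambda>t. fld (\<lambda>b. tfam \<Lambda> n t (F b)) x) has_vector_derivative fld (\<lambda>b. tfam \<Lambda> (Suc n) t (F b)) x) (at t)"
    if "\<And>b. b \<in> Basis \<Longrightarrow> amp a c r (F b)" for F :: "'b \<Rightarrow> ampseq" and a c t n
    unfolding fld_def
    using synth_tfam_deriv[OF that L(1), unfolded has_real_derivative_iff_has_vector_derivative]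
    by (intro has_vector_derivative_sum bounded_linear.has_vector_derivative[OF bounded_linear_scaleR_left]) auto
  have d: "((\<lambda>t. evol \<Lambda> Dp Dm n t x) has_vector_derivative evol \<Lambda> Dp Dm (Suc n) t x) (at t)" for t n
    unfolding evol_def fld2_def using fd[of 0 l Dp n t] fd[of "-m" 0 Dm n t] D by (cases "x $ 3 > 0") (auto simp: amps2_def)
  have c: "continuous_on {s..t} (\<lambda>t. evol \<Lambda> Dp Dm (Suc n) t x)"
    by (rule continuous_on_vector_derivative[OF has_vector_derivative_at_within[OF d]])
  have i: "set_integrable lebesgue {s..t} (\<lambda>\<tau>. evol \<Lambda> Dp Dm (Suc n) \<tau> x)"
    using loc_integrable_continuous[OF c] by (simp add: loc_integrable_def)
  have "((\<lambda>\<tau>. evol \<Lambda> Dp Dm (Suc n) \<tau> x) has_integral (evol \<Lambda> Dp Dm n t x - evol \<Lambda> Dp Dm n s x)) {s..t}"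
    using st has_vector_derivative_at_within[OF d] by (intro fundamental_theorem_of_calculus) auto
  then have "evol \<Lambda> Dp Dm n t x - evol \<Lambda> Dp Dm n s x = (LINT \<tau>:{s..t}|lebesgue. evol \<Lambda> Dp Dm (Suc n) \<tau> x)"
    using set_lebesgue_integral_eq_integral(2)[OF i] by (simp add: integral_unique)
  then show "set_integrable lebesgue {s..t} (\<lambda>\<tau>. evol \<Lambda> Dp Dm (Suc n) \<tau> x) \<and>
      evol \<Lambda> Dp Dm n t x - evol \<Lambda> Dp Dm n s x = (LINT \<tau>:{s..t}|lebesgue. evol \<Lambda> Dp Dm (Suc n) \<tau> x)"
    using i by simp
qed

end

section \<open>Reduction of the linearized problem to equations for amplitudes\<close>

lemma synth_cong: "(\<And>\<xi>. A \<xi> (x $ 3) = B \<xi> (x $ 3)) \<Longrightarrow> synth A x = synth B x"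
  by (simp add: synth_def)

text \<open>Four is the number of terms in both the continuity and the momentum equation; shorter
  relations are padded with zero coefficients. The coefficients belong to the height of the given
  point and are constant in the integral.\<close>

lemma synth_lincomb_0:
  fixes c1 c2 c3 c4 :: real and A1 A2 A3 A4 :: "real^2 \<Rightarrow> real \<Rightarrow> complex"
  assumes i: "bcs (\<lambda>\<xi>. A1 \<xi> (x $ 3))" "bcs (\<lambda>\<xi>. A2 \<xi> (x $ 3))" "bcs (\<lambda>\<xi>. A3 \<xi> (x $ 3))" "bcs (\<lambda>\<xi>. A4 \<xi> (x $ 3))"
    and z: "\<And>\<xi>. c1 * A1 \<xi> (x $ 3) + c2 * A2 \<xi> (x $ 3) + c3 * A3 \<xi> (x $ 3) + c4 * A4 \<xi> (x $ 3) = 0"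
  shows "c1 * synth A1 x + c2 * synth A2 x + c3 * synth A3 x + c4 * synth A4 x = 0"
proof -
  let ?h = "\<lambda>A \<xi>. A \<xi> (x $ 3) * cis (\<xi> \<bullet> hor x)"
  have int: "integrable lborel (?h A1)" "integrable lborel (?h A2)" "integrable lborel (?h A3)" "integrable lborel (?h A4)"
    using i by (auto intro!: bcs_integrable bcs_cis(1))
  have "complex_of_real c1 * (LINT \<xi>|lborel. ?h A1 \<xi>) + complex_of_real c2 * (LINT \<xi>|lborel. ?h A2 \<xi>)
      + complex_of_real c3 * (LINT \<xi>|lborel. ?h A3 \<xi>) + complex_of_real c4 * (LINT \<xi>|lborel. ?h A4 \<xi>)
    = (LINT \<xi>|lborel. complex_of_real c1 * ?h A1 \<xi> + complex_of_real c2 * ?h A2 \<xi> + complex_of_real c3 * ?h A3 \<xi> + complex_of_real c4 * ?h A4 \<xi>)"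
    using int by simp
  also have "\<dots> = (LINT \<xi>|lborel. (c1 * A1 \<xi> (x $ 3) + c2 * A2 \<xi> (x $ 3) + c3 * A3 \<xi> (x $ 3) + c4 * A4 \<xi> (x $ 3)) * cis (\<xi> \<bullet> hor x))"
    by (simp add: algebra_simps)
  also have "\<dots> = 0" unfolding z by simp
  finally have "complex_of_real c1 * (LINT \<xi>|lborel. ?h A1 \<xi>) + complex_of_real c2 * (LINT \<xi>|lborel. ?h A2 \<xi>)
      + complex_of_real c3 * (LINT \<xi>|lborel. ?h A3 \<xi>) + complex_of_real c4 * (LINT \<xi>|lborel. ?h A4 \<xi>) = 0" .
  from arg_cong[OF this, of Re] show ?thesis by (simp add: synth_def)
qed

lemma wpartial_synth:
  assumes D: "amp a b r D" and f: "\<And>x. x \<in> slab {a<..<b} \<Longrightarrow> f x = synth (D 0) x"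
  shows "AE x in lebesgue. x \<in> slab {a<..<b} \<longrightarrow> wpartial (slab {a<..<b}) (axis i 1) f x = synth (pamp i D 0) x"
proof (rule wpartial_AE)
  show o: "open (slab {a<..<b})" by (intro open_slab) simp
  have 1: "fld (\<lambda>_::real. D) = synth (D 0)" for D by (simp add: fld_def fun_eq_iff)
  have "weak_partial (slab {a<..<b}) (axis i 1) (synth (D 0)) (synth (pamp i D 0))"
    using fld_weak_partial[where D = "\<lambda>_::real. D" and a = a and b = b and r = r and i = i] D by (simp add: 1)
  then show "weak_partial (slab {a<..<b}) (axis i 1) f (synth (pamp i D 0))"
    by (rule weak_partial_cong_AE[rotated 3]) (use f in \<open>auto simp: Basis_cart\<close>)
qed

text \<open>One identity per frequency and height suffices. The relation for \<open>Q\<close> is the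
  time-integrated form q = - \<rho> div \<eta>; multiplied by \<Lambda> it becomes the continuity
  equation. The product P'(\<rho>) q has an amplitude sequence \<open>PQ\<close> of its own because
  its gradient is taken by differentiating such a sequence.\<close>

lemma linearized_equations_synth:
  fixes E :: "real^3 \<Rightarrow> ampseq" and Q PQ :: ampseq and \<rho> p :: "real \<Rightarrow> real" and g :: real
  assumes E: "\<And>i. amp a b r (E (axis i 1))" and Q: "amp a b r Q" and PQ: "amp a b r PQ"
    and L: "continuous_on UNIV \<Lambda>" "\<And>\<xi>. \<Lambda> (- \<xi>) = \<Lambda> \<xi>"
    and e1: "\<And>\<xi> z. z \<in> {a<..<b} \<Longrightarrow> Q 0 \<xi> z + \<rho> z * (pamp 1 (E (axis 1 1)) 0 \<xi> z + pamp 2 (E (axis 2 1)) 0 \<xi> z + pamp 3 (E (axis 3 1)) 0 \<xi> z) = 0"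
    and e2: "\<And>\<xi> z i. z \<in> {a<..<b} \<Longrightarrow> \<rho> z * (\<Lambda> \<xi>)\<^sup>2 * E (axis i 1) 0 \<xi> z + pamp i PQ 0 \<xi> z
       + g * (if i = 3 then 1 else 0) * Q 0 \<xi> z + (g * \<rho> z) * pamp i (E (axis 3 1)) 0 \<xi> z = 0"
    and e3: "\<And>\<xi> z. z \<in> {a<..<b} \<Longrightarrow> p z * Q 0 \<xi> z = PQ 0 \<xi> z"
    and u: "\<And>n x i. x \<in> slab {a<..<b} \<Longrightarrow> u n x $ i = synth (tfam \<Lambda> n t (E (axis i 1)) 0) x"
    and q: "\<And>n x. x \<in> slab {a<..<b} \<Longrightarrow> q n x = synth (tfam \<Lambda> n t Q 0) x"
  shows "linearized_equations_on {a<..<b} g \<rho> p (u 0) (u 1) (q 0) (u 1) (u 2) (q 1)"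
proof -
  let ?I = "{a<..<b}"
  have T: "amp a b r (tfam \<Lambda> n t D)" if "amp a b r D" for D n by (rule amp_tfam[OF that L])
  have b: "bcs (\<lambda>\<xi>. tfam \<Lambda> n t D 0 \<xi> z)" if "amp a b r D" for D n z by (rule amp_bcs[OF T[OF that]])
  have pq: "p (x $ 3) * q 0 x = synth (tfam \<Lambda> 0 t PQ 0) x" if x: "x \<in> slab ?I" for x
  proof -
    have "p (x $ 3) * synth (tfam \<Lambda> 0 t Q 0) x + (-1) * synth (tfam \<Lambda> 0 t PQ 0) x + 0 * synth (tfam \<Lambda> 0 t PQ 0) x + 0 * synth (tfam \<Lambda> 0 t PQ 0) x = 0"
    proof (rule synth_lincomb_0)
      fix \<xi>
      show "complex_of_real (p (x $ 3)) * tfam \<Lambda> 0 t Q 0 \<xi> (x $ 3) + complex_of_real (-1) * tfam \<Lambda> 0 t PQ 0 \<xi> (x $ 3)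
         + complex_of_real 0 * tfam \<Lambda> 0 t PQ 0 \<xi> (x $ 3) + complex_of_real 0 * tfam \<Lambda> 0 t PQ 0 \<xi> (x $ 3) = 0"
        using e3[of "x $ 3" \<xi>] x by (simp add: tfam_def slab_def mult.left_commute[of "complex_of_real (p (x $ 3))"])
    qed (use b Q PQ in auto)
    then show ?thesis by (simp add: q[OF x])
  qed
  have div: "AE x in lebesgue. \<forall>i. x \<in> slab ?I \<longrightarrow> wpartial (slab ?I) (axis i 1) (\<lambda>y. u 1 y $ i) x = synth (tfam \<Lambda> 1 t (pamp i (E (axis i 1))) 0) x"
    using wpartial_synth[OF T[OF E] u] by (intro AE_finite_allI[of UNIV, simplified]) (auto simp: pamp_tfam)
  have gp: "AE x in lebesgue. \<forall>i. x \<in> slab ?I \<longrightarrow> wpartial (slab ?I) (axis i 1) (\<lambda>y. p (y $ 3) * q 0 y) x = synth (tfam \<Lambda> 0 t (pamp i PQ) 0) x"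
    using wpartial_synth[OF T[OF PQ] pq] by (intro AE_finite_allI[of UNIV, simplified]) (auto simp: pamp_tfam)
  have ge: "AE x in lebesgue. \<forall>i. x \<in> slab ?I \<longrightarrow> wpartial (slab ?I) (axis i 1) (\<lambda>y. e3 \<bullet> u 0 y) x = synth (tfam \<Lambda> 0 t (pamp i (E (axis 3 1))) 0) x"
    using wpartial_synth[OF T[OF E], of "\<lambda>y. e3 \<bullet> u 0 y" 0 3] u
    by (intro AE_finite_allI[of UNIV, simplified]) (auto simp: pamp_tfam inner_axis' )
  show ?thesis unfolding linearized_equations_on_def
    using div gp ge
  proof eventually_elim
    case (elim x)
    show ?case
    proof (intro impI conjI)
      assume x: "x \<in> slab ?I"
      then have x3: "x $ 3 \<in> ?I" by (simp add: slab_def)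
      show "u 1 x = u 1 x" ..
      have "1 * synth (tfam \<Lambda> 1 t Q 0) x + \<rho> (x $ 3) * synth (tfam \<Lambda> 1 t (pamp 1 (E (axis 1 1))) 0) x
         + \<rho> (x $ 3) * synth (tfam \<Lambda> 1 t (pamp 2 (E (axis 2 1))) 0) x + \<rho> (x $ 3) * synth (tfam \<Lambda> 1 t (pamp 3 (E (axis 3 1))) 0) x = 0"
      proof (rule synth_lincomb_0)
        fix \<xi>
        have "complex_of_real (\<Lambda> \<xi> ^ 1 * exp (\<Lambda> \<xi> * t)) * (Q 0 \<xi> (x $ 3) + \<rho> (x $ 3) * (pamp 1 (E (axis 1 1)) 0 \<xi> (x $ 3) + pamp 2 (E (axis 2 1)) 0 \<xi> (x $ 3) + pamp 3 (E (axis 3 1)) 0 \<xi> (x $ 3))) = 0"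
          unfolding e1[OF x3] by simp
        then show "complex_of_real 1 * tfam \<Lambda> 1 t Q 0 \<xi> (x $ 3) + complex_of_real (\<rho> (x $ 3)) * tfam \<Lambda> 1 t (pamp 1 (E (axis 1 1))) 0 \<xi> (x $ 3)
          + complex_of_real (\<rho> (x $ 3)) * tfam \<Lambda> 1 t (pamp 2 (E (axis 2 1))) 0 \<xi> (x $ 3) + complex_of_real (\<rho> (x $ 3)) * tfam \<Lambda> 1 t (pamp 3 (E (axis 3 1))) 0 \<xi> (x $ 3) = 0"
          by (simp add: tfam_def algebra_simps)
      qed (use b Q amp_pamp[OF E] in auto)
      then show "q 1 x + \<rho> (x $ 3) * wdiv (slab ?I) (u 1) x = 0"
        using elim(1) x by (simp add: wdiv_def sum_3 q algebra_simps)
      show "\<rho> (x $ 3) *\<^sub>R u 2 x + wgrad (slab ?I) (\<lambda>y. p (y $ 3) * q 0 y) x =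
          - (g * q 0 x) *\<^sub>R e3 - (g * \<rho> (x $ 3)) *\<^sub>R wgrad (slab ?I) (\<lambda>y. e3 \<bullet> u 0 y) x"
        unfolding vec_eq_iff
      proof
        fix i
        have "\<rho> (x $ 3) * synth (tfam \<Lambda> 2 t (E (axis i 1)) 0) x + 1 * synth (tfam \<Lambda> 0 t (pamp i PQ) 0) x
           + g * (if i = 3 then 1 else 0) * synth (tfam \<Lambda> 0 t Q 0) x + (g * \<rho> (x $ 3)) * synth (tfam \<Lambda> 0 t (pamp i (E (axis 3 1))) 0) x = 0"
        proof (rule synth_lincomb_0)
          fix \<xi>
          have "complex_of_real (exp (\<Lambda> \<xi> * t)) * (\<rho> (x $ 3) * (\<Lambda> \<xi>)\<^sup>2 * E (axis i 1) 0 \<xi> (x $ 3) + pamp i PQ 0 \<xi> (x $ 3)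
            + g * (if i = 3 then 1 else 0) * Q 0 \<xi> (x $ 3) + (g * \<rho> (x $ 3)) * pamp i (E (axis 3 1)) 0 \<xi> (x $ 3)) = 0"
            unfolding e2[OF x3] by simp
          then show "complex_of_real (\<rho> (x $ 3)) * tfam \<Lambda> 2 t (E (axis i 1)) 0 \<xi> (x $ 3) + complex_of_real 1 * tfam \<Lambda> 0 t (pamp i PQ) 0 \<xi> (x $ 3)
             + complex_of_real (g * (if i = 3 then 1 else 0)) * tfam \<Lambda> 0 t Q 0 \<xi> (x $ 3)
             + complex_of_real (g * \<rho> (x $ 3)) * tfam \<Lambda> 0 t (pamp i (E (axis 3 1))) 0 \<xi> (x $ 3) = 0"
            by (simp add: tfam_def algebra_simps)
        qed (use b Q E amp_pamp[OF E] amp_pamp[OF PQ] in auto)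
        then show "(\<rho> (x $ 3) *\<^sub>R u 2 x + wgrad (slab ?I) (\<lambda>y. p (y $ 3) * q 0 y) x) $ i =
          (- (g * q 0 x) *\<^sub>R e3 - (g * \<rho> (x $ 3)) *\<^sub>R wgrad (slab ?I) (\<lambda>y. e3 \<bullet> u 0 y) x) $ i"
          using elim(2,3) x by (simp add: wgrad_def u q axis_def algebra_simps)
      qed
    qed
  qed
qed

lemma evol_nth:
  fixes E :: "real^3 \<Rightarrow> ampseq"
  assumes "x \<in> slab {0<..<l}" shows "evol \<Lambda> E Em n t x $ i = synth (tfam \<Lambda> n t (E (axis i 1)) 0) x"
  using fld_inner[of "axis i 1" "\<lambda>b. tfam \<Lambda> n t (E b)" x]
  by (simp add: evol_def fld2_slab(1)[OF assms] Basis_cart inner_axis)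

lemma evol_nth':
  fixes E :: "real^3 \<Rightarrow> ampseq"
  assumes "x \<in> slab {-m<..<0}" shows "evol \<Lambda> Ep E n t x $ i = synth (tfam \<Lambda> n t (E (axis i 1)) 0) x"
  using fld_inner[of "axis i 1" "\<lambda>b. tfam \<Lambda> n t (E b)" x]
  by (simp add: evol_def fld2_slab(2)[OF assms] Basis_cart inner_axis)

lemma evol_real:
  "x \<in> slab {0<..<l} \<Longrightarrow> evol \<Lambda> (\<lambda>_::real. Qp) (\<lambda>_. Qm) n t x = synth (tfam \<Lambda> n t Qp 0) x"
  "x \<in> slab {-m<..<0} \<Longrightarrow> evol \<Lambda> (\<lambda>_::real. Qp) (\<lambda>_. Qm) n t x = synth (tfam \<Lambda> n t Qm 0) x"
  by (simp_all add: evol_def fld2_slab fld_def)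

text \<open>All traces are evaluated by \<open>plane_trace_synth\<close>, so the conditions reduce
  to values of amplitudes at the walls and on both sides of the interface.\<close>

lemma evol_jump_conditions:
  fixes Ep Em :: "real^3 \<Rightarrow> ampseq" and Qp Qm PQp PQm :: ampseq and p :: "real \<Rightarrow> real"
  assumes E: "amps2 m l r Ep Em" and PQ: "amp 0 l r PQp" "amp (-m) 0 r PQm"
    and L: "continuous_on UNIV \<Lambda>" "\<And>\<xi>. \<Lambda> (- \<xi>) = \<Lambda> \<xi>"
    and pq: "\<And>x. x \<in> slab {0<..<l} \<Longrightarrow> p (x $ 3) * q x = synth (tfam \<Lambda> 0 t PQp 0) x"
      "\<And>x. x \<in> slab {-m<..<0} \<Longrightarrow> p (x $ 3) * q x = synth (tfam \<Lambda> 0 t PQm 0) x"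
    and E0: "\<And>\<xi>. Ep e3 0 \<xi> 0 = Em e3 0 \<xi> 0" "\<And>\<xi>. Ep e3 0 \<xi> l = 0" "\<And>\<xi>. Em e3 0 \<xi> (-m) = 0"
    and PQ0: "\<And>\<xi>. PQp 0 \<xi> 0 = PQm 0 \<xi> 0"
  shows "jump_boundary_conditions m l p (evol \<Lambda> Ep Em n t) q"
proof -
  have ml: "-m < 0" "0 < l" using E by (auto simp: amps2_def)
  have e: "amp 0 l r (Ep e3)" "amp (-m) 0 r (Em e3)" using E by (auto simp: amps2_def Basis_cart)
  have T: "amp a b r (tfam \<Lambda> n t D)" if "amp a b r D" for a b D n by (rule amp_tfam[OF that L])
  let ?v = "\<lambda>x. evol \<Lambda> Ep Em n t x \<bullet> e3"
  have vp: "?v x = synth (tfam \<Lambda> n t (Ep e3) 0) x" if "x \<in> slab {0<..<l}" for x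
    using evol_nth[OF that, of \<Lambda> Ep Em n t 3] by (simp add: inner_axis)
  have vm: "?v x = synth (tfam \<Lambda> n t (Em e3) 0) x" if "x \<in> slab {-m<..<0}" for x
    using evol_nth'[OF that, of \<Lambda> Ep Em n t 3] by (simp add: inner_axis)
  have c: "synth (tfam \<Lambda> n t D 0) (pt y z) = synth (tfam \<Lambda> n t D' 0) (pt y z)" if "\<And>\<xi>. D 0 \<xi> z = D' 0 \<xi> z" for D D' n y z
    using that by (intro synth_cong) (simp add: tfam_def)
  have c0: "synth (tfam \<Lambda> n t D 0) (pt y z) = 0" if "\<And>\<xi>. D 0 \<xi> z = 0" for D y z
    using that by (simp add: synth_def tfam_def)
  have p0: "AE y in lebesgue. plane_trace {0<..<l} 0 ?v y = synth (tfam \<Lambda> n t (Ep e3) 0) (pt y 0)"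
    by (rule plane_trace_synth[OF T[OF e(1)] ml(2) disjI1[OF refl]]) (rule vp)
  have m0: "AE y in lebesgue. plane_trace {-m<..<0} 0 ?v y = synth (tfam \<Lambda> n t (Em e3) 0) (pt y 0)"
    by (rule plane_trace_synth[OF T[OF e(2)] ml(1) disjI2[OF refl]]) (rule vm)
  have pl: "AE y in lebesgue. plane_trace {0<..<l} l ?v y = synth (tfam \<Lambda> n t (Ep e3) 0) (pt y l)"
    by (rule plane_trace_synth[OF T[OF e(1)] ml(2) disjI2[OF refl]]) (rule vp)
  have mm: "AE y in lebesgue. plane_trace {-m<..<0} (-m) ?v y = synth (tfam \<Lambda> n t (Em e3) 0) (pt y (-m))"
    by (rule plane_trace_synth[OF T[OF e(2)] ml(1) disjI1[OF refl]]) (rule vm)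
  have q0: "AE y in lebesgue. plane_trace {0<..<l} 0 (\<lambda>x. p (x $ 3) * q x) y = synth (tfam \<Lambda> 0 t PQp 0) (pt y 0)"
    by (rule plane_trace_synth[OF T[OF PQ(1)] ml(2) disjI1[OF refl]]) (rule pq(1))
  have q0': "AE y in lebesgue. plane_trace {-m<..<0} 0 (\<lambda>x. p (x $ 3) * q x) y = synth (tfam \<Lambda> 0 t PQm 0) (pt y 0)"
    by (rule plane_trace_synth[OF T[OF PQ(2)] ml(1) disjI2[OF refl]]) (rule pq(2))
  show ?thesis
    unfolding jump_boundary_conditions_def plane_jump_def Iplus_def Iminus_def
    using p0 m0 pl mm q0 q0'
  proof eventually_elim
    case (elim y)
    then show ?case
      using c[of "Ep e3" 0 "Em e3" n y] c[of PQp 0 PQm 0 y] c0[of "Ep e3" l y] c0[of "Em e3" "-m" y] E0 PQ0 by simp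
  qed
qed

text \<open>\<open>E\<close>, \<open>Q\<close>, \<open>PQ\<close> are the amplitudes of \<open>\<eta>\<close>, \<open>q\<close> and \<open>P'(\<rho>\<^sub>0) q\<close>.\<close>

definition mode_equations ::
    "real \<Rightarrow> real \<Rightarrow> real \<Rightarrow> (real \<Rightarrow> real) \<Rightarrow> (real \<Rightarrow> real) \<Rightarrow> (real^2 \<Rightarrow> real) \<Rightarrow> (real^3 \<Rightarrow> ampseq) \<Rightarrow> ampseq \<Rightarrow> ampseq \<Rightarrow> bool" where
  "mode_equations a b g \<rho> p \<Lambda> E Q PQ \<longleftrightarrow> (\<forall>\<xi>. \<forall>z\<in>{a<..<b}.
     Q 0 \<xi> z + \<rho> z * (pamp 1 (E (axis 1 1)) 0 \<xi> z + pamp 2 (E (axis 2 1)) 0 \<xi> z + pamp 3 (E (axis 3 1)) 0 \<xi> z) = 0 \<and>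
     (\<forall>i. complex_of_real (\<rho> z * (\<Lambda> \<xi>)\<^sup>2) * E (axis i 1) 0 \<xi> z + pamp i PQ 0 \<xi> z
       + complex_of_real (g * (if i = 3 then 1 else 0)) * Q 0 \<xi> z + complex_of_real (g * \<rho> z) * pamp i (E (axis 3 1)) 0 \<xi> z = 0) \<and>
     p z * Q 0 \<xi> z = PQ 0 \<xi> z)"

lemma mode_equationsD:
  fixes E :: "real^3 \<Rightarrow> ampseq" and Q PQ :: ampseq and \<rho> p :: "real \<Rightarrow> real" and g :: real
  assumes "mode_equations a b g \<rho> p \<Lambda> E Q PQ"
  shows "z \<in> {a<..<b} \<Longrightarrow> Q 0 \<xi> z + \<rho> z * (pamp 1 (E (axis 1 1)) 0 \<xi> z + pamp 2 (E (axis 2 1)) 0 \<xi> z + pamp 3 (E (axis 3 1)) 0 \<xi> z) = 0"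
    "z \<in> {a<..<b} \<Longrightarrow> complex_of_real (\<rho> z * (\<Lambda> \<xi>)\<^sup>2) * E (axis i 1) 0 \<xi> z + pamp i PQ 0 \<xi> z
       + complex_of_real (g * (if i = 3 then 1 else 0)) * Q 0 \<xi> z + complex_of_real (g * \<rho> z) * pamp i (E (axis 3 1)) 0 \<xi> z = 0"
    "z \<in> {a<..<b} \<Longrightarrow> p z * Q 0 \<xi> z = PQ 0 \<xi> z"
  by (insert assms[unfolded mode_equations_def], blast+)

lemma evol_solution:
  fixes Ep Em :: "real^3 \<Rightarrow> ampseq" and Qp Qm PQp PQm :: ampseq and \<rho> p :: "real \<Rightarrow> real" and g :: real
  assumes E: "amps2 m l r Ep Em" and Q: "amp 0 l r Qp" "amp (-m) 0 r Qm" and PQ: "amp 0 l r PQp" "amp (-m) 0 r PQm"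
    and L: "continuous_on UNIV \<Lambda>" "\<And>\<xi>. \<Lambda> (- \<xi>) = \<Lambda> \<xi>" "\<And>\<xi>. 1 \<le> \<Lambda> \<xi>"
    and eqs: "mode_equations 0 l g \<rho> p \<Lambda> Ep Qp PQp" "mode_equations (-m) 0 g \<rho> p \<Lambda> Em Qm PQm"
    and E0: "\<And>\<xi>. Ep e3 0 \<xi> 0 = Em e3 0 \<xi> 0" "\<And>\<xi>. Ep e3 0 \<xi> l = 0" "\<And>\<xi>. Em e3 0 \<xi> (-m) = 0"
    and PQ0: "\<And>\<xi>. PQp 0 \<xi> 0 = PQm 0 \<xi> 0"
  shows "linearized_solution g m l \<rho> p \<infinity> (evol \<Lambda> Ep Em 0) (evol \<Lambda> Ep Em 1) (evol \<Lambda> (\<lambda>_. Qp) (\<lambda>_. Qm) 0)"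
proof -
  let ?u = "evol \<Lambda> Ep Em" and ?q = "evol \<Lambda> (\<lambda>_::real. Qp) (\<lambda>_. Qm)"
  have Q2: "amps2 m l r (\<lambda>_::real. Qp) (\<lambda>_. Qm)" using Q E by (simp add: amps2_def)
  have e: "amp 0 l r (Ep (axis i 1))" "amp (-m) 0 r (Em (axis i 1))" for i using E by (auto simp: amps2_def Basis_cart)
  have pq: "p (x $ 3) * ?q 0 t x = synth (tfam \<Lambda> 0 t PQp 0) x" if x: "x \<in> slab {0<..<l}" for x t
  proof -
    have "p (x $ 3) * synth (tfam \<Lambda> 0 t Qp 0) x = synth (tfam \<Lambda> 0 t PQp 0) x"
    proof -
      have "p (x $ 3) * synth (tfam \<Lambda> 0 t Qp 0) x = synth (\<lambda>\<xi> z. p z * tfam \<Lambda> 0 t Qp 0 \<xi> z) x"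
        by (simp add: synth_def mult.assoc)
      also have "\<dots> = synth (tfam \<Lambda> 0 t PQp 0) x"
        using eqs(1) x by (intro synth_cong) (auto simp: mode_equations_def tfam_def slab_def mult.left_commute[of "complex_of_real (p _)"])
      finally show ?thesis .
    qed
    then show ?thesis by (simp add: evol_real(1)[OF x])
  qed
  have pq': "p (x $ 3) * ?q 0 t x = synth (tfam \<Lambda> 0 t PQm 0) x" if x: "x \<in> slab {-m<..<0}" for x t
  proof -
    have "p (x $ 3) * synth (tfam \<Lambda> 0 t Qm 0) x = synth (\<lambda>\<xi> z. p z * tfam \<Lambda> 0 t Qm 0 \<xi> z) x"
      by (simp add: synth_def mult.assoc)
    also have "\<dots> = synth (tfam \<Lambda> 0 t PQm 0) x"
      using eqs(2) x by (intro synth_cong) (auto simp: mode_equations_def tfam_def slab_def mult.left_commute[of "complex_of_real (p _)"])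
    finally show ?thesis by (simp add: evol_real(2)[OF x])
  qed
  have "linearized_equations_on {0<..<l} g \<rho> p (?u 0 t) (?u 1 t) (?q 0 t) (?u 1 t) (?u 2 t) (?q 1 t)" for t
    by (rule linearized_equations_synth[where E = Ep and Q = Qp and PQ = PQp and r = r and \<Lambda> = \<Lambda> and t = t
          and u = "\<lambda>n. ?u n t" and q = "\<lambda>n. ?q n t", OF e(1) Q(1) PQ(1) L(1,2)])
      (rule mode_equationsD[OF eqs(1)] evol_nth evol_real(1), assumption)+
  moreover have "linearized_equations_on {-m<..<0} g \<rho> p (?u 0 t) (?u 1 t) (?q 0 t) (?u 1 t) (?u 2 t) (?q 1 t)" for t
    by (rule linearized_equations_synth[where E = Em and Q = Qm and PQ = PQm and r = r and \<Lambda> = \<Lambda> and t = t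
          and u = "\<lambda>n. ?u n t" and q = "\<lambda>n. ?q n t", OF e(2) Q(2) PQ(2) L(1,2)])
      (rule mode_equationsD[OF eqs(2)] evol_nth' evol_real(2), assumption)+
  moreover have "jump_boundary_conditions m l p (?u 1 t) (?q 0 t)" for t
    by (rule evol_jump_conditions[OF E PQ L(1,2) _ _ E0 PQ0]) (rule pq pq', assumption)+
  moreover note evol_Linf_loc[OF E L] evol_Linf_loc[OF Q2 L]
    evol_time_deriv[OF E L, of 0] evol_time_deriv[OF E L, of 1] evol_time_deriv[OF Q2 L, of 0]
  ultimately show ?thesis
    unfolding linearized_solution_def Iplus_def Iminus_def
    by (intro conjI exI[of _ "?u 1"] exI[of _ "?u 2"] exI[of _ "?q 1"]) (auto simp: numeral_2_eq_2)
qed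

text \<open>Bridge from the smoothness notion in the hypotheses on the pressure laws to the one used
  on closed intervals; in one variable the Frechet derivative is multiplication by its value at
  1.\<close>

lemma Ck_on_imp_Cr: "open S \<Longrightarrow> Ck_on n S f \<Longrightarrow> Cr n S f"
proof (induction n arbitrary: f)
  case (Suc n)
  have "(f has_real_derivative frechet_derivative f (at x) 1) (at x within S)" if "x \<in> S" for x
  proof -
    have "f differentiable at x"
      using Suc.prems that by (metis Ck_on.simps(2) at_within_open differentiable_on_def)
    then have "(f has_derivative frechet_derivative f (at x)) (at x)" by (simp add: frechet_derivative_works)
    moreover have "frechet_derivative f (at x) = (*) (frechet_derivative f (at x) 1)"
      using calculation has_derivative_bounded_linear[OF calculation]
      by (auto simp: fun_eq_iff) (metis linear_simps(5) mult.commute mult.right_neutral real_scaleR_def)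
    ultimately show ?thesis
      by (metis has_derivative_at_withinI has_field_derivative_def)
  qed
  then show ?case using Suc by (auto intro!: exI[of _ "\<lambda>x. frechet_derivative f (at x) 1"])
qed simp

lemma Cr_inverse: "Cr n {0<..} (\<lambda>x. inverse x)"
proof (induction n)
  case (Suc n)
  have "Cr n {0<..} (\<lambda>x::real. (-1) * (inverse x * inverse x))" by (intro Cr_mult Suc Cr_const)
  moreover have "((\<lambda>x. inverse x) has_real_derivative (-1) * (inverse x * inverse x)) (at x within {0<..})" if "x > 0" for x
    using that by (auto intro!: derivative_eq_intros simp: power2_eq_square)
  ultimately show ?case by (auto intro!: exI[of _ "\<lambda>x. (-1) * (inverse x * inverse x)"])
qed (auto intro!: continuous_intros)

section \<open>The steady state\<close>

context
  fixes P :: "real \<Rightarrow> real"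
  assumes P: "pressure_law P"
begin

lemma pressure_deriv: "r > 0 \<Longrightarrow> (P has_real_derivative deriv P r) (at r)" "Cr n {0<..} (deriv P)"
proof -
  have C: "Cr n {0<..} P" for n
    using P Ck_on_imp_Cr[of "{0<..}" n P] by (auto simp: pressure_law_def smooth_on_def)
  obtain f' where f': "\<And>x. x > 0 \<Longrightarrow> (P has_real_derivative f' x) (at x within {0<..})" "Cr n {0<..} f'"
    using C[of "Suc n"] unfolding Cr.simps by blast
  have d: "(P has_real_derivative f' x) (at x)" if "x > 0" for x
    using f'(1)[OF that] at_within_open[of x "{0<..}"] that by simp
  then show "r > 0 \<Longrightarrow> (P has_real_derivative deriv P r) (at r)" by (metis DERIV_imp_deriv)
  show "Cr n {0<..} (deriv P)" by (rule Cr_cong[OF _ f'(2)]) (use DERIV_imp_deriv[OF d] in simp)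
qed

lemma pressure_deriv_continuous: "continuous_on {0<..} (deriv P)"
  using pressure_deriv(2)[of 0] by simp

lemma pressure_strict_mono: "0 < r \<Longrightarrow> r < s \<Longrightarrow> P r < P s"
  using P by (auto simp: pressure_law_def strict_mono_on_def)

lemma pressure_deriv_nonneg: "r > 0 \<Longrightarrow> 0 \<le> deriv P r"
proof (rule ccontr)
  assume r: "r > 0" and "\<not> 0 \<le> deriv P r"
  then obtain d where d: "d > 0" "\<And>h. h > 0 \<Longrightarrow> h < d \<Longrightarrow> P (r + h) < P r"
    using DERIV_neg_dec_right[OF pressure_deriv(1)[OF r]] by auto
  from d(2)[of "d / 2"] pressure_strict_mono[OF r, of "r + d / 2"] d(1) show False by simp
qed

text \<open>The division by zero convention lets \<open>1 / P'\<close> be bounded although \<open>P'\<close> vanishes somewhere; but then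
  \<open>P'\<close> attains small positive values on a nonempty open set.\<close>

lemma pressure_deriv_pos: assumes r: "r > 0" shows "0 < deriv P r"
proof (rule ccontr)
  assume "\<not> 0 < deriv P r"
  then have r0: "deriv P r = 0" using pressure_deriv_nonneg[OF r] by simp
  have "compact {r..r + 1} \<and> {r..r + 1} \<subseteq> {0<..}" using r by auto
  then obtain C where C: "AE x in lebesgue. x \<in> {r..r + 1} \<longrightarrow> \<bar>1 / deriv P x\<bar> \<le> C"
    using P unfolding pressure_law_def by blast
  \<comment> \<open>Where 0 < P' < e, the reciprocal of P' exceeds max C 0 + 1 and so violates the
    almost-everywhere bound.\<close>
  define e where "e = 1 / (max C 0 + 1)"
  have e: "e > 0" by (simp add: e_def)
  have "\<exists>x. r < x \<and> x < r + 1 \<and> 0 < deriv P x"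
  proof (rule ccontr)
    assume *: "\<not> (\<exists>x. r < x \<and> x < r + 1 \<and> 0 < deriv P x)"
    obtain z where z: "r < z" "z < r + 1" "P (r + 1) - P r = (r + 1 - r) * deriv P z"
      using MVT2[of r "r + 1" P "deriv P"] pressure_deriv(1) r by auto
    then have "deriv P z \<le> 0" using * by (meson not_less)
    then show False using z pressure_strict_mono[OF r, of "r + 1"] by simp
  qed
  then obtain y where y: "r < y" "y < r + 1" "0 < deriv P y" by blast
  \<comment> \<open>A value between P'(r) = 0 and P'(y) that is also below e; since P' attains it,
    the set \<open>U\<close> is nonempty.\<close>
  define c where "c = min (deriv P y) e / 2"
  have c: "0 < c" "c < deriv P y" "c < e" using y e by (auto simp: c_def)
  have cont: "continuous_on {r..y} (deriv P)"
    using pressure_deriv_continuous by (rule continuous_on_subset) (use r in auto)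
  obtain x where x: "r \<le> x" "x \<le> y" "deriv P x = c"
    using IVT'[of "deriv P" r c y] r0 c y cont by auto
  define U where "U = {r<..<r + 1} \<inter> deriv P -` {0<..<e}"
  have "continuous_on {r<..<r + 1} (deriv P)"
    using pressure_deriv_continuous by (rule continuous_on_subset) (use r in auto)
  then have "open U" unfolding U_def by (intro continuous_open_preimage) auto
  moreover have "x \<in> U" using x c y r0 by (cases "x = r") (auto simp: U_def)
  moreover have "AE x in lebesgue. x \<notin> U"
    using C
  proof eventually_elim
    case (elim x)
    show ?case
    proof
      assume "x \<in> U"
      then have u: "x \<in> {r..r + 1}" "0 < deriv P x" "deriv P x < e" by (auto simp: U_def)
      then have "1 / e < 1 / deriv P x" using e by (simp add: divide_strict_left_mono)
      moreover have "1 / e = max C 0 + 1" by (simp add: e_def)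
      ultimately show False using elim u by auto
    qed
  qed
  ultimately have "U \<in> null_sets lebesgue" "U \<noteq> {}" "open U"
    using AE_iff_null[of lebesgue "\<lambda>x. x \<notin> U"] by auto
  then show False using open_not_negligible[of U] by (simp add: negligible_iff_null_sets)
qed

lemma enthalpy_deriv: assumes z: "z > 0" shows "(enthalpy P has_real_derivative deriv P z / z) (at z)"
proof -
  \<comment> \<open>An interval inside the positive axis that contains the base point 1 and has z in
    its interior, so that the derivative within the interval is a full one.\<close>
  define a b where "a = min 1 z / 2" and "b = max 1 z + 1"
  have ab: "0 < a" "a \<le> 1" "1 \<le> b" "a < z" "z < b" using z by (auto simp: a_def b_def)
  have "continuous_on {a..b} (deriv P)"
    by (rule continuous_on_subset[OF pressure_deriv_continuous]) (use ab in auto)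
  then have "continuous_on {a..b} (\<lambda>r. deriv P r / r)"
    using ab by (intro continuous_intros) auto
  then have "((\<lambda>u. LBINT y=1..ereal u. deriv P y / y) has_vector_derivative deriv P z / z) (at z within {a..b})"
    using interval_integral_FTC2[of a 1 b "\<lambda>r. deriv P r / r" z] ab by (simp add: one_ereal_def)
  moreover have "at z within {a..b} = at z" using ab by (intro at_within_Icc_at) auto
  ultimately show ?thesis
    by (simp add: enthalpy_def[abs_def] has_real_derivative_iff_has_vector_derivative)
qed

lemma enthalpy_strict_mono: assumes "0 < x" "x < y" shows "enthalpy P x < enthalpy P y"
proof (rule DERIV_pos_imp_increasing[OF assms(2)])
  fix t assume "x \<le> t" "t \<le> y"
  then show "\<exists>d. (enthalpy P has_real_derivative d) (at t) \<and> 0 < d"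
    using enthalpy_deriv[of t] pressure_deriv_pos[of t] assms by (intro exI[of _ "deriv P t / t"]) auto
qed

lemma enthalpy_inj: "inj_on (enthalpy P) {0<..}"
  by (rule linorder_inj_onI) (use enthalpy_strict_mono in \<open>force+\<close>)

text \<open>Inverse function rule: the enthalpy has derivative P'(r) / r, so its inverse G satisfies
  G' = G / P'(G).\<close>

lemma enthalpy_inverse_deriv:
  assumes y: "y \<in> enthalpy P ` {0<..}"
  defines "G \<equiv> inv_into {0<..} (enthalpy P)"
  shows "G y > 0" "enthalpy P (G y) = y" "(G has_real_derivative G y / deriv P (G y)) (at y)"
proof -
  show G: "G y > 0" unfolding G_def using inv_into_into[OF y] by simp
  show h: "enthalpy P (G y) = y" unfolding G_def by (rule f_inv_into_f[OF y])
  have "(G has_derivative (*) (inverse (deriv P (G y) / G y))) (at y)"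
  proof (rule has_derivative_inverse_strong_x[where S = "{0<..}" and f = "enthalpy P" and f' = "(*) (deriv P (G y) / G y)"])
    show "continuous_on {0<..} (enthalpy P)"
      by (rule DERIV_continuous_on[OF has_field_derivative_at_within[OF enthalpy_deriv]]) simp
    show "G (enthalpy P z) = z" if "z \<in> {0<..}" for z
      unfolding G_def by (rule inv_into_f_f[OF enthalpy_inj that])
    show "(enthalpy P has_derivative (*) (deriv P (G y) / G y)) (at (G y))"
      using enthalpy_deriv[OF G] by (simp add: has_field_derivative_def)
    show "(*) (deriv P (G y) / G y) \<circ> (*) (inverse (deriv P (G y) / G y)) = id"
      using pressure_deriv_pos[OF G] G by (auto simp: fun_eq_iff)
  qed (use G h in auto)
  then have "(G has_real_derivative inverse (deriv P (G y) / G y)) (at y)" by (simp only: has_field_derivative_def)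
  then show "(G has_real_derivative G y / deriv P (G y)) (at y)" by simp
qed

text \<open>Hydrostatics reads \<open>\<rho>' = - g w \<rho>\<close> with \<open>w = 1 / P' (\<rho>)\<close>.\<close>

lemma steady_state_layer:
  fixes a b g h0 :: real
  assumes range: "\<And>z. z \<in> {a..b} \<Longrightarrow> h0 - g * z \<in> enthalpy P ` {0<..}"
  defines "\<rho> \<equiv> \<lambda>z. inv_into {0<..} (enthalpy P) (h0 - g * z)"
  defines "w \<equiv> \<lambda>z. inverse (deriv P (\<rho> z))"
  shows "\<And>z. z \<in> {a..b} \<Longrightarrow> \<rho> z > 0" "\<And>z. z \<in> {a..b} \<Longrightarrow> w z > 0"
    "\<And>z. z \<in> {a..b} \<Longrightarrow> (\<rho> has_real_derivative - g * w z * \<rho> z) (at z within {a..b})"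
    "\<And>n. Cr n {a..b} \<rho>" "\<And>n. Cr n {a..b} w"
proof -
  show pos: "\<rho> z > 0" if "z \<in> {a..b}" for z
    unfolding \<rho>_def by (rule enthalpy_inverse_deriv(1)[OF range[OF that]])
  then show "w z > 0" if "z \<in> {a..b}" for z using that pressure_deriv_pos by (simp add: w_def)
  show d: "(\<rho> has_real_derivative - g * w z * \<rho> z) (at z within {a..b})" if "z \<in> {a..b}" for z
  proof -
    have "((\<lambda>z. h0 - g * z) has_real_derivative - g) (at z)" by (auto intro!: derivative_eq_intros)
    from has_field_derivative_at_within[OF DERIV_chain2[OF enthalpy_inverse_deriv(3)[OF range[OF that]] this]]
    show ?thesis unfolding \<rho>_def w_def
      by (rule DERIV_cong) (simp add: divide_inverse)
  qed
  \<comment> \<open>Bootstrap: w = 1 / P'(\<rho>) is as smooth as \<rho>, and \<rho>' = - g w \<rho>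
    then makes \<rho> smoother by one order.\<close>
  have "Cr n {0<..} (\<lambda>r. inverse (deriv P r))" for n
    by (rule Cr_compose[OF _ pressure_deriv(2) Cr_inverse]) (use pressure_deriv_pos in auto)
  then have w_of: "Cr n {a..b} w" if "Cr n {a..b} \<rho>" for n
    unfolding w_def by (rule Cr_compose[OF _ that, rotated]) (use pos in auto)
  show C: "Cr n {a..b} \<rho>" for n
  proof (induction n)
    case 0
    have "continuous_on {a..b} \<rho>" by (rule DERIV_continuous_on) (rule d)
    then show ?case by simp
  next
    case (Suc n)
    have "Cr n {a..b} (\<lambda>z. - g * w z * \<rho> z)" by (intro Cr_mult Cr_const w_of Suc)
    with d show ?case unfolding Cr.simps by (intro exI[of _ "\<lambda>z. - g * w z * \<rho> z"] conjI ballI)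
  qed
  show "Cr n {a..b} w" for n by (rule w_of[OF C])
qed

end

section \<open>Families of vertical modes\<close>

text \<open>Extends functions from [a, b] to the line, constant beyond the end points:
  \<open>amp\<close> and \<open>side\<close> require continuity for all arguments, whereas the
  coefficients are controlled on the closed layer only.\<close>

definition clamp1 :: "real \<Rightarrow> real \<Rightarrow> real \<Rightarrow> real" where "clamp1 a b z = max a (min b z)"

lemma clamp1_id [simp]: "z \<in> {a..b} \<Longrightarrow> clamp1 a b z = z"
  by (auto simp: clamp1_def)

lemma clamp1_in: "a \<le> b \<Longrightarrow> clamp1 a b z \<in> {a..b}"
  by (auto simp: clamp1_def)

lemma clamp1_continuous [continuous_intros]: "continuous_on S f \<Longrightarrow> continuous_on S (\<lambda>x. clamp1 a b (f x))"
  unfolding clamp1_def by (intro continuous_intros)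

text \<open>Truncated at \<open>1\<close> from below to stay away from the frequency \<open>\<xi> = 0\<close>.\<close>

definition freq :: "real^2 \<Rightarrow> real" where "freq \<xi> = max 1 ((norm \<xi>)\<^sup>2)"

lemma freq_pos: "freq \<xi> > 0" "freq (- \<xi>) = freq \<xi>" by (auto simp: freq_def)

lemma freq_continuous: "continuous_on S freq" unfolding freq_def by (intro continuous_intros)

lemma freq_eq: "norm \<xi> \<ge> 1 \<Longrightarrow> freq \<xi> = (norm \<xi>)\<^sup>2"
  using one_le_power[of "norm \<xi>" 2] by (simp add: freq_def)

text \<open>\<open>c\<close> is the profile in \<xi>. The vertical factor sees \<xi> only through s
  = \<open>freq \<xi>\<close> and \<mu> = M(s); being real and even in \<xi>, it leaves the symmetry
  required by \<open>amp\<close> to \<open>c\<close>.\<close>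

definition mamp :: "real \<Rightarrow> real \<Rightarrow> (real \<Rightarrow> real) \<Rightarrow> (real^2 \<Rightarrow> complex) \<Rightarrow> (nat \<Rightarrow> real \<Rightarrow> real \<Rightarrow> real \<Rightarrow> real) \<Rightarrow> ampseq" where
  "mamp a b M c F = (\<lambda>j \<xi> z. c \<xi> * complex_of_real (F j (freq \<xi>) (M (freq \<xi>)) (clamp1 a b z)))"

text \<open>\<open>w\<close> stands for 1 / P'(\<rho>) and \<psi> for \<phi>'. The equation for
  \<psi>' is (\<rho> \<phi>')' = \<rho> (s + \<mu> w) \<phi> with \<rho>' = - g w \<rho> inserted.
  The locale separates the calculus of vertical derivatives from the construction of the
  modes.\<close>

locale vmode =
  fixes a b g :: real and \<rho> w :: "real \<Rightarrow> real" and \<phi> \<psi> :: "real \<Rightarrow> real \<Rightarrow> real \<Rightarrow> real"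
  assumes ab: "a < b" and rho_smooth: "\<And>n. Cr n {a..b} \<rho>" and w_smooth: "\<And>n. Cr n {a..b} w"
    and rho_deriv: "\<And>z. z \<in> {a..b} \<Longrightarrow> (\<rho> has_real_derivative - g * w z * \<rho> z) (at z within {a..b})"
    and phi_cont: "continuous_on (({0<..} \<times> {0..}) \<times> {a..b}) (\<lambda>q. \<phi> (fst (fst q)) (snd (fst q)) (snd q))"
    and psi_cont: "continuous_on (({0<..} \<times> {0..}) \<times> {a..b}) (\<lambda>q. \<psi> (fst (fst q)) (snd (fst q)) (snd q))"
    and phi_deriv: "\<And>s \<mu> z. s > 0 \<Longrightarrow> \<mu> \<ge> 0 \<Longrightarrow> z \<in> {a..b} \<Longrightarrow> (\<phi> s \<mu> has_real_derivative \<psi> s \<mu> z) (at z within {a..b})"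
    and psi_deriv: "\<And>s \<mu> z. s > 0 \<Longrightarrow> \<mu> \<ge> 0 \<Longrightarrow> z \<in> {a..b} \<Longrightarrow>
      (\<psi> s \<mu> has_real_derivative g * w z * \<psi> s \<mu> z + (s + \<mu> * w z) * \<phi> s \<mu> z) (at z within {a..b})"
begin

text \<open>A function built from the modes together with all its vertical derivatives. Growth is
  measured relative to |\<phi>| + |\<psi>|, because the modes themselves are estimated separately,
  and for large s only.\<close>

definition vseq :: "(nat \<Rightarrow> real \<Rightarrow> real \<Rightarrow> real \<Rightarrow> real) \<Rightarrow> bool" where
  "vseq F \<longleftrightarrow> (\<forall>j. continuous_on (({0<..} \<times> {0..}) \<times> {a..b}) (\<lambda>q. F j (fst (fst q)) (snd (fst q)) (snd q))) \<and>
     (\<forall>j s \<mu> z. s > 0 \<longrightarrow> \<mu> \<ge> 0 \<longrightarrow> z \<in> {a..b} \<longrightarrow> (F j s \<mu> has_real_derivative F (Suc j) s \<mu> z) (at z within {a..b})) \<and>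
     (\<forall>j. \<exists>C N. C \<ge> 0 \<and> (\<forall>s \<mu> z. s > 0 \<longrightarrow> \<mu> \<ge> 0 \<longrightarrow> z \<in> {a..b} \<longrightarrow>
        \<bar>F j s \<mu> z\<bar> \<le> C * (1 + s + \<mu>) ^ N * (\<bar>\<phi> s \<mu> z\<bar> + \<bar>\<psi> s \<mu> z\<bar>)))"

lemma vseq_exists:
  assumes "coef {a..b} A0" "coef {a..b} B0"
  obtains F where "vseq F" "\<And>s \<mu> z. F 0 s \<mu> z = A0 s \<mu> z * \<phi> s \<mu> z + B0 s \<mu> z * \<psi> s \<mu> z"
proof -
  have h: "Cr n {a..b} (\<lambda>z. g * w z)" for n by (intro Cr_mult Cr_const w_smooth)
  obtain A B where AB: "A 0 = A0" "B 0 = B0" "\<And>n. coef {a..b} (A n)" "\<And>n. coef {a..b} (B n)"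
    "\<And>n s \<mu> z \<phi> \<psi>. z \<in> {a..b} \<Longrightarrow> (\<phi> has_real_derivative \<psi> z) (at z within {a..b}) \<Longrightarrow>
      (\<psi> has_real_derivative (g * w z) * \<psi> z + (s + \<mu> * w z) * \<phi> z) (at z within {a..b}) \<Longrightarrow>
      ((\<lambda>z. A n s \<mu> z * \<phi> z + B n s \<mu> z * \<psi> z) has_real_derivative A (Suc n) s \<mu> z * \<phi> z + B (Suc n) s \<mu> z * \<psi> z) (at z within {a..b})"
    using coef_sequence[OF ab assms w_smooth h] by blast
  let ?F = "\<lambda>j s \<mu> z. A j s \<mu> z * \<phi> s \<mu> z + B j s \<mu> z * \<psi> s \<mu> z"
  have "vseq ?F"
    unfolding vseq_def
  proof (intro conjI allI impI)
    show "continuous_on (({0<..} \<times> {0..}) \<times> {a..b}) (\<lambda>q. ?F j (fst (fst q)) (snd (fst q)) (snd q))" for j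
      by (intro continuous_intros phi_cont psi_cont continuous_on_subset[OF coef_continuous[OF AB(3)]] continuous_on_subset[OF coef_continuous[OF AB(4)]]) auto
    show "(?F j s \<mu> has_real_derivative ?F (Suc j) s \<mu> z) (at z within {a..b})" if "s > 0" "\<mu> \<ge> 0" "z \<in> {a..b}" for j s \<mu> z
      by (rule AB(5)[OF that(3) phi_deriv[OF that] psi_deriv[OF that]])
    fix j
    obtain C N where C: "C \<ge> 0" "\<And>s \<mu> z. s \<ge> 0 \<Longrightarrow> \<mu> \<ge> 0 \<Longrightarrow> z \<in> {a..b} \<Longrightarrow> \<bar>A j s \<mu> z\<bar> \<le> C * (1 + s + \<mu>) ^ N"
      using coef_bound[OF AB(3)] by blast
    obtain C' N' where C': "C' \<ge> 0" "\<And>s \<mu> z. s \<ge> 0 \<Longrightarrow> \<mu> \<ge> 0 \<Longrightarrow> z \<in> {a..b} \<Longrightarrow> \<bar>B j s \<mu> z\<bar> \<le> C' * (1 + s + \<mu>) ^ N'"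
      using coef_bound[OF AB(4)] by blast
    have "\<bar>?F j s \<mu> z\<bar> \<le> (C + C') * (1 + s + \<mu>) ^ (N + N') * (\<bar>\<phi> s \<mu> z\<bar> + \<bar>\<psi> s \<mu> z\<bar>)" if h: "s > 0" "\<mu> \<ge> 0" "z \<in> {a..b}" for s \<mu> z
    proof -
      let ?P = "(C + C') * (1 + s + \<mu>) ^ (N + N')"
      have "C * (1 + s + \<mu>) ^ N \<le> ?P" "C' * (1 + s + \<mu>) ^ N' \<le> ?P"
        using h C(1) C'(1) by (auto intro!: mult_mono power_increasing)
      then have "\<bar>A j s \<mu> z\<bar> \<le> ?P" "\<bar>B j s \<mu> z\<bar> \<le> ?P"
        using C(2)[of s \<mu> z] C'(2)[of s \<mu> z] h by auto
      then have "\<bar>A j s \<mu> z\<bar> * \<bar>\<phi> s \<mu> z\<bar> + \<bar>B j s \<mu> z\<bar> * \<bar>\<psi> s \<mu> z\<bar> \<le> ?P * \<bar>\<phi> s \<mu> z\<bar> + ?P * \<bar>\<psi> s \<mu> z\<bar>"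
        by (intro add_mono mult_right_mono) auto
      then show ?thesis
        using abs_triangle_ineq[of "A j s \<mu> z * \<phi> s \<mu> z" "B j s \<mu> z * \<psi> s \<mu> z"] by (simp add: abs_mult distrib_left)
    qed
    then show "\<exists>C N. C \<ge> 0 \<and> (\<forall>s \<mu> z. s > 0 \<longrightarrow> \<mu> \<ge> 0 \<longrightarrow> z \<in> {a..b} \<longrightarrow>
        \<bar>?F j s \<mu> z\<bar> \<le> C * (1 + s + \<mu>) ^ N * (\<bar>\<phi> s \<mu> z\<bar> + \<bar>\<psi> s \<mu> z\<bar>))"
      using C(1) C'(1) by (intro exI[of _ "C + C'"] exI[of _ "N + N'"]) auto
  qed
  then show thesis using that[of ?F] by (simp add: AB(1,2))
qed

lemma vseq_deriv: "vseq F \<Longrightarrow> s > 0 \<Longrightarrow> \<mu> \<ge> 0 \<Longrightarrow> z \<in> {a..b} \<Longrightarrow> (F j s \<mu> has_real_derivative F (Suc j) s \<mu> z) (at z within {a..b})"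
  by (simp add: vseq_def)

lemma vseq_continuous: "vseq F \<Longrightarrow> continuous_on (({0<..} \<times> {0..}) \<times> {a..b}) (\<lambda>q. F j (fst (fst q)) (snd (fst q)) (snd q))"
  by (simp add: vseq_def)

text \<open>\<open>vseq_exists\<close> specifies member 0 only; later members are identified by
  uniqueness of derivatives.\<close>

lemma vseq_deriv_eq:
  assumes "vseq F" "s > 0" "\<mu> \<ge> 0" "z \<in> {a..b}" "(F j s \<mu> has_real_derivative d) (at z within {a..b})"
  shows "F (Suc j) s \<mu> z = d"
  using vector_derivative_unique_within_closed_interval[of a b z "F j s \<mu>" "F (Suc j) s \<mu> z" d] vseq_deriv[OF assms(1-4)] assms(4,5) ab
  by (simp add: has_real_derivative_iff_has_vector_derivative)

lemma amp_mamp: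
  assumes F: "vseq F" and M: "\<And>s. s > 0 \<Longrightarrow> M s > 0" "continuous_on {0<..} M"
    and c: "continuous_on UNIV c" "\<And>\<xi>. c (- \<xi>) = cnj (c \<xi>)" "\<And>\<xi>. norm \<xi> > r \<Longrightarrow> c \<xi> = 0"
  shows "amp a b r (mamp a b M c F)"
  unfolding amp_def
proof (intro conjI allI impI)
  fix j
  have "continuous_on UNIV (\<lambda>\<xi>. M (freq \<xi>))"
    by (rule continuous_on_compose2[OF M(2) freq_continuous]) (auto simp: freq_pos)
  then have "continuous_on UNIV (\<lambda>p::(real^2) \<times> real. ((freq (fst p), M (freq (fst p))), clamp1 a b (snd p)))"
    using continuous_on_compose2[of UNIV "\<lambda>\<xi>. M (freq \<xi>)" UNIV fst] continuous_on_compose2[OF freq_continuous[of UNIV], of UNIV fst]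
    by (intro continuous_on_Pair clamp1_continuous continuous_on_snd continuous_on_id) (simp_all add: continuous_on_fst)
  moreover have "(\<lambda>p::(real^2) \<times> real. ((freq (fst p), M (freq (fst p))), clamp1 a b (snd p))) ` UNIV \<subseteq> ({0<..} \<times> {0..}) \<times> {a..b}"
    by (intro image_subsetI) (simp add: freq_pos clamp1_in[OF less_imp_le[OF ab]] less_imp_le[OF M(1)[OF freq_pos(1)]] del: atLeastAtMost_iff)
  ultimately have "continuous_on UNIV (\<lambda>p::(real^2) \<times> real. F j (freq (fst p)) (M (freq (fst p))) (clamp1 a b (snd p)))"
    using continuous_on_compose2[OF vseq_continuous[OF F, of j], of UNIV "\<lambda>p. ((freq (fst p), M (freq (fst p))), clamp1 a b (snd p))"]
    by simp
  then show "continuous_on UNIV (\<lambda>p. mamp a b M c F j (fst p) (snd p))"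
    unfolding mamp_def by (intro continuous_intros continuous_on_compose2[OF c(1)]) auto
next
  fix j \<xi> z assume z: "z \<in> {a..b}"
  have "(F j (freq \<xi>) (M (freq \<xi>)) has_vector_derivative F (Suc j) (freq \<xi>) (M (freq \<xi>)) z) (at z within {a..b})"
    using vseq_deriv[OF F freq_pos(1) _ z, of "M (freq \<xi>)"] M(1)[OF freq_pos(1)]
    by (simp add: has_real_derivative_iff_has_vector_derivative less_imp_le)
  from has_vector_derivative_mult_right[OF bounded_linear.has_vector_derivative[OF bounded_linear_of_real this], of "c \<xi>"]
  have "((\<lambda>z. c \<xi> * complex_of_real (F j (freq \<xi>) (M (freq \<xi>)) z)) has_vector_derivative mamp a b M c F (Suc j) \<xi> z) (at z within {a..b})"
    using z by (simp add: mamp_def)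
  then show "(mamp a b M c F j \<xi> has_vector_derivative mamp a b M c F (Suc j) \<xi> z) (at z within {a..b})"
    by (rule has_vector_derivative_transform[OF z, rotated]) (simp add: mamp_def)
qed (use c in \<open>auto simp: mamp_def freq_pos\<close>)

end

text \<open>The gradient of exp (i x \<bullet> \<xi>) \<phi>(x3), weighted by \<theta>: i \<xi>
  \<phi> horizontally and \<phi>' = \<psi> vertically. \<open>F1\<close> and \<open>F3\<close> are
  meant to be the sequences that start with \<phi> and \<psi>.\<close>

definition E_amp :: "real \<Rightarrow> real \<Rightarrow> (real \<Rightarrow> real) \<Rightarrow> (real^2 \<Rightarrow> real) \<Rightarrow> (nat \<Rightarrow> real \<Rightarrow> real \<Rightarrow> real \<Rightarrow> real) \<Rightarrow>
    (nat \<Rightarrow> real \<Rightarrow> real \<Rightarrow> real \<Rightarrow> real) \<Rightarrow> real^3 \<Rightarrow> ampseq" where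
  "E_amp a b M \<theta> F1 F3 b' =
     (if b' = axis 3 1 then mamp a b M (\<lambda>\<xi>. complex_of_real (\<theta> \<xi>)) F3
      else mamp a b M (\<lambda>\<xi>. (\<i> * complex_of_real (\<xi> $ (if b' = axis 1 1 then 1 else 2))) * complex_of_real (\<theta> \<xi>)) F1)"

lemma E_amp_axis:
  "E_amp a b M \<theta> F1 F3 (axis 3 1) = mamp a b M (\<lambda>\<xi>. complex_of_real (\<theta> \<xi>)) F3"
  "i \<noteq> 3 \<Longrightarrow> E_amp a b M \<theta> F1 F3 (axis i 1) = mamp a b M (\<lambda>\<xi>. (\<i> * complex_of_real (\<xi> $ h2 i)) * complex_of_real (\<theta> \<xi>)) F1"
  using exhaust_3[of i] by (auto simp: E_amp_def axis_eq_axis h2_def)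

context vmode
begin

text \<open>The divergence of the displacement is \<psi>' - s \<phi> = w (\<mu> \<phi> + g \<psi>),
  which explains \<open>FQ\<close>; division by w gives \<open>FP\<close>. The horizontal momentum
  equations then hold without any differentiation, and the vertical one uses \<rho>' = - g w \<rho>.
  Where \<theta> vanishes there is nothing to show; elsewhere |\<xi>| \<ge> 1, so the truncation in
  \<open>freq\<close> is inactive.\<close>

lemma mode_equations_mamp:
  fixes \<theta> :: "real^2 \<Rightarrow> real" and rho p :: "real \<Rightarrow> real"
  assumes F1: "\<And>s \<mu> z. F1 0 s \<mu> z = \<phi> s \<mu> z" and F3: "vseq F3" "\<And>s \<mu> z. F3 0 s \<mu> z = \<psi> s \<mu> z"
    and FQ: "\<And>s \<mu> z. FQ 0 s \<mu> z = - (\<rho> z * w z) * (\<mu> * \<phi> s \<mu> z + g * \<psi> s \<mu> z)"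
    and FP: "vseq FP" "\<And>s \<mu> z. FP 0 s \<mu> z = - \<rho> z * (\<mu> * \<phi> s \<mu> z + g * \<psi> s \<mu> z)"
    and M: "\<And>s. s > 0 \<Longrightarrow> M s > 0" and \<Lambda>: "\<And>\<xi>. \<theta> \<xi> \<noteq> 0 \<Longrightarrow> (\<Lambda> \<xi>)\<^sup>2 = M (freq \<xi>)" and \<theta>: "\<And>\<xi>. \<theta> \<xi> \<noteq> 0 \<Longrightarrow> norm \<xi> \<ge> 1"
    and rho: "\<And>z. z \<in> {a<..<b} \<Longrightarrow> rho z = \<rho> z" and p: "\<And>z. z \<in> {a<..<b} \<Longrightarrow> p z * w z = 1"
  shows "mode_equations a b g rho p \<Lambda> (E_amp a b M \<theta> F1 F3)
     (mamp a b M (\<lambda>\<xi>. complex_of_real (\<theta> \<xi>)) FQ) (mamp a b M (\<lambda>\<xi>. complex_of_real (\<theta> \<xi>)) FP)"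
  unfolding mode_equations_def
proof (intro allI ballI conjI)
  fix \<xi> :: "real^2" and z assume z: "z \<in> {a<..<b}"
  then have zI: "z \<in> {a..b}" by auto
  let ?s = "freq \<xi>" let ?\<mu> = "M ?s"
  let ?ph = "\<phi> ?s ?\<mu> z" and ?ps = "\<psi> ?s ?\<mu> z"
  have s: "?s > 0" "?\<mu> \<ge> 0" using freq_pos(1)[of \<xi>] M[OF freq_pos(1)[of \<xi>]] by auto
  define X where "X = g * w z * ?ps + (?s + ?\<mu> * w z) * ?ph"
  have F3': "F3 (Suc 0) ?s ?\<mu> z = X"
    unfolding X_def
  proof (rule vseq_deriv_eq[OF F3(1) s zI])
    have "F3 0 ?s ?\<mu> = \<psi> ?s ?\<mu>" by (simp add: F3(2) fun_eq_iff)
    then show "(F3 0 ?s ?\<mu> has_real_derivative g * w z * ?ps + (?s + ?\<mu> * w z) * ?ph) (at z within {a..b})"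
      using psi_deriv[OF s zI] by simp
  qed
  have FP': "FP (Suc 0) ?s ?\<mu> z = g * w z * \<rho> z * (?\<mu> * ?ph + g * ?ps) - \<rho> z * (?\<mu> * ?ps + g * X)"
  proof (rule vseq_deriv_eq[OF FP(1) s zI])
    have "((\<lambda>z. - \<rho> z * (?\<mu> * \<phi> ?s ?\<mu> z + g * \<psi> ?s ?\<mu> z)) has_real_derivative
       g * w z * \<rho> z * (?\<mu> * ?ph + g * ?ps) - \<rho> z * (?\<mu> * ?ps + g * X)) (at z within {a..b})"
      by (auto intro!: derivative_eq_intros rho_deriv[OF zI] phi_deriv[OF s zI] psi_deriv[OF s zI] simp: X_def algebra_simps)
    moreover have "FP 0 ?s ?\<mu> = (\<lambda>z. - \<rho> z * (?\<mu> * \<phi> ?s ?\<mu> z + g * \<psi> ?s ?\<mu> z))" by (simp add: FP(2) fun_eq_iff)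
    ultimately show "(FP 0 ?s ?\<mu> has_real_derivative g * w z * \<rho> z * (?\<mu> * ?ph + g * ?ps) - \<rho> z * (?\<mu> * ?ps + g * X)) (at z within {a..b})"
      by simp
  qed
  have m: "mamp a b M c F j \<xi> z = c \<xi> * complex_of_real (F j ?s ?\<mu> z)" for c F j using zI by (simp add: mamp_def)
  have n2: "(norm \<xi>)\<^sup>2 = (\<xi> $ 1)\<^sup>2 + (\<xi> $ 2)\<^sup>2"
    unfolding power2_norm_eq_inner by (simp add: inner_vec_def sum_2 power2_eq_square)
  have h2s: "h2 1 = 1" "h2 2 = 2" "(1::3) \<noteq> 3" "(2::3) \<noteq> 3" by (auto simp: h2_def)
  let ?c = "complex_of_real (\<theta> \<xi>)"
  show "mamp a b M (\<lambda>\<xi>. complex_of_real (\<theta> \<xi>)) FQ 0 \<xi> z + complex_of_real (rho z) *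
      (pamp 1 (E_amp a b M \<theta> F1 F3 (axis 1 1)) 0 \<xi> z + pamp 2 (E_amp a b M \<theta> F1 F3 (axis 2 1)) 0 \<xi> z + pamp 3 (E_amp a b M \<theta> F1 F3 e3) 0 \<xi> z) = 0"
  proof (cases "\<theta> \<xi> = 0")
    case False
    have sx: "?s = (\<xi> $ 1)\<^sup>2 + (\<xi> $ 2)\<^sup>2" using freq_eq[OF \<theta>[OF False]] n2 by simp
    have "FQ 0 ?s ?\<mu> z + \<rho> z * (- ((\<xi> $ 1)\<^sup>2 + (\<xi> $ 2)\<^sup>2) * ?ph + X) = 0"
      unfolding FQ X_def sx[symmetric] by (simp add: algebra_simps)
    then have "?c * complex_of_real (FQ 0 ?s ?\<mu> z + \<rho> z * (- ((\<xi> $ 1)\<^sup>2 + (\<xi> $ 2)\<^sup>2) * ?ph + X)) = 0" by simp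
    moreover have "\<i> * (\<i> * x) = - x" for x by (simp flip: mult.assoc)
    ultimately show ?thesis
      using rho[OF z] by (simp add: E_amp_axis pamp_def h2s m F1 F3' power2_eq_square algebra_simps)
  qed (simp add: E_amp_axis pamp_def h2s m)
  fix i :: 3
  show "complex_of_real (rho z * (\<Lambda> \<xi>)\<^sup>2) * E_amp a b M \<theta> F1 F3 (axis i 1) 0 \<xi> z + pamp i (mamp a b M (\<lambda>\<xi>. complex_of_real (\<theta> \<xi>)) FP) 0 \<xi> z
       + complex_of_real (g * (if i = 3 then 1 else 0)) * mamp a b M (\<lambda>\<xi>. complex_of_real (\<theta> \<xi>)) FQ 0 \<xi> z
       + complex_of_real (g * rho z) * pamp i (E_amp a b M \<theta> F1 F3 e3) 0 \<xi> z = 0"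
  proof (cases "\<theta> \<xi> = 0")
    case False
    note L = \<Lambda>[OF False]
    show ?thesis
    proof (cases "i = 3")
      case True
      have "\<rho> z * ?\<mu> * ?ps + FP (Suc 0) ?s ?\<mu> z + g * FQ 0 ?s ?\<mu> z + g * \<rho> z * X = 0"
        unfolding FP' FQ by (simp add: algebra_simps)
      then have zero: "?c * complex_of_real (\<rho> z * ?\<mu> * ?ps + FP (Suc 0) ?s ?\<mu> z + g * FQ 0 ?s ?\<mu> z + g * \<rho> z * X) = 0" by simp
      show ?thesis
        by (rule trans[OF _ zero]) (use True rho[OF z] in \<open>simp add: E_amp_axis pamp_def m L F3(2) F3' algebra_simps\<close>)
    next
      case False
      have "\<rho> z * ?\<mu> * ?ph + FP 0 ?s ?\<mu> z + g * \<rho> z * ?ps = 0"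
        unfolding FP by (simp add: algebra_simps)
      then have zero: "(\<i> * complex_of_real (\<xi> $ h2 i) * ?c) * complex_of_real (\<rho> z * ?\<mu> * ?ph + FP 0 ?s ?\<mu> z + g * \<rho> z * ?ps) = 0" by simp
      show ?thesis
        by (rule trans[OF _ zero]) (use False rho[OF z] in \<open>simp add: E_amp_axis pamp_def m L F1 F3(2) algebra_simps\<close>)
    qed
  qed (cases "i = 3"; simp add: E_amp_axis pamp_def m)
next
  fix \<xi> :: "real^2" and z assume z: "z \<in> {a<..<b}"
  have "p z * FQ 0 s \<mu> z = FP 0 s \<mu> z" for s \<mu>
  proof -
    have "p z * FQ 0 s \<mu> z = (p z * w z) * (- \<rho> z * (\<mu> * \<phi> s \<mu> z + g * \<psi> s \<mu> z))" unfolding FQ by (simp add: algebra_simps)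
    then show ?thesis using p[OF z] by (simp add: FP)
  qed
  from arg_cong[OF this, of complex_of_real] show "complex_of_real (p z) * mamp a b M (\<lambda>\<xi>. complex_of_real (\<theta> \<xi>)) FQ 0 \<xi> z = mamp a b M (\<lambda>\<xi>. complex_of_real (\<theta> \<xi>)) FP 0 \<xi> z"
    using z by (simp add: mamp_def mult.left_commute[of "complex_of_real (p z)"])
qed

end

section \<open>Polynomially bounded functions of the band radius\<close>

definition pb :: "(real \<Rightarrow> real) \<Rightarrow> bool" where
  "pb f \<longleftrightarrow> (\<exists>C N. \<forall>R\<ge>1. 0 \<le> f R \<and> f R \<le> C * R ^ N)"

lemma pb_const: "c \<ge> 0 \<Longrightarrow> pb (\<lambda>R. c)"
  unfolding pb_def by (intro exI[of _ c] exI[of _ 0]) simp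

lemma pb_id: "pb (\<lambda>R. R)"
  unfolding pb_def by (intro exI[of _ 1] exI[of _ 1]) simp

lemma pb_mult: "pb f \<Longrightarrow> pb h \<Longrightarrow> pb (\<lambda>R. f R * h R)"
proof -
  assume "pb f" "pb h"
  then obtain C N C' N' where c: "\<And>R. R \<ge> 1 \<Longrightarrow> 0 \<le> f R \<and> f R \<le> C * R ^ N" "\<And>R. R \<ge> 1 \<Longrightarrow> 0 \<le> h R \<and> h R \<le> C' * R ^ N'"
    unfolding pb_def by blast
  have "0 \<le> f R * h R \<and> f R * h R \<le> (C * C') * R ^ (N + N')" if "R \<ge> 1" for R
  proof -
    have "f R * h R \<le> (C * R ^ N) * (C' * R ^ N')" using c[OF that] by (intro mult_mono) auto
    then show ?thesis using c[OF that] by (simp add: power_add ac_simps)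
  qed
  then show ?thesis unfolding pb_def by blast
qed

lemma pb_add: "pb f \<Longrightarrow> pb h \<Longrightarrow> pb (\<lambda>R. f R + h R)"
proof -
  assume "pb f" "pb h"
  then obtain C N C' N' where c: "\<And>R. R \<ge> 1 \<Longrightarrow> 0 \<le> f R \<and> f R \<le> C * R ^ N" "\<And>R. R \<ge> 1 \<Longrightarrow> 0 \<le> h R \<and> h R \<le> C' * R ^ N'"
    unfolding pb_def by blast
  have "C \<ge> 0" "C' \<ge> 0" using c[of 1] by auto
  have "0 \<le> f R + h R \<and> f R + h R \<le> (C + C') * R ^ (N + N')" if "R \<ge> 1" for R
  proof -
    have "C * R ^ N \<le> C * R ^ (N + N')" "C' * R ^ N' \<le> C' * R ^ (N + N')"
      using that \<open>C \<ge> 0\<close> \<open>C' \<ge> 0\<close> by (auto intro!: mult_left_mono power_increasing)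
    then show ?thesis using c[OF that] by (simp add: distrib_right)
  qed
  then show ?thesis unfolding pb_def by blast
qed

lemma pb_power: "pb f \<Longrightarrow> pb (\<lambda>R. f R ^ n)"
  by (induction n) (simp_all add: pb_const pb_mult)

lemma pb_sum: "finite A \<Longrightarrow> (\<And>i. i \<in> A \<Longrightarrow> pb (f i)) \<Longrightarrow> pb (\<lambda>R. \<Sum>i\<in>A. f i R)"
  by (induction A rule: finite_induct) (simp_all add: pb_const pb_add)

lemma pb_nonneg: "pb f \<Longrightarrow> R \<ge> 1 \<Longrightarrow> 0 \<le> f R"
  unfolding pb_def by blast

text \<open>With R = x^2 this is exponential against polynomial growth in x, the degree being
  doubled.\<close>

lemma pb_less_exp_sqrt:
  assumes f: "pb f" and c: "c > 0"
  shows "\<exists>R\<ge>R0. R \<ge> 1 \<and> f R \<le> exp (c * sqrt R)"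
proof -
  obtain C N where C: "\<And>R. R \<ge> 1 \<Longrightarrow> 0 \<le> f R \<and> f R \<le> C * R ^ N" using f unfolding pb_def by blast
  have "((\<lambda>x. poly (monom C (2 * N)) x * exp (- (c * x))) \<longlongrightarrow> 0) at_top"
    by (rule poly_mult_exp_tendsto_0[OF c])
  then have "\<forall>\<^sub>F x in at_top. poly (monom C (2 * N)) x * exp (- (c * x)) < 1"
    by (rule order_tendstoD) simp
  then have "\<forall>\<^sub>F x in at_top. C * x ^ (2 * N) < exp (c * x)"
    by eventually_elim (simp add: poly_monom exp_minus field_simps)
  then obtain x0 where x0: "\<And>x. x \<ge> x0 \<Longrightarrow> C * x ^ (2 * N) < exp (c * x)"
    by (auto simp: eventually_at_top_linorder)
  \<comment> \<open>At least 1, so that x^2 \<ge> x and the conditions on R = x^2 follow from those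
    on x.\<close>
  define x where "x = max (max x0 1) R0"
  have x: "x \<ge> x0" "x \<ge> 1" "x \<ge> R0" by (auto simp: x_def)
  have "1 * x \<le> x * x" using x by (intro mult_right_mono) auto
  then have x2: "x\<^sup>2 \<ge> 1" "x\<^sup>2 \<ge> R0" using x unfolding power2_eq_square by linarith+
  have "f (x\<^sup>2) \<le> C * (x\<^sup>2) ^ N" using C[OF x2(1)] by simp
  also have "\<dots> = C * x ^ (2 * N)" by (simp add: power_mult)
  also have "\<dots> \<le> exp (c * sqrt (x\<^sup>2))" using x0[OF x(1)] x by (simp add: less_imp_le)
  finally show ?thesis using x2 by blast
qed

lemma pb_volc: "pb (\<lambda>R. volc (R + 1))"
proof -
  have "volc (R + 1) = unit_ball_vol 2 * (R + 1)\<^sup>2" if "R \<ge> 1" for R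
    unfolding volc_def using that by (simp add: content_cball)
  moreover have "pb (\<lambda>R. unit_ball_vol 2 * (R + 1)\<^sup>2)"
    by (intro pb_mult pb_power pb_add pb_id pb_const) auto
  ultimately show ?thesis unfolding pb_def by auto
qed

text \<open>One of the two fluid layers: \<open>\<sigma> = 1\<close> for the layer below the interface \<open>z = 0\<close>, \<open>\<sigma> = -1\<close> for
  the one above it; the distance from the rigid wall is \<open>x = b - a + \<sigma> z\<close>.\<close>

locale layer =
  fixes a b g :: real and \<rho> w :: "real \<Rightarrow> real" and \<sigma> r1 r2 w2 :: real
  assumes ab: "a < b" and rho_smooth: "\<And>n. Cr n {a..b} \<rho>" and w_smooth: "\<And>n. Cr n {a..b} w"
    and rho_deriv: "\<And>z. z \<in> {a..b} \<Longrightarrow> (\<rho> has_real_derivative - g * w z * \<rho> z) (at z within {a..b})"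
    and \<sigma>: "(\<sigma> = 1 \<and> b = 0) \<or> (\<sigma> = -1 \<and> a = 0)"
    and bd: "r1 > 0" "w2 > 0" "\<And>z. z \<in> {a..b} \<Longrightarrow> r1 \<le> \<rho> z" "\<And>z. z \<in> {a..b} \<Longrightarrow> \<rho> z \<le> r2"
      "\<And>z. z \<in> {a..b} \<Longrightarrow> 0 \<le> w z" "\<And>z. z \<in> {a..b} \<Longrightarrow> w z \<le> w2"
begin

abbreviation "L \<equiv> b - a"
abbreviation "R \<equiv> \<lambda>x. \<rho> (clamp1 a b (\<sigma> * (x - L)))"
abbreviation "W \<equiv> \<lambda>x. w (clamp1 a b (\<sigma> * (x - L)))"

lemma clamp_in: "clamp1 a b z \<in> {a..b}" using clamp1_in[of a b] ab by simp

sublocale S: side R W L r1 r2 w2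
proof
  have c: "continuous_on UNIV (\<lambda>x. f (clamp1 a b (\<sigma> * (x - L))))" if "Cr 0 {a..b} f" for f
    by (rule continuous_on_compose2[OF Cr_imp_continuous[OF that]]) (auto intro!: continuous_intros clamp_in simp del: atLeastAtMost_iff)
  show "continuous_on UNIV R" "continuous_on UNIV W" by (rule c[OF rho_smooth], rule c[OF w_smooth])
qed (use ab bd clamp_in in auto)

text \<open>As \<psi> = nu v / \<rho>, the factor \<rho>(0) / v(L) is what makes \<psi> equal to 1
  at the interface. The sign \<sigma> in \<open>phi\<close> converts the derivative in the distance
  from the wall into the derivative in z.\<close>

definition nu where "nu s \<mu> = \<rho> 0 / S.v s \<mu> L"
definition phi where "phi s \<mu> z = \<sigma> * nu s \<mu> * S.u s \<mu> (L + \<sigma> * z)"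
definition psi where "psi s \<mu> z = nu s \<mu> * S.v s \<mu> (L + \<sigma> * z) / \<rho> z"

lemma zero_in: "0 \<in> {a..b}" using \<sigma> ab by auto

lemma depth_in: "z \<in> {a..b} \<Longrightarrow> L + \<sigma> * z \<in> {0..L}" using \<sigma> by auto

lemma rho_pos: "z \<in> {a..b} \<Longrightarrow> \<rho> z > 0" using bd(1) bd(3)[of z] by linarith

lemma R_depth: "z \<in> {a..b} \<Longrightarrow> R (L + \<sigma> * z) = \<rho> z" "z \<in> {a..b} \<Longrightarrow> W (L + \<sigma> * z) = w z"
  using \<sigma> by auto

lemma R_L: "R L = \<rho> 0" using R_depth(1)[OF zero_in] by simp

lemma depth_deriv:
  assumes z: "z \<in> {a..b}" and f: "(f has_real_derivative d) (at (L + \<sigma> * z) within {0..L})"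
  shows "((\<lambda>z. f (L + \<sigma> * z)) has_real_derivative \<sigma> * d) (at z within {a..b})"
proof -
  have "((\<lambda>z. L + \<sigma> * z) has_real_derivative \<sigma>) (at z within {a..b})" by (auto intro!: derivative_eq_intros)
  moreover have "(\<lambda>z. L + \<sigma> * z) ` {a..b} \<subseteq> {0..L}" using depth_in by blast
  ultimately have "(f \<circ> (\<lambda>z. L + \<sigma> * z) has_real_derivative d * \<sigma>) (at z within {a..b})"
    using DERIV_subset[OF f] by (intro DERIV_image_chain) auto
  then show ?thesis by (simp add: o_def mult.commute)
qed

sublocale vmode a b g \<rho> w phi psi
proof
  show "continuous_on (({0<..} \<times> {0..}) \<times> {a..b}) (\<lambda>q. phi (fst (fst q)) (snd (fst q)) (snd q))"
    "continuous_on (({0<..} \<times> {0..}) \<times> {a..b}) (\<lambda>q. psi (fst (fst q)) (snd (fst q)) (snd q))"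
  proof -
    let ?D = "({0::real<..} \<times> {0::real..}) \<times> {a..b}"
    have uv: "continuous_on ?D (\<lambda>q. f (fst (fst q)) (snd (fst q)) (h (snd q)))"
      if "continuous_on (({0..} \<times> {0..}) \<times> {0..L}) (\<lambda>q. f (fst (fst q)) (snd (fst q)) (snd q))"
        "continuous_on UNIV h" "\<And>z. z \<in> {a..b} \<Longrightarrow> h z \<in> {0..L}" for f :: "real \<Rightarrow> real \<Rightarrow> real \<Rightarrow> real" and h
    proof -
      have "continuous_on ?D (\<lambda>q. h (snd q))"
        by (rule continuous_on_compose2[OF that(2)]) (auto intro!: continuous_intros)
      then have "continuous_on ?D (\<lambda>q. (fst q, h (snd q)))" by (intro continuous_intros)
      moreover have "(\<lambda>q. (fst q, h (snd q))) ` ?D \<subseteq> ({0..} \<times> {0..}) \<times> {0..L}"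
        using that(3) by (intro image_subsetI) (auto simp del: atLeastAtMost_iff intro: less_imp_le)
      ultimately show ?thesis
        using continuous_on_compose2[OF that(1), of ?D "\<lambda>q. (fst q, h (snd q))"] by simp
    qed
    have u: "continuous_on ?D (\<lambda>q. S.u (fst (fst q)) (snd (fst q)) (L + \<sigma> * snd q))"
      and v: "continuous_on ?D (\<lambda>q. S.v (fst (fst q)) (snd (fst q)) (L + \<sigma> * snd q))"
      and vL: "continuous_on ?D (\<lambda>q. S.v (fst (fst q)) (snd (fst q)) L)"
    proof -
      have c: "continuous_on UNIV (\<lambda>z. L + \<sigma> * z)" "continuous_on UNIV (\<lambda>z::real. L)" by (intro continuous_intros)+
      have "L \<in> {0..L}" using ab by simp
      from uv[OF S.uv_continuous(1) c(1) depth_in] uv[OF S.uv_continuous(2) c(1) depth_in] uv[OF S.uv_continuous(2) c(2) this]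
      show "continuous_on ?D (\<lambda>q. S.u (fst (fst q)) (snd (fst q)) (L + \<sigma> * snd q))"
        "continuous_on ?D (\<lambda>q. S.v (fst (fst q)) (snd (fst q)) (L + \<sigma> * snd q))"
        "continuous_on ?D (\<lambda>q. S.v (fst (fst q)) (snd (fst q)) L)" by blast+
    qed
    have r: "continuous_on ?D (\<lambda>q. \<rho> (snd q))"
      by (rule continuous_on_compose2[OF Cr_imp_continuous[OF rho_smooth[of 0]]]) (auto intro!: continuous_intros)
    have k: "continuous_on ?D (\<lambda>q. nu (fst (fst q)) (snd (fst q)))"
      unfolding nu_def
    proof (intro continuous_intros vL ballI)
      fix q assume "q \<in> ?D"
      then have "S.v (fst (fst q)) (snd (fst q)) L > 0" by (intro S.v_L_pos) auto
      then show "S.v (fst (fst q)) (snd (fst q)) L \<noteq> 0" by simp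
    qed
    show "continuous_on ?D (\<lambda>q. phi (fst (fst q)) (snd (fst q)) (snd q))"
      unfolding phi_def by (intro continuous_intros u k)
    show "continuous_on ?D (\<lambda>q. psi (fst (fst q)) (snd (fst q)) (snd q))"
      unfolding psi_def
    proof (intro continuous_intros v k r ballI)
      fix q assume "q \<in> ?D"
      then show "\<rho> (snd q) \<noteq> 0" using rho_pos[of "snd q"] by auto
    qed
  qed
next
  fix s \<mu> z :: real assume s: "s > 0" "\<mu> \<ge> 0" and z: "z \<in> {a..b}"
  have \<sigma>2: "\<sigma> * \<sigma> = 1" using \<sigma> by auto
  note d = depth_deriv[OF z S.uv_deriv(1)[OF less_imp_le[OF s(1)] s(2) depth_in[OF z]]] depth_deriv[OF z S.uv_deriv(2)[OF less_imp_le[OF s(1)] s(2) depth_in[OF z]]]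
  have p: "\<rho> z \<noteq> 0" using rho_pos[OF z] by simp
  have "(phi s \<mu> has_real_derivative \<sigma> * nu s \<mu> * (\<sigma> * (S.v s \<mu> (L + \<sigma> * z) / \<rho> z))) (at z within {a..b})"
    unfolding phi_def using DERIV_cmult[OF d(1)[unfolded R_depth[OF z]]] .
  moreover have "\<sigma> * nu s \<mu> * (\<sigma> * (S.v s \<mu> (L + \<sigma> * z) / \<rho> z)) = (\<sigma> * \<sigma>) * psi s \<mu> z" by (simp add: psi_def)
  ultimately show "(phi s \<mu> has_real_derivative psi s \<mu> z) (at z within {a..b})" using \<sigma>2 by simp
  have "(psi s \<mu> has_real_derivative (nu s \<mu> * (\<sigma> * (\<rho> z * (s + \<mu> * w z) * S.u s \<mu> (L + \<sigma> * z))) * \<rho> z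
      - nu s \<mu> * S.v s \<mu> (L + \<sigma> * z) * (- g * w z * \<rho> z)) / (\<rho> z * \<rho> z)) (at z within {a..b})"
    unfolding psi_def by (rule DERIV_divide[OF DERIV_cmult[OF d(2)[unfolded R_depth[OF z]]] rho_deriv[OF z] p])
  moreover have "(nu s \<mu> * (\<sigma> * (\<rho> z * (s + \<mu> * w z) * S.u s \<mu> (L + \<sigma> * z))) * \<rho> z
      - nu s \<mu> * S.v s \<mu> (L + \<sigma> * z) * (- g * w z * \<rho> z)) / (\<rho> z * \<rho> z) = g * w z * psi s \<mu> z + (s + \<mu> * w z) * phi s \<mu> z"
    using p by (simp add: phi_def psi_def field_simps)
  ultimately show "(psi s \<mu> has_real_derivative g * w z * psi s \<mu> z + (s + \<mu> * w z) * phi s \<mu> z) (at z within {a..b})" by simp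
qed (use ab rho_smooth w_smooth rho_deriv in auto)

lemma psi_wall: "s > 0 \<Longrightarrow> \<mu> \<ge> 0 \<Longrightarrow> psi s \<mu> (- \<sigma> * L) = 0"
proof -
  assume "s > 0" "\<mu> \<ge> 0"
  moreover have e: "L + \<sigma> * (- \<sigma> * L) = 0" using \<sigma> by auto
  ultimately show ?thesis unfolding psi_def e using S.uv_0(2)[of s \<mu>] by simp
qed

lemma psi_interface: "s > 0 \<Longrightarrow> \<mu> \<ge> 0 \<Longrightarrow> psi s \<mu> 0 = 1"
  using S.v_L_pos[of s \<mu>] rho_pos[OF zero_in] by (simp add: psi_def nu_def)

lemma phi_interface: "phi s \<mu> 0 = \<sigma> * \<rho> 0 * (S.u s \<mu> L / S.v s \<mu> L)"
  by (simp add: phi_def nu_def)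

text \<open>The threshold of \<open>ratio_upper\<close>, raised to 1 so that sqrt s \<ge> 1.\<close>

definition s0 where "s0 = max 1 (2 * r2 / (r1 * L\<^sup>2))"

text \<open>u and v increase from the wall to the interface, so their quotients by v(L) are largest
  at the interface, where they are at most 2 / r1 and exactly 1. The resulting bounds 2 r2 / r1 for
  \<phi> and r2 / r1 for \<psi> add up to the constant.\<close>

lemma mode_bound:
  assumes s: "s \<ge> s0" "\<mu> \<ge> 0" and z: "z \<in> {a..b}"
  shows "\<bar>phi s \<mu> z\<bar> + \<bar>psi s \<mu> z\<bar> \<le> 3 * r2 / r1"
proof -
  let ?x = "L + \<sigma> * z"
  have x: "0 \<le> ?x" "?x \<le> L" "?x \<in> {0..L}" using depth_in[OF z] by auto
  have s1: "s \<ge> 2 * r2 / (r1 * L\<^sup>2)" "s \<ge> 1" "s > 0" using s by (auto simp: s0_def)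
  then have sm: "s \<ge> 0" "\<mu> \<ge> 0" using s by auto
  have v: "S.v s \<mu> L > 0" by (rule S.v_L_pos) (use s1 s in auto)
  have r: "r1 > 0" "0 < \<rho> 0" "\<rho> 0 \<le> r2" "r1 \<le> \<rho> z" "\<rho> z > 0" using bd(1,3,4) zero_in z rho_pos by auto
  have u: "0 \<le> S.u s \<mu> ?x" "S.u s \<mu> ?x \<le> S.u s \<mu> L" "0 \<le> S.v s \<mu> ?x" "S.v s \<mu> ?x \<le> S.v s \<mu> L"
    using S.uv_nonneg[OF sm x(3)] S.u_mono[OF sm x(1,2)] S.v_mono[OF sm x(1,2)] by auto
  have "S.u s \<mu> L / S.v s \<mu> L \<le> 2 / (r1 * sqrt s)" by (rule S.ratio_upper[OF s1(1,3) s(2)])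
  also have "\<dots> \<le> 2 / r1" using r s1 by (intro divide_left_mono) (auto simp: mult_le_cancel_left1)
  finally have ratio: "S.u s \<mu> L / S.v s \<mu> L \<le> 2 / r1" .
  have "\<bar>phi s \<mu> z\<bar> = \<rho> 0 * (S.u s \<mu> ?x / S.v s \<mu> L)"
    using \<sigma> r v u by (auto simp: phi_def nu_def abs_mult)
  also have "\<dots> \<le> r2 * (2 / r1)"
  proof (rule mult_mono)
    have "S.u s \<mu> ?x / S.v s \<mu> L \<le> S.u s \<mu> L / S.v s \<mu> L" using u v by (intro divide_right_mono) auto
    then show "S.u s \<mu> ?x / S.v s \<mu> L \<le> 2 / r1" using ratio by linarith
  qed (use r u v in auto)
  finally have 1: "\<bar>phi s \<mu> z\<bar> \<le> r2 * (2 / r1)" .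
  have "\<bar>psi s \<mu> z\<bar> = \<rho> 0 * (S.v s \<mu> ?x / S.v s \<mu> L) / \<rho> z"
    using r v u by (simp add: psi_def nu_def abs_mult)
  also have "\<dots> \<le> r2 * 1 / r1"
    using r u v by (intro frac_le mult_mono) auto
  finally have "\<bar>psi s \<mu> z\<bar> \<le> r2 * 1 / r1" .
  then show ?thesis using 1 r by (simp add: field_simps)
qed

text \<open>For s \<le> (R + 1)^2 both s and \<mu> are polynomially bounded in R, so the relative
  growth clause of \<open>vseq\<close> and \<open>mode_bound\<close> combine to one bound for all
  vertical derivatives up to order \<open>J\<close>.\<close>

lemma vseq_pb:
  assumes F: "vseq F" and K: "K > 0"
  obtains f where "pb f" "\<And>j R s \<mu> z. j \<le> J \<Longrightarrow> R \<ge> 1 \<Longrightarrow> s0 \<le> s \<Longrightarrow> s \<le> (R + 1)\<^sup>2 \<Longrightarrow> 0 \<le> \<mu> \<Longrightarrow> \<mu> \<le> K * (1 + s) \<Longrightarrow>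
    z \<in> {a..b} \<Longrightarrow> \<bar>F j s \<mu> z\<bar> \<le> f R"
proof -
  obtain C N where C: "\<And>j. C j \<ge> 0" "\<And>j s \<mu> z. s > 0 \<Longrightarrow> \<mu> \<ge> 0 \<Longrightarrow> z \<in> {a..b} \<Longrightarrow>
        \<bar>F j s \<mu> z\<bar> \<le> C j * (1 + s + \<mu>) ^ N j * (\<bar>phi s \<mu> z\<bar> + \<bar>psi s \<mu> z\<bar>)"
  proof -
    have "\<forall>j. \<exists>C N. C \<ge> 0 \<and> (\<forall>s \<mu> z. s > 0 \<longrightarrow> \<mu> \<ge> 0 \<longrightarrow> z \<in> {a..b} \<longrightarrow>
        \<bar>F j s \<mu> z\<bar> \<le> C * (1 + s + \<mu>) ^ N * (\<bar>phi s \<mu> z\<bar> + \<bar>psi s \<mu> z\<bar>))"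
      using F unfolding vseq_def by (elim conjE)
    from choice[OF this] obtain C where "\<forall>j. \<exists>N. C j \<ge> 0 \<and> (\<forall>s \<mu> z. s > 0 \<longrightarrow> \<mu> \<ge> 0 \<longrightarrow> z \<in> {a..b} \<longrightarrow>
        \<bar>F j s \<mu> z\<bar> \<le> C j * (1 + s + \<mu>) ^ N * (\<bar>phi s \<mu> z\<bar> + \<bar>psi s \<mu> z\<bar>))" ..
    from choice[OF this] obtain N where "\<forall>j. C j \<ge> 0 \<and> (\<forall>s \<mu> z. s > 0 \<longrightarrow> \<mu> \<ge> 0 \<longrightarrow> z \<in> {a..b} \<longrightarrow>
        \<bar>F j s \<mu> z\<bar> \<le> C j * (1 + s + \<mu>) ^ N j * (\<bar>phi s \<mu> z\<bar> + \<bar>psi s \<mu> z\<bar>))" ..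
    then show thesis using that by blast
  qed
  let ?f = "\<lambda>j R. C j * ((1 + K) * (1 + (R + 1)\<^sup>2)) ^ N j * (3 * r2 / r1)"
  have r: "3 * r2 / r1 \<ge> 0" using S.r2 bd(1) by simp
  have pb: "pb (?f j)" for j
    using C(1) K r by (intro pb_mult pb_power pb_add pb_const pb_id) auto
  show thesis
  proof (rule that[of "\<lambda>R. \<Sum>j\<le>J. ?f j R"])
    show "pb (\<lambda>R. \<Sum>j\<le>J. ?f j R)" by (rule pb_sum[OF _ pb]) simp
    fix j and R s \<mu> z :: real
    assume h: "j \<le> J" "R \<ge> 1" "s0 \<le> s" "s \<le> (R + 1)\<^sup>2" "0 \<le> \<mu>" "\<mu> \<le> K * (1 + s)" "z \<in> {a..b}"
    have s: "s > 0" using h(3) by (simp add: s0_def)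
    have "1 + s + \<mu> \<le> (1 + K) * (1 + s)" using h(6) by (simp add: algebra_simps)
    also have "\<dots> \<le> (1 + K) * (1 + (R + 1)\<^sup>2)" using h(4) K by (intro mult_left_mono) auto
    finally have "(1 + s + \<mu>) ^ N j \<le> ((1 + K) * (1 + (R + 1)\<^sup>2)) ^ N j" using s h(5) by (intro power_mono) auto
    then have "C j * (1 + s + \<mu>) ^ N j * (\<bar>phi s \<mu> z\<bar> + \<bar>psi s \<mu> z\<bar>) \<le> ?f j R"
      using mode_bound[OF h(3,5,7)] C(1) s h(5) K by (intro mult_mono) auto
    then have "\<bar>F j s \<mu> z\<bar> \<le> ?f j R" using C(2)[OF s h(5,7), of j] by linarith
    also have "\<dots> \<le> (\<Sum>j\<le>J. ?f j R)" using h(1) by (intro member_le_sum) (use pb_nonneg[OF pb h(2)] in auto)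
    finally show "\<bar>F j s \<mu> z\<bar> \<le> (\<Sum>j\<le>J. ?f j R)" .
  qed
qed

end

section \<open>Growing solutions\<close>

text \<open>A continuous profile on the annulus R < |\<xi>| < R + 1 that peaks with value \<kappa>
  on the middle circle.\<close>

definition tent :: "real \<Rightarrow> real \<Rightarrow> real^2 \<Rightarrow> real" where
  "tent \<kappa> R \<xi> = \<kappa> * max 0 (1 - \<bar>2 * (norm \<xi> - R) - 1\<bar>)"

lemma tent_even: "tent \<kappa> R (- \<xi>) = tent \<kappa> R \<xi>" by (simp add: tent_def)

lemma tent_continuous: "continuous_on S (tent \<kappa> R)" unfolding tent_def by (intro continuous_intros)

lemma tent_bounds: "\<kappa> \<ge> 0 \<Longrightarrow> 0 \<le> tent \<kappa> R \<xi>" "\<kappa> \<ge> 0 \<Longrightarrow> tent \<kappa> R \<xi> \<le> \<kappa>"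
  unfolding tent_def by (simp, intro mult_left_le) auto

lemma tent_support: "tent \<kappa> R \<xi> \<noteq> 0 \<Longrightarrow> R < norm \<xi> \<and> norm \<xi> < R + 1"
  unfolding tent_def by (auto simp: max_def split: if_splits)

text \<open>Points of this ball are within 1/4 of the middle circle, where the tent has at least
  half its height. The area of the ball does not depend on R.\<close>

lemma tent_ge:
  assumes "\<kappa> \<ge> 0" "R \<ge> 0" "\<xi> \<in> ball (((R + 1/2) *\<^sub>R axis 1 1)) (1/4)"
  shows "\<kappa> / 2 \<le> tent \<kappa> R \<xi>"
proof -
  have "\<bar>norm \<xi> - norm (((R + 1/2) *\<^sub>R axis 1 1) :: real^2)\<bar> \<le> norm (\<xi> - ((R + 1/2) *\<^sub>R axis 1 1))" by (rule norm_triangle_ineq3)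
  then have "\<bar>norm \<xi> - (R + 1/2)\<bar> < 1/4" using assms by (simp add: norm_axis_1 dist_norm norm_minus_commute)
  then have "1/2 \<le> max 0 (1 - \<bar>2 * (norm \<xi> - R) - 1\<bar>)" by (auto simp: max_def abs_if split: if_splits)
  from mult_left_mono[OF this assms(1)] show ?thesis by (simp add: tent_def)
qed

text \<open>The bound \<kappa> (R + 1) leaves room for the factor i \<xi> in the horizontal
  components.\<close>

definition bandamp :: "real \<Rightarrow> real \<Rightarrow> (real^2 \<Rightarrow> complex) \<Rightarrow> bool" where
  "bandamp \<kappa> R c \<longleftrightarrow> continuous_on UNIV c \<and> (\<forall>\<xi>. c (- \<xi>) = cnj (c \<xi>)) \<and>
     (\<forall>\<xi>. c \<xi> \<noteq> 0 \<longrightarrow> R < norm \<xi> \<and> norm \<xi> < R + 1) \<and> (\<forall>\<xi>. cmod (c \<xi>) \<le> \<kappa> * (R + 1))"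

lemma bandamp_tent:
  assumes "\<kappa> \<ge> 0" "R \<ge> 0"
  shows "bandamp \<kappa> R (\<lambda>\<xi>. complex_of_real (tent \<kappa> R \<xi>))"
    "bandamp \<kappa> R (\<lambda>\<xi>. (\<i> * complex_of_real (\<xi> $ i)) * complex_of_real (tent \<kappa> R \<xi>))"
proof -
  have "tent \<kappa> R \<xi> \<le> \<kappa> * (R + 1)" for \<xi>
  proof -
    have "\<kappa> * 1 \<le> \<kappa> * (R + 1)" using assms by (intro mult_left_mono) auto
    then show ?thesis using tent_bounds(2)[OF assms(1), of R \<xi>] by linarith
  qed
  then show "bandamp \<kappa> R (\<lambda>\<xi>. complex_of_real (tent \<kappa> R \<xi>))"
    unfolding bandamp_def using tent_bounds(1)[OF assms(1)] tent_support[of \<kappa> R]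
    by (auto simp: tent_even intro!: continuous_intros tent_continuous)
  have "\<bar>\<xi> $ i\<bar> * tent \<kappa> R \<xi> \<le> \<kappa> * (R + 1)" for \<xi>
  proof (cases "tent \<kappa> R \<xi> = 0")
    case False
    then have "\<bar>\<xi> $ i\<bar> \<le> R + 1" using tent_support[OF False] component_le_norm_cart[of \<xi> i] by linarith
    then have "\<bar>\<xi> $ i\<bar> * tent \<kappa> R \<xi> \<le> (R + 1) * \<kappa>"
      using tent_bounds[OF assms(1), of R \<xi>] assms by (intro mult_mono) auto
    then show ?thesis by (simp add: mult.commute)
  qed (use assms in simp)
  then show "bandamp \<kappa> R (\<lambda>\<xi>. (\<i> * complex_of_real (\<xi> $ i)) * complex_of_real (tent \<kappa> R \<xi>))"
    unfolding bandamp_def using tent_bounds(1)[OF assms(1)] tent_support[of \<kappa> R]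
    by (auto simp: tent_even norm_mult intro!: continuous_intros tent_continuous)
qed

text \<open>For |\<xi>| \<le> R the rate is free apart from being continuous, even and at least 1;
  the band amplitudes vanish there.\<close>

definition rate :: "(real \<Rightarrow> real) \<Rightarrow> real \<Rightarrow> (real^2 \<Rightarrow> real) \<Rightarrow> bool" where
  "rate M R \<Lambda> \<longleftrightarrow> continuous_on UNIV \<Lambda> \<and> (\<forall>\<xi>. \<Lambda> (- \<xi>) = \<Lambda> \<xi>) \<and> (\<forall>\<xi>. 1 \<le> \<Lambda> \<xi>) \<and>
     (\<forall>\<xi>. R < norm \<xi> \<longrightarrow> (\<Lambda> \<xi>)\<^sup>2 = M (freq \<xi>))"

text \<open>All four functions have the form A \<phi> + B \<psi> with A and B in
  \<open>coef\<close>; the factor \<mu> in the last two is the reason why \<open>coef\<close> admits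
  multiplication by \<mu> from the start.\<close>

lemma (in vmode) mode_families:
  obtains F1 F3 FQ FP where "vseq F1" "\<And>s \<mu> z. F1 0 s \<mu> z = \<phi> s \<mu> z"
    "vseq F3" "\<And>s \<mu> z. F3 0 s \<mu> z = \<psi> s \<mu> z"
    "vseq FQ" "\<And>s \<mu> z. FQ 0 s \<mu> z = - (\<rho> z * w z) * (\<mu> * \<phi> s \<mu> z + g * \<psi> s \<mu> z)"
    "vseq FP" "\<And>s \<mu> z. FP 0 s \<mu> z = - \<rho> z * (\<mu> * \<phi> s \<mu> z + g * \<psi> s \<mu> z)"
proof -
  have c: "coef {a..b} (\<lambda>s \<mu> z. c)" for c by (rule coef.base) simp
  have q: "coef {a..b} (\<lambda>s \<mu> z. c * (\<rho> z * w z))" and p: "coef {a..b} (\<lambda>s \<mu> z. c * \<rho> z)" for c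
    by (rule coef.base, intro Cr_mult Cr_const rho_smooth w_smooth)+
  obtain F1 where F1: "vseq F1" "\<And>s \<mu> z. F1 0 s \<mu> z = 1 * \<phi> s \<mu> z + 0 * \<psi> s \<mu> z" by (rule vseq_exists[OF c[of 1] c[of 0]]) (rule that)
  obtain F3 where F3: "vseq F3" "\<And>s \<mu> z. F3 0 s \<mu> z = 0 * \<phi> s \<mu> z + 1 * \<psi> s \<mu> z" by (rule vseq_exists[OF c[of 0] c[of 1]]) (rule that)
  obtain FQ where FQ: "vseq FQ" "\<And>s \<mu> z. FQ 0 s \<mu> z = \<mu> * (-1 * (\<rho> z * w z)) * \<phi> s \<mu> z + - g * (\<rho> z * w z) * \<psi> s \<mu> z"
    by (rule vseq_exists[OF coef.mu[OF q[of "-1"]] q[of "-g"]]) (rule that)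
  obtain FP where FP: "vseq FP" "\<And>s \<mu> z. FP 0 s \<mu> z = \<mu> * (-1 * \<rho> z) * \<phi> s \<mu> z + - g * \<rho> z * \<psi> s \<mu> z"
    by (rule vseq_exists[OF coef.mu[OF p[of "-1"]] p[of "-g"]]) (rule that)
  show thesis
    by (rule that[OF F1(1) _ F3(1) _ FQ(1) _ FP(1)]) (simp_all add: F1 F3 FQ FP algebra_simps)
qed

section \<open>Norm bounds for one layer\<close>

context layer
begin

text \<open>Squared initial norms are quadratic in \<kappa> and polynomial in R. The factors of
  \<open>G\<close> bound the rate (through \<Lambda> \<le> \<Lambda>^2 = \<mu>), the profile and the
  vertical factor; n = 1 covers the velocity.\<close>

lemma nsq_band:
  assumes F: "vseq F" and K: "K > 0" and M: "\<And>s. s > 0 \<Longrightarrow> M s > 0" "continuous_on {0<..} M" "\<And>s. s > 0 \<Longrightarrow> M s \<le> K * (1 + s)"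
  obtains U where "pb U" "\<And>\<kappa> R c \<Lambda> n. \<kappa> \<ge> 0 \<Longrightarrow> R \<ge> 1 \<Longrightarrow> R \<ge> s0 \<Longrightarrow> bandamp \<kappa> R c \<Longrightarrow> rate M R \<Lambda> \<Longrightarrow> n \<le> 1 \<Longrightarrow>
    nsq J a b (tfam \<Lambda> n 0 (mamp a b M c F)) \<le> ennreal (\<kappa>\<^sup>2 * U R)"
proof -
  obtain f where f: "pb f" "\<And>j R s \<mu> z. j \<le> J \<Longrightarrow> R \<ge> 1 \<Longrightarrow> s0 \<le> s \<Longrightarrow> s \<le> (R + 1)\<^sup>2 \<Longrightarrow> 0 \<le> \<mu> \<Longrightarrow> \<mu> \<le> K * (1 + s) \<Longrightarrow>
    z \<in> {a..b} \<Longrightarrow> \<bar>F j s \<mu> z\<bar> \<le> f R"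
    using vseq_pb[OF F K] by blast
  define G where "G = (\<lambda>R. (1 + K * (1 + (R + 1)\<^sup>2)) * ((R + 1) * f R))"
  define U where "U = (\<lambda>R. real (Suc J) * ((1 + (R + 1)\<^sup>2) ^ J * (((2 * pi)\<^sup>2 * G R)\<^sup>2 * L)) * volc (R + 1))"
  have G: "pb G" unfolding G_def using K f(1) by (intro pb_mult pb_add pb_power pb_const pb_id) auto
  have U: "pb U" unfolding U_def using ab by (intro pb_mult pb_add pb_power pb_const pb_id pb_volc G) auto
  show thesis
  proof (rule that[OF U])
    fix \<kappa> R c \<Lambda> and n :: nat
    assume \<kappa>: "\<kappa> \<ge> 0" and R: "R \<ge> 1" "R \<ge> s0" and c: "bandamp \<kappa> R c" and L: "rate M R \<Lambda>" and n: "n \<le> 1"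
    have A: "amp a b (R + 1) (tfam \<Lambda> n 0 (mamp a b M c F))"
    proof (rule amp_tfam[OF amp_mamp[OF F M(1,2)]])
      show "continuous_on UNIV c" "\<And>\<xi>. c (- \<xi>) = cnj (c \<xi>)" "\<And>\<xi>. R + 1 < norm \<xi> \<Longrightarrow> c \<xi> = 0"
        using c by (force simp: bandamp_def)+
      show "continuous_on UNIV \<Lambda>" "\<And>\<xi>. \<Lambda> (- \<xi>) = \<Lambda> \<xi>" using L by (auto simp: rate_def)
    qed
    have Gn: "G R \<ge> 0" by (rule pb_nonneg[OF G R(1)])
    have "cmod (tfam \<Lambda> n 0 (mamp a b M c F) j \<xi> z) \<le> \<kappa> * G R" if j: "j \<le> J" and z: "z \<in> {a<..<b}" for j \<xi> z
    proof (cases "c \<xi> = 0")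
      case False
      then have x: "R < norm \<xi>" "norm \<xi> < R + 1" using c by (auto simp: bandamp_def)
      let ?s = "freq \<xi>" let ?\<mu> = "M ?s"
      have s: "?s = (norm \<xi>)\<^sup>2" using freq_eq x R by simp
      have "R \<le> R\<^sup>2" using R by (simp add: power2_eq_square)
      also have "\<dots> \<le> ?s" unfolding s using x R by (intro power_mono) auto
      finally have s0: "s0 \<le> ?s" using R by linarith
      have s1: "?s \<le> (R + 1)\<^sup>2" unfolding s using x by (intro power_mono) auto
      have m: "0 < ?\<mu>" "?\<mu> \<le> K * (1 + ?s)" using M freq_pos by auto
      have Fb: "\<bar>F j ?s ?\<mu> z\<bar> \<le> f R" using z by (intro f(2)[OF j R(1) s0 s1 _ m(2)]) (use m in auto)
      have l: "1 \<le> \<Lambda> \<xi>" "(\<Lambda> \<xi>)\<^sup>2 = ?\<mu>" using L x by (auto simp: rate_def)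
      have "\<Lambda> \<xi> * 1 \<le> \<Lambda> \<xi> * \<Lambda> \<xi>" using l by (intro mult_left_mono) auto
      moreover have "K * (1 + ?s) \<le> K * (1 + (R + 1)\<^sup>2)" using K s1 by (intro mult_left_mono) auto
      moreover have "0 \<le> K * (1 + (R + 1)\<^sup>2)" using K by simp
      ultimately have "\<Lambda> \<xi> ^ n \<le> 1 + K * (1 + (R + 1)\<^sup>2)"
        using n l m unfolding power2_eq_square by (cases n) auto
      moreover have "cmod (c \<xi>) \<le> \<kappa> * (R + 1)" using c by (simp add: bandamp_def)
      ultimately have "\<Lambda> \<xi> ^ n * (cmod (c \<xi>) * \<bar>F j ?s ?\<mu> z\<bar>) \<le> (1 + K * (1 + (R + 1)\<^sup>2)) * ((\<kappa> * (R + 1)) * f R)"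
        using l K Fb R \<kappa> by (intro mult_mono) auto
      then show ?thesis
        using z l by (simp add: tfam_def mamp_def norm_mult norm_power G_def ac_simps)
    qed (use Gn \<kappa> in \<open>simp add: tfam_def mamp_def\<close>)
    from nsq_le[OF A ab _ this, of J] have "nsq J a b (tfam \<Lambda> n 0 (mamp a b M c F))
       \<le> ennreal (real (Suc J) * ((1 + (R + 1)\<^sup>2) ^ J * (((2 * pi)\<^sup>2 * (\<kappa> * G R))\<^sup>2 * L)) * volc (R + 1))"
      using \<kappa> Gn by simp
    also have "real (Suc J) * ((1 + (R + 1)\<^sup>2) ^ J * (((2 * pi)\<^sup>2 * (\<kappa> * G R))\<^sup>2 * L)) * volc (R + 1) = \<kappa>\<^sup>2 * U R"
      by (simp add: U_def power_mult_distrib ac_simps)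
    finally show "nsq J a b (tfam \<Lambda> n 0 (mamp a b M c F)) \<le> ennreal (\<kappa>\<^sup>2 * U R)" .
  qed
qed

lemma E_amp_cases:
  assumes "P (mamp a b M (\<lambda>\<xi>. complex_of_real (\<theta> \<xi>)) F3)"
    "\<And>i. P (mamp a b M (\<lambda>\<xi>. (\<i> * complex_of_real (\<xi> $ i)) * complex_of_real (\<theta> \<xi>)) F1)"
  shows "P (E_amp a b M \<theta> F1 F3 b')"
  using assms unfolding E_amp_def by simp

lemma amp_band:
  fixes \<kappa> R :: real
  assumes M: "\<And>s. s > 0 \<Longrightarrow> M s > 0" "continuous_on {0<..} M" and k: "\<kappa> \<ge> 0" "R \<ge> 0"
  shows "vseq F \<Longrightarrow> amp a b (R + 1) (mamp a b M (\<lambda>\<xi>. complex_of_real (tent \<kappa> R \<xi>)) F)"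
    "vseq F1 \<Longrightarrow> vseq F3 \<Longrightarrow> amp a b (R + 1) (E_amp a b M (tent \<kappa> R) F1 F3 b')"
proof -
  have *: "amp a b (R + 1) (mamp a b M c F)" if "bandamp \<kappa> R c" "vseq F" for c F
    by (rule amp_mamp[OF that(2) M]) (use that in \<open>force simp: bandamp_def\<close>)+
  show "vseq F \<Longrightarrow> amp a b (R + 1) (mamp a b M (\<lambda>\<xi>. complex_of_real (tent \<kappa> R \<xi>)) F)"
    by (rule *[OF bandamp_tent(1)[OF k]])
  show "vseq F1 \<Longrightarrow> vseq F3 \<Longrightarrow> amp a b (R + 1) (E_amp a b M (tent \<kappa> R) F1 F3 b')"
    by (rule E_amp_cases[where P = "amp a b (R + 1)"]) (rule *[OF bandamp_tent(1)[OF k]], assumption, rule *[OF bandamp_tent(2)[OF k]], assumption)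
qed

text \<open>Collects what the two-layer argument needs from one layer. \<open>U\<close> bounds the
  squared norms of q and of each component of displacement and velocity at time 0; \<open>B\<close>
  bounds \<psi>', which later fixes how far from the interface \<psi> stays above 1/2.\<close>

lemma layer_modes:
  assumes K: "K > 0" and growth: "\<forall>s>0. 0 < M s \<and> M s \<le> K * (1 + s)" and cont: "continuous_on {0<..} M"
  obtains F1 F3 FQ FP U B where "vseq F1" "\<And>s \<mu> z. F1 0 s \<mu> z = phi s \<mu> z"
    "vseq F3" "\<And>s \<mu> z. F3 0 s \<mu> z = psi s \<mu> z"
    "vseq FQ" "\<And>s \<mu> z. FQ 0 s \<mu> z = - (\<rho> z * w z) * (\<mu> * phi s \<mu> z + g * psi s \<mu> z)"
    "vseq FP" "\<And>s \<mu> z. FP 0 s \<mu> z = - \<rho> z * (\<mu> * phi s \<mu> z + g * psi s \<mu> z)"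
    "pb U" "pb B"
    "\<And>\<kappa> R \<Lambda> n b'. \<kappa> \<ge> 0 \<Longrightarrow> R \<ge> 1 \<Longrightarrow> R \<ge> s0 \<Longrightarrow> rate M R \<Lambda> \<Longrightarrow> n \<le> 1 \<Longrightarrow>
      nsq J a b (tfam \<Lambda> n 0 (E_amp a b M (tent \<kappa> R) F1 F3 b')) \<le> ennreal (\<kappa>\<^sup>2 * U R)"
    "\<And>\<kappa> R \<Lambda> n. \<kappa> \<ge> 0 \<Longrightarrow> R \<ge> 1 \<Longrightarrow> R \<ge> s0 \<Longrightarrow> rate M R \<Lambda> \<Longrightarrow> n \<le> 1 \<Longrightarrow>
      nsq J a b (tfam \<Lambda> n 0 (mamp a b M (\<lambda>\<xi>. complex_of_real (tent \<kappa> R \<xi>)) FQ)) \<le> ennreal (\<kappa>\<^sup>2 * U R)"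
    "\<And>R s \<mu> z. R \<ge> 1 \<Longrightarrow> s0 \<le> s \<Longrightarrow> s \<le> (R + 1)\<^sup>2 \<Longrightarrow> 0 \<le> \<mu> \<Longrightarrow> \<mu> \<le> K * (1 + s) \<Longrightarrow> z \<in> {a..b} \<Longrightarrow>
      \<bar>F3 (Suc 0) s \<mu> z\<bar> \<le> B R"
proof -
  have M: "\<And>s. s > 0 \<Longrightarrow> M s > 0" "continuous_on {0<..} M" "\<And>s. s > 0 \<Longrightarrow> M s \<le> K * (1 + s)"
    using growth cont by auto
  obtain F1 F3 FQ FP where F: "vseq F1" "\<And>s \<mu> z. F1 0 s \<mu> z = phi s \<mu> z"
    "vseq F3" "\<And>s \<mu> z. F3 0 s \<mu> z = psi s \<mu> z"
    "vseq FQ" "\<And>s \<mu> z. FQ 0 s \<mu> z = - (\<rho> z * w z) * (\<mu> * phi s \<mu> z + g * psi s \<mu> z)"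
    "vseq FP" "\<And>s \<mu> z. FP 0 s \<mu> z = - \<rho> z * (\<mu> * phi s \<mu> z + g * psi s \<mu> z)"
    using mode_families by blast
  obtain U1 where U1: "pb U1" "\<And>\<kappa> R c \<Lambda> n. \<kappa> \<ge> 0 \<Longrightarrow> R \<ge> 1 \<Longrightarrow> R \<ge> s0 \<Longrightarrow> bandamp \<kappa> R c \<Longrightarrow> rate M R \<Lambda> \<Longrightarrow> n \<le> 1 \<Longrightarrow>
    nsq J a b (tfam \<Lambda> n 0 (mamp a b M c F1)) \<le> ennreal (\<kappa>\<^sup>2 * U1 R)"
    using nsq_band[OF F(1) K M, of J] by blast
  obtain U3 where U3: "pb U3" "\<And>\<kappa> R c \<Lambda> n. \<kappa> \<ge> 0 \<Longrightarrow> R \<ge> 1 \<Longrightarrow> R \<ge> s0 \<Longrightarrow> bandamp \<kappa> R c \<Longrightarrow> rate M R \<Lambda> \<Longrightarrow> n \<le> 1 \<Longrightarrow>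
    nsq J a b (tfam \<Lambda> n 0 (mamp a b M c F3)) \<le> ennreal (\<kappa>\<^sup>2 * U3 R)"
    using nsq_band[OF F(3) K M, of J] by blast
  obtain UQ where UQ: "pb UQ" "\<And>\<kappa> R c \<Lambda> n. \<kappa> \<ge> 0 \<Longrightarrow> R \<ge> 1 \<Longrightarrow> R \<ge> s0 \<Longrightarrow> bandamp \<kappa> R c \<Longrightarrow> rate M R \<Lambda> \<Longrightarrow> n \<le> 1 \<Longrightarrow>
    nsq J a b (tfam \<Lambda> n 0 (mamp a b M c FQ)) \<le> ennreal (\<kappa>\<^sup>2 * UQ R)"
    using nsq_band[OF F(5) K M, of J] by blast
  obtain B where B: "pb B" "\<And>j R s \<mu> z. j \<le> 1 \<Longrightarrow> R \<ge> 1 \<Longrightarrow> s0 \<le> s \<Longrightarrow> s \<le> (R + 1)\<^sup>2 \<Longrightarrow> 0 \<le> \<mu> \<Longrightarrow> \<mu> \<le> K * (1 + s) \<Longrightarrow>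
    z \<in> {a..b} \<Longrightarrow> \<bar>F3 j s \<mu> z\<bar> \<le> B R"
    by (rule vseq_pb[OF F(3) K, of 1]) (rule that)
  show thesis
  proof (rule that[OF F pb_add[OF pb_add[OF U1(1) U3(1)] UQ(1)] B(1)])
    fix \<kappa> R :: real and \<Lambda> and n :: nat and b' :: "real^3"
    assume h: "\<kappa> \<ge> 0" "R \<ge> 1" "R \<ge> s0" and r: "rate M R \<Lambda>" "n \<le> 1"
    have nn: "0 \<le> U1 R" "0 \<le> U3 R" "0 \<le> UQ R" using pb_nonneg[OF _ h(2)] U1(1) U3(1) UQ(1) by auto
    have le: "ennreal (\<kappa>\<^sup>2 * U1 R) \<le> ennreal (\<kappa>\<^sup>2 * (U1 R + U3 R + UQ R))"
      "ennreal (\<kappa>\<^sup>2 * U3 R) \<le> ennreal (\<kappa>\<^sup>2 * (U1 R + U3 R + UQ R))"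
      "ennreal (\<kappa>\<^sup>2 * UQ R) \<le> ennreal (\<kappa>\<^sup>2 * (U1 R + U3 R + UQ R))"
      using nn by (auto intro!: ennreal_leI mult_left_mono)
    have R0: "R \<ge> 0" using h by simp
    note ba = bandamp_tent[OF h(1) R0]
    show "nsq J a b (tfam \<Lambda> n 0 (E_amp a b M (tent \<kappa> R) F1 F3 b')) \<le> ennreal (\<kappa>\<^sup>2 * (U1 R + U3 R + UQ R))"
      by (rule E_amp_cases[where P = "\<lambda>D. nsq J a b (tfam \<Lambda> n 0 D) \<le> ennreal (\<kappa>\<^sup>2 * (U1 R + U3 R + UQ R))"])
        (rule order_trans[OF U3(2)[OF h ba(1) r] le(2)], rule order_trans[OF U1(2)[OF h ba(2) r] le(1)])
    show "nsq J a b (tfam \<Lambda> n 0 (mamp a b M (\<lambda>\<xi>. complex_of_real (tent \<kappa> R \<xi>)) FQ)) \<le> ennreal (\<kappa>\<^sup>2 * (U1 R + U3 R + UQ R))"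
      by (rule order_trans[OF UQ(2)[OF h ba(1) r] le(3)])
  next
    fix R s \<mu> z :: real
    assume "R \<ge> 1" "s0 \<le> s" "s \<le> (R + 1)\<^sup>2" "0 \<le> \<mu>" "\<mu> \<le> K * (1 + s)" "z \<in> {a..b}"
    then show "\<bar>F3 (Suc 0) s \<mu> z\<bar> \<le> B R" by (intro B(2)) auto
  qed
qed

end

locale two_layers =
  P: layer 0 l g \<rho>p wp "-1" p1 p2 pw + N: layer "-m" 0 g \<rho>m wm 1 m1 m2 mw
  for l m g :: real and \<rho>p wp \<rho>m wm :: "real \<Rightarrow> real" and p1 p2 pw m1 m2 mw :: real +
  assumes g: "g > 0" and heavy_top: "\<rho>p 0 > \<rho>m 0"
begin

sublocale D: two_sides P.R P.W "l - 0" p1 p2 pw N.R N.W "0 - - m" m1 m2 mw ..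

text \<open>Given \<psi> = 1 on both sides, the dispersion relation is the continuity of P' q: the
  opposite signs of \<phi> at the interface bring the two terms of \<open>disp\<close> to the same
  side.\<close>

lemma interface_pressure:
  assumes "D.disp s \<mu> = g * (\<rho>p 0 - \<rho>m 0)"
  shows "- \<rho>p 0 * (\<mu> * P.phi s \<mu> 0 + g) = - \<rho>m 0 * (\<mu> * N.phi s \<mu> 0 + g)"
proof -
  have R: "P.R (l - 0) = \<rho>p 0" "N.R (0 - - m) = \<rho>m 0" by (rule P.R_L, rule N.R_L)
  show ?thesis
    using assms unfolding D.disp_def R P.phi_interface N.phi_interface
    by (simp add: algebra_simps power2_eq_square)
qed

text \<open>The amplitude \<open>\<kappa>\<close> that makes the initial norms at most \<open>\<epsilon>\<close> is only polynomially small in the band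
  radius \<open>R\<close>, whereas the growth factor at time \<open>T0\<close> is exponential in \<open>sqrt R\<close>.\<close>

lemma growing_solution:
  fixes rho p :: "real \<Rightarrow> real" and T0 \<alpha> \<epsilon> :: real
  assumes rho: "\<And>z. z \<in> {0<..<l} \<Longrightarrow> rho z = \<rho>p z \<and> p z * wp z = 1" "\<And>z. z \<in> {-m<..<0} \<Longrightarrow> rho z = \<rho>m z \<and> p z * wm z = 1"
    and T0: "T0 > 0" and \<epsilon>: "\<epsilon> > 0"
  shows "\<exists>\<eta> v q. linearized_solution g m l rho p \<infinity> \<eta> v q \<and>
    \<eta> 0 \<in> H_space m l j \<and> v 0 \<in> H_space m l j \<and> q 0 \<in> H_space m l j \<and>
    H_norm m l j (\<eta> 0) + H_norm m l j (v 0) + H_norm m l j (q 0) \<le> \<epsilon> \<and>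
    (\<forall>t\<ge>T0. \<eta> t \<in> H_space m l k \<and> v t \<in> H_space m l k \<and>
      H_norm m l k (v t) \<ge> H_norm m l k (\<eta> t) \<and> H_norm m l k (\<eta> t) \<ge> \<alpha>)"
proof -
  have lm: "l > 0" "m > 0" using P.ab N.ab by auto
  have "g * (\<rho>p 0 - \<rho>m 0) > 0" using g heavy_top by simp
  then obtain M K \<gamma> s1 where M: "\<And>s. s > 0 \<Longrightarrow> 0 < M s \<and> D.disp s (M s) = g * (\<rho>p 0 - \<rho>m 0)" "continuous_on {0<..} M"
    "K > 0" "\<gamma> > 0" "\<And>s. s > 0 \<Longrightarrow> M s \<le> K * (1 + s)" "\<And>s. s \<ge> s1 \<Longrightarrow> s > 0 \<Longrightarrow> \<gamma> * sqrt s \<le> M s"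
    using D.disp_growth by blast
  have Mp: "\<And>s. s > 0 \<Longrightarrow> M s > 0" using M(1) by blast
  have growth: "\<forall>s>0. 0 < M s \<and> M s \<le> K * (1 + s)" using M(1,5) by blast
  obtain F1p F3p FQp FPp Up Bp where P: "P.vseq F1p" "\<And>s \<mu> z. F1p 0 s \<mu> z = P.phi s \<mu> z"
    "P.vseq F3p" "\<And>s \<mu> z. F3p 0 s \<mu> z = P.psi s \<mu> z"
    "P.vseq FQp" "\<And>s \<mu> z. FQp 0 s \<mu> z = - (\<rho>p z * wp z) * (\<mu> * P.phi s \<mu> z + g * P.psi s \<mu> z)"
    "P.vseq FPp" "\<And>s \<mu> z. FPp 0 s \<mu> z = - \<rho>p z * (\<mu> * P.phi s \<mu> z + g * P.psi s \<mu> z)"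
    "pb Up" "pb Bp"
    "\<And>\<kappa> R \<Lambda> n b'. \<kappa> \<ge> 0 \<Longrightarrow> R \<ge> 1 \<Longrightarrow> R \<ge> P.s0 \<Longrightarrow> rate M R \<Lambda> \<Longrightarrow> n \<le> 1 \<Longrightarrow>
      nsq j 0 l (tfam \<Lambda> n 0 (E_amp 0 l M (tent \<kappa> R) F1p F3p b')) \<le> ennreal (\<kappa>\<^sup>2 * Up R)"
    "\<And>\<kappa> R \<Lambda> n. \<kappa> \<ge> 0 \<Longrightarrow> R \<ge> 1 \<Longrightarrow> R \<ge> P.s0 \<Longrightarrow> rate M R \<Lambda> \<Longrightarrow> n \<le> 1 \<Longrightarrow>
      nsq j 0 l (tfam \<Lambda> n 0 (mamp 0 l M (\<lambda>\<xi>. complex_of_real (tent \<kappa> R \<xi>)) FQp)) \<le> ennreal (\<kappa>\<^sup>2 * Up R)"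
    by (rule P.layer_modes[OF M(3) growth M(2), of j]) (rule that)
  obtain F1m F3m FQm FPm Um B0 where N: "N.vseq F1m" "\<And>s \<mu> z. F1m 0 s \<mu> z = N.phi s \<mu> z"
    "N.vseq F3m" "\<And>s \<mu> z. F3m 0 s \<mu> z = N.psi s \<mu> z"
    "N.vseq FQm" "\<And>s \<mu> z. FQm 0 s \<mu> z = - (\<rho>m z * wm z) * (\<mu> * N.phi s \<mu> z + g * N.psi s \<mu> z)"
    "N.vseq FPm" "\<And>s \<mu> z. FPm 0 s \<mu> z = - \<rho>m z * (\<mu> * N.phi s \<mu> z + g * N.psi s \<mu> z)"
    "pb Um" "pb B0"
    "\<And>\<kappa> R \<Lambda> n b'. \<kappa> \<ge> 0 \<Longrightarrow> R \<ge> 1 \<Longrightarrow> R \<ge> N.s0 \<Longrightarrow> rate M R \<Lambda> \<Longrightarrow> n \<le> 1 \<Longrightarrow>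
      nsq j (-m) 0 (tfam \<Lambda> n 0 (E_amp (-m) 0 M (tent \<kappa> R) F1m F3m b')) \<le> ennreal (\<kappa>\<^sup>2 * Um R)"
    "\<And>\<kappa> R \<Lambda> n. \<kappa> \<ge> 0 \<Longrightarrow> R \<ge> 1 \<Longrightarrow> R \<ge> N.s0 \<Longrightarrow> rate M R \<Lambda> \<Longrightarrow> n \<le> 1 \<Longrightarrow>
      nsq j (-m) 0 (tfam \<Lambda> n 0 (mamp (-m) 0 M (\<lambda>\<xi>. complex_of_real (tent \<kappa> R \<xi>)) FQm)) \<le> ennreal (\<kappa>\<^sup>2 * Um R)"
    "\<And>R s \<mu> z. R \<ge> 1 \<Longrightarrow> N.s0 \<le> s \<Longrightarrow> s \<le> (R + 1)\<^sup>2 \<Longrightarrow> 0 \<le> \<mu> \<Longrightarrow> \<mu> \<le> K * (1 + s) \<Longrightarrow> z \<in> {-m..0} \<Longrightarrow>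
      \<bar>F3m (Suc 0) s \<mu> z\<bar> \<le> B0 R"
    by (rule N.layer_modes[OF M(3) growth M(2), of j]) (rule that)
  \<comment> \<open>The added constants only enforce U \<ge> 1, B > 0 and 1 / B \<le> m.\<close>
  define U B where "U = (\<lambda>R. Up R + Um R + 1)" and "B = (\<lambda>R. B0 R + 1 + 1 / m)"
  have UB: "pb U" "pb B" unfolding U_def B_def using P(9) N(9,10) lm by (auto intro!: pb_add pb_const)
  define vol where "vol = measure lborel (ball (0::real^2) (1/4))"
  have vol: "vol > 0" unfolding vol_def by (simp add: content_ball unit_ball_vol_pos)
  \<comment> \<open>Collects the constants of the final estimate: 864 is 16 times 54, with 16 from
    the square of \<kappa> / 4 and 54 = 6 times 9 from the choice of \<kappa>.\<close>
  define C where "C = \<alpha>\<^sup>2 * 864 / (\<epsilon>\<^sup>2 * vol)"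
  have C: "C \<ge> 0" using vol by (simp add: C_def)
  have "pb (\<lambda>R. C * 2 * (U R * B R))" using C UB by (intro pb_mult pb_const) auto
  moreover have "2 * sqrt \<gamma> * T0 > 0" using M(4) T0 by simp
  \<comment> \<open>The band lies beyond the thresholds of both layers and of the lower bound for M;
    R \<ge> 1 / \<gamma> makes M \<ge> 1 on it.\<close>
  ultimately obtain R where R: "R \<ge> max (max (P.s0) (N.s0)) (max s1 (1 / \<gamma>))" "R \<ge> 1"
    "C * 2 * (U R * B R) \<le> exp (2 * sqrt \<gamma> * T0 * sqrt R)"
    using pb_less_exp_sqrt by blast
  have R': "R \<ge> P.s0" "R \<ge> N.s0" "R \<ge> s1" "1 \<le> \<gamma> * R" "R \<ge> 0"
    using R(1,2) M(4) by (auto simp: field_simps)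
  have U1: "U R \<ge> 1" "U R > 0" and B1: "B R > 0" "1 / B R \<le> m" "B0 R \<le> B R"
  proof -
    have nn: "0 \<le> Up R" "0 \<le> Um R" "0 \<le> B0 R" using pb_nonneg[OF _ R(2)] P(9) N(9,10) by auto
    then show "U R \<ge> 1" "U R > 0" by (auto simp: U_def)
    have im: "1 / m > 0" using lm by simp
    then show "B R > 0" "B0 R \<le> B R" using nn unfolding B_def by linarith+
    have "1 / m \<le> B R" using nn by (simp add: B_def)
    then have "1 \<le> m * B R" using lm by (simp add: field_simps)
    then show "1 / B R \<le> m" using \<open>B R > 0\<close> by (simp add: field_simps)
  qed
  \<comment> \<open>Three components in two layers contribute at most \<kappa>^2 U each, which makes
    a norm at most \<epsilon> / 3; three such norms are added.\<close>
  define \<kappa> where "\<kappa> = \<epsilon> / (3 * sqrt (6 * U R))"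
  have \<kappa>: "\<kappa> > 0" using \<epsilon> U1 by (simp add: \<kappa>_def)
  have \<kappa>0: "\<kappa> \<ge> 0" using \<kappa> by simp
  have band: "R \<le> freq \<xi>" "freq \<xi> \<le> (norm \<xi>)\<^sup>2" "(norm \<xi>)\<^sup>2 \<le> freq \<xi>" if "R < norm \<xi>" for \<xi>
  proof -
    have "R \<le> R\<^sup>2" using R by (simp add: power2_eq_square)
    also have "\<dots> \<le> (norm \<xi>)\<^sup>2" using that R' by (intro power_mono) auto
    finally show "R \<le> freq \<xi>" "freq \<xi> \<le> (norm \<xi>)\<^sup>2" "(norm \<xi>)\<^sup>2 \<le> freq \<xi>" using freq_eq[of \<xi>] that R by auto
  qed
  have Mband: "\<gamma> * R \<le> M (freq \<xi>)" if x: "R < norm \<xi>" for \<xi>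
  proof -
    have "R \<le> sqrt (freq \<xi>)" using freq_eq[of \<xi>] x R by (simp add: real_sqrt_abs)
    then have "\<gamma> * R \<le> \<gamma> * sqrt (freq \<xi>)" using M(4) by (intro mult_left_mono) auto
    also have "\<dots> \<le> M (freq \<xi>)" using band(1)[OF x] R' R freq_pos by (intro M(6)) auto
    finally show ?thesis .
  qed
  \<comment> \<open>The truncation at 1 concerns frequencies below the band; on the band \<Lambda> =
    sqrt M.\<close>
  define \<Lambda> where "\<Lambda> = (\<lambda>\<xi>. max 1 (sqrt (M (freq \<xi>))))"
  have "continuous_on UNIV (\<lambda>\<xi>. M (freq \<xi>))"
    by (rule continuous_on_compose2[OF M(2) freq_continuous]) (auto simp: freq_pos)
  then have Lc: "continuous_on UNIV \<Lambda>" unfolding \<Lambda>_def by (intro continuous_intros)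
  have Le: "\<Lambda> (- \<xi>) = \<Lambda> \<xi>" and L1: "1 \<le> \<Lambda> \<xi>" for \<xi> by (simp_all add: \<Lambda>_def freq_pos)
  have Lb: "(\<Lambda> \<xi>)\<^sup>2 = M (freq \<xi>)" "sqrt (\<gamma> * R) \<le> \<Lambda> \<xi>" if x: "R < norm \<xi>" for \<xi>
  proof -
    have "1 \<le> M (freq \<xi>)" using Mband[OF x] R' by linarith
    then have "\<Lambda> \<xi> = sqrt (M (freq \<xi>))" by (simp add: \<Lambda>_def)
    then show "(\<Lambda> \<xi>)\<^sup>2 = M (freq \<xi>)" "sqrt (\<gamma> * R) \<le> \<Lambda> \<xi>"
      using \<open>1 \<le> M (freq \<xi>)\<close> Mband[OF x] by auto
  qed
  have rate: "rate M R \<Lambda>" unfolding rate_def using Lc Le L1 Lb by auto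
  let ?Ep = "E_amp 0 l M (tent \<kappa> R) F1p F3p" and ?Em = "E_amp (-m) 0 M (tent \<kappa> R) F1m F3m"
  let ?t = "\<lambda>\<xi>. complex_of_real (tent \<kappa> R \<xi>)"
  let ?Qp = "mamp 0 l M ?t FQp" and ?Qm = "mamp (-m) 0 M ?t FQm"
  let ?PQp = "mamp 0 l M ?t FPp" and ?PQm = "mamp (-m) 0 M ?t FPm"
  have ampP: "amp 0 l (R + 1) (?Ep b')" "amp 0 l (R + 1) ?Qp" "amp 0 l (R + 1) ?PQp" for b'
    using P.amp_band[OF Mp M(2) \<kappa>0 R'(5)] P(1,3,5,7) by blast+
  have ampN: "amp (-m) 0 (R + 1) (?Em b')" "amp (-m) 0 (R + 1) ?Qm" "amp (-m) 0 (R + 1) ?PQm" for b'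
    using N.amp_band[OF Mp M(2) \<kappa>0 R'(5)] N(1,3,5,7) by blast+
  have E2: "amps2 m l (R + 1) ?Ep ?Em" and Q2: "amps2 m l (R + 1) (\<lambda>_::real. ?Qp) (\<lambda>_. ?Qm)"
    using lm ampP ampN by (simp_all add: amps2_def)
  have supp: "R < norm \<xi> \<and> norm \<xi> < R + 1" if "tent \<kappa> R \<xi> \<noteq> 0" for \<xi> using tent_support[OF that] .
  have supp1: "1 \<le> norm \<xi>" "(\<Lambda> \<xi>)\<^sup>2 = M (freq \<xi>)" if "tent \<kappa> R \<xi> \<noteq> 0" for \<xi> using supp[OF that] R Lb by auto
  have eqP: "mode_equations 0 l g rho p \<Lambda> ?Ep ?Qp ?PQp"
    by (rule P.mode_equations_mamp) ((rule P(2,3,4,6,7,8) Mp supp1, assumption?) | simp add: rho)+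
  have eqN: "mode_equations (-m) 0 g rho p \<Lambda> ?Em ?Qm ?PQm"
    by (rule N.mode_equations_mamp) ((rule N(2,3,4,6,7,8) Mp supp1, assumption?) | simp add: rho)+
  have fp: "freq \<xi> > 0" "M (freq \<xi>) \<ge> 0" for \<xi> using freq_pos Mp[OF freq_pos(1), of \<xi>] by auto
  have mP: "mamp 0 l M c F i \<xi> z = c \<xi> * complex_of_real (F i (freq \<xi>) (M (freq \<xi>)) z)" if "z \<in> {0..l}" for c F i \<xi> z
    using that by (simp add: mamp_def)
  have mN: "mamp (-m) 0 M c F i \<xi> z = c \<xi> * complex_of_real (F i (freq \<xi>) (M (freq \<xi>)) z)" if "z \<in> {-m..0}" for c F i \<xi> z
    using that by (simp add: mamp_def)
  have psi0: "P.psi (freq \<xi>) (M (freq \<xi>)) 0 = 1" "N.psi (freq \<xi>) (M (freq \<xi>)) 0 = 1"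
     "P.psi (freq \<xi>) (M (freq \<xi>)) l = 0" "N.psi (freq \<xi>) (M (freq \<xi>)) (-m) = 0" for \<xi>
    using P.psi_interface[OF fp, of \<xi>] N.psi_interface[OF fp, of \<xi>] P.psi_wall[OF fp, of \<xi>] N.psi_wall[OF fp, of \<xi>] by simp_all
  let ?\<eta> = "evol \<Lambda> ?Ep ?Em 0" and ?v = "evol \<Lambda> ?Ep ?Em 1" and ?q = "evol \<Lambda> (\<lambda>_::real. ?Qp) (\<lambda>_. ?Qm) 0"
  have sol: "linearized_solution g m l rho p \<infinity> ?\<eta> ?v ?q"
  proof (rule evol_solution[OF E2 ampP(2) ampN(2) ampP(3) ampN(3) Lc Le L1 eqP eqN])
    fix \<xi> :: "real^2"
    show "?Ep e3 0 \<xi> 0 = ?Em e3 0 \<xi> 0" "?Ep e3 0 \<xi> l = 0" "?Em e3 0 \<xi> (-m) = 0"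
      using lm by (simp_all add: E_amp_axis mP mN P(4) N(4) psi0)
    have "- \<rho>p 0 * (M (freq \<xi>) * P.phi (freq \<xi>) (M (freq \<xi>)) 0 + g) = - \<rho>m 0 * (M (freq \<xi>) * N.phi (freq \<xi>) (M (freq \<xi>)) 0 + g)"
      by (rule interface_pressure) (use M(1)[OF fp(1)] in blast)
    then have "FPp 0 (freq \<xi>) (M (freq \<xi>)) 0 = FPm 0 (freq \<xi>) (M (freq \<xi>)) 0"
      unfolding P(8) N(8) psi0 by simp
    then show "?PQp 0 \<xi> 0 = ?PQm 0 \<xi> 0" using lm by (simp add: mP mN)
  qed
  note ev = E2 Lc Le L1
  have hs: "?\<eta> t \<in> H_space m l i" "?v t \<in> H_space m l i" "?q t \<in> H_space m l i" for t i
    using evol_H_space[OF E2 Lc Le L1] evol_H_space[OF Q2 Lc Le L1] by blast+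
  have six: "6 * (\<kappa>\<^sup>2 * U R) = (\<epsilon> / 3)\<^sup>2"
    using U1 by (simp add: \<kappa>_def power_divide power_mult_distrib)
  have le: "ennreal (\<kappa>\<^sup>2 * Up R) \<le> ennreal (\<kappa>\<^sup>2 * U R)" "ennreal (\<kappa>\<^sup>2 * Um R) \<le> ennreal (\<kappa>\<^sup>2 * U R)"
    using pb_nonneg[OF P(9) R(2)] pb_nonneg[OF N(9) R(2)] by (auto intro!: ennreal_leI mult_left_mono simp: U_def)
  have nn: "0 \<le> \<kappa>\<^sup>2 * U R" using U1 by simp
  have dbl: "ennreal (\<kappa>\<^sup>2 * U R) + ennreal (\<kappa>\<^sup>2 * U R) = ennreal (2 * (\<kappa>\<^sup>2 * U R))"
    by (subst ennreal_plus[symmetric, OF nn nn]) (simp only: mult_2)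
  have nE: "H_norm m l j (evol \<Lambda> ?Ep ?Em n 0) \<le> \<epsilon> / 3" if "n \<le> 1" for n
    unfolding evol_def
  proof (rule fld2_H_norm_le[OF evol_amps2[OF E2 Lc Le L1]])
    have "nsq2 m l j (\<lambda>b. tfam \<Lambda> n 0 (?Ep b)) (\<lambda>b. tfam \<Lambda> n 0 (?Em b)) \<le> (\<Sum>b\<in>(Basis::(real^3) set). ennreal (\<kappa>\<^sup>2 * U R) + ennreal (\<kappa>\<^sup>2 * U R))"
      unfolding nsq2_def
      by (intro sum_mono add_mono order_trans[OF P(11)[OF \<kappa>0 R(2) R'(1) rate that] le(1)] order_trans[OF N(11)[OF \<kappa>0 R(2) R'(2) rate that] le(2)])
    also have "\<dots> = (\<Sum>b\<in>(Basis::(real^3) set). ennreal (2 * (\<kappa>\<^sup>2 * U R)))"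
      unfolding dbl ..
    also have "\<dots> = ennreal (\<Sum>b\<in>(Basis::(real^3) set). 2 * (\<kappa>\<^sup>2 * U R))"
      using U1 by (intro sum_ennreal) auto
    also have "\<dots> = ennreal ((\<epsilon> / 3)\<^sup>2)" using six by simp
    finally show "nsq2 m l j (\<lambda>b. tfam \<Lambda> n 0 (?Ep b)) (\<lambda>b. tfam \<Lambda> n 0 (?Em b)) \<le> ennreal ((\<epsilon> / 3)\<^sup>2)" .
  qed (use \<epsilon> in auto)
  have nQ: "H_norm m l j (?q 0) \<le> \<epsilon> / 3"
    unfolding evol_def
  proof (rule fld2_H_norm_le[OF evol_amps2[OF Q2 Lc Le L1]])
    have "nsq2 m l j (\<lambda>_::real. tfam \<Lambda> 0 0 ?Qp) (\<lambda>_. tfam \<Lambda> 0 0 ?Qm) \<le> ennreal (\<kappa>\<^sup>2 * U R) + ennreal (\<kappa>\<^sup>2 * U R)"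
      unfolding nsq2_def
      using add_mono[OF order_trans[OF P(12)[OF \<kappa>0 R(2) R'(1) rate, of 0] le(1)] order_trans[OF N(12)[OF \<kappa>0 R(2) R'(2) rate, of 0] le(2)]] by simp
    also have "\<dots> = ennreal (2 * (\<kappa>\<^sup>2 * U R))"
      unfolding dbl ..
    also have "\<dots> \<le> ennreal ((\<epsilon> / 3)\<^sup>2)"
    proof (rule ennreal_leI)
      have "0 \<le> \<kappa>\<^sup>2 * U R" using U1 by simp
      then show "2 * (\<kappa>\<^sup>2 * U R) \<le> (\<epsilon> / 3)\<^sup>2" using six by linarith
    qed
    finally show "nsq2 m l j (\<lambda>_::real. tfam \<Lambda> 0 0 ?Qp) (\<lambda>_. tfam \<Lambda> 0 0 ?Qm) \<le> ennreal ((\<epsilon> / 3)\<^sup>2)" .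
  qed (use \<epsilon> in auto)
  have big: "\<alpha> \<le> H_norm m l k (?\<eta> T0)"
    unfolding evol_def
  proof (rule fld2_H_norm_ge[OF evol_amps2[OF E2 Lc Le L1], where b = e3])
    let ?X = "ball ((R + 1/2) *\<^sub>R axis 1 1) (1/4) :: (real^2) set"
    \<comment> \<open>Since \<psi> = 1 at the interface and |\<psi>'| \<le> B, one has \<psi> \<ge>
      1/2 within distance 1 / (2 B).\<close>
    define \<delta> where "\<delta> = 1 / (2 * B R)"
    \<comment> \<open>Growth at the minimal rate sqrt (\<gamma> R), times half the height of the
      tent, times the lower bound 1/2 for \<psi>.\<close>
    define c where "c = exp (sqrt (\<gamma> * R) * T0) * (\<kappa> / 4)"
    have \<delta>: "0 < \<delta>" "\<delta> \<le> m" using B1 lm by (auto simp: \<delta>_def field_simps)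
    have lower: "c \<le> cmod (tfam \<Lambda> 0 T0 (?Em e3) 0 \<xi> z)" if x: "\<xi> \<in> ?X" and z: "z \<in> {-\<delta><..<0}" for \<xi> z
    proof -
      have t: "\<kappa> / 2 \<le> tent \<kappa> R \<xi>" by (rule tent_ge[OF \<kappa>0 R'(5) x])
      then have n: "R < norm \<xi>" "norm \<xi> < R + 1" using supp[of \<xi>] \<kappa> by auto
      have z': "z \<in> {-m..0}" using z \<delta> by auto
      let ?s = "freq \<xi>" and ?\<mu> = "M (freq \<xi>)"
      have sb: "N.s0 \<le> ?s" "?s \<le> (R + 1)\<^sup>2"
      proof -
        show "N.s0 \<le> ?s" using band(1)[OF n(1)] R' by linarith
        have "(norm \<xi>)\<^sup>2 \<le> (R + 1)\<^sup>2" using n by (intro power_mono) auto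
        then show "?s \<le> (R + 1)\<^sup>2" using band(2)[OF n(1)] by linarith
      qed
      have "norm (F3m 0 ?s ?\<mu> z - F3m 0 ?s ?\<mu> 0) \<le> B0 R * norm (z - 0)"
      proof (rule field_differentiable_bound[where S = "{-m..0}" and f' = "F3m (Suc 0) ?s ?\<mu>"])
        show "(F3m 0 ?s ?\<mu> has_real_derivative F3m (Suc 0) ?s ?\<mu> y) (at y within {-m..0})" if "y \<in> {-m..0}" for y
          by (rule N.vseq_deriv[OF N(3) fp that])
        show "norm (F3m (Suc 0) ?s ?\<mu> y) \<le> B0 R" if "y \<in> {-m..0}" for y
          using N(13)[OF R(2) sb fp(2) M(5)[OF fp(1)] that] by simp
      qed (use z' lm in auto)
      also have "\<dots> \<le> B R * \<delta>" using z B1 by (intro mult_mono) auto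
      also have "\<dots> = 1/2" using B1 by (simp add: \<delta>_def)
      finally have psi: "1/2 \<le> F3m 0 ?s ?\<mu> z" unfolding N(4) psi0 by (simp add: abs_if split: if_splits)
      have "sqrt (\<gamma> * R) * T0 \<le> \<Lambda> \<xi> * T0" using Lb(2)[OF n(1)] T0 by (intro mult_right_mono) auto
      then have "exp (sqrt (\<gamma> * R) * T0) * (\<kappa> / 2 * (1/2)) \<le> exp (\<Lambda> \<xi> * T0) * (tent \<kappa> R \<xi> * F3m 0 ?s ?\<mu> z)"
        using t psi \<kappa> by (intro mult_mono) auto
      then show ?thesis using t psi \<kappa> z' by (simp add: c_def tfam_def E_amp_axis mN norm_mult)
    qed
    have cc: "c \<ge> 0" using \<kappa>0 by (simp add: c_def)
    have vX: "emeasure lborel ?X = ennreal vol"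
    proof -
      have "emeasure lborel ?X = ennreal (measure lborel ?X)"
        using emeasure_bounded_finite[of ?X] by (subst emeasure_eq_ennreal_measure) (auto simp: infinity_ennreal_def)
      then show ?thesis by (simp add: vol_def content_ball)
    qed
    have "\<alpha>\<^sup>2 \<le> c\<^sup>2 * \<delta> * vol"
    proof -
      have e: "(exp (sqrt (\<gamma> * R) * T0))\<^sup>2 = exp (2 * sqrt \<gamma> * T0 * sqrt R)"
        by (simp add: real_sqrt_mult ac_simps flip: exp_double)
      have k2: "\<kappa>\<^sup>2 = \<epsilon>\<^sup>2 / (54 * U R)" using six U1 by (simp add: field_simps power_divide)
      have "c\<^sup>2 * \<delta> * vol = exp (2 * sqrt \<gamma> * T0 * sqrt R) * (\<epsilon>\<^sup>2 * vol / (864 * (2 * (U R * B R))))"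
        unfolding c_def power_mult_distrib e power_divide k2 \<delta>_def by simp
      moreover have "C * 2 * (U R * B R) * (\<epsilon>\<^sup>2 * vol / (864 * (2 * (U R * B R)))) = \<alpha>\<^sup>2"
        using U1 B1 \<epsilon> vol unfolding C_def by (simp add: field_simps)
      moreover have "C * 2 * (U R * B R) * (\<epsilon>\<^sup>2 * vol / (864 * (2 * (U R * B R)))) \<le>
        exp (2 * sqrt \<gamma> * T0 * sqrt R) * (\<epsilon>\<^sup>2 * vol / (864 * (2 * (U R * B R))))"
        using R(3) U1 B1 vol by (intro mult_right_mono) auto
      ultimately show ?thesis by linarith
    qed
    also have "\<dots> \<le> ((2 * pi)\<^sup>2 * c)\<^sup>2 * (0 - - \<delta>) * vol"
    proof -
      have "1 * c \<le> (2 * pi)\<^sup>2 * c" using cc pi_gt3 by (intro mult_right_mono one_le_power) auto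
      then have "c\<^sup>2 \<le> ((2 * pi)\<^sup>2 * c)\<^sup>2" using cc by (intro power_mono) auto
      then show ?thesis using \<delta> vol by (intro mult_right_mono) auto
    qed
    finally have "ennreal (\<alpha>\<^sup>2) \<le> ennreal (((2 * pi)\<^sup>2 * c)\<^sup>2 * (0 - - \<delta>) * vol)" by (rule ennreal_leI)
    also have "\<dots> \<le> nsq k (-m) 0 (tfam \<Lambda> 0 T0 (?Em e3))"
      using nsq_ge[where X = ?X and ?a1.0 = "- \<delta>" and ?b1.0 = 0 and D = "tfam \<Lambda> 0 T0 (?Em e3)" and a = "-m" and b = 0 and v = vol, OF cc lower _ vX] \<delta> vol
      by (simp add: greaterThanLessThan_subseteq_greaterThanLessThan)
    finally show "ennreal (\<alpha>\<^sup>2) \<le> nsq k (-m) 0 (tfam \<Lambda> 0 T0 (?Em e3))" .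
  qed (auto simp: axis_in_Basis_iff)
  have mono: "H_norm m l k (?\<eta> t) \<le> H_norm m l k (?v t)" "T0 \<le> t \<Longrightarrow> H_norm m l k (?\<eta> T0) \<le> H_norm m l k (?\<eta> t)" for t
    using evol_H_norm_mono[OF E2 Lc Le L1] by auto
  have "H_norm m l j (?\<eta> 0) + H_norm m l j (?v 0) + H_norm m l j (?q 0) \<le> \<epsilon>"
    using nE[of 0] nE[of 1] nQ by simp
  then show ?thesis
    using sol hs mono big by (intro exI[of _ ?\<eta>] exI[of _ ?v] exI[of _ ?q]) (auto intro: order_trans)
qed

end

section \<open>From the pressure laws to the two layers\<close>

lemma enthalpy_range:
  assumes P: "pressure_law P" and x: "x \<in> enthalpy P ` {0<..}" and y: "y \<in> enthalpy P ` {0<..}" and z: "x \<le> z" "z \<le> y"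
  shows "z \<in> enthalpy P ` {0<..}"
proof -
  have "continuous_on {0<..} (enthalpy P)"
    using enthalpy_deriv[OF P] by (intro continuous_at_imp_continuous_on ballI DERIV_isCont) auto
  then have "connected (enthalpy P ` {0<..})" by (rule connected_continuous_image) (simp add: connected_iff_interval)
  then show ?thesis by (rule connectedD_interval[OF _ x y z])
qed

lemma compact_positive_bounds:
  fixes f :: "real \<Rightarrow> real"
  assumes "a \<le> b" "continuous_on {a..b} f" "\<And>z. z \<in> {a..b} \<Longrightarrow> f z > 0"
  obtains c C where "c > 0" "C > 0" "\<And>z. z \<in> {a..b} \<Longrightarrow> c \<le> f z" "\<And>z. z \<in> {a..b} \<Longrightarrow> f z \<le> C"
proof -
  have ne: "{a..b} \<noteq> {}" using assms(1) by simp
  obtain x where x: "x \<in> {a..b}" "\<forall>y\<in>{a..b}. f x \<le> f y" using continuous_attains_inf[OF compact_Icc ne assms(2)] by blast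
  obtain y where y: "y \<in> {a..b}" "\<forall>z\<in>{a..b}. f z \<le> f y" using continuous_attains_sup[OF compact_Icc ne assms(2)] by blast
  show thesis using that[of "f x" "f y"] x y assms(3) by blast
qed

text \<open>The range of the enthalpy is an interval, so the conditions at the two ends put the
  whole layer into the domain of its inverse; compactness then provides the bounds demanded by
  \<open>layer\<close>.\<close>

lemma steady_state_is_layer:
  fixes a b g h0 :: real
  assumes P: "pressure_law P" and ab: "a < b" and g: "g > 0" and s: "(\<sigma> = 1 \<and> b = 0) \<or> (\<sigma> = -1 \<and> a = 0)"
    and range: "h0 - g * a \<in> enthalpy P ` {0<..}" "h0 - g * b \<in> enthalpy P ` {0<..}"
    and \<rho>: "\<And>z. \<rho> z = inv_into {0<..} (enthalpy P) (h0 - g * z)"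
  obtains r1 r2 w2 where "layer a b g \<rho> (\<lambda>z. inverse (deriv P (\<rho> z))) \<sigma> r1 r2 w2"
    "\<And>z. z \<in> {a..b} \<Longrightarrow> deriv P (\<rho> z) * inverse (deriv P (\<rho> z)) = 1"
proof -
  have r: "h0 - g * z \<in> enthalpy P ` {0<..}" if "z \<in> {a..b}" for z
    by (rule enthalpy_range[OF P range(2,1)]) (use that g in auto)
  have ss: "\<And>z. z \<in> {a..b} \<Longrightarrow> \<rho> z > 0" "\<And>z. z \<in> {a..b} \<Longrightarrow> inverse (deriv P (\<rho> z)) > 0"
    "\<And>z. z \<in> {a..b} \<Longrightarrow> (\<rho> has_real_derivative - g * inverse (deriv P (\<rho> z)) * \<rho> z) (at z within {a..b})"
    "\<And>n. Cr n {a..b} \<rho>" "\<And>n. Cr n {a..b} (\<lambda>z. inverse (deriv P (\<rho> z)))"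
    using steady_state_layer[OF P, of a b h0 g, folded \<rho>] r by blast+
  obtain r1 r2 where b1: "r1 > 0" "r2 > 0" "\<And>z. z \<in> {a..b} \<Longrightarrow> r1 \<le> \<rho> z" "\<And>z. z \<in> {a..b} \<Longrightarrow> \<rho> z \<le> r2"
    using compact_positive_bounds[OF less_imp_le[OF ab] Cr_imp_continuous[OF ss(4)[of 0]] ss(1)] by blast
  obtain w1 w2 where b2: "w1 > 0" "w2 > 0" "\<And>z. z \<in> {a..b} \<Longrightarrow> w1 \<le> inverse (deriv P (\<rho> z))" "\<And>z. z \<in> {a..b} \<Longrightarrow> inverse (deriv P (\<rho> z)) \<le> w2"
    using compact_positive_bounds[OF less_imp_le[OF ab] Cr_imp_continuous[OF ss(5)[of 0]] ss(2)] by blast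
  show thesis
  proof (rule that)
    show "layer a b g \<rho> (\<lambda>z. inverse (deriv P (\<rho> z))) \<sigma> r1 r2 w2"
      by unfold_locales (use ab ss s b1 b2 in \<open>auto intro: less_imp_le\<close>)
    show "deriv P (\<rho> z) * inverse (deriv P (\<rho> z)) = 1" if "z \<in> {a..b}" for z
      using ss(2)[OF that] by simp
  qed
qed

theorem theorem4p5:
  fixes g m l rm T0 \<alpha> :: real
    and Pp Pm :: "real \<Rightarrow> real"
    and k j :: nat
  assumes "g > 0" and "m > 0" and "l > 0"
    and "pressure_law Pp" and "pressure_law Pm"
    and "rm > 0"
    and "Pm rm > Pp rm"
    and "Pm rm \<in> Pp ` {0<..}"
    and "enthalpy Pm rm + g * m \<in> enthalpy Pm ` {0<..}"
    and "enthalpy Pp (rho0_plus Pp Pm rm) - g * l \<in> enthalpy Pp ` {0<..}"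
    and "j \<ge> k" and "T0 > 0" and "\<alpha> > 0"
  shows "\<exists>(\<eta> :: nat \<Rightarrow> real \<Rightarrow> real^3 \<Rightarrow> real^3)
          (v :: nat \<Rightarrow> real \<Rightarrow> real^3 \<Rightarrow> real^3)
          (q :: nat \<Rightarrow> real \<Rightarrow> real^3 \<Rightarrow> real).
    \<forall>n\<ge>1.
      linearized_solution g m l (rho0 g Pp Pm rm) (Pprime_rho0 g Pp Pm rm) \<infinity> (\<eta> n) (v n) (q n) \<and>
      \<eta> n 0 \<in> H_space m l j \<and> v n 0 \<in> H_space m l j \<and> q n 0 \<in> H_space m l j \<and>
      H_norm m l j (\<eta> n 0) + H_norm m l j (v n 0) + H_norm m l j (q n 0) \<le> 1 / real n \<and>
      (\<forall>t\<ge>T0. \<eta> n t \<in> H_space m l k \<and> v n t \<in> H_space m l k \<and>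
         H_norm m l k (v n t) \<ge> H_norm m l k (\<eta> n t) \<and> H_norm m l k (\<eta> n t) \<ge> \<alpha>)"
proof -
  define rp where "rp = rho0_plus Pp Pm rm"
  have rp: "rp > 0" "Pp rp = Pm rm"
    using inv_into_into[OF assms(8)] f_inv_into_f[OF assms(8)] by (simp_all add: rp_def rho0_plus_def)
  \<comment> \<open>The heavier fluid is on top: at density \<open>rm\<close> the upper law gives
    the smaller pressure, so equal pressure needs a larger upper density.\<close>
  have rp_gt: "rm < rp"
  proof (rule ccontr)
    assume "\<not> rm < rp"
    then have "Pp rp \<le> Pp rm" using pressure_strict_mono[OF assms(4) rp(1), of rm] by (cases "rp = rm") auto
    then show False using rp(2) assms(7) by simp
  qed
  define \<rho>p where "\<rho>p = (\<lambda>z. inv_into {0<..} (enthalpy Pp) (enthalpy Pp rp - g * z))"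
  define \<rho>m where "\<rho>m = (\<lambda>z. inv_into {0<..} (enthalpy Pm) (enthalpy Pm rm - g * z))"
  have \<rho>0: "\<rho>p 0 = rp" "\<rho>m 0 = rm"
    using inv_into_f_f[OF enthalpy_inj[OF assms(4)], of rp] inv_into_f_f[OF enthalpy_inj[OF assms(5)], of rm] rp assms(6)
    by (simp_all add: \<rho>p_def \<rho>m_def)
  have rp_range: "enthalpy Pp rp - g * 0 \<in> enthalpy Pp ` {0<..}" "enthalpy Pp rp - g * l \<in> enthalpy Pp ` {0<..}"
    using rp assms(10) by (auto simp: rp_def)
  have rm_range: "enthalpy Pm rm - g * - m \<in> enthalpy Pm ` {0<..}" "enthalpy Pm rm - g * 0 \<in> enthalpy Pm ` {0<..}"
    using assms(6,9) by auto
  have \<sigma>: "(-1::real) = 1 \<and> l = 0 \<or> (-1::real) = -1 \<and> (0::real) = 0" "(1::real) = 1 \<and> (0::real) = 0 \<or> (1::real) = -1 \<and> -m = 0"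
    by auto
  have ml: "-m < 0" using assms(2) by simp
  obtain p1 p2 pw where P: "layer 0 l g \<rho>p (\<lambda>z. inverse (deriv Pp (\<rho>p z))) (-1) p1 p2 pw"
    "\<And>z. z \<in> {0..l} \<Longrightarrow> deriv Pp (\<rho>p z) * inverse (deriv Pp (\<rho>p z)) = 1"
    by (rule steady_state_is_layer[OF assms(4,3,1) \<sigma>(1) rp_range, of \<rho>p]) (simp add: \<rho>p_def, rule that)
  obtain m1 m2 mw where N: "layer (-m) 0 g \<rho>m (\<lambda>z. inverse (deriv Pm (\<rho>m z))) 1 m1 m2 mw"
    "\<And>z. z \<in> {-m..0} \<Longrightarrow> deriv Pm (\<rho>m z) * inverse (deriv Pm (\<rho>m z)) = 1"
    by (rule steady_state_is_layer[OF assms(5) ml assms(1) \<sigma>(2) rm_range, of \<rho>m]) (simp add: \<rho>m_def, rule that)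
  interpret two_layers l m g \<rho>p "\<lambda>z. inverse (deriv Pp (\<rho>p z))" \<rho>m "\<lambda>z. inverse (deriv Pm (\<rho>m z))" p1 p2 pw m1 m2 mw
    by (intro two_layers.intro P(1) N(1) two_layers_axioms.intro) (use assms(1) \<rho>0 rp_gt in auto)
  \<comment> \<open>The guard n \<ge> 1 permits choice over all n; 1 / n plays the role of
    \<epsilon>.\<close>
  have "\<forall>n. \<exists>\<eta> v q. n \<ge> 1 \<longrightarrow> linearized_solution g m l (rho0 g Pp Pm rm) (Pprime_rho0 g Pp Pm rm) \<infinity> \<eta> v q \<and>
      \<eta> 0 \<in> H_space m l j \<and> v 0 \<in> H_space m l j \<and> q 0 \<in> H_space m l j \<and>
      H_norm m l j (\<eta> 0) + H_norm m l j (v 0) + H_norm m l j (q 0) \<le> 1 / real n \<and>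
      (\<forall>t\<ge>T0. \<eta> t \<in> H_space m l k \<and> v t \<in> H_space m l k \<and>
         H_norm m l k (v t) \<ge> H_norm m l k (\<eta> t) \<and> H_norm m l k (\<eta> t) \<ge> \<alpha>)" (is "\<forall>n. \<exists>\<eta> v q. n \<ge> 1 \<longrightarrow> ?Q n \<eta> v q")
  proof
    fix n
    show "\<exists>\<eta> v q. n \<ge> 1 \<longrightarrow> ?Q n \<eta> v q"
    proof (cases "n \<ge> 1")
      case True
      then have n: "1 / real n > 0" by simp
      have "\<exists>\<eta> v q. ?Q n \<eta> v q"
        by (rule growing_solution[OF _ _ assms(12) n])
          (use P(2) N(2) in \<open>auto simp: rho0_def Pprime_rho0_def \<rho>p_def \<rho>m_def rp_def\<close>)
      then show ?thesis by blast
    qed simp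
  qed
  from choice[OF this] obtain \<eta> where "\<forall>n. \<exists>v q. n \<ge> 1 \<longrightarrow> ?Q n (\<eta> n) v q" ..
  from choice[OF this] obtain v where "\<forall>n. \<exists>q. n \<ge> 1 \<longrightarrow> ?Q n (\<eta> n) (v n) q" ..
  from choice[OF this] obtain q where "\<forall>n. n \<ge> 1 \<longrightarrow> ?Q n (\<eta> n) (v n) (q n)" ..
  then show ?thesis by (intro exI[of _ \<eta>] exI[of _ v] exI[of _ q])
qed

end
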